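(* Let $n\ge 1$. There exists $\varepsilon_0>0$ such that for any $(f_0,f_1)\in (H^1(\mathbb{R}^n)\times L^2(\mathbb{R}^n))\cap\widetilde{\mathscr{Y}}(\mathbb{R}^n)$ with $$\|f_0\|^2_{L^2(\mathbb{R}^n)}+\|f_1\|^2_{\dot H^{-1}(\mathbb{R}^n)}+|(f_0,f_1)|_{\widetilde{\mathscr{Y}}(\mathbb{R}^n)}\le\varepsilon_0,$$ the Cauchy problem $$\partial_t^2u-\left(1+\int_{\mathbb{R}^n}|u(t,x)|^2\,dx\right)\Delta u=0,\quad t\neq0,\ x\in\mathbb{R}^n,\qquad u(0,x)=f_0(x),\quad \partial_tu(0,x)=f_1(x),$$ has a unique solution $u\in C(\mathbb{R};H^1(\mathbb{R}^n))\cap C^1(\mathbb{R};L^2(\mathbb{R}^n))$.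
   Context: $H^1(\mathbb{R}^n)$ is the standard Sobolev space; $\dot H^{-1}(\mathbb{R}^n)=|D_x|L^2(\mathbb{R}^n)$ is the homogeneous Sobolev space of order $-1$, where $|D_x|$ is the Fourier multiplier with symbol $|\xi|$. The class $\widetilde{\mathscr{Y}}(\mathbb{R}^n)$ consists of all pairs $(f_0,f_1)\in\mathscr{S}'(\mathbb{R}^n)\times\mathscr{S}'(\mathbb{R}^n)$ (tempered distributions) such that $$|(f_0,f_1)|_{\widetilde{\mathscr{Y}}(\mathbb{R}^n)}:=\sum_{j,k=0}^{1}\int_{-\infty}^\infty\left(\int_{\mathbb{S}^{n-1}}\left|\int_0^\infty e^{i\tau\rho}\widehat f_j(\rho\omega)\overline{\widehat f_k(\rho\omega)}\rho^{n-j-k}\,d\rho\right|d\sigma(\omega)\right)d\tau<\infty,$$ where $d\sigma$ is the $(n-1)$-dimensional Hausdorff measure on the unit sphere $\mathbb{S}^{n-1}$. *)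

theory Defs
  imports "HOL-Analysis.Analysis"
begin

section \<open>Schwartz functions and tempered distributions\<close>

definition partial_deriv ::
  "'a::euclidean_space \<Rightarrow> ('a \<Rightarrow> complex) \<Rightarrow> 'a \<Rightarrow> complex" where
  "partial_deriv b f = (\<lambda>x. frechet_derivative f (at x) b)"

definition iter_deriv ::
  "'a::euclidean_space list \<Rightarrow> ('a \<Rightarrow> complex) \<Rightarrow> 'a \<Rightarrow> complex" where
  "iter_deriv bs f = foldr partial_deriv bs f"

definition schwartz :: "('a::euclidean_space \<Rightarrow> complex) set" where
  "schwartz = {\<phi>. \<forall>bs\<in>lists Basis.
      (\<forall>x. iter_deriv bs \<phi> differentiable (at x)) \<and>
      (\<forall>N::nat. bdd_above (range (\<lambda>x. (1 + norm x) ^ N * norm (iter_deriv bs \<phi> x))))}"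

definition schwartz_seminorm ::
  "nat \<Rightarrow> 'a::euclidean_space list \<Rightarrow> ('a \<Rightarrow> complex) \<Rightarrow> real" where
  "schwartz_seminorm N bs \<phi> = (SUP x. (1 + norm x) ^ N * norm (iter_deriv bs \<phi> x))"

text \<open>Only the values of a distribution on \<^const>\<open>schwartz\<close> are meaningful; equality of
  distributions is always stated as equality on \<^const>\<open>schwartz\<close>.\<close>

type_synonym 'a distr = "('a \<Rightarrow> complex) \<Rightarrow> complex"

definition tempered :: "'a::euclidean_space distr \<Rightarrow> bool" where
  "tempered T \<longleftrightarrow>
     (\<forall>\<phi>\<in>schwartz. \<forall>\<psi>\<in>schwartz. T (\<lambda>x. \<phi> x + \<psi> x) = T \<phi> + T \<psi>) \<and>
     (\<forall>\<phi>\<in>schwartz. \<forall>c. T (\<lambda>x. c * \<phi> x) = c * T \<phi>) \<and>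
     (\<exists>C N. \<forall>\<phi>\<in>schwartz.
        norm (T \<phi>) \<le> C * (\<Sum>bs\<in>{bs\<in>lists Basis. length bs \<le> N}. schwartz_seminorm N bs \<phi>))"

definition dist_of :: "('a::euclidean_space \<Rightarrow> complex) \<Rightarrow> 'a distr" where
  "dist_of f \<phi> = (\<integral>x. f x * \<phi> x \<partial>lborel)"

definition represented_by :: "'a::euclidean_space distr \<Rightarrow> ('a \<Rightarrow> complex) \<Rightarrow> bool" where
  "represented_by T f \<longleftrightarrow> f \<in> borel_measurable lborel \<and>
     (\<forall>\<phi>\<in>schwartz. integrable lborel (\<lambda>x. f x * \<phi> x) \<and> T \<phi> = dist_of f \<phi>)"

definition deriv_dist :: "'a::euclidean_space \<Rightarrow> 'a distr \<Rightarrow> 'a distr" where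
  "deriv_dist b T \<phi> = - T (partial_deriv b \<phi>)"

definition laplace_dist :: "'a::euclidean_space distr \<Rightarrow> 'a distr" where
  "laplace_dist T \<phi> = (\<Sum>b\<in>Basis. deriv_dist b (deriv_dist b T) \<phi>)"


section \<open>Fourier transform\<close>

definition fourier :: "('a::euclidean_space \<Rightarrow> complex) \<Rightarrow> 'a \<Rightarrow> complex" where
  "fourier \<phi> \<xi> = (\<integral>x. cis (- (x \<bullet> \<xi>)) * \<phi> x \<partial>lborel)"

definition inv_fourier :: "('a::euclidean_space \<Rightarrow> complex) \<Rightarrow> 'a \<Rightarrow> complex" where
  "inv_fourier \<phi> x = (\<integral>\<xi>. cis (x \<bullet> \<xi>) * \<phi> \<xi> \<partial>lborel) / of_real ((2 * pi) ^ DIM('a))"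

definition fourier_dist :: "'a::euclidean_space distr \<Rightarrow> 'a distr" where
  "fourier_dist T \<phi> = T (fourier \<phi>)"

text \<open>A Borel function (unique up to null sets) representing the Fourier transform of \<open>T\<close>,
  if there is one; by Plancherel's theorem there is one whenever \<open>T\<close> is given by an
  \<open>L\<^sup>2\<close> function.\<close>

definition fourier_fun :: "'a::euclidean_space distr \<Rightarrow> 'a \<Rightarrow> complex" where
  "fourier_fun T = (SOME g. represented_by (fourier_dist T) g)"


section \<open>The spaces \<open>L\<^sup>2\<close>, \<open>H\<^sup>1\<close> and the homogeneous space of order \<open>-1\<close>\<close>

text \<open>Elements of \<open>L\<^sup>2\<close> and \<open>H\<^sup>1\<close> are Borel functions, not classes of functions, so identities
  between them are stated almost everywhere.\<close>

definition L2 :: "('a::euclidean_space \<Rightarrow> complex) set" where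
  "L2 = {f. f \<in> borel_measurable lborel \<and> integrable lborel (\<lambda>x. (norm (f x))\<^sup>2)}"

definition L2_norm :: "('a::euclidean_space \<Rightarrow> complex) \<Rightarrow> real" where
  "L2_norm f = sqrt (\<integral>x. (norm (f x))\<^sup>2 \<partial>lborel)"

definition is_weak_deriv ::
  "'a::euclidean_space \<Rightarrow> ('a \<Rightarrow> complex) \<Rightarrow> ('a \<Rightarrow> complex) \<Rightarrow> bool" where
  "is_weak_deriv b f g \<longleftrightarrow> g \<in> L2 \<and> (\<forall>\<phi>\<in>schwartz. deriv_dist b (dist_of f) \<phi> = dist_of g \<phi>)"

definition weak_deriv ::
  "'a::euclidean_space \<Rightarrow> ('a \<Rightarrow> complex) \<Rightarrow> 'a \<Rightarrow> complex" where
  "weak_deriv b f = (SOME g. is_weak_deriv b f g)"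

definition H1 :: "('a::euclidean_space \<Rightarrow> complex) set" where
  "H1 = {f\<in>L2. \<forall>b\<in>Basis. \<exists>g. is_weak_deriv b f g}"

definition H1_norm :: "('a::euclidean_space \<Rightarrow> complex) \<Rightarrow> real" where
  "H1_norm f = sqrt ((L2_norm f)\<^sup>2 + (\<Sum>b\<in>Basis. (L2_norm (weak_deriv b f))\<^sup>2))"

definition abs_D :: "('a::euclidean_space \<Rightarrow> complex) \<Rightarrow> 'a distr" where
  "abs_D g \<phi> =
     dist_of (\<lambda>\<xi>. of_real (norm \<xi>) * fourier_fun (dist_of g) \<xi>) (inv_fourier \<phi>)"

text \<open>The norm carried over from \<open>L\<^sup>2\<close> by the multiplier \<^const>\<open>abs_D\<close>, which is injective on
  \<open>L\<^sup>2\<close>: the infimum is over functions that agree almost everywhere, and it is \<open>\<infinity>\<close> exactly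
  when \<open>T\<close> does not lie in the space.\<close>

definition Hdot_minus1_norm :: "'a::euclidean_space distr \<Rightarrow> ennreal" where
  "Hdot_minus1_norm T =
     (INF g\<in>{g\<in>L2. \<forall>\<phi>\<in>schwartz. T \<phi> = abs_D g \<phi>}. ennreal (L2_norm g))"


section \<open>Hausdorff measure\<close>

text \<open>Normalised so that in dimension \<open>s\<close> the measure agrees with Lebesgue measure on
  \<open>\<real>\<^sup>s\<close>. The power has a natural exponent since \<open>0 ^ 0 = 1\<close> is needed for
  \<open>s = 0\<close> (counting measure), whereas \<open>0 powr 0 = 0\<close>.\<close>

definition hausdorff_premeasure :: "nat \<Rightarrow> real \<Rightarrow> 'a::euclidean_space set \<Rightarrow> ennreal" where
  "hausdorff_premeasure s \<delta> A =
     (INF U\<in>{U :: nat \<Rightarrow> 'a set. A \<subseteq> (\<Union>i. U i) \<and> (\<forall>i. bounded (U i) \<and> diameter (U i) \<le> \<delta>)}.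
        \<Sum>i. if U i = {} then 0
             else ennreal (unit_ball_vol (real s) * (diameter (U i) / 2) ^ s))"

definition hausdorff_outer :: "nat \<Rightarrow> 'a::euclidean_space set \<Rightarrow> ennreal" where
  "hausdorff_outer s A = (SUP \<delta>\<in>{0<..}. hausdorff_premeasure s \<delta> A)"

definition hausdorff_measure :: "nat \<Rightarrow> 'a::euclidean_space measure" where
  "hausdorff_measure s = measure_of UNIV (sets borel) (hausdorff_outer s)"

definition sphere_measure :: "'a::euclidean_space measure" where
  "sphere_measure = restrict_space (hausdorff_measure (DIM('a) - 1)) (sphere 0 1)"


section \<open>The class \<open>Y\<close>\<close>

definition Y_radial ::
  "('a::euclidean_space \<Rightarrow> complex) \<Rightarrow> ('a \<Rightarrow> complex) \<Rightarrow> int \<Rightarrow> real \<Rightarrow> 'a \<Rightarrow> real \<Rightarrow> complex" where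
  "Y_radial g h m \<tau> \<omega> \<rho> =
     cis (\<tau> * \<rho>) * g (\<rho> *\<^sub>R \<omega>) * cnj (h (\<rho> *\<^sub>R \<omega>)) * of_real (\<rho> powi m)"

text \<open>The value \<open>\<infinity>\<close> below prevents an undefined radial integral from counting as \<open>0\<close>.\<close>

definition Y_radial_integral ::
  "('a::euclidean_space \<Rightarrow> complex) \<Rightarrow> ('a \<Rightarrow> complex) \<Rightarrow> int \<Rightarrow> real \<Rightarrow> 'a \<Rightarrow> ennreal" where
  "Y_radial_integral g h m \<tau> \<omega> =
     (if set_integrable lborel {0<..} (Y_radial g h m \<tau> \<omega>)
      then ennreal (norm (LINT \<rho>:{0<..}|lborel. Y_radial g h m \<tau> \<omega> \<rho>))
      else \<infinity>)"

definition Y_norm :: "'a::euclidean_space distr \<Rightarrow> 'a distr \<Rightarrow> ennreal" where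
  "Y_norm T0 T1 =
     (let F = (\<lambda>j::nat. fourier_fun (if j = 0 then T0 else T1)) in
      \<Sum>j\<in>{0..1}. \<Sum>k\<in>{0..1}.
        \<integral>\<^sup>+\<tau>. (\<integral>\<^sup>+\<omega>. Y_radial_integral (F j) (F k) (int DIM('a) - int j - int k) \<tau> \<omega>
                 \<partial>sphere_measure) \<partial>lborel)"

text \<open>The defining formula evaluates the Fourier transforms pointwise, so these are required to
  be functions.\<close>

definition Y_class :: "('a::euclidean_space distr \<times> 'a distr) set" where
  "Y_class = {(T0, T1). tempered T0 \<and> tempered T1 \<and>
     (\<exists>g. represented_by (fourier_dist T0) g) \<and> (\<exists>g. represented_by (fourier_dist T1) g) \<and>
     Y_norm T0 T1 < \<infinity>}"


section \<open>The Cauchy problem\<close>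

definition continuous_H1 :: "(real \<Rightarrow> 'a::euclidean_space \<Rightarrow> complex) \<Rightarrow> bool" where
  "continuous_H1 u \<longleftrightarrow> (\<forall>t. u t \<in> H1) \<and>
     (\<forall>t. ((\<lambda>s. H1_norm (\<lambda>x. u s x - u t x)) \<longlongrightarrow> 0) (at t))"

definition continuous_L2 :: "(real \<Rightarrow> 'a::euclidean_space \<Rightarrow> complex) \<Rightarrow> bool" where
  "continuous_L2 u \<longleftrightarrow> (\<forall>t. u t \<in> L2) \<and>
     (\<forall>t. ((\<lambda>s. L2_norm (\<lambda>x. u s x - u t x)) \<longlongrightarrow> 0) (at t))"

definition time_deriv_L2 ::
  "(real \<Rightarrow> 'a::euclidean_space \<Rightarrow> complex) \<Rightarrow> (real \<Rightarrow> 'a \<Rightarrow> complex) \<Rightarrow> bool" where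
  "time_deriv_L2 u v \<longleftrightarrow> (\<forall>t. u t \<in> L2 \<and> v t \<in> L2 \<and>
     ((\<lambda>h. L2_norm (\<lambda>x. (u (t + h) x - u t x) / of_real h - v t x)) \<longlongrightarrow> 0) (at 0))"

text \<open>\<open>V\<close> is the derivative at \<open>t\<close> of the curve \<open>U\<close> of distributions, in the weak-star
  topology.\<close>

definition has_distr_derivative ::
  "(real \<Rightarrow> 'a::euclidean_space distr) \<Rightarrow> 'a distr \<Rightarrow> real \<Rightarrow> bool" where
  "has_distr_derivative U V t \<longleftrightarrow>
     (\<forall>\<phi>\<in>schwartz. ((\<lambda>s. U s \<phi>) has_vector_derivative V \<phi>) (at t))"

text \<open>\<open>v\<close> is the time derivative of \<open>u\<close>. At the regularity of \<open>u\<close>, its second time derivative and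
  its Laplacian are only distributions in \<open>x\<close>, so the equation is an identity of tempered
  distributions for each \<open>t \<noteq> 0\<close>.\<close>

definition kirchhoff_solution ::
  "('a::euclidean_space \<Rightarrow> complex) \<Rightarrow> ('a \<Rightarrow> complex) \<Rightarrow> (real \<Rightarrow> 'a \<Rightarrow> complex) \<Rightarrow> bool" where
  "kirchhoff_solution f0 f1 u \<longleftrightarrow>
     continuous_H1 u \<and>
     (\<exists>v. time_deriv_L2 u v \<and> continuous_L2 v \<and>
        (\<forall>t. t \<noteq> 0 \<longrightarrow>
           has_distr_derivative (\<lambda>s. dist_of (v s))
             (\<lambda>\<phi>. of_real (1 + (\<integral>x. (norm (u t x))\<^sup>2 \<partial>lborel)) * laplace_dist (dist_of (u t)) \<phi>) t) \<and>
        (AE x in lborel. u 0 x = f0 x) \<and>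
        (AE x in lborel. v 0 x = f1 x))"

end

theory Submission
 imports Defs "HOL-Probability.Probability"
begin

text \<open>On the Fourier side the equation is \<open>y'' + c\<^sup>2 r\<^sup>2 y = 0\<close> for each frequency of norm \<open>r\<close>, where
 the speed \<open>c\<close> depends on time only. Given the derivative \<open>q\<close> of the speed, small in mean, let \<open>\<theta>\<close> be
 the primitive of \<open>c\<close> and write \<open>y = sqrt (c0 / c) (exp (- \<i> r \<theta>) V + exp (\<i> r \<theta>) W) / 2\<close>; the amplitudes \<open>V\<close>, \<open>W\<close> move
 only through \<open>q / c\<close>. The relation \<open>c\<^sup>2 = 1 + \<parallel>u\<parallel>\<^sup>2\<close> becomes a fixed point equation \<open>q = T q\<close>, in which
 \<open>T q\<close> is an oscillatory integral of \<open>r V cnj W\<close> evaluated at time \<open>-2 \<theta>\<close>. Its integral over all times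
 is bounded by the integral of the radial transforms of the initial data, hence, after passing to polar
 coordinates, by the norm of the class \<open>Y\<close>; so \<open>T\<close> preserves small \<open>q\<close>, and its iterates converge
 factorially on bounded time intervals. For uniqueness, let \<open>D\<close> be the difference of two solutions and
 \<open>E\<close> its time derivative: then \<open>- E / r\<^sup>2\<close> is an \<open>L\<^sup>2\<close> primitive of the forcing, so that the energy
 \<open>(1 + \<parallel>u\<parallel>\<^sup>2) \<parallel>D\<parallel>\<^sup>2 + \<parallel>E / r\<parallel>\<^sup>2\<close> of one derivative less than usual is differentiable, and Gronwall's
 inequality applies.\<close>

text \<open>The derivative of \<open>c^2\<close> is twice the real inner product of \<open>u\<close>
  and its time derivative. For data of this regularity it is bounded, but nothing obvious makes it
  integrable in time, and without an integrable \<open>q / c\<close> the amplitudes could grow. The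
  gain lies in the phase: only \<open>V cnj W\<close> enters, multiplied by an oscillating factor.
  Yet \<open>V\<close> and \<open>W\<close> depend on \<open>q\<close>, while the class
  \<open>Y\<close> speaks of the initial data alone. What transports its bound is that the coupling
  of \<open>V\<close> and \<open>W\<close> contains the frequency only through
  \<open>cis (2 r \<theta>)\<close>, which acts on radial transforms as a translation, and
  translations preserve integrals over the line. A change of \<open>q\<close> shifts the phase,
  which costs one more power of \<open>r\<close> and a factor growing with time. So the iterates are
  compared on bounded intervals only, and the bound on the whole line passes to the limit by Fatou's
  lemma. For uniqueness, the difference of two speeds multiplies the Laplacian of a solution, which
  lies one derivative too low for the usual energy; this dictates the weaker energy, and makes the
  division by \<open>r\<close> at low frequencies the point to be proved.\<close>

abbreviation lborel_integral (binder "LI " 10) where "lborel_integral f \<equiv> lebesgue_integral lborel f"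
abbreviation lborel_nn_integral (binder "NI " 10) where "lborel_nn_integral f \<equiv> nn_integral lborel f"
abbreviation Borel where "Borel \<equiv> borel_measurable borel"


section \<open>Lebesgue integrals on Euclidean spaces\<close>

lemma lborel_integral_affine:
 fixes f :: "'a::euclidean_space => 'b::{banach, second_countable_topology}"
 assumes "c \<noteq> 0" and [measurable]: "f \<in> Borel"
 shows "integrable lborel (\<lambda>x. f (t + c *\<^sub>R x)) \<longleftrightarrow> integrable lborel f"
  and "(LI x. f x) = \<bar>c\<bar> ^ DIM('a) *\<^sub>R (LI x. f (t + c *\<^sub>R x))"
proof -
 have *: "lborel = density (distr lborel borel (\<lambda>x::'a. t + c *\<^sub>R x)) (\<lambda>_. ennreal (\<bar>c\<bar> ^ DIM('a)))"
  using lborel_affine[OF assms(1), of t] by (simp add: ennreal_power)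
 have "integrable lborel f \<longleftrightarrow> integrable lborel (\<lambda>x. \<bar>c\<bar> ^ DIM('a) *\<^sub>R f (t + c *\<^sub>R x))"
  by (subst *) (simp add: integrable_density integrable_distr_eq)
 then show "integrable lborel (\<lambda>x. f (t + c *\<^sub>R x)) \<longleftrightarrow> integrable lborel f"
  using assms(1) integrable_scaleR_right[of "1 / \<bar>c\<bar> ^ DIM('a)" lborel "\<lambda>x. \<bar>c\<bar> ^ DIM('a) *\<^sub>R f (t + c *\<^sub>R x)"]
  by auto
 show "(LI x. f x) = \<bar>c\<bar> ^ DIM('a) *\<^sub>R (LI x. f (t + c *\<^sub>R x))"
  by (subst *) (simp add: integral_density integral_distr)
qed

lemma lborel_integral_minus:
 fixes f :: "'a::euclidean_space => 'b::{banach, second_countable_topology}"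
 assumes [measurable]: "f \<in> Borel"
 shows "integrable lborel (\<lambda>x. f (- x)) \<longleftrightarrow> integrable lborel f"
  and "(LI x. f (- x)) = (LI x. f x)"
 using lborel_integral_affine[of "-1" f 0] by simp_all

lemma AE_lborel_minus:
 fixes P :: "'a::euclidean_space => bool"
 assumes "AE x in lborel. P x" shows "AE x in lborel. P (- x)"
proof -
 have *: "lborel = distr lborel borel (\<lambda>x::'a. - x)"
  using lborel_affine[of "-1::real" "0::'a"] by (simp add: density_1)
 have "AE x in distr lborel borel (\<lambda>x::'a. - x). P x" using assms by (subst *[symmetric])
 then show ?thesis by (rule AE_distrD[rotated]) simp
qed

lemma lborel_prod_integral:
 fixes f :: "'a::euclidean_space => real => 'b::{real_normed_field,banach,second_countable_topology}"
 assumes "\<And>b. b \<in> Basis ==> integrable lborel (f b)"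
 shows "integrable lborel (\<lambda>x. \<Prod>b\<in>Basis. f b (x \<bullet> b))"
  and "(LI x. (\<Prod>b\<in>Basis. f b (x \<bullet> b))) = (\<Prod>b\<in>Basis. \<integral>t. f b t \<partial>lborel)"
proof -
 interpret product_sigma_finite "\<lambda>_::'a. lborel :: real measure" ..
 have [measurable]: "f b \<in> Borel" if "b \<in> Basis" for b
  using borel_measurable_integrable[OF assms[OF that]] by simp
 have [measurable]: "(\<lambda>x::'a. \<Prod>b\<in>Basis. f b (x \<bullet> b)) \<in> Borel"
  by (intro borel_measurable_prod) (auto intro!: measurable_compose[OF _ \<open>\<And>b. b \<in> Basis ==> f b \<in> Borel\<close>])
 have *: "(\<Prod>b\<in>Basis. f b ((\<Sum>i\<in>Basis. g i *\<^sub>R i) \<bullet> b)) = (\<Prod>b\<in>Basis. f b (g b))" for g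
  by (intro prod.cong refl) (simp add: inner_sum_left inner_Basis sum.delta if_distrib cong: if_cong)
 show "integrable lborel (\<lambda>x. \<Prod>b\<in>Basis. f b (x \<bullet> b))"
  by (subst lborel_eq, subst integrable_distr_eq)
   (auto simp: * intro!: product_integrable_prod assms)
 show "(LI x. (\<Prod>b\<in>Basis. f b (x \<bullet> b))) = (\<Prod>b\<in>Basis. \<integral>t. f b t \<partial>lborel)"
  by (subst lborel_eq, subst integral_distr)
   (auto simp: * intro!: product_integral_prod assms)
qed

section \<open>Gaussians\<close>

text \<open>Real and imaginary linear terms \<open>a\<close> and \<open>b\<close> are both present
  because the Fourier transform exchanges their roles: up to constants the family is stable under
  it, and under modulation.\<close>

definition gaussian :: "real => 'a::euclidean_space => 'a => 'a => complex" where
 "gaussian d a b x = of_real (exp (- d * (x \<bullet> x) + a \<bullet> x)) * cis (b \<bullet> x)"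

lemma gaussian_continuous: "continuous_on UNIV (gaussian d a b)"
 unfolding gaussian_def[abs_def] cis_conv_exp by (intro continuous_intros)

lemma gaussian_measurable [measurable]: "gaussian d a b \<in> Borel"
 by (rule borel_measurable_continuous_onI[OF gaussian_continuous])

lemma norm_gaussian: "norm (gaussian d a b x) = exp (- d * (x \<bullet> x) + a \<bullet> x)"
 by (simp add: gaussian_def norm_mult)

text \<open>The substitution \<open>x = a / (2 d) + y / s\<close> with \<open>s = sqrt (2 d)\<close>
  completes the square and leaves a constant times the standard normal density times a character,
  whose integral is the characteristic function of the normal law.\<close>

lemma gaussian_integral_real:
 assumes "d > 0"
 shows "integrable lborel (gaussian d a (b::real))"
  and "(LI x. gaussian d a b x)
    = of_real (sqrt (pi / d) * exp ((a\<^sup>2 - b\<^sup>2) / (4 * d))) * cis (a * b / (2 * d))"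
proof -
 define s where "s = sqrt (2 * d)"
 have s: "s > 0" "s\<^sup>2 = 2 * d" using assms by (auto simp: s_def)
 define K where "K = of_real (sqrt (2 * pi) * exp (a\<^sup>2 / (4 * d))) * cis (a * b / (2 * d))"
 have eq: "gaussian d a b (a / (2 * d) + (1 / s) * y)
   = K * (std_normal_density y *\<^sub>R iexp ((b / s) * y))" for y
 proof -
  let ?x = "a / (2 * d) + (1 / s) * y"
  have ss: "1 / s * (1 / s) = 1 / (2 * d)" using s by (simp add: power2_eq_square)
  have "- d * (?x * ?x) + a * ?x = a\<^sup>2 / (4 * d) - d * (1 / s * (1 / s)) * (y * y)"
   using assms s(1) by (simp add: field_simps power2_eq_square)
  also have "... = a\<^sup>2 / (4 * d) - y\<^sup>2 / 2"
   unfolding ss using assms by (simp add: field_simps power2_eq_square)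
  finally have 1: "- d * (?x * ?x) + a * ?x = a\<^sup>2 / (4 * d) - y\<^sup>2 / 2" .
  have 2: "b * ?x = a * b / (2 * d) + (b / s) * y" by (simp add: field_simps)
  show ?thesis
   unfolding gaussian_def inner_real_def 1 2 K_def std_normal_density_def exp_diff
   unfolding cis_mult[symmetric] cis_conv_exp[of "b / s * y"]
   by (simp add: scaleR_conv_of_real exp_minus field_simps)
 qed
 have int: "integrable lborel (\<lambda>y. std_normal_density y *\<^sub>R iexp (t * y))" for t
  by (rule Bochner_Integration.integrable_bound[of _ std_normal_density]) (auto intro: integrable_normal_density)
 have val: "(LI y. std_normal_density y *\<^sub>R iexp (t * y)) = of_real (exp (- (t^2) / 2))" for t
  using fun_cong[OF char_std_normal_distribution, of t]
  unfolding char_def by (subst (asm) integral_density) (auto simp: normal_density_nonneg)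
 have "integrable lborel (\<lambda>y. gaussian d a b (a / (2 * d) + (1 / s) * y))"
  unfolding eq by (intro integrable_mult_right int)
 then show "integrable lborel (gaussian d a b)"
  using s by (subst (asm) lborel_integrable_real_affine_iff) auto
 have "(LI x. gaussian d a b x) = \<bar>1 / s\<bar> *\<^sub>R (LI y. gaussian d a b (a / (2 * d) + (1 / s) * y))"
  by (rule lborel_integral_real_affine) (use s in auto)
 also have "... = (1 / s) *\<^sub>R (K * of_real (exp (- ((b / s)^2) / 2)))"
  unfolding eq using s by (subst integral_mult_right_zero, subst val) simp
 also have "(b / s)^2 = b\<^sup>2 / (2 * d)" using s by (simp add: power_divide)
 also have "(1 / s) *\<^sub>R (K * of_real (exp (- (b\<^sup>2 / (2 * d)) / 2)))
  = of_real ((1 / s) * sqrt (2 * pi) * (exp (a\<^sup>2 / (4 * d)) * exp (- (b\<^sup>2 / (2 * d)) / 2))) * cis (a * b / (2 * d))"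
  by (simp add: K_def scaleR_conv_of_real)
 also have "exp (a\<^sup>2 / (4 * d)) * exp (- (b\<^sup>2 / (2 * d)) / 2) = exp ((a\<^sup>2 - b\<^sup>2) / (4 * d))"
  by (simp add: exp_add[symmetric] diff_divide_distrib)
 also have "(1 / s) * sqrt (2 * pi) = sqrt (pi / d)"
  using assms by (simp add: s_def real_sqrt_mult real_sqrt_divide)
 finally show "(LI x. gaussian d a b x)
    = of_real (sqrt (pi / d) * exp ((a\<^sup>2 - b\<^sup>2) / (4 * d))) * cis (a * b / (2 * d))" .
qed

lemma cis_sum: "finite A ==> cis (\<Sum>i\<in>A. f i) = (\<Prod>i\<in>A. cis (f i))"
 by (induction A rule: finite_induct) (auto simp: cis_mult[symmetric])

lemma gaussian_integral:
 fixes a b :: "'a::euclidean_space"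
 assumes "d > 0"
 shows "integrable lborel (gaussian d a b)"
  and "(LI x. gaussian d a b x)
    = of_real (sqrt (pi / d) ^ DIM('a) * exp ((a \<bullet> a - b \<bullet> b) / (4 * d))) * cis (a \<bullet> b / (2 * d))"
proof -
 have eq: "gaussian d a b = (\<lambda>x. \<Prod>e\<in>Basis. gaussian d (a \<bullet> e) (b \<bullet> e) (x \<bullet> e))"
 proof
  fix x :: 'a
  have 1: "- d * (x \<bullet> x) + a \<bullet> x = (\<Sum>e\<in>Basis. - d * ((x \<bullet> e) \<bullet> (x \<bullet> e)) + (a \<bullet> e) \<bullet> (x \<bullet> e))"
   by (subst (1 2) euclidean_inner) (simp add: sum.distrib sum_distrib_left sum_negf sum_subtractf)
  have 2: "b \<bullet> x = (\<Sum>e\<in>Basis. (b \<bullet> e) \<bullet> (x \<bullet> e))" by (subst euclidean_inner) simp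
  show "gaussian d a b x = (\<Prod>e\<in>Basis. gaussian d (a \<bullet> e) (b \<bullet> e) (x \<bullet> e))"
   unfolding gaussian_def 1 2 by (simp only: exp_sum[OF finite_Basis] cis_sum[OF finite_Basis] of_real_prod prod.distrib)
 qed
 show "integrable lborel (gaussian d a b)"
  unfolding eq by (intro lborel_prod_integral gaussian_integral_real assms)
 have "(LI x. gaussian d a b x) = (\<Prod>e\<in>Basis. of_real (sqrt (pi / d) * exp (((a \<bullet> e)^2 - (b \<bullet> e)^2) / (4 * d)))
   * cis ((a \<bullet> e) * (b \<bullet> e) / (2 * d)))"
  unfolding eq by (subst lborel_prod_integral) (simp_all add: gaussian_integral_real assms)
 also have "... = of_real (sqrt (pi / d) ^ DIM('a) * exp (\<Sum>e\<in>Basis. ((a \<bullet> e)^2 - (b \<bullet> e)^2) / (4 * d)))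
   * cis (\<Sum>e\<in>Basis. (a \<bullet> e) * (b \<bullet> e) / (2 * d))"
  by (simp add: prod.distrib exp_sum cis_sum)
 also have "(\<Sum>e\<in>Basis. ((a \<bullet> e)^2 - (b \<bullet> e)^2) / (4 * d)) = (a \<bullet> a - b \<bullet> b) / (4 * d)"
  by (subst (3 4) euclidean_inner) (simp add: sum_divide_distrib[symmetric] sum_subtractf power2_eq_square)
 also have "(\<Sum>e\<in>Basis. (a \<bullet> e) * (b \<bullet> e) / (2 * d)) = a \<bullet> b / (2 * d)"
  by (subst (3) euclidean_inner) (simp add: sum_divide_distrib[symmetric])
 finally show "(LI x. gaussian d a b x)
    = of_real (sqrt (pi / d) ^ DIM('a) * exp ((a \<bullet> a - b \<bullet> b) / (4 * d))) * cis (a \<bullet> b / (2 * d))" .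
qed

lemma fourier_gaussian:
 fixes a b :: "'a::euclidean_space"
 assumes "d > 0"
 shows "fourier (gaussian d a b) = (\<lambda>z. of_real (sqrt (pi / d) ^ DIM('a) * exp ((a \<bullet> a - b \<bullet> b) / (4 * d)))
  * cis (a \<bullet> b / (2 * d)) * gaussian (1 / (4 * d)) ((1 / (2 * d)) *\<^sub>R b) (- (1 / (2 * d)) *\<^sub>R a) z)"
proof
 fix z :: 'a
 have "cis (- (x \<bullet> z)) * gaussian d a b x = gaussian d a (b - z) x" for x
 proof -
  have "(b - z) \<bullet> x = - (x \<bullet> z) + b \<bullet> x" by (simp add: inner_diff_left inner_commute[of x])
  then show ?thesis unfolding gaussian_def by (simp only: cis_mult[symmetric] mult_ac)
 qed
 then have "fourier (gaussian d a b) z = (LI x. gaussian d a (b - z) x)"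
  by (simp add: fourier_def)
 also have "... = of_real (sqrt (pi / d) ^ DIM('a) * exp ((a \<bullet> a - (b - z) \<bullet> (b - z)) / (4 * d))) * cis (a \<bullet> (b - z) / (2 * d))"
  by (rule gaussian_integral[OF assms])
 also have "(a \<bullet> a - (b - z) \<bullet> (b - z)) / (4 * d)
   = (a \<bullet> a - b \<bullet> b) / (4 * d) + (- (1 / (4 * d)) * (z \<bullet> z) + ((1 / (2 * d)) *\<^sub>R b) \<bullet> z)"
  using assms by (simp add: inner_diff inner_commute field_simps)
 also have "a \<bullet> (b - z) / (2 * d) = a \<bullet> b / (2 * d) + (- (1 / (2 * d)) *\<^sub>R a) \<bullet> z"
  using assms by (simp add: inner_diff field_simps)
 finally show "fourier (gaussian d a b) z = of_real (sqrt (pi / d) ^ DIM('a) * exp ((a \<bullet> a - b \<bullet> b) / (4 * d)))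
  * cis (a \<bullet> b / (2 * d)) * gaussian (1 / (4 * d)) ((1 / (2 * d)) *\<^sub>R b) (- (1 / (2 * d)) *\<^sub>R a) z"
  unfolding gaussian_def exp_add cis_mult[symmetric] by (simp add: mult_ac)
qed

lemma fourier_scale: "fourier (\<lambda>x. c * f x) = (\<lambda>z. c * fourier f z)"
 by (rule ext, cases "c = 0") (simp_all add: fourier_def mult.left_commute[of _ c])

text \<open>The transform of a Gaussian is a Gaussian, so the explicit formula applies twice.
  Inversion is computed in this case only; for square-integrable functions it follows by duality,
  since Gaussians separate functions.\<close>

lemma fourier_fourier_gaussian:
 fixes a b :: "'a::euclidean_space"
 assumes "d > 0"
 shows "fourier (fourier (gaussian d a b)) z = of_real ((2 * pi) ^ DIM('a)) * gaussian d a b (- z)"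
proof -
 have A: "1 / (4 * d) > 0" using assms by simp
 have "sqrt (pi / d) * sqrt (pi / (1 / (4 * d))) = sqrt ((2 * pi)^2)"
  unfolding real_sqrt_mult[symmetric] using assms by (simp add: power2_eq_square)
 also have "... = 2 * pi" by (rule real_sqrt_unique) auto
 finally have 1: "sqrt (pi / d) ^ DIM('a) * sqrt (pi / (1 / (4 * d))) ^ DIM('a) = (2 * pi) ^ DIM('a)"
  unfolding power_mult_distrib[symmetric] by (rule arg_cong)
 have 2: "1 / (4 * (1 / (4 * d))) = d" "1 / (2 * (1 / (4 * d))) = 2 * d" using assms by auto
 have 3: "exp ((a \<bullet> a - b \<bullet> b) / (4 * d)) * exp ((((1 / (2 * d)) *\<^sub>R b) \<bullet> ((1 / (2 * d)) *\<^sub>R b) - (- (1 / (2 * d)) *\<^sub>R a) \<bullet> (- (1 / (2 * d)) *\<^sub>R a)) / (4 * (1 / (4 * d)))) = 1"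
  using assms by (simp add: exp_add[symmetric] field_simps)
 have 4: "cis (a \<bullet> b / (2 * d)) * cis ((((1 / (2 * d)) *\<^sub>R b) \<bullet> (- (1 / (2 * d)) *\<^sub>R a)) / (2 * (1 / (4 * d)))) = 1"
  using assms by (simp add: cis_mult field_simps inner_commute)
 have 5: "gaussian d ((2 * d) *\<^sub>R (- (1 / (2 * d)) *\<^sub>R a)) (- (2 * d) *\<^sub>R ((1 / (2 * d)) *\<^sub>R b)) z = gaussian d a b (- z)"
  using assms by (simp add: gaussian_def)
 let ?A = "sqrt (pi / d) ^ DIM('a)" and ?B = "exp ((a \<bullet> a - b \<bullet> b) / (4 * d))" and ?C = "cis (a \<bullet> b / (2 * d))"
 let ?A' = "sqrt (pi / (1 / (4 * d))) ^ DIM('a)" 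
 let ?B' = "exp ((((1 / (2 * d)) *\<^sub>R b) \<bullet> ((1 / (2 * d)) *\<^sub>R b) - (- (1 / (2 * d)) *\<^sub>R a) \<bullet> (- (1 / (2 * d)) *\<^sub>R a)) / (4 * (1 / (4 * d))))"
 let ?C' = "cis ((((1 / (2 * d)) *\<^sub>R b) \<bullet> (- (1 / (2 * d)) *\<^sub>R a)) / (2 * (1 / (4 * d))))"
 have "fourier (fourier (gaussian d a b)) z = (of_real (?A * ?B) * ?C) * (of_real (?A' * ?B') * ?C' * 
  gaussian (1 / (4 * (1 / (4 * d)))) ((1 / (2 * (1 / (4 * d)))) *\<^sub>R (- (1 / (2 * d)) *\<^sub>R a)) (- (1 / (2 * (1 / (4 * d)))) *\<^sub>R ((1 / (2 * d)) *\<^sub>R b)) z)"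
  unfolding fourier_gaussian[OF assms] fourier_scale fourier_gaussian[OF A] ..
 also have "... = of_real ((?A * ?A') * (?B * ?B')) * (?C * ?C') * gaussian d a b (- z)"
  unfolding 2 5 by (simp only: of_real_mult mult_ac)
 also have "... = of_real ((2 * pi) ^ DIM('a)) * gaussian d a b (- z)"
  unfolding 1 3 4 by simp
 finally show ?thesis .
qed

section \<open>Schwartz functions\<close>

text \<open>Iterated derivatives never have to be computed: a family of differentiable, rapidly
  decreasing functions that is stable under partial derivatives contains all iterated derivatives of
  its members.\<close>

lemma schwartz_coinduct:
 assumes "h \<in> A"
  and "\<And>f x. f \<in> A ==> f differentiable (at x)"
  and "\<And>f N. f \<in> A ==> \<exists>B. \<forall>x. (1 + norm x) ^ N * norm (f x) \<le> B"
  and "\<And>f b. f \<in> A ==> b \<in> Basis ==> partial_deriv b f \<in> A"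
 shows "h \<in> schwartz"
proof -
 have "iter_deriv bs h \<in> A" if "bs \<in> lists Basis" for bs
  using that unfolding iter_deriv_def by (induction bs) (auto simp: assms)
 then show ?thesis unfolding schwartz_def using assms(2,3)
  by (fastforce simp: bdd_above_def)
qed

lemma schwartz_partial_deriv:
 assumes "h \<in> schwartz" "b \<in> Basis" shows "partial_deriv b h \<in> schwartz"
proof -
 have "iter_deriv bs (partial_deriv b h) = iter_deriv (bs @ [b]) h" for bs
  by (simp add: iter_deriv_def)
 then show ?thesis using assms unfolding schwartz_def by auto
qed

lemma schwartz_differentiable: "h \<in> schwartz ==> h differentiable (at x)"
 unfolding schwartz_def by (auto dest!: bspec[of _ _ "[]"] simp: iter_deriv_def)

lemma schwartz_bound:
 assumes "h \<in> schwartz"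
 obtains B where "B \<ge> 0" "\<And>x. norm (h x) \<le> B / (1 + norm x) ^ N"
proof -
 have "bdd_above (range (\<lambda>x. (1 + norm x) ^ N * norm (h x)))"
  using assms unfolding schwartz_def by (auto dest!: bspec[of _ _ "[]"] simp: iter_deriv_def)
 then obtain B where B: "\<And>x. (1 + norm x) ^ N * norm (h x) \<le> B" by (auto simp: bdd_above_def)
 have "0 \<le> (1 + norm (0::'a)) ^ N * norm (h 0)" by simp
 with B[of 0] have "B \<ge> 0" by linarith
 moreover have "norm (h x) \<le> B / (1 + norm x) ^ N" for x
  using B[of x] by (simp add: field_simps add_pos_nonneg)
 ultimately show ?thesis using that by blast
qed

lemma schwartz_continuous: "h \<in> schwartz ==> continuous_on UNIV h"
 by (simp add: continuous_on_eq_continuous_at differentiable_imp_continuous_within schwartz_differentiable)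

lemma schwartz_measurable: "h \<in> schwartz ==> h \<in> Borel"
 by (rule borel_measurable_continuous_onI[OF schwartz_continuous])

lemma partial_deriv_eq:
 "(f has_derivative D) (at x) ==> partial_deriv b f x = D b"
 by (simp add: partial_deriv_def frechet_derivative_at[symmetric])

text \<open>Polynomials times a fixed Gaussian, generated by closure rules, so that stability under
  differentiation becomes an induction over the rules.\<close>

inductive_set gaussian_poly :: "real => 'a::euclidean_space => 'a => ('a => complex) set" for d a b where
 base: "gaussian d a b \<in> gaussian_poly d a b"
| coord: "f \<in> gaussian_poly d a b ==> (\<lambda>x. of_real (x \<bullet> e) * f x) \<in> gaussian_poly d a b"
| scale: "f \<in> gaussian_poly d a b ==> (\<lambda>x. c * f x) \<in> gaussian_poly d a b"
| add: "f \<in> gaussian_poly d a b ==> g \<in> gaussian_poly d a b ==> (\<lambda>x. f x + g x) \<in> gaussian_poly d a b"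

lemma gaussian_has_derivative:
 "(gaussian d a b has_derivative
  (\<lambda>h. (of_real (- 2 * d * (x \<bullet> h) + a \<bullet> h) + \<i> * of_real (b \<bullet> h)) * gaussian d a b x)) (at x)"
proof -
 have eq: "gaussian d a b = (\<lambda>x. exp (of_real (- d * (x \<bullet> x) + a \<bullet> x) + \<i> * of_real (b \<bullet> x)))"
  by (rule ext) (simp only: gaussian_def cis_conv_exp exp_add exp_of_real)
 have "((\<lambda>x. complex_of_real (- d * (x \<bullet> x) + a \<bullet> x) + \<i> * of_real (b \<bullet> x)) has_derivative
  (\<lambda>h. of_real (- d * (2 * (x \<bullet> h)) + a \<bullet> h) + \<i> * of_real (b \<bullet> h))) (at x)"
  by (auto intro!: derivative_eq_intros simp: inner_commute)
 from has_derivative_compose[OF this, of exp "\<lambda>h. h * exp (of_real (- d * (x \<bullet> x) + a \<bullet> x) + \<i> * of_real (b \<bullet> x))"]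
  DERIV_exp[of "complex_of_real (- d * (x \<bullet> x) + a \<bullet> x) + \<i> * of_real (b \<bullet> x)"]
 show ?thesis unfolding eq has_field_derivative_def by (simp add: mult_ac mult_commute_abs)
qed

lemma gaussian_poly_derivative:
 assumes "f \<in> gaussian_poly d a b"
 shows "f differentiable (at x)" "partial_deriv e f \<in> gaussian_poly d a b"
proof -
 \<comment> \<open>One derivative \<open>D\<close> serves both claims: the product rule for a
   coordinate times \<open>f\<close> needs that the directional values of \<open>D\<close> lie in
   the class again.\<close>
 have "\<exists>D. (\<forall>x. (f has_derivative D x) (at x)) \<and> (\<forall>e. (\<lambda>x. D x e) \<in> gaussian_poly d a b)"
  using assms
 proof induction
  case base
  let ?g = "gaussian d a b"
  have "(\<lambda>x. (of_real (- 2 * d * (x \<bullet> h) + a \<bullet> h) + \<i> * of_real (b \<bullet> h)) * ?g x) \<in> gaussian_poly d a b" for h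
  proof -
   have "(\<lambda>x. of_real (- 2 * d) * (of_real (x \<bullet> h) * ?g x) + (of_real (a \<bullet> h) + \<i> * of_real (b \<bullet> h)) * ?g x) \<in> gaussian_poly d a b"
    by (intro gaussian_poly.intros)
   then show ?thesis by (simp add: algebra_simps)
  qed
  then show ?case by (intro exI[of _ "\<lambda>x h. (of_real (- 2 * d * (x \<bullet> h) + a \<bullet> h) + \<i> * of_real (b \<bullet> h)) * ?g x"])
   (use gaussian_has_derivative in auto)
 next
  case (coord f e)
  then obtain D where D: "\<And>x. (f has_derivative D x) (at x)" "\<And>e. (\<lambda>x. D x e) \<in> gaussian_poly d a b" by blast
  have "((\<lambda>x. of_real (x \<bullet> e) * f x) has_derivative (\<lambda>h. of_real (x \<bullet> e) * D x h + of_real (h \<bullet> e) * f x)) (at x)" for x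
   by (auto intro!: derivative_eq_intros D)
  moreover have "(\<lambda>x. of_real (x \<bullet> e) * D x h + of_real (h \<bullet> e) * f x) \<in> gaussian_poly d a b" for h
   by (intro gaussian_poly.intros D coord)
  ultimately show ?case by (intro exI[of _ "\<lambda>x h. of_real (x \<bullet> e) * D x h + of_real (h \<bullet> e) * f x"]) blast
 next
  case (scale f c)
  then obtain D where D: "\<And>x. (f has_derivative D x) (at x)" "\<And>e. (\<lambda>x. D x e) \<in> gaussian_poly d a b" by blast
  have "((\<lambda>x. c * f x) has_derivative (\<lambda>h. c * D x h)) (at x)" for x
   by (auto intro!: derivative_eq_intros D)
  moreover have "(\<lambda>x. c * D x h) \<in> gaussian_poly d a b" for h
   by (intro gaussian_poly.intros D)
  ultimately show ?case by (intro exI[of _ "\<lambda>x h. c * D x h"]) blast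
 next
  case (add f g)
  then obtain D E where D: "\<And>x. (f has_derivative D x) (at x)" "\<And>e. (\<lambda>x. D x e) \<in> gaussian_poly d a b"
   and E: "\<And>x. (g has_derivative E x) (at x)" "\<And>e. (\<lambda>x. E x e) \<in> gaussian_poly d a b" by blast
  have "((\<lambda>x. f x + g x) has_derivative (\<lambda>h. D x h + E x h)) (at x)" for x
   by (auto intro!: derivative_eq_intros D E)
  moreover have "(\<lambda>x. D x h + E x h) \<in> gaussian_poly d a b" for h
   by (intro gaussian_poly.intros D E)
  ultimately show ?case by (intro exI[of _ "\<lambda>x h. D x h + E x h"]) blast
 qed
 then obtain D where D: "\<And>x. (f has_derivative D x) (at x)" "\<And>e. (\<lambda>x. D x e) \<in> gaussian_poly d a b" by blast
 then show "f differentiable (at x)" by (auto simp: differentiable_def)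
 have "partial_deriv e f = (\<lambda>x. D x e)" by (rule ext) (rule partial_deriv_eq[OF D(1)])
 then show "partial_deriv e f \<in> gaussian_poly d a b" using D by simp
qed

lemma power_le_fact_exp: 
 assumes x: "x \<ge> 0" shows "x ^ N \<le> fact N * exp (x::real)"
proof -
 have "x ^ N / fact N \<le> (\<Sum>k<Suc N. x ^ k / fact k)"
  using x by (simp add: sum_nonneg)
 also have "... \<le> exp x"
  unfolding exp_def using x summable_exp_generic[of x]
  by (subst divide_real_def, subst mult.commute, fold real_scaleR_def, intro sum_le_suminf) auto
 finally show ?thesis by (simp add: field_simps)
qed

lemma gaussian_poly_bound:
 fixes a b :: "'a::euclidean_space"
 assumes "f \<in> gaussian_poly d a b" "d > 0"
 shows "\<exists>B. \<forall>x. (1 + norm x) ^ N * norm (f x) \<le> B"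
 using assms
proof (induction arbitrary: N)
 case base
 \<comment> \<open>The maximum of \<open>- d s^2 + (norm a + 1) s\<close> over real
   \<open>s\<close>; the extra 1 pays for the weight, which is at most
   \<open>fact N * exp (1 + norm x)\<close>.\<close>
 define c where "c = (norm a + 1)^2 / (4 * d)"
 have "(1 + norm x) ^ N * norm (gaussian d a b x) \<le> fact N * exp (1 + c)" for x
 proof -
  have "- d * (x \<bullet> x) + a \<bullet> x + norm x \<le> - d * (norm x)^2 + (norm a + 1) * norm x"
   using norm_cauchy_schwarz[of a x] by (simp add: power2_norm_eq_inner algebra_simps)
  also have "... = c - d * (norm x - (norm a + 1) / (2 * d))^2"
   using assms unfolding c_def by (simp add: field_simps power2_eq_square)
  also have "... \<le> c" using assms by simp
  finally have *: "(1 + norm x) + (- d * (x \<bullet> x) + a \<bullet> x) \<le> 1 + c" by simp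
  have "(1 + norm x) ^ N * norm (gaussian d a b x) \<le> fact N * exp (1 + norm x) * exp (- d * (x \<bullet> x) + a \<bullet> x)"
   unfolding norm_gaussian by (intro mult_right_mono power_le_fact_exp) auto
  also have "... = fact N * exp ((1 + norm x) + (- d * (x \<bullet> x) + a \<bullet> x))" by (simp add: exp_add)
  also have "... \<le> fact N * exp (1 + c)" using * by simp
  finally show ?thesis .
 qed
 then show ?case by blast
next
 case (coord f e)
 then obtain B where B: "\<And>x. (1 + norm x) ^ Suc N * norm (f x) \<le> B" by blast
 have "(1 + norm x) ^ N * norm (of_real (x \<bullet> e) * f x) \<le> norm e * B" for x
 proof -
  have "\<bar>x \<bullet> e\<bar> \<le> norm x * norm e" by (rule Cauchy_Schwarz_ineq2)
  also have "... \<le> (1 + norm x) * norm e" by (simp add: mult_right_mono)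
  finally have "(1 + norm x) ^ N * (\<bar>x \<bullet> e\<bar> * norm (f x)) \<le> (1 + norm x) ^ N * ((1 + norm x) * norm e * norm (f x))"
   by (intro mult_left_mono mult_right_mono) auto
  also have "... = norm e * ((1 + norm x) ^ Suc N * norm (f x))" by simp
  also have "... \<le> norm e * B" by (intro mult_left_mono B) simp
  finally show ?thesis by (simp add: norm_mult)
 qed
 then show ?case by blast
next
 case (scale f c)
 then obtain B where B: "\<And>x. (1 + norm x) ^ N * norm (f x) \<le> B" by blast
 have "(1 + norm x) ^ N * norm (c * f x) \<le> norm c * B" for x
  using mult_left_mono[OF B[of x], of "norm c"] by (simp add: norm_mult mult_ac)
 then show ?case by blast
next
 case (add f g)
 then obtain B C where B: "\<And>x. (1 + norm x) ^ N * norm (f x) \<le> B" and C: "\<And>x. (1 + norm x) ^ N * norm (g x) \<le> C" by metis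
 have "(1 + norm x) ^ N * norm (f x + g x) \<le> B + C" for x
 proof -
  have "(1 + norm x) ^ N * norm (f x + g x) \<le> (1 + norm x) ^ N * (norm (f x) + norm (g x))"
   by (intro mult_left_mono norm_triangle_ineq) simp
  then show ?thesis using B[of x] C[of x] by (simp add: distrib_left)
 qed
 then show ?case by blast
qed

lemma gaussian_poly_schwartz:
 assumes "f \<in> gaussian_poly d a b" "d > 0" shows "f \<in> schwartz"
 by (rule schwartz_coinduct[where A = "gaussian_poly d a b"])
  (use assms gaussian_poly_derivative gaussian_poly_bound in auto)

lemma gaussian_schwartz: "d > 0 ==> (\<lambda>x. c * gaussian d a b x) \<in> schwartz"
 by (rule gaussian_poly_schwartz[of _ d a b]) (auto intro: gaussian_poly.intros)

text \<open>The exponent is twice the dimension because \<open>(1 + norm x)^2\<close> dominates each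
  \<open>1 + (x \<bullet> b)^2\<close>, and the product of the reciprocals of these splits into
  integrable functions of one variable.\<close>

lemma integrable_japanese:
 "integrable lborel (\<lambda>x::'a::euclidean_space. 1 / (1 + norm x) ^ (2 * DIM('a)))"
proof -
 have "set_integrable lborel (einterval (-\<infinity>) \<infinity>) (\<lambda>x. inverse (1 + x^2))"
  by (rule integrable_inverse_1_plus_square)
 then have 1: "integrable lborel (\<lambda>x::real. inverse (1 + x^2))"
  by (simp add: set_integrable_def)
 have "integrable lborel (\<lambda>x::'a. \<Prod>b\<in>Basis. inverse (1 + (x \<bullet> b)^2))"
  by (rule lborel_prod_integral[of "\<lambda>b t. inverse (1 + t^2)"]) (rule 1)
 then show ?thesis
 proof (rule Bochner_Integration.integrable_bound)
  show "AE x::'a in lborel. norm (1 / (1 + norm x) ^ (2 * DIM('a))) \<le> norm (\<Prod>b\<in>Basis. inverse (1 + (x \<bullet> b)^2))"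
  proof (rule AE_I2)
   fix x :: 'a
   have "(\<Prod>b\<in>Basis. 1 + (x \<bullet> b)^2) \<le> (\<Prod>b\<in>(Basis::'a set). (1 + norm x)^2)"
   proof (intro prod_mono conjI)
    fix b :: 'a assume "b \<in> Basis"
    then have "(x \<bullet> b)^2 \<le> (norm x)^2" using Basis_le_norm[of b x] by (metis abs_le_square_iff abs_norm_cancel)
    then show "1 + (x \<bullet> b)^2 \<le> (1 + norm x)^2" by (simp add: power2_sum add.commute add_increasing)
   qed simp
   also have "... = (1 + norm x) ^ (2 * DIM('a))" by (simp add: power_mult)
   finally have *: "(\<Prod>b\<in>Basis. 1 + (x \<bullet> b)^2) \<le> (1 + norm x) ^ (2 * DIM('a))" .
   have "(\<Prod>b\<in>Basis. 1 + (x \<bullet> b)^2) > 0" by (intro prod_pos) (simp add: add_pos_nonneg)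
   with * have "inverse ((1 + norm x) ^ (2 * DIM('a))) \<le> inverse (\<Prod>b\<in>Basis. 1 + (x \<bullet> b)^2)"
    by (rule le_imp_inverse_le)
   then show "norm (1 / (1 + norm x) ^ (2 * DIM('a))) \<le> norm (\<Prod>b\<in>Basis. inverse (1 + (x \<bullet> b)^2))"
    by (simp add: prod_inversef[symmetric] o_def inverse_eq_divide prod_nonneg abs_prod prod_dividef)
  qed
 qed simp
qed

lemma integrable_of_decay:
 fixes f :: "'a::euclidean_space => complex"
 assumes "f \<in> Borel" "\<And>x. norm (f x) \<le> B / (1 + norm x) ^ (2 * DIM('a))" "B \<ge> 0"
 shows "integrable lborel f"
proof (rule Bochner_Integration.integrable_bound)
 show "integrable lborel (\<lambda>x::'a. B * (1 / (1 + norm x) ^ (2 * DIM('a))))"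
  by (rule integrable_mult_right[OF integrable_japanese])
 show "AE x in lborel. norm (f x) \<le> norm (B * (1 / (1 + norm x) ^ (2 * DIM('a))))"
  using assms by (intro AE_I2) simp
qed (use assms in simp)

lemma schwartz_integrable: "h \<in> schwartz ==> integrable lborel h"
 by (metis integrable_of_decay schwartz_bound schwartz_measurable)

lemma schwartz_L2:
 assumes "h \<in> schwartz" shows "h \<in> L2"
proof -
 obtain B where B: "B \<ge> 0" "\<And>x. norm (h x) \<le> B / (1 + norm x) ^ 0" using schwartz_bound[OF assms, of 0] by blast
 have [measurable]: "h \<in> Borel" by (rule schwartz_measurable[OF assms])
 have "integrable lborel (\<lambda>x. (norm (h x))^2)"
 proof (rule Bochner_Integration.integrable_bound)
  show "integrable lborel (\<lambda>x. of_real B * h x)" using schwartz_integrable[OF assms] by simp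
  show "AE x in lborel. norm ((norm (h x))^2) \<le> norm (of_real B * h x)"
   using B by (intro AE_I2) (simp add: norm_mult power2_eq_square mult_right_mono)
 qed simp
 then show ?thesis by (simp add: L2_def)
qed

text \<open>By translation invariance every difference quotient of \<open>g\<close> in direction
  \<open>b\<close> has integral zero. The mean value inequality and the decay of the derivative give
  a majorant for all steps of length at most 1, so the quotients converge under the
  integral.\<close>

lemma integral_partial_deriv_zero:
 fixes g :: "'a::euclidean_space => complex"
 assumes g: "integrable lborel g" and b: "norm b = 1"
  and deriv: "\<And>x. (g has_derivative D x) (at x)"
  and B: "B \<ge> 0" "\<And>x. norm (D x b) \<le> B / (1 + norm x) ^ (2 * DIM('a))"
  and [measurable]: "(\<lambda>x. D x b) \<in> Borel"
 shows "(LI x. D x b) = 0"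
proof -
 let ?h = "\<lambda>k::nat. 1 / real (Suc k)"
 let ?s = "\<lambda>k x. (g (x + ?h k *\<^sub>R b) - g x) /\<^sub>R ?h k"
 let ?M = "2 * DIM('a)"
 have [measurable]: "g \<in> Borel" using borel_measurable_integrable[OF g] by simp
 have shift: "((\<lambda>t. g (x + t *\<^sub>R b)) has_vector_derivative D (x + t *\<^sub>R b) b) (at t)" for x t
 proof -
  have "((\<lambda>t. x + t *\<^sub>R b) has_derivative (\<lambda>h. h *\<^sub>R b)) (at t)"
   by (auto intro!: derivative_eq_intros)
  from has_derivative_compose[OF this deriv]
  show ?thesis
   by (simp add: has_vector_derivative_def linear_cmul[OF has_derivative_linear[OF deriv]])
 qed
 have "(\<lambda>k. \<integral>x. ?s k x \<partial>lborel) \<longlonglongrightarrow> (LI x. D x b)"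
 proof (rule integral_dominated_convergence[where w = "\<lambda>x. B * 2 ^ ?M * (1 / (1 + norm x) ^ ?M)"])
  show "integrable lborel (\<lambda>x::'a. B * 2 ^ ?M * (1 / (1 + norm x) ^ ?M))"
   by (rule integrable_mult_right[OF integrable_japanese])
  show "AE x in lborel. (\<lambda>k. ?s k x) \<longlonglongrightarrow> D x b"
  proof (rule AE_I2)
   fix x
   have "((\<lambda>t. (g (x + t *\<^sub>R b) - g x) /\<^sub>R t) \<longlongrightarrow> D x b) (at 0)"
    using shift[of x 0] unfolding has_vector_derivative_def has_derivative_at
   proof (elim conjE)
    assume *: "(\<lambda>h. norm (g (x + (0 + h) *\<^sub>R b) - g (x + 0 *\<^sub>R b) - h *\<^sub>R D (x + 0 *\<^sub>R b) b) / norm h) \<midarrow>0\<rightarrow> 0"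
    show ?thesis
    proof (rule LIM_zero_cancel, rule tendsto_norm_zero_cancel, rule Lim_transform_eventually[OF *])
     show "\<forall>\<^sub>F t in at 0. norm (g (x + (0 + t) *\<^sub>R b) - g (x + 0 *\<^sub>R b) - t *\<^sub>R D (x + 0 *\<^sub>R b) b) / norm t = norm ((g (x + t *\<^sub>R b) - g x) /\<^sub>R t - D x b)"
     proof (rule eventually_at_filter[THEN iffD2], intro always_eventually allI impI)
      fix t :: real assume t: "t \<noteq> 0"
      have "(g (x + t *\<^sub>R b) - g x) /\<^sub>R t - D x b = (g (x + t *\<^sub>R b) - g x - t *\<^sub>R D x b) /\<^sub>R t"
       using t by (simp add: scaleR_diff_right)
      then show "norm (g (x + (0 + t) *\<^sub>R b) - g (x + 0 *\<^sub>R b) - t *\<^sub>R D (x + 0 *\<^sub>R b) b) / norm t = norm ((g (x + t *\<^sub>R b) - g x) /\<^sub>R t - D x b)"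
       by (simp add: divide_inverse mult.commute)
     qed
    qed
   qed
   then show "(\<lambda>k. ?s k x) \<longlonglongrightarrow> D x b"
    by (rule filterlim_compose) (use LIMSEQ_inverse_real_of_nat in \<open>auto simp: filterlim_at inverse_eq_divide\<close>)
  qed
  show "AE x in lborel. norm (?s k x) \<le> B * 2 ^ ?M * (1 / (1 + norm x) ^ ?M)" for k
  proof (rule AE_I2)
   fix x
   have h: "0 < ?h k" "?h k \<le> 1" by (auto simp: field_simps)
   have "norm (g (x + ?h k *\<^sub>R b) - g (x + 0 *\<^sub>R b)) \<le> (B * 2 ^ ?M * (1 / (1 + norm x) ^ ?M)) * norm (?h k - 0)"
   proof (rule differentiable_bound[of "{0..?h k}" "\<lambda>t. g (x + t *\<^sub>R b)" "\<lambda>t h. h *\<^sub>R D (x + t *\<^sub>R b) b"])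
    fix t assume t: "t \<in> {0..?h k}"
    show "((\<lambda>t. g (x + t *\<^sub>R b)) has_derivative (\<lambda>h. h *\<^sub>R D (x + t *\<^sub>R b) b)) (at t within {0..?h k})"
     using shift[of x t] by (simp add: has_vector_derivative_def has_derivative_at_withinI)
    \<comment> \<open>A displacement of length at most 1 changes \<open>1 + norm x\<close> by a
      factor of at most 2; hence the factor \<open>2 ^ ?M\<close> in the majorant.\<close>
    have aux: "1 + p \<le> 2 * (1 + q)" if "p \<le> q + s" "s \<le> 1" "0 \<le> q" for p q s :: real using that by argo
    have "norm x \<le> norm (x + t *\<^sub>R b) + norm (t *\<^sub>R b)" by (metis add_diff_cancel_right' norm_triangle_ineq4)
    moreover have "norm (t *\<^sub>R b) \<le> 1" using t h(2) b order_trans[of t "?h k" 1] by simp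
    ultimately have "1 + norm x \<le> 2 * (1 + norm (x + t *\<^sub>R b))" by (rule aux) simp
    then have "(1 + norm x) ^ ?M \<le> (2 * (1 + norm (x + t *\<^sub>R b))) ^ ?M" by (intro power_mono) auto
    then have "(1 + norm x) ^ ?M \<le> 2 ^ ?M * (1 + norm (x + t *\<^sub>R b)) ^ ?M" by (simp only: power_mult_distrib)
    then have "B / (1 + norm (x + t *\<^sub>R b)) ^ ?M \<le> B * 2 ^ ?M * (1 / (1 + norm x) ^ ?M)"
     using B(1) by (simp add: field_simps add_pos_nonneg) (metis mult.left_commute mult_left_mono)
    then have "norm (D (x + t *\<^sub>R b) b) \<le> B * 2 ^ ?M * (1 / (1 + norm x) ^ ?M)"
     using B(2)[of "x + t *\<^sub>R b"] by linarith
    then show "onorm (\<lambda>h. h *\<^sub>R D (x + t *\<^sub>R b) b) \<le> B * 2 ^ ?M * (1 / (1 + norm x) ^ ?M)"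
     by (intro order_trans[OF onorm_le[of _ "norm (D (x + t *\<^sub>R b) b)"]]) (auto simp: mult.commute)
   qed (use h in auto)
   then have "inverse (?h k) * norm (g (x + ?h k *\<^sub>R b) - g x) \<le> inverse (?h k) * ((B * 2 ^ ?M * (1 / (1 + norm x) ^ ?M)) * ?h k)"
    using h by (intro mult_left_mono) auto
   also have "... = B * 2 ^ ?M * (1 / (1 + norm x) ^ ?M)" using h by (simp only: field_simps) simp
   finally show "norm (?s k x) \<le> B * 2 ^ ?M * (1 / (1 + norm x) ^ ?M)"
    using h by simp
  qed
 qed simp_all
 moreover have "(LI x. ?s k x) = 0" for k
 proof -
  have "integrable lborel (\<lambda>x. g (x + ?h k *\<^sub>R b))" "(LI x. g (x + ?h k *\<^sub>R b)) = (LI x. g x)"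
   using lborel_integral_affine[of 1 g "?h k *\<^sub>R b"] g by (simp_all add: add.commute)
  then show ?thesis using g by simp
 qed
 ultimately show ?thesis by (simp add: LIMSEQ_const_iff)
qed

text \<open>Integration by parts: the derivative of \<open>cis (- (x \<bullet> z)) * g x\<close> in
  direction \<open>b\<close> has integral zero.\<close>

lemma fourier_partial_deriv:
 fixes g :: "'a::euclidean_space => complex"
 assumes "g \<in> schwartz" "b \<in> Basis"
 shows "fourier (partial_deriv b g) z = \<i> * of_real (z \<bullet> b) * fourier g z"
proof -
 have p: "partial_deriv b g \<in> schwartz" by (rule schwartz_partial_deriv[OF assms])
 note [measurable] = schwartz_measurable[OF assms(1)] schwartz_measurable[OF p]
 define F where "F x = frechet_derivative g (at x)" for x
 have F: "(g has_derivative F x) (at x)" "F x b = partial_deriv b g x" for x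
  using schwartz_differentiable[OF assms(1)] unfolding F_def partial_deriv_def
  by (auto simp: frechet_derivative_works)
 have [measurable]: "(\<lambda>x. cis (- (x \<bullet> z))) \<in> Borel"
  unfolding cis_conv_exp by measurable
 define D where "D x h = cis (- (x \<bullet> z)) * F x h - \<i> * of_real (h \<bullet> z) * cis (- (x \<bullet> z)) * g x" for x h
 have ints: "integrable lborel (\<lambda>x. cis (- (x \<bullet> z)) * \<psi> x)" if "\<psi> \<in> schwartz" for \<psi>
 proof -
  note [measurable] = schwartz_measurable[OF that]
  show ?thesis
  by (rule Bochner_Integration.integrable_bound[OF schwartz_integrable[OF that]]) (auto simp: norm_mult)
 qed
 obtain B1 where B1: "B1 \<ge> 0" "\<And>x. norm (g x) \<le> B1 / (1 + norm x) ^ (2 * DIM('a))" using schwartz_bound[OF assms(1), of "2 * DIM('a)"] by blast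
 obtain B2 where B2: "B2 \<ge> 0" "\<And>x. norm (partial_deriv b g x) \<le> B2 / (1 + norm x) ^ (2 * DIM('a))" using schwartz_bound[OF p, of "2 * DIM('a)"] by blast
 have "(LI x. D x b) = 0"
 proof (rule integral_partial_deriv_zero[where B = "B2 + \<bar>b \<bullet> z\<bar> * B1"])
  show "integrable lborel (\<lambda>x. cis (- (x \<bullet> z)) * g x)" by (rule ints[OF assms(1)])
  show "norm b = 1" using assms(2) by simp
  show "((\<lambda>x. cis (- (x \<bullet> z)) * g x) has_derivative D x) (at x)" for x
  proof -
   have "((\<lambda>x. exp (\<i> * of_real (- (x \<bullet> z)))) has_derivative (\<lambda>h. (\<i> * of_real (- (h \<bullet> z))) * exp (\<i> * of_real (- (x \<bullet> z))))) (at x)"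
   proof -
    have "((\<lambda>x. \<i> * complex_of_real (- (x \<bullet> z))) has_derivative (\<lambda>h. \<i> * of_real (- (h \<bullet> z)))) (at x)"
     by (auto intro!: derivative_eq_intros)
    from has_derivative_compose[OF this DERIV_exp[unfolded has_field_derivative_def]]
    show ?thesis by (simp add: mult_ac)
   qed
   from has_derivative_mult[OF this F(1)[of x]]
   show ?thesis unfolding cis_conv_exp D_def[abs_def] by (simp add: algebra_simps)
  qed
  show "norm (D x b) \<le> (B2 + \<bar>b \<bullet> z\<bar> * B1) / (1 + norm x) ^ (2 * DIM('a))" for x
  proof -
   have "norm (D x b) \<le> norm (partial_deriv b g x) + \<bar>b \<bullet> z\<bar> * norm (g x)"
    unfolding D_def F(2) by (rule order_trans[OF norm_triangle_ineq4]) (simp add: norm_mult)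
   also have "... \<le> B2 / (1 + norm x) ^ (2 * DIM('a)) + \<bar>b \<bullet> z\<bar> * (B1 / (1 + norm x) ^ (2 * DIM('a)))"
    by (intro add_mono mult_left_mono B1 B2) auto
   finally show ?thesis by (simp add: add_divide_distrib)
  qed
  show "(\<lambda>x. D x b) \<in> Borel" unfolding D_def F(2) by measurable
 qed (use B1 B2 in auto)
 moreover have "(LI x. D x b) = fourier (partial_deriv b g) z - \<i> * of_real (b \<bullet> z) * fourier g z"
  unfolding D_def F(2) fourier_def mult.assoc using ints[OF p] ints[OF assms(1)] by simp
 ultimately show ?thesis by (simp add: inner_commute)
qed


section \<open>Square-integrable functions\<close>

lemma borel_measurable_cis [measurable (raw)]:
 "f \<in> borel_measurable M ==> (\<lambda>x. cis (f x)) \<in> borel_measurable M"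
 unfolding cis_conv_exp by measurable

lemma L2_D:
 assumes "f \<in> L2"
 shows L2_measurable: "f \<in> Borel"
  and L2_integrable: "integrable lborel (\<lambda>x. (norm (f x))^2)"
 using assms by (auto simp: L2_def)

lemma L2_I:
 "f \<in> Borel ==> integrable lborel (\<lambda>x. (norm (f x))^2) ==> f \<in> L2"
 by (auto simp: L2_def)

lemma L2_dominated:
 fixes f g :: "'a::euclidean_space => complex"
 assumes "g \<in> L2" "f \<in> Borel" "AE x in lborel. norm (f x) \<le> C * norm (g x)"
 shows "f \<in> L2"
proof (rule L2_I)
 note [measurable] = assms(2)
 have "integrable lborel (\<lambda>x. C\<^sup>2 * (norm (g x))^2)"
  using L2_integrable[OF assms(1)] by simp
 then show "integrable lborel (\<lambda>x. (norm (f x))^2)"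
 proof (rule Bochner_Integration.integrable_bound)
  show "AE x in lborel. norm ((norm (f x))^2) \<le> norm (C\<^sup>2 * (norm (g x))^2)"
   using assms(3)
  proof eventually_elim
   case (elim x)
   have "(norm (f x))^2 \<le> (C * norm (g x))^2" using elim by (intro power_mono) auto
   then show ?case by (simp add: power_mult_distrib abs_mult)
  qed
 qed simp
qed fact

lemma L2_cong_AE:
 assumes "f \<in> L2" "g \<in> Borel" "AE x in lborel. g x = f x"
 shows "g \<in> L2"
 by (rule L2_dominated[OF assms(1,2), of 1]) (use assms(3) in auto)

lemma L2_norm_cong_AE:
 assumes "f \<in> Borel" "g \<in> Borel" "AE x in lborel. f x = g x"
 shows "L2_norm f = L2_norm g"
proof -
 note [measurable] = assms(1,2)
 show ?thesis unfolding L2_norm_def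
  by (intro arg_cong[where f = sqrt] integral_cong_AE) (use assms(3) in auto)
qed

lemma L2_norm_nonneg [simp]: "L2_norm f \<ge> 0"
 by (simp add: L2_norm_def integral_nonneg_AE)

lemma L2_norm_power2: "(L2_norm f)^2 = (LI x. (norm (f x))^2)"
 by (simp add: L2_norm_def integral_nonneg_AE)

lemma L2_norm_nn:
 assumes "f \<in> L2"
 shows "(NI x. ennreal ((norm (f x))^2)) = ennreal ((L2_norm f)^2)"
 unfolding L2_norm_power2 by (rule nn_integral_eq_integral) (use L2_integrable[OF assms] in auto)

lemma L2_scale: "f \<in> L2 ==> (\<lambda>x. c * f x) \<in> L2"
 using L2_dominated[of f "\<lambda>x. c * f x" "norm c"] L2_measurable[of f] by (simp add: norm_mult)

lemma L2_add:
 fixes f g :: "'a::euclidean_space => complex"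
 assumes "f \<in> L2" "g \<in> L2"
 shows "(\<lambda>x. f x + g x) \<in> L2"
proof (rule L2_I)
 note [measurable] = L2_measurable[OF assms(1)] L2_measurable[OF assms(2)]
 show "(\<lambda>x. f x + g x) \<in> Borel" by measurable
 have "integrable lborel (\<lambda>x. 2 * (norm (f x))^2 + 2 * (norm (g x))^2)"
  using L2_integrable[OF assms(1)] L2_integrable[OF assms(2)] by simp
 then show "integrable lborel (\<lambda>x. (norm (f x + g x))^2)"
 proof (rule Bochner_Integration.integrable_bound)
  show "AE x in lborel. norm ((norm (f x + g x))^2) \<le> norm (2 * (norm (f x))^2 + 2 * (norm (g x))^2)"
  proof (rule AE_I2)
   fix x
   have "(norm (f x + g x))^2 \<le> (norm (f x) + norm (g x))^2"
    by (intro power_mono norm_triangle_ineq) simp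
   also have "... \<le> 2 * (norm (f x))^2 + 2 * (norm (g x))^2"
    using zero_le_power2[of "norm (f x) - norm (g x)"] unfolding power2_sum power2_diff by argo
   finally show "norm ((norm (f x + g x))^2) \<le> norm (2 * (norm (f x))^2 + 2 * (norm (g x))^2)" by simp
  qed
 qed measurable
qed

lemma L2_diff: "f \<in> L2 ==> g \<in> L2 ==> (\<lambda>x. f x - g x) \<in> L2"
 using L2_add[of f "\<lambda>x. - 1 * g x"] L2_scale[of g "- 1"] by simp

lemma L2_cnj: "f \<in> L2 ==> (\<lambda>x. cnj (f x)) \<in> L2"
proof -
 assume f: "f \<in> L2"
 have "cnj \<in> Borel" by (intro borel_measurable_continuous_onI continuous_intros)
 then have "(\<lambda>x. cnj (f x)) \<in> Borel"
  using L2_measurable[OF f] by (rule measurable_compose[rotated])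
 then show "(\<lambda>x. cnj (f x)) \<in> L2" using L2_dominated[OF f, of _ 1] by simp
qed

lemma L2_norm_scale: "L2_norm (\<lambda>x. c * f x) = norm c * L2_norm f"
 by (simp add: L2_norm_def norm_mult power_mult_distrib real_sqrt_mult)

lemma L2_norm_minus_commute: "L2_norm (\<lambda>x. f x - g x) = L2_norm (\<lambda>x. g x - f x)"
 by (simp add: L2_norm_def norm_minus_commute)

lemma L2_norm_reflect:
 assumes "f \<in> Borel"
 shows "L2_norm (\<lambda>x. f (- x)) = L2_norm f"
 using assms lborel_integral_minus(2)[of "\<lambda>x. (norm (f x))^2"] by (simp add: L2_norm_def)

lemma L2_reflect: "f \<in> L2 ==> (\<lambda>x. f (- x)) \<in> L2"
 using lborel_integral_minus(1)[of "\<lambda>x. (norm (f x))^2"] by (auto simp: L2_def)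

lemma L2_mult_integrable:
 fixes f g :: "'a::euclidean_space => complex"
 assumes "f \<in> L2" "g \<in> L2"
 shows "integrable lborel (\<lambda>x. f x * g x)"
proof -
 note [measurable] = L2_measurable[OF assms(1)] L2_measurable[OF assms(2)]
 have "integrable lborel (\<lambda>x. (norm (f x))^2 + (norm (g x))^2)"
  using L2_integrable[OF assms(1)] L2_integrable[OF assms(2)] by simp
 then show ?thesis
 proof (rule Bochner_Integration.integrable_bound)
  have "norm (f x) * norm (g x) \<le> (norm (f x))^2 + (norm (g x))^2" for x
  proof -
   have "0 \<le> norm (f x) * norm (g x)" by simp
   then show ?thesis using zero_le_power2[of "norm (f x) - norm (g x)"] unfolding power2_diff by argo
  qed
  then show "AE x in lborel. norm (f x * g x) \<le> norm ((norm (f x))^2 + (norm (g x))^2)"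
   by (simp add: norm_mult)
 qed measurable
qed

lemma L2_Cauchy_Schwarz_norm:
 fixes f g :: "'a::euclidean_space => complex"
 assumes "f \<in> L2" "g \<in> L2"
 shows "(LI x. norm (f x) * norm (g x)) \<le> L2_norm f * L2_norm g"
proof -
 note [measurable] = L2_measurable[OF assms(1)] L2_measurable[OF assms(2)]
 let ?I = "\<integral>x. norm (f x) * norm (g x) \<partial>lborel"
 have int: "integrable lborel (\<lambda>x. norm (f x) * norm (g x))"
  using integrable_norm[OF L2_mult_integrable[OF assms]] by (simp add: norm_mult)
 have I0: "?I \<ge> 0" by (simp add: integral_nonneg_AE)
 have "ennreal (?I\<^sup>2) = (NI x. ennreal (norm (f x)) * ennreal (norm (g x)))^2"
  using nn_integral_eq_integral[OF int] I0 by (simp add: ennreal_mult ennreal_power)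
 also have "... \<le> (NI x. ennreal (norm (f x)) ^ 2) * (NI x. ennreal (norm (g x)) ^ 2)"
  by (rule Cauchy_Schwarz_nn_integral) auto
 also have "... = ennreal ((L2_norm f)^2 * (L2_norm g)^2)"
  using L2_norm_nn[OF assms(1)] L2_norm_nn[OF assms(2)] by (simp add: ennreal_power ennreal_mult)
 finally have "?I\<^sup>2 \<le> (L2_norm f * L2_norm g)^2" by (simp add: power_mult_distrib)
 then show ?thesis by (rule power2_le_imp_le) simp
qed

lemma L2_Cauchy_Schwarz:
 fixes f g :: "'a::euclidean_space => complex"
 assumes "f \<in> L2" "g \<in> L2"
 shows "norm (LI x. f x * g x) \<le> L2_norm f * L2_norm g"
 using integral_norm_bound[of lborel "\<lambda>x. f x * g x"] L2_Cauchy_Schwarz_norm[OF assms]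
 by (simp add: norm_mult)

lemma L2_norm_triangle:
 fixes f g :: "'a::euclidean_space => complex"
 assumes "f \<in> L2" "g \<in> L2"
 shows "L2_norm (\<lambda>x. f x + g x) \<le> L2_norm f + L2_norm g"
proof -
 have int: "integrable lborel (\<lambda>x. norm (f x) * norm (g x))"
  using integrable_norm[OF L2_mult_integrable[OF assms]] by (simp add: norm_mult)
 note ints = L2_integrable[OF assms(1)] L2_integrable[OF assms(2)] int L2_integrable[OF L2_add[OF assms]]
 have "(L2_norm (\<lambda>x. f x + g x))^2 \<le> (LI x. (norm (f x))^2 + 2 * (norm (f x) * norm (g x)) + (norm (g x))^2)"
  unfolding L2_norm_power2
 proof (rule integral_mono)
  fix x
  have "(norm (f x + g x))^2 \<le> (norm (f x) + norm (g x))^2"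
   by (intro power_mono norm_triangle_ineq) simp
  then show "(norm (f x + g x))^2 \<le> (norm (f x))^2 + 2 * (norm (f x) * norm (g x)) + (norm (g x))^2"
   by (simp add: power2_sum)
 qed (use ints in auto)
 also have "... = (L2_norm f)^2 + 2 * (LI x. norm (f x) * norm (g x)) + (L2_norm g)^2"
  using ints by (simp add: L2_norm_power2)
 also have "... \<le> (L2_norm f)^2 + 2 * (L2_norm f * L2_norm g) + (L2_norm g)^2"
  using L2_Cauchy_Schwarz_norm[OF assms] by simp
 also have "... = (L2_norm f + L2_norm g)^2" by (simp add: power2_sum)
 finally show ?thesis by (rule power2_le_imp_le) simp
qed

lemma L2_norm_triangle_diff:
 assumes "f \<in> L2" "g \<in> L2" "h \<in> L2"
 shows "L2_norm (\<lambda>x. f x - h x) \<le> L2_norm (\<lambda>x. f x - g x) + L2_norm (\<lambda>x. g x - h x)"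
 using L2_norm_triangle[of "\<lambda>x. f x - g x" "\<lambda>x. g x - h x"] assms by (simp add: L2_diff)

lemma L2_norm_le_add_diff:
 assumes "f \<in> L2" "g \<in> L2"
 shows "L2_norm f \<le> L2_norm g + L2_norm (\<lambda>x. f x - g x)"
 using L2_norm_triangle[of g "\<lambda>x. f x - g x"] assms by (simp add: L2_diff)

lemma L2_norm_eq_0:
 assumes "f \<in> L2" "L2_norm f = 0"
 shows "AE x in lborel. f x = 0"
proof -
 have "(LI x. (norm (f x))^2) = 0" using assms(2) L2_norm_power2[of f] by simp
 then have "AE x in lborel. (norm (f x))^2 = 0"
  using integral_nonneg_eq_0_iff_AE[OF L2_integrable[OF assms(1)]] by simp
 then show ?thesis by simp
qed

text \<open>Fatou's lemma for a uniform bound. Most finiteness claims below come from it: for limits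
  of Cauchy sequences, of smoothing parameters, of truncations, and of the iterates of
  \<open>T\<close>.\<close>

lemma nn_integral_le_of_tendsto:
 fixes u :: "nat => 'a => ennreal"
 assumes "\<And>k. u k \<in> borel_measurable M" "AE x in M. (\<lambda>k. u k x) \<longlonglongrightarrow> v x"
  and "eventually (\<lambda>k. (\<integral>\<^sup>+x. u k x \<partial>M) \<le> C) sequentially"
 shows "(\<integral>\<^sup>+x. v x \<partial>M) \<le> C"
proof -
 have "(\<integral>\<^sup>+x. v x \<partial>M) = (\<integral>\<^sup>+x. liminf (\<lambda>k. u k x) \<partial>M)"
  by (rule nn_integral_cong_AE) (use assms(2) in \<open>auto elim!: eventually_mono dest!: lim_imp_Liminf[rotated]\<close>)
 also have "... \<le> liminf (\<lambda>k. \<integral>\<^sup>+x. u k x \<partial>M)"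
  by (rule nn_integral_liminf) (rule assms(1))
 also have "... \<le> liminf (\<lambda>k. C)" by (rule Liminf_mono) (rule assms(3))
 finally show ?thesis by (simp add: Liminf_const)
qed

text \<open>The squares still have a finite sum of integrals after weighting with
  \<open>sqrt 2 ^ k\<close>, because \<open>sqrt 2 / 4 < 1\<close>. Then
  \<open>b <= w b^2 + 1 / w\<close> with \<open>w = sqrt 2 ^ k\<close> turns summability of the
  weighted squares into summability of the norms.\<close>

lemma L2_summable_AE:
 fixes d :: "nat => 'a::euclidean_space => complex"
 assumes "\<And>k. d k \<in> L2" "\<And>k. L2_norm (d k) \<le> (1/2) ^ k"
 shows "AE x in lborel. summable (\<lambda>k. norm (d k x))"
proof -
 have [measurable]: "d k \<in> Borel" for k by (rule L2_measurable[OF assms(1)])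
 have "(NI x. (\<Sum>k. ennreal (sqrt 2 ^ k * (norm (d k x))^2)))
  = (\<Sum>k. ennreal (sqrt 2 ^ k) * ennreal ((L2_norm (d k))^2))"
  by (subst nn_integral_suminf) (simp_all add: ennreal_mult nn_integral_cmult L2_norm_nn[OF assms(1)])
 also have "... \<le> (\<Sum>k. ennreal ((sqrt 2 / 4) ^ k))"
 proof (rule suminf_le)
  fix k
  have "(L2_norm (d k))^2 \<le> ((1/2) ^ k)^2" by (intro power_mono assms(2)) simp
  then have "sqrt 2 ^ k * (L2_norm (d k))^2 \<le> sqrt 2 ^ k * (1/4) ^ k"
   by (intro mult_left_mono) (auto simp: power_mult[symmetric] power_mult_distrib[symmetric] power2_eq_square power_commutes simp flip: power_mult_distrib)
  then show "ennreal (sqrt 2 ^ k) * ennreal ((L2_norm (d k))^2) \<le> ennreal ((sqrt 2 / 4) ^ k)"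
   by (subst ennreal_mult[symmetric]) (auto simp: power_divide power_one_over intro!: ennreal_leI)
 qed auto
 also have "... < \<infinity>"
 proof -
  have "sqrt 2 < (4::real)" by (rule real_less_lsqrt) auto
  then have "summable (\<lambda>k. (sqrt 2 / 4 :: real) ^ k)" by (intro summable_geometric) simp
  then show ?thesis by (subst suminf_ennreal2) auto
 qed
 finally have "AE x in lborel. (\<Sum>k. ennreal (sqrt 2 ^ k * (norm (d k x))^2)) \<noteq> \<infinity>"
  by (intro nn_integral_noteq_infinite) auto
 then show ?thesis
 proof eventually_elim
  case (elim x)
  have s1: "summable (\<lambda>k. sqrt 2 ^ k * (norm (d k x))^2)"
   using elim by (intro summable_suminf_not_top) (auto simp: infinity_ennreal_def)
  have "1 / sqrt 2 < (1::real)" by (simp add: divide_less_eq)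
  then have s2: "summable (\<lambda>k. (1 / sqrt 2 :: real) ^ k)" by (intro summable_geometric) simp
  show ?case
  proof (rule summable_comparison_test'[OF summable_add[OF s1 s2], of 0])
   fix k
   let ?a = "sqrt 2 ^ k" and ?b = "norm (d k x)"
   have a: "?a > 0" by simp
   have "2 * (?a * ?b) \<le> (?a * ?b)^2 + 1" using sum_squares_bound[of "?a * ?b" 1] by simp
   moreover have "?a * ?b \<ge> 0" by simp
   ultimately have "?a * ?b \<le> (?a * ?b)^2 + 1" by argo
   then have "?b \<le> ((?a * ?b)^2 + 1) / ?a" using a by (simp add: field_simps)
   also have "... = ?a * ?b\<^sup>2 + (1 / sqrt 2) ^ k" using a by (simp add: field_simps power2_eq_square power_one_over)
   finally show "norm (norm (d k x)) \<le> sqrt 2 ^ k * (norm (d k x))^2 + (1 / sqrt 2) ^ k" by simp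
  qed
 qed
qed

lemma L2_complete:
 fixes f :: "nat => 'a::euclidean_space => complex"
 assumes f: "\<And>k. f k \<in> L2"
  and cauchy: "\<And>e. e > 0 ==> \<exists>N. \<forall>i\<ge>N. \<forall>j\<ge>N. L2_norm (\<lambda>x. f i x - f j x) < e"
 obtains g where "g \<in> L2" "(\<lambda>k. L2_norm (\<lambda>x. f k x - g x)) \<longlonglongrightarrow> 0"
proof -
 have [measurable]: "f k \<in> Borel" for k by (rule L2_measurable[OF f])
 have "\<exists>N. \<forall>k. \<forall>i\<ge>N k. \<forall>j\<ge>N k. L2_norm (\<lambda>x. f i x - f j x) < (1/2) ^ k"
  using cauchy by (intro choice) simp
 then obtain N where N: "\<And>k i j. i \<ge> N k ==> j \<ge> N k ==> L2_norm (\<lambda>x. f i x - f j x) < (1/2) ^ k" by blast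
 \<comment> \<open>The maximum over all earlier thresholds makes \<open>r\<close> monotone, so that
   \<open>r k\<close> and \<open>r (Suc k)\<close> both exceed \<open>N k\<close>; the summand
   \<open>k\<close> makes it unbounded.\<close>
 define r where "r k = Max (N ` {..k}) + k" for k
 have rN: "r k \<ge> N k" for k unfolding r_def by (intro trans_le_add1 Max_ge) auto
 have rmono: "r k \<le> r (Suc k)" for k unfolding r_def by (intro add_mono Max_mono) auto
 have rk: "r k \<ge> k" for k by (simp add: r_def)
 have "AE x in lborel. summable (\<lambda>k. norm (f (r (Suc k)) x - f (r k) x))"
  by (rule L2_summable_AE) (auto intro!: L2_diff f less_imp_le N order_trans[OF rN rmono] rN)
 then have conv: "AE x in lborel. convergent (\<lambda>k. f (r k) x)"
 proof eventually_elim
  case (elim x)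
  have "summable (\<lambda>k. f (r (Suc k)) x - f (r k) x)" by (rule summable_norm_cancel[OF elim])
  then have "(\<lambda>n. \<Sum>k<n. f (r (Suc k)) x - f (r k) x) \<longlonglongrightarrow> (\<Sum>k. f (r (Suc k)) x - f (r k) x)"
   by (rule summable_LIMSEQ)
  from tendsto_add[OF this tendsto_const[of "f (r 0) x"]]
  show ?case unfolding sum_lessThan_telescope[of "\<lambda>k. f (r k) x"] by (auto simp: convergent_def)
 qed
 define g where "g x = lim (\<lambda>k. f (r k) x)" for x
 have [measurable]: "g \<in> Borel"
  unfolding g_def by (rule borel_measurable_lim_metric) measurable
 have lim: "AE x in lborel. (\<lambda>k. f (r k) x) \<longlonglongrightarrow> g x"
  using conv by eventually_elim (simp add: g_def convergent_LIMSEQ_iff)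
 \<comment> \<open>Fatou along the subsequence. The finite right-hand side gives both that the
   difference lies in \<open>L2\<close> and that its norm is small, without knowing yet that
   \<open>g\<close> lies in \<open>L2\<close>.\<close>
 have bound: "(NI x. ennreal ((norm (f i x - g x))^2)) \<le> ennreal (e\<^sup>2)"
  if "e > 0" "\<forall>i\<ge>M. \<forall>j\<ge>M. L2_norm (\<lambda>x. f i x - f j x) < e" "i \<ge> M" for e M i
 proof (rule nn_integral_le_of_tendsto[where u = "\<lambda>k x. ennreal ((norm (f i x - f (r k) x))^2)"])
  show "AE x in lborel. (\<lambda>k. ennreal ((norm (f i x - f (r k) x))^2)) \<longlonglongrightarrow> ennreal ((norm (f i x - g x))^2)"
   using lim by eventually_elim (auto intro!: tendsto_intros)
  show "\<forall>\<^sub>F k in sequentially. (\<integral>\<^sup>+ x. ennreal ((norm (f i x - f (r k) x))^2) \<partial>lborel) \<le> ennreal (e\<^sup>2)"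
   using eventually_ge_at_top[of M]
  proof eventually_elim
   case (elim k)
   then have "L2_norm (\<lambda>x. f i x - f (r k) x) < e" using that(2,3) rk[of k] by (meson order_trans)
   then have "(L2_norm (\<lambda>x. f i x - f (r k) x))^2 \<le> e\<^sup>2" by (intro power_mono) auto
   then show ?case by (subst L2_norm_nn) (auto intro!: L2_diff f ennreal_leI)
  qed
 qed measurable
 have L2: "(\<lambda>x. f i x - g x) \<in> L2" "L2_norm (\<lambda>x. f i x - g x) \<le> e"
  if "e > 0" "\<forall>i\<ge>M. \<forall>j\<ge>M. L2_norm (\<lambda>x. f i x - f j x) < e" "i \<ge> M" for e M i
 proof -
  show *: "(\<lambda>x. f i x - g x) \<in> L2"
   by (rule L2_I) (use bound[OF that] in \<open>auto simp: integrable_iff_bounded le_less_trans[OF _ ennreal_less_top]\<close>)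
  have "(L2_norm (\<lambda>x. f i x - g x))^2 \<le> e\<^sup>2" using bound[OF that] unfolding L2_norm_nn[OF *] by simp
  then show "L2_norm (\<lambda>x. f i x - g x) \<le> e" by (rule power2_le_imp_le) (use that in simp)
 qed
 obtain M where M: "\<forall>i\<ge>M. \<forall>j\<ge>M. L2_norm (\<lambda>x. f i x - f j x) < 1" using cauchy[of 1] by auto
 have "(\<lambda>x. f M x - (f M x - g x)) \<in> L2" by (intro L2_diff f L2(1)[OF _ M]) auto
 then have "g \<in> L2" by simp
 moreover have "(\<lambda>k. L2_norm (\<lambda>x. f k x - g x)) \<longlonglongrightarrow> 0"
 proof (rule LIMSEQ_I)
  fix e :: real assume "e > 0"
  then obtain M where "\<forall>i\<ge>M. \<forall>j\<ge>M. L2_norm (\<lambda>x. f i x - f j x) < e / 2" using cauchy[of "e / 2"] by auto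
  then have "\<forall>i\<ge>M. L2_norm (\<lambda>x. f i x - g x) \<le> e / 2" using L2(2)[of "e / 2" M] \<open>e > 0\<close> by auto
  then show "\<exists>M. \<forall>k\<ge>M. norm (L2_norm (\<lambda>x. f k x - g x) - 0) < e"
   using \<open>e > 0\<close> by (intro exI[of _ M]) (auto simp: le_less_trans[of _ "e / 2"])
 qed
 ultimately show ?thesis by (rule that)
qed

section \<open>Functions orthogonal to all Gaussians\<close>

definition heat_kernel :: "real => 'a::euclidean_space => real" where
 "heat_kernel s z = exp (- (z \<bullet> z) / (4 * s))"

lemma heat_kernel_measurable [measurable]: "heat_kernel s \<in> Borel"
 unfolding heat_kernel_def[abs_def] by measurable

lemma heat_kernel_integral:
 assumes "s > 0"
 shows "integrable lborel (heat_kernel s :: 'a::euclidean_space => real)"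
  and "(LI z. heat_kernel s (z::'a)) = sqrt (4 * pi * s) ^ DIM('a)"
proof -
 have eq: "gaussian (1 / (4 * s)) 0 0 = (\<lambda>z::'a. complex_of_real (heat_kernel s z))"
  by (simp add: fun_eq_iff gaussian_def heat_kernel_def)
 have "integrable lborel (\<lambda>z::'a. complex_of_real (heat_kernel s z))"
  using gaussian_integral(1)[of "1 / (4 * s)" "0::'a" 0] assms by (simp add: eq)
 then show "integrable lborel (heat_kernel s :: 'a => real)"
  by (simp only: complex_of_real_integrable_eq)
 have "complex_of_real (LI z. heat_kernel s (z::'a)) = of_real (sqrt (4 * pi * s) ^ DIM('a))"
  using gaussian_integral(2)[of "1 / (4 * s)" "0::'a" 0] assms unfolding eq by (simp add: mult_ac)
 then show "(LI z. heat_kernel s (z::'a)) = sqrt (4 * pi * s) ^ DIM('a)"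
  by (simp only: of_real_eq_iff)
qed

lemma heat_kernel_shift:
 assumes "s > 0"
 shows "integrable lborel (\<lambda>y. heat_kernel s (y - x :: 'a::euclidean_space))"
  and "(LI y. heat_kernel s (y - x :: 'a)) = sqrt (4 * pi * s) ^ DIM('a)"
 using lborel_integral_affine[of 1 "\<lambda>z::'a. heat_kernel s z" "- x"] heat_kernel_integral[OF assms, where 'a='a] by simp_all

text \<open>\<open>G s\<close> is \<open>g\<close> averaged with a Gaussian of width
  \<open>s\<close>, written with the kernel of parameter 1 so that the limit \<open>s -> 0\<close>
  is dominated convergence. After rescaling, Fubini makes the pairing of \<open>k\<close> with
  \<open>G s\<close> a superposition of pairings with translated heat kernels, which vanish.\<close>

lemma bounded_continuous_orthogonal:
 fixes k :: "'a::euclidean_space => complex" and g :: "'a => real"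
 assumes k: "integrable lborel k"
  and orth: "\<And>s y. s > 0 ==> (LI x. k x * of_real (heat_kernel s (x - y))) = 0"
  and g: "continuous_on UNIV g" "\<And>x. \<bar>g x\<bar> \<le> B"
 shows "(LI x. k x * of_real (g x)) = 0"
proof -
 note [measurable] = borel_measurable_continuous_onI[OF g(1)] borel_measurable_integrable[OF k, simplified]
 have B: "B \<ge> 0" using g(2)[of 0] by linarith
 define c where "c = sqrt (4 * pi) ^ DIM('a)"
 have c: "c > 0" by (simp add: c_def)
 define G where "G s x = (LI z. heat_kernel 1 z * g (x + s *\<^sub>R z))" for s x
 have hk: "integrable lborel (heat_kernel 1 :: 'a => real)" by (rule heat_kernel_integral) simp
 have G_bound: "\<bar>G s x\<bar> \<le> c * B" for s x
 proof -
  have "\<bar>G s x\<bar> \<le> (LI z. heat_kernel 1 (z::'a) * B)"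
   unfolding G_def real_norm_def[symmetric]
  proof (rule Bochner_Integration.integral_norm_bound_integral)
   have le: "norm (heat_kernel 1 z * g (x + s *\<^sub>R z)) \<le> heat_kernel 1 z * B" for z
    using g(2) by (auto simp: abs_mult heat_kernel_def)
   show "integrable lborel (\<lambda>z::'a. heat_kernel 1 z * B)" using hk by simp
   then show "integrable lborel (\<lambda>z. heat_kernel 1 z * g (x + s *\<^sub>R z))"
    by (rule Bochner_Integration.integrable_bound) (use le B in \<open>auto simp: heat_kernel_def abs_mult\<close>)
   show "norm (heat_kernel 1 z * g (x + s *\<^sub>R z)) \<le> heat_kernel 1 z * B" for z by (rule le)
  qed
  also have "... = c * B" using heat_kernel_integral[of 1, where 'a='a] by (simp add: c_def)
  finally show ?thesis .
 qed
 have [measurable]: "G s \<in> Borel" for s unfolding G_def[abs_def] by measurable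
 have zero: "(LI x. k x * of_real (G s x)) = 0" if s: "s > 0" for s
 proof -
  let ?H = "\<lambda>x y. k x * of_real (heat_kernel (s\<^sup>2) (y - x) * g y)"
  have G: "G s x = (1 / s ^ DIM('a)) * (LI y. heat_kernel (s\<^sup>2) (y - x) * g y)" for x
   using lborel_integral_affine(2)[of s "\<lambda>y. heat_kernel (s\<^sup>2) (y - x) * g y" x] s
   by (simp add: G_def heat_kernel_def power2_eq_square)
  have "integrable (lborel \<Otimes>\<^sub>M lborel) (\<lambda>(x, y). ?H x y)"
  proof (rule lborel_pair.Fubini_integrable)
   have *: "integrable lborel (\<lambda>y. heat_kernel (s\<^sup>2) (y - x) * g y)" for x
   proof (rule Bochner_Integration.integrable_bound[of _ "\<lambda>y. heat_kernel (s\<^sup>2) (y - x) * B"])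
    show "integrable lborel (\<lambda>y. heat_kernel (s\<^sup>2) (y - x) * B)"
     using heat_kernel_shift[of "s\<^sup>2" x] s by simp
   qed (use g(2) in \<open>auto simp: abs_mult heat_kernel_def B intro!: mult_left_mono\<close>)
   show "AE x in lborel. integrable lborel (\<lambda>y. case (x, y) of (x, y) => ?H x y)"
    using * by (auto intro!: AE_I2 integrable_mult_right integrable_of_real simp del: of_real_mult)
   show "integrable lborel (\<lambda>x. \<integral>y. norm (case (x, y) of (x, y) => ?H x y) \<partial>lborel)"
   proof (rule Bochner_Integration.integrable_bound)
    show "integrable lborel (\<lambda>x. norm (k x) * (sqrt (4 * pi * s\<^sup>2) ^ DIM('a) * B))" using k by simp
    show "AE x in lborel. norm (LI y. norm (case (x, y) of (x, y) => ?H x y)) \<le> norm (norm (k x) * (sqrt (4 * pi * s\<^sup>2) ^ DIM('a) * B))"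
    proof (rule AE_I2)
     fix x
     have "(LI y. norm (?H x y)) \<le> (LI y. norm (k x) * (heat_kernel (s\<^sup>2) (y - x) * B))"
     proof (rule integral_mono)
      show "integrable lborel (\<lambda>y. norm (?H x y))"
       by (intro integrable_norm integrable_mult_right integrable_of_real *)
      show "integrable lborel (\<lambda>y. norm (k x) * (heat_kernel (s\<^sup>2) (y - x) * B))"
       using heat_kernel_shift[of "s\<^sup>2" x] s by simp
      show "norm (?H x y) \<le> norm (k x) * (heat_kernel (s\<^sup>2) (y - x) * B)" for y
       using g(2)[of y] by (auto simp: norm_mult heat_kernel_def intro!: mult_left_mono)
     qed
     also have "... = norm (k x) * (sqrt (4 * pi * s\<^sup>2) ^ DIM('a) * B)"
      using heat_kernel_shift[of "s\<^sup>2" x] s by simp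
     finally show "norm (LI y. norm (case (x, y) of (x, y) => ?H x y)) \<le> norm (norm (k x) * (sqrt (4 * pi * s\<^sup>2) ^ DIM('a) * B))"
      using B by (simp add: integral_nonneg_AE abs_mult)
    qed
   qed measurable
  qed measurable
  from lborel_pair.Fubini_integral[OF this]
  have "(LI x. (LI y. ?H x y)) = (LI y. (LI x. ?H x y))" by simp
  also have "... = (LI y. of_real (g y) * (LI x. k x * of_real (heat_kernel (s\<^sup>2) (x - y))))"
   by (subst integral_mult_right_zero[symmetric])
    (simp add: mult_ac heat_kernel_def inner_diff inner_commute algebra_simps)
  also have "... = 0" using orth[of "s\<^sup>2"] s by simp
  finally have "(LI x. k x * of_real (LI y. heat_kernel (s\<^sup>2) (y - x) * g y)) = 0"
   unfolding integral_mult_right_zero integral_complex_of_real .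
  then have "0 = of_real (1 / s ^ DIM('a)) * (LI x. k x * of_real (LI y. heat_kernel (s\<^sup>2) (y - x) * g y))"
   by simp
  also have "of_real (1 / s ^ DIM('a)) * (LI x. k x * of_real (LI y. heat_kernel (s\<^sup>2) (y - x) * g y))
   = (LI x. k x * of_real (G s x))"
   unfolding G of_real_mult
   by (subst integral_mult_right_zero[symmetric]) (intro Bochner_Integration.integral_cong refl mult.left_commute)
  finally show ?thesis by (rule sym)
 qed
 have "(\<lambda>i. \<integral>x. k x * of_real (G (1 / real (Suc i)) x) \<partial>lborel) \<longlonglongrightarrow> (LI x. k x * of_real (c * g x))"
 proof (rule integral_dominated_convergence[where w = "\<lambda>x. norm (k x) * (c * B)"])
  show "AE x in lborel. (\<lambda>i. k x * of_real (G (1 / real (Suc i)) x)) \<longlonglongrightarrow> k x * of_real (c * g x)"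
  proof (intro AE_I2 tendsto_intros)
   fix x
   have "(\<lambda>i. G (1 / real (Suc i)) x) \<longlonglongrightarrow> (LI z. heat_kernel 1 (z::'a) * g x)"
    unfolding G_def
   proof (rule integral_dominated_convergence[where w = "\<lambda>z. heat_kernel 1 z * B"])
    show "AE z in lborel. (\<lambda>i. heat_kernel 1 z * g (x + (1 / real (Suc i)) *\<^sub>R z)) \<longlonglongrightarrow> heat_kernel 1 z * g x"
    proof (intro AE_I2 tendsto_mult tendsto_const)
     fix z
     have "(\<lambda>i. x + (1 / real (Suc i)) *\<^sub>R z) \<longlonglongrightarrow> x + 0 *\<^sub>R z"
      using LIMSEQ_inverse_real_of_nat by (intro tendsto_intros) (simp add: inverse_eq_divide)
     then show "(\<lambda>i. g (x + (1 / real (Suc i)) *\<^sub>R z)) \<longlonglongrightarrow> g x"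
      using g(1) by (simp add: continuous_on_tendsto_compose[of UNIV g])
    qed
    show "AE z in lborel. norm (heat_kernel 1 z * g (x + (1 / real (Suc i)) *\<^sub>R z)) \<le> heat_kernel 1 z * B" for i
     using g(2) by (auto simp: abs_mult heat_kernel_def)
   qed (use hk in auto)
   then show "(\<lambda>i. G (1 / real (Suc i)) x) \<longlonglongrightarrow> c * g x"
    using heat_kernel_integral(2)[of 1, where 'a='a] by (simp add: c_def)
  qed
  show "AE x in lborel. norm (k x * of_real (G (1 / real (Suc i)) x)) \<le> norm (k x) * (c * B)" for i
   using G_bound by (auto simp: norm_mult intro!: mult_left_mono)
 qed (use k in auto)
 then have "(LI x. k x * of_real (c * g x)) = 0"
  using zero by (simp add: LIMSEQ_const_iff)
 then have "of_real c * (LI x. k x * of_real (g x)) = 0"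
  by (subst integral_mult_right_zero[symmetric]) (simp add: mult_ac)
 then show ?thesis using c by simp
qed

text \<open>Closed sets are stable under intersection and generate the Borel sets; the sets over
  which \<open>k\<close> integrates to zero form a Dynkin system.\<close>

lemma AE_zero_of_closed_integrals:
 fixes k :: "'a::euclidean_space => complex"
 assumes k: "integrable lborel k"
  and zero: "\<And>C. closed C ==> (LINT x:C|lborel. k x) = 0"
 shows "AE x in lborel. k x = 0"
proof (rule sigma_finite_measure.density_zero[OF lborel.sigma_finite_measure_axioms k])
 have si: "set_integrable lborel A k" if "A \<in> sets borel" for A
  using k that unfolding set_integrable_def by (intro integrable_mult_indicator) auto
 fix A :: "'a set" assume "A \<in> sets lborel"
 then have "A \<in> sigma_sets UNIV (Collect closed)" by (simp add: borel_eq_closed)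
 note * = this
 have "Int_stable (Collect closed :: 'a set set)" by (auto simp: Int_stable_def)
 moreover have "Collect closed \<subseteq> Pow (UNIV :: 'a set)" by auto
 ultimately show "(LINT x:A|lborel. k x) = 0" using *
 proof (induction rule: sigma_sets_induct_disjoint)
  case (basic A) then show ?case using zero by simp
 next
  case empty show ?case by (simp add: set_lebesgue_integral_def)
 next
  case (compl A)
  have A: "A \<in> sets borel" using compl(1) by (simp add: borel_eq_closed)
  have "(LINT x:A \<union> (UNIV - A)|lborel. k x) = (LINT x:A|lborel. k x) + (LINT x:UNIV - A|lborel. k x)"
   using A by (intro set_integral_Un si) auto
  moreover have "A \<union> (UNIV - A) = UNIV" by auto
  ultimately show ?case using zero[of UNIV] compl(2) by simp
 next
  case (union A)
  have A: "A i \<in> sets borel" for i using union(2) by (auto simp: borel_eq_closed)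
  have "(LINT x:(\<Union>i. A i)|lborel. k x) = (\<Sum>i. (LINT x:A i|lborel. k x))"
   by (rule lebesgue_integral_countable_add) (use A union(1) si in \<open>auto simp: disjoint_family_on_def\<close>)
  then show ?case using union(3) by simp
 qed
qed

text \<open>As \<open>h\<close> is not assumed integrable, it is first multiplied by a fixed
  Gaussian. A Gaussian times a translated heat kernel is once more a real Gaussian with a linear
  term, so the product is orthogonal to all heat kernels and hence to bounded continuous
  functions.\<close>

lemma AE_zero_of_gaussians:
 fixes h :: "'a::euclidean_space => complex"
 assumes "h \<in> Borel"
  and int: "\<And>c a. c > 0 ==> integrable lborel (\<lambda>x. h x * gaussian c a 0 x)"
  and zero: "\<And>c a. c > 0 ==> (LI x. h x * gaussian c a 0 x) = 0"
 shows "AE x in lborel. h x = 0"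
proof -
 define k where "k x = h x * gaussian 1 0 0 x" for x
 have k: "integrable lborel k" unfolding k_def[abs_def] by (rule int) simp
 have orth: "(LI x. k x * of_real (heat_kernel s (x - y))) = 0" if "s > 0" for s y
 proof -
  have eq: "gaussian 1 0 0 x * complex_of_real (heat_kernel s (x - y))
   = of_real (heat_kernel s y) * gaussian (1 + 1 / (4 * s)) ((1 / (2 * s)) *\<^sub>R y) 0 x" for x
  proof -
   have "- (x \<bullet> x) + (- ((x - y) \<bullet> (x - y)) / (4 * s)) = - (y \<bullet> y) / (4 * s) + (- (1 + 1 / (4 * s)) * (x \<bullet> x) + ((1 / (2 * s)) *\<^sub>R y) \<bullet> x)"
    using that by (simp add: inner_diff inner_commute field_simps)
   then have "exp (- (x \<bullet> x)) * heat_kernel s (x - y) = heat_kernel s y * exp (- (1 + 1 / (4 * s)) * (x \<bullet> x) + ((1 / (2 * s)) *\<^sub>R y) \<bullet> x)"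
    unfolding heat_kernel_def exp_add[symmetric] by (rule arg_cong)
   then have "complex_of_real (exp (- (x \<bullet> x)) * heat_kernel s (x - y)) = of_real (heat_kernel s y * exp (- (1 + 1 / (4 * s)) * (x \<bullet> x) + ((1 / (2 * s)) *\<^sub>R y) \<bullet> x))"
    by (rule arg_cong)
   then show ?thesis unfolding gaussian_def of_real_mult[of "exp (- (x \<bullet> x))"] of_real_mult[of "heat_kernel s y"] by simp
  qed
  have "(LI x. k x * of_real (heat_kernel s (x - y)))
   = (LI x. of_real (heat_kernel s y) * (h x * gaussian (1 + 1 / (4 * s)) ((1 / (2 * s)) *\<^sub>R y) 0 x))"
   unfolding k_def mult.assoc eq by (simp add: mult.left_commute)
  also have "... = 0" using zero[of "1 + 1 / (4 * s)"] that by (simp add: add_pos_pos)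
  finally show ?thesis .
 qed
 have "AE x in lborel. k x = 0"
 proof (rule AE_zero_of_closed_integrals[OF k])
  fix C :: "'a set" assume C: "closed C"
  show "(LINT x:C|lborel. k x) = 0"
  proof (cases "C = {}")
   case False
   have [measurable]: "k \<in> Borel" using borel_measurable_integrable[OF k] by simp
   have [measurable]: "C \<in> sets borel" using C by simp
   \<comment> \<open>Continuous functions decreasing to the indicator of \<open>C\<close>: off the
     closed set the distance is positive, so \<open>g j x\<close> vanishes for large
     \<open>j\<close>.\<close>
   define g where "g j x = max 0 (1 - real j * infdist x C)" for j :: nat and x
   have g: "continuous_on UNIV (g j)" for j unfolding g_def by (intro continuous_intros)
   have g1: "\<bar>g j x\<bar> \<le> 1" for j x using infdist_nonneg[of x C] by (auto simp: g_def)
   note [measurable] = borel_measurable_continuous_onI[OF g]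
   have "(\<lambda>j. \<integral>x. k x * of_real (g j x) \<partial>lborel) \<longlonglongrightarrow> (LI x. indicator C x *\<^sub>R k x)"
   proof (rule integral_dominated_convergence[where w = "\<lambda>x. norm (k x)"])
    show "AE x in lborel. (\<lambda>j. k x * of_real (g j x)) \<longlonglongrightarrow> indicator C x *\<^sub>R k x"
    proof (rule AE_I2)
     fix x
     show "(\<lambda>j. k x * of_real (g j x)) \<longlonglongrightarrow> indicator C x *\<^sub>R k x"
     proof (cases "x \<in> C")
      case True then show ?thesis by (simp add: g_def)
     next
      case False
      then have d: "infdist x C > 0" using C \<open>C \<noteq> {}\<close> by (metis in_closed_iff_infdist_zero infdist_nonneg less_eq_real_def)
      obtain n where n: "1 / infdist x C < real n" using reals_Archimedean2 by blast
      have "\<forall>\<^sub>F j in sequentially. k x * of_real (g j x) = 0"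
       using eventually_ge_at_top[of n]
      proof eventually_elim
       case (elim j)
       have "1 / infdist x C \<le> real j" using n elim by linarith
       then have "1 \<le> real j * infdist x C" using d by (simp add: field_simps)
       then show ?case by (simp add: g_def)
      qed
      then show ?thesis using False by (simp add: tendsto_eventually)
     qed
    qed
    show "AE x in lborel. norm (k x * of_real (g j x)) \<le> norm (k x)" for j
     using g1 by (auto simp: norm_mult mult_left_le)
   qed (use k in auto)
   then show ?thesis
    using bounded_continuous_orthogonal[OF k orth g g1]
    by (simp add: LIMSEQ_const_iff set_lebesgue_integral_def)
  qed (simp add: set_lebesgue_integral_def)
 qed
 then show ?thesis by eventually_elim (simp add: k_def gaussian_def)
qed


section \<open>Plancherel's theorem\<close>

lemma fourier_measurable [measurable]:
 fixes f :: "'a::euclidean_space => complex"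
 assumes [measurable]: "f \<in> Borel"
 shows "fourier f \<in> Borel"
 unfolding fourier_def[abs_def] by measurable

lemma fourier_norm_le: "norm (fourier f z) \<le> (LI x. norm (f x))"
 unfolding fourier_def by (rule order_trans[OF integral_norm_bound]) (simp add: norm_mult)

lemma integrable_cis_mult:
 fixes f :: "'a::euclidean_space => complex"
 assumes "integrable lborel f"
 shows "integrable lborel (\<lambda>x. cis (- (x \<bullet> z)) * f x)"
proof -
 note [measurable] = borel_measurable_integrable[OF assms, simplified]
 show ?thesis by (rule Bochner_Integration.integrable_bound[OF assms]) (auto simp: norm_mult)
qed

lemma fourier_diff:
 assumes "integrable lborel f" "integrable lborel g"
 shows "fourier (\<lambda>x. f x - g x) z = fourier f z - fourier g z"
 unfolding fourier_def right_diff_distrib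
 by (rule Bochner_Integration.integral_diff; rule integrable_cis_mult) fact+

lemma fourier_reflect:
 fixes f :: "'a::euclidean_space => complex"
 assumes [measurable]: "f \<in> Borel"
 shows "fourier (\<lambda>x. f (- x)) z = fourier f (- z)"
 using lborel_integral_minus(2)[of "\<lambda>x. cis (- (x \<bullet> (- z))) * f x"] by (simp add: fourier_def)

text \<open>Fubini, with the symmetric kernel \<open>cis (- (x \<bullet> z))\<close>. This identity
  is what defines the transform on \<open>L2\<close> by duality below.\<close>

lemma fourier_multiplication:
 fixes f g :: "'a::euclidean_space => complex"
 assumes f: "integrable lborel f" and g: "integrable lborel g"
 shows "(LI z. fourier f z * g z) = (LI x. f x * fourier g x)"
proof -
 note [measurable] = borel_measurable_integrable[OF f, simplified] borel_measurable_integrable[OF g, simplified]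
 have "integrable (lborel \<Otimes>\<^sub>M lborel) (\<lambda>(x, z). cis (- (x \<bullet> z)) * f x * g z)"
 proof (rule lborel_pair.Fubini_integrable)
  show "integrable lborel (\<lambda>x. \<integral>z. norm (case (x, z) of (x, z) => cis (- (x \<bullet> z)) * f x * g z) \<partial>lborel)"
   using f g by (simp add: norm_mult)
  show "AE x in lborel. integrable lborel (\<lambda>z. case (x, z) of (x, z) => cis (- (x \<bullet> z)) * f x * g z)"
  proof (rule AE_I2)
   fix x
   have "integrable lborel (\<lambda>z. f x * g z)" using g by simp
   then show "integrable lborel (\<lambda>z. case (x, z) of (x, z) => cis (- (x \<bullet> z)) * f x * g z)"
    by (rule Bochner_Integration.integrable_bound) (auto simp: norm_mult)
  qed
 qed measurable
 from lborel_pair.Fubini_integral[OF this]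
 have "(LI z. (LI x. cis (- (x \<bullet> z)) * f x * g z)) = (LI x. (LI z. cis (- (x \<bullet> z)) * f x * g z))"
  by simp
 also have "(LI x. (LI z. cis (- (x \<bullet> z)) * f x * g z)) = (LI x. f x * fourier g x)"
  unfolding fourier_def
  by (intro Bochner_Integration.integral_cong refl, subst integral_mult_right_zero[symmetric])
   (simp add: mult_ac inner_commute)
 finally show ?thesis unfolding fourier_def by simp
qed

lemma fourier_gaussian_heat_kernel:
 fixes b z :: "'a::euclidean_space"
 assumes "d > 0"
 shows "fourier (gaussian d 0 b) z = of_real (sqrt (pi / d) ^ DIM('a) * heat_kernel d (z - b))"
proof -
 have "cis (- (x \<bullet> z)) * gaussian d 0 b x = gaussian d 0 (b - z) x" for x
 proof -
  have "(b - z) \<bullet> x = - (x \<bullet> z) + b \<bullet> x" by (simp add: inner_diff_left inner_commute[of x])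
  then show ?thesis unfolding gaussian_def by (simp only: cis_mult[symmetric] mult_ac)
 qed
 then have "fourier (gaussian d 0 b) z = (LI x. gaussian d 0 (b - z) x)"
  by (simp add: fourier_def)
 moreover have "(b - z) \<bullet> (b - z) = (z - b) \<bullet> (z - b)"
  by (simp add: inner_diff inner_commute)
 ultimately show ?thesis using gaussian_integral(2)[OF assms, of 0 "b - z"]
  by (simp add: heat_kernel_def)
qed

text \<open>Gaussian summability: the smoothed square integral of the transform is a double integral
 against the heat kernel, whose total mass is independent of the smoothing parameter.\<close>

lemma fourier_smoothed_bound:
 fixes f :: "'a::euclidean_space => complex"
 assumes f: "integrable lborel f" "f \<in> L2" and d: "d > 0"
 shows "(NI v. ennreal ((norm (fourier f v))^2 * exp (- d * (v \<bullet> v)))) \<le> ennreal ((2 * pi) ^ DIM('a) * (L2_norm f)^2)"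
proof -
 note [measurable] = L2_measurable[OF f(2)]
 define I where "I = (LI x. norm (f x))"
 have I: "I \<ge> 0" by (simp add: I_def integral_nonneg_AE)
 define K where "K z = sqrt (pi / d) ^ DIM('a) * heat_kernel d z" for z :: 'a
 have [measurable]: "K \<in> Borel" unfolding K_def[abs_def] by measurable
 have K0: "K z \<ge> 0" for z using d by (simp add: K_def heat_kernel_def)
 have Kint: "integrable lborel (\<lambda>y. K (y - x))" "(LI y. K (y - x)) = (2 * pi) ^ DIM('a)" for x
 proof -
  show "integrable lborel (\<lambda>y. K (y - x))" unfolding K_def using heat_kernel_shift(1)[OF d, of x] by simp
  have "sqrt (pi / d) * sqrt (4 * pi * d) = sqrt ((2 * pi)^2)"
   unfolding real_sqrt_mult[symmetric] using d by (simp add: power2_eq_square)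
  also have "... = 2 * pi" by (rule real_sqrt_unique) auto
  finally have "sqrt (pi / d) ^ DIM('a) * sqrt (4 * pi * d) ^ DIM('a) = (2 * pi) ^ DIM('a)"
   unfolding power_mult_distrib[symmetric] by (rule arg_cong)
  then show "(LI y. K (y - x)) = (2 * pi) ^ DIM('a)"
   unfolding K_def using heat_kernel_shift(2)[OF d, of x] by simp
 qed
 have Ksym: "K (x - y) = K (y - x)" for x y
  by (simp add: K_def heat_kernel_def inner_diff inner_commute algebra_simps)
 \<comment> \<open>Chosen so that \<open>fourier f * \<psi>\<close> is the smoothed square of
   \<open>fourier f\<close>; the multiplication formula then moves the transform onto
   \<open>\<psi>\<close>, where it becomes a convolution with the heat kernel.\<close>
 define \<psi> where "\<psi> v = gaussian d 0 0 v * cnj (fourier f v)" for v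
 have [measurable]: "cnj \<in> Borel" by (intro borel_measurable_continuous_onI continuous_intros)
 have [measurable]: "\<psi> \<in> Borel" unfolding \<psi>_def[abs_def] by measurable
 have fc: "integrable lborel (\<lambda>x. cnj (f x))"
  by (rule Bochner_Integration.integrable_bound[OF f(1)]) auto
 have cnj_fourier: "cnj (fourier f v) = fourier (\<lambda>x. cnj (f x)) (- v)" for v
 proof -
  have "cnj (fourier f v) = (LI x. cnj (cis (- (x \<bullet> v)) * f x))"
   unfolding fourier_def by (rule integral_bounded_linear'[OF bounded_linear_cnj bounded_linear_cnj, symmetric]) simp
  then show ?thesis unfolding fourier_def by (simp add: cis_cnj)
 qed
 have \<psi>: "integrable lborel \<psi>"
  by (rule Bochner_Integration.integrable_bound[OF integrable_mult_right[OF gaussian_integral(1)[OF d, of 0 0], of "of_real I"]])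
   (use fourier_norm_le[of f] I in \<open>auto simp: \<psi>_def norm_mult I_def[symmetric] mult.commute[of _ "norm (fourier f _)"] intro!: AE_I2 mult_right_mono\<close>)
 have \<psi>_hat: "fourier \<psi> x = (LI y. of_real (K (y - x)) * cnj (f y))" for x
 proof -
  have "fourier \<psi> x = (LI v. fourier (\<lambda>x. cnj (f x)) v * gaussian d 0 x v)"
   unfolding fourier_def[of \<psi>] \<psi>_def cnj_fourier
   by (subst lborel_integral_minus(2)[symmetric])
    (auto simp: gaussian_def cis_mult mult_ac inner_commute intro!: Bochner_Integration.integral_cong)
  also have "... = (LI y. cnj (f y) * fourier (gaussian d 0 x) y)"
   by (rule fourier_multiplication[OF fc gaussian_integral(1)[OF d]])
  finally show ?thesis unfolding fourier_gaussian_heat_kernel[OF d] K_def by (simp add: mult_ac)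
 qed
 define N where "N = (LI v. (norm (fourier f v))^2 * exp (- d * (v \<bullet> v)))"
 have eq: "fourier f v * \<psi> v = of_real ((norm (fourier f v))^2 * exp (- d * (v \<bullet> v)))" for v
  by (simp add: \<psi>_def gaussian_def mult_ac complex_norm_square[symmetric] del: of_real_power)
 have "integrable lborel (\<lambda>v. fourier f v * \<psi> v)"
  by (rule Bochner_Integration.integrable_bound[OF integrable_mult_right[OF \<psi>, of "of_real I"]])
   (use fourier_norm_le[of f] I in \<open>auto simp: norm_mult I_def[symmetric] intro!: mult_right_mono\<close>)
 then have Nint: "integrable lborel (\<lambda>v. (norm (fourier f v))^2 * exp (- d * (v \<bullet> v)))"
  unfolding eq complex_of_real_integrable_eq .
 have "complex_of_real N = (LI x. f x * fourier \<psi> x)"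
  unfolding N_def integral_complex_of_real[symmetric] eq[symmetric] by (rule fourier_multiplication[OF f(1) \<psi>])
 then have "ennreal N \<le> ennreal (norm (LI x. f x * fourier \<psi> x))"
  by (intro ennreal_leI) (metis abs_ge_self norm_of_real)
 also have "... \<le> (NI x. ennreal (norm (f x * fourier \<psi> x)))"
  by (rule integral_norm_bound_ennreal)
   (rule Bochner_Integration.integrable_bound[OF integrable_mult_right[OF f(1), of "of_real (LI x. norm (\<psi> x))"]],
    use fourier_norm_le[of \<psi>] in \<open>auto simp: norm_mult mult.commute[of "norm (f _)"] integral_nonneg_AE intro!: mult_right_mono\<close>)
 \<comment> \<open>Schur's test with a symmetric kernel: the product
   \<open>norm (f x) * norm (f y)\<close> is split into half squares, and both halves give the same
   integral, the total mass of \<open>K\<close> times half the squared norm of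
   \<open>f\<close>.\<close>
 also have "... \<le> (NI x. (NI y. ennreal (K (y - x) * (norm (f x))^2 / 2) + ennreal (K (y - x) * (norm (f y))^2 / 2)))"
 proof (rule nn_integral_mono)
  fix x
  have "integrable lborel (\<lambda>y. of_real (K (y - x)) * cnj (f y))"
  proof (rule Bochner_Integration.integrable_bound[OF integrable_mult_right[OF f(1), of "of_real (sqrt (pi / d) ^ DIM('a))"]])
   show "AE y in lborel. norm (of_real (K (y - x)) * cnj (f y)) \<le> norm (of_real (sqrt (pi / d) ^ DIM('a)) * f y)"
    using d by (auto simp: norm_mult K_def heat_kernel_def abs_mult power_abs intro!: AE_I2 mult_left_le_one_le)
  qed measurable
  then have "ennreal (norm (fourier \<psi> x)) \<le> (NI y. ennreal (norm (of_real (K (y - x)) * cnj (f y))))"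
   unfolding \<psi>_hat by (rule integral_norm_bound_ennreal)
  then have "ennreal (norm (f x * fourier \<psi> x)) \<le> ennreal (norm (f x)) * (NI y. ennreal (K (y - x) * norm (f y)))"
   unfolding norm_mult using K0 by (simp add: ennreal_mult mult_left_mono)
  also have "... = (NI y. ennreal (norm (f x) * (K (y - x) * norm (f y))))"
   by (subst nn_integral_cmult[symmetric]) (auto simp: ennreal_mult K0)
  also have "... \<le> (NI y. ennreal (K (y - x) * (norm (f x))^2 / 2) + ennreal (K (y - x) * (norm (f y))^2 / 2))"
  proof (rule nn_integral_mono)
   fix y
   have "norm (f x) * norm (f y) \<le> (norm (f x))^2 / 2 + (norm (f y))^2 / 2"
    using zero_le_power2[of "norm (f x) - norm (f y)"] unfolding power2_diff by argo
   then have "K (y - x) * (norm (f x) * norm (f y)) \<le> K (y - x) * ((norm (f x))^2 / 2 + (norm (f y))^2 / 2)"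
    by (rule mult_left_mono) (rule K0)
   then show "ennreal (norm (f x) * (K (y - x) * norm (f y))) \<le> ennreal (K (y - x) * (norm (f x))^2 / 2) + ennreal (K (y - x) * (norm (f y))^2 / 2)"
    by (subst ennreal_plus[symmetric]) (auto simp: K0 algebra_simps simp del: ennreal_plus intro!: ennreal_leI)
  qed
  finally show "ennreal (norm (f x * fourier \<psi> x)) \<le> (NI y. ennreal (K (y - x) * (norm (f x))^2 / 2) + ennreal (K (y - x) * (norm (f y))^2 / 2))" .
 qed
 also have "... = (NI x. (NI y. ennreal (K (y - x) * (norm (f x))^2 / 2))) + (NI x. (NI y. ennreal (K (y - x) * (norm (f y))^2 / 2)))"
  by (simp add: nn_integral_add)
 also have "(NI x. (NI y. ennreal (K (y - x) * (norm (f y))^2 / 2))) = (NI y. (NI x. ennreal (K (y - x) * (norm (f y))^2 / 2)))"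
  by (rule lborel_pair.Fubini') measurable
 also have "... = (NI x. (NI y. ennreal (K (y - x) * (norm (f x))^2 / 2)))"
  by (simp only: Ksym)
 also have "(NI x. (NI y. ennreal (K (y - x) * (norm (f x))^2 / 2))) = (NI x. ennreal ((2 * pi) ^ DIM('a) / 2) * ennreal ((norm (f x))^2))"
 proof (rule nn_integral_cong)
  fix x
  have "(NI y. ennreal (K (y - x) * ((norm (f x))^2 / 2))) = ennreal (LI y. K (y - x) * ((norm (f x))^2 / 2))"
   by (rule nn_integral_eq_integral) (auto simp: Kint K0)
  then show "(NI y. ennreal (K (y - x) * (norm (f x))^2 / 2)) = ennreal ((2 * pi) ^ DIM('a) / 2) * ennreal ((norm (f x))^2)"
   using Kint by (simp add: ennreal_mult[symmetric])
 qed
 also have "... = ennreal ((2 * pi) ^ DIM('a) / 2) * ennreal ((L2_norm f)^2)"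
  by (subst nn_integral_cmult) (auto simp: L2_norm_nn[OF f(2)])
 also have "... + ... = ennreal ((2 * pi) ^ DIM('a) * (L2_norm f)^2)"
  by (subst (1 2) ennreal_mult[symmetric]) (auto simp flip: ennreal_plus)
 finally show ?thesis
  unfolding N_def by (subst nn_integral_eq_integral[OF Nint]) auto
qed

text \<open>The bound for the smoothed integral does not depend on \<open>d\<close>; let
  \<open>d\<close> tend to zero.\<close>

lemma fourier_L2:
 fixes f :: "'a::euclidean_space => complex"
 assumes f: "integrable lborel f" "f \<in> L2"
 shows "fourier f \<in> L2" "L2_norm (fourier f) \<le> sqrt ((2 * pi) ^ DIM('a)) * L2_norm f"
proof -
 note [measurable] = L2_measurable[OF f(2)]
 have *: "(NI z. ennreal ((norm (fourier f z))^2)) \<le> ennreal ((2 * pi) ^ DIM('a) * (L2_norm f)^2)"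
 proof (rule nn_integral_le_of_tendsto)
  show "AE z in lborel. (\<lambda>k. ennreal ((norm (fourier f z))^2 * exp (- (1 / real (Suc k)) * (z \<bullet> z)))) \<longlonglongrightarrow> ennreal ((norm (fourier f z))^2)"
  proof (intro AE_I2 tendsto_ennrealI)
   fix z :: 'a
   have "(\<lambda>k. (norm (fourier f z))^2 * exp (- (1 / real (Suc k)) * (z \<bullet> z))) \<longlonglongrightarrow> (norm (fourier f z))\<^sup>2 * exp (- 0 * (z \<bullet> z))"
    using LIMSEQ_inverse_real_of_nat by (intro tendsto_intros) (simp add: inverse_eq_divide)
   then show "(\<lambda>k. (norm (fourier f z))^2 * exp (- (1 / real (Suc k)) * (z \<bullet> z))) \<longlonglongrightarrow> (norm (fourier f z))\<^sup>2" by simp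
  qed
  show "\<forall>\<^sub>F k in sequentially. (NI z. ennreal ((norm (fourier f z))^2 * exp (- (1 / real (Suc k)) * (z \<bullet> z)))) \<le> ennreal ((2 * pi) ^ DIM('a) * (L2_norm f)^2)"
   by (intro always_eventually allI fourier_smoothed_bound f) simp
 qed measurable
 show L2: "fourier f \<in> L2"
  by (rule L2_I) (use * in \<open>auto simp: integrable_iff_bounded le_less_trans[OF _ ennreal_less_top]\<close>)
 have "(L2_norm (fourier f))^2 \<le> (sqrt ((2 * pi) ^ DIM('a)) * L2_norm f)^2"
  using * unfolding L2_norm_nn[OF L2] by (simp add: power_mult_distrib)
 then show "L2_norm (fourier f) \<le> sqrt ((2 * pi) ^ DIM('a)) * L2_norm f"
  by (rule power2_le_imp_le) simp
qed

text \<open>The Fourier transform on \<open>L2\<close>, singled out by duality against functions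
  that are integrable and square integrable. The choice fixes it up to null sets only, so linearity
  and inversion are stated almost everywhere.\<close>

definition plancherel :: "('a::euclidean_space => complex) => 'a => complex" where
 "plancherel f = (SOME g. g \<in> L2 \<and> L2_norm g \<le> sqrt ((2 * pi) ^ DIM('a)) * L2_norm f \<and>
  (\<forall>h\<in>L2. integrable lborel h \<longrightarrow> (LI x. g x * h x) = (LI x. f x * fourier h x)))"

lemma L2_integral_tendsto:
 assumes "\<And>k. f k \<in> L2" "g \<in> L2" "(\<lambda>k. L2_norm (\<lambda>x. f k x - g x)) \<longlonglongrightarrow> 0" "h \<in> L2"
 shows "(\<lambda>k. \<integral>x. f k x * h x \<partial>lborel) \<longlonglongrightarrow> (LI x. g x * h x)"
proof (rule LIM_zero_cancel, rule Lim_null_comparison)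
 show "\<forall>\<^sub>F k in sequentially. norm ((LI x. f k x * h x) - (LI x. g x * h x)) \<le> L2_norm (\<lambda>x. f k x - g x) * L2_norm h"
 proof (intro always_eventually allI)
  fix k
  have "(LI x. f k x * h x) - (LI x. g x * h x) = (LI x. (f k x - g x) * h x)"
   using L2_mult_integrable[OF assms(1,4)] L2_mult_integrable[OF assms(2,4)] by (simp add: left_diff_distrib)
  then show "norm ((LI x. f k x * h x) - (LI x. g x * h x)) \<le> L2_norm (\<lambda>x. f k x - g x) * L2_norm h"
   using L2_Cauchy_Schwarz[of "\<lambda>x. f k x - g x" h] assms by (simp add: L2_diff)
 qed
 show "(\<lambda>k. L2_norm (\<lambda>x. f k x - g x) * L2_norm h) \<longlonglongrightarrow> 0"
  using tendsto_mult_right[OF assms(3), of "L2_norm h"] by simp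
qed

lemma plancherel_exists:
 fixes f :: "'a::euclidean_space => complex"
 assumes f: "f \<in> L2"
 shows "\<exists>g. g \<in> L2 \<and> L2_norm g \<le> sqrt ((2 * pi) ^ DIM('a)) * L2_norm f \<and>
  (\<forall>h\<in>L2. integrable lborel h \<longrightarrow> (LI x. g x * h x) = (LI x. f x * fourier h x))"
proof -
 let ?K = "sqrt ((2 * pi) ^ DIM('a))"
 note [measurable] = L2_measurable[OF f]
 \<comment> \<open>Truncations to balls are integrable as well, since
   \<open>norm (f x) <= (norm (f x))^2 + 1\<close> and balls have finite measure; their classical
   transforms form a Cauchy sequence.\<close>
 define u where "u k x = (if norm x \<le> real k then f x else 0)" for k :: nat and x
 have [measurable]: "u k \<in> Borel" for k unfolding u_def[abs_def] by measurable
 have u: "u k \<in> L2" for k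
  by (rule L2_dominated[OF f, of _ 1]) (auto simp: u_def)
 have ui: "integrable lborel (u k)" for k
 proof -
  have "integrable lborel (\<lambda>x. (norm (f x))^2 + indicator (cball (0::'a) k) x)"
   by (intro Bochner_Integration.integrable_add integrable_real_indicator L2_integrable[OF f] emeasure_lborel_cball_finite) simp
  then show ?thesis
  proof (rule Bochner_Integration.integrable_bound)
   have "norm (f x) \<le> (norm (f x))^2 + 1" for x
   proof -
    have "2 * norm (f x) \<le> (norm (f x))^2 + 1" using sum_squares_bound[of "norm (f x)" 1] by simp
    then show ?thesis using norm_ge_zero[of "f x"] by linarith
   qed
   then show "AE x in lborel. norm (u k x) \<le> norm ((norm (f x))^2 + indicator (cball (0::'a) k) x)"
    by (auto simp: u_def)
  qed measurable
 qed
 have "(\<lambda>k. \<integral>x. (norm (u k x - f x))^2 \<partial>lborel) \<longlonglongrightarrow> integral\<^sup>L lborel (\<lambda>x::'a. 0::real)"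
 proof (rule integral_dominated_convergence[where w = "\<lambda>x. (norm (f x))^2"])
  show "AE x in lborel. (\<lambda>k. (norm (u k x - f x))^2) \<longlonglongrightarrow> 0"
  proof (rule AE_I2, rule tendsto_eventually)
   fix x :: 'a
   show "\<forall>\<^sub>F k in sequentially. (norm (u k x - f x))^2 = 0"
    using eventually_ge_at_top[of "nat \<lceil>norm x\<rceil>"] by eventually_elim (auto simp: u_def nat_ceiling_le_eq)
  qed
 qed (use L2_integrable[OF f] in \<open>auto simp: u_def\<close>)
 then have conv: "(\<lambda>k. L2_norm (\<lambda>x. u k x - f x)) \<longlonglongrightarrow> 0"
  unfolding L2_norm_def using tendsto_real_sqrt by fastforce
 have diff: "L2_norm (\<lambda>z. fourier (u i) z - fourier (u j) z) \<le> ?K * (L2_norm (\<lambda>x. u i x - f x) + L2_norm (\<lambda>x. u j x - f x))" for i j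
 proof -
  have "L2_norm (\<lambda>z. fourier (u i) z - fourier (u j) z) = L2_norm (fourier (\<lambda>x. u i x - u j x))"
   by (simp add: fourier_diff[OF ui ui, abs_def, symmetric])
  also have "... \<le> ?K * L2_norm (\<lambda>x. u i x - u j x)"
   by (rule fourier_L2) (auto intro!: ui L2_diff u)
  also have "L2_norm (\<lambda>x. u i x - u j x) \<le> L2_norm (\<lambda>x. u i x - f x) + L2_norm (\<lambda>x. u j x - f x)"
   using L2_norm_triangle_diff[OF u f u, of i j] L2_norm_minus_commute[of f "u j"] by simp
  finally show ?thesis by (simp add: mult_left_mono)
 qed
 have "\<exists>N. \<forall>i\<ge>N. \<forall>j\<ge>N. L2_norm (\<lambda>z. fourier (u i) z - fourier (u j) z) < e" if "e > 0" for e
 proof -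
  have K: "?K > 0" by simp
  obtain N where N: "\<And>k. k \<ge> N ==> L2_norm (\<lambda>x. u k x - f x) < e / (2 * ?K)"
  proof -
   have "e / (2 * ?K) > 0" using \<open>e > 0\<close> K by (intro divide_pos_pos mult_pos_pos) auto
   from order_tendstoD(2)[OF conv this] show ?thesis
    unfolding eventually_sequentially by (elim exE) (rule that, blast)
  qed
  have "L2_norm (\<lambda>z. fourier (u i) z - fourier (u j) z) < e" if "i \<ge> N" "j \<ge> N" for i j
  proof -
   have "?K * (L2_norm (\<lambda>x. u i x - f x) + L2_norm (\<lambda>x. u j x - f x)) < ?K * (e / (2 * ?K) + e / (2 * ?K))"
    by (intro mult_strict_left_mono add_strict_mono N that K)
   also have "... = e" using K by (simp add: field_simps)
   finally show ?thesis using diff[of i j] by simp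
  qed
  then show ?thesis by blast
 qed
 from L2_complete[OF fourier_L2(1)[OF ui u] this]
 obtain g where g: "g \<in> L2" "(\<lambda>k. L2_norm (\<lambda>x. fourier (u k) x - g x)) \<longlonglongrightarrow> 0" by auto
 have "L2_norm g \<le> ?K * L2_norm f"
 proof (rule tendsto_lowerbound)
  show "(\<lambda>k. ?K * (L2_norm f + L2_norm (\<lambda>x. u k x - f x)) + L2_norm (\<lambda>x. fourier (u k) x - g x)) \<longlonglongrightarrow> ?K * L2_norm f"
   by (rule tendsto_eq_intros conv g(2) refl | simp)+
  show "\<forall>\<^sub>F k in sequentially. L2_norm g \<le> ?K * (L2_norm f + L2_norm (\<lambda>x. u k x - f x)) + L2_norm (\<lambda>x. fourier (u k) x - g x)"
  proof (intro always_eventually allI)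
   fix k
   have "L2_norm g \<le> L2_norm (fourier (u k)) + L2_norm (\<lambda>x. fourier (u k) x - g x)"
    using L2_norm_le_add_diff[OF g(1) fourier_L2(1)[OF ui u, of k]] L2_norm_minus_commute[of g "fourier (u k)"] by simp
   also have "L2_norm (fourier (u k)) \<le> ?K * L2_norm (u k)" by (rule fourier_L2[OF ui u])
   also have "L2_norm (u k) \<le> L2_norm f + L2_norm (\<lambda>x. u k x - f x)" by (rule L2_norm_le_add_diff[OF u f])
   finally show "L2_norm g \<le> ?K * (L2_norm f + L2_norm (\<lambda>x. u k x - f x)) + L2_norm (\<lambda>x. fourier (u k) x - g x)"
    by (simp add: mult_left_mono)
  qed
 qed simp
 moreover have "(LI x. g x * h x) = (LI x. f x * fourier h x)" if h: "h \<in> L2" "integrable lborel h" for h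
 proof (rule LIMSEQ_unique)
  show "(\<lambda>k. \<integral>x. fourier (u k) x * h x \<partial>lborel) \<longlonglongrightarrow> (LI x. g x * h x)"
   by (rule L2_integral_tendsto[OF fourier_L2(1)[OF ui u] g h(1)])
  show "(\<lambda>k. \<integral>x. fourier (u k) x * h x \<partial>lborel) \<longlonglongrightarrow> (LI x. f x * fourier h x)"
   unfolding fourier_multiplication[OF ui h(2)]
   by (rule L2_integral_tendsto[OF u f conv fourier_L2(1)[OF h(2,1)]])
 qed
 ultimately show ?thesis using g(1) by blast
qed

lemma plancherel_props:
 fixes f :: "'a::euclidean_space => complex"
 assumes f: "f \<in> L2"
 shows plancherel_L2: "plancherel f \<in> L2"
  and plancherel_norm_le: "L2_norm (plancherel f) \<le> sqrt ((2 * pi) ^ DIM('a)) * L2_norm f"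
  and plancherel_pairing: "\<And>h. h \<in> L2 ==> integrable lborel h ==>
   (LI x. plancherel f x * h x) = (LI x. f x * fourier h x)"
 using someI_ex[OF plancherel_exists[OF f]] unfolding plancherel_def[symmetric] by blast+

lemma gaussian_L2: "d > 0 ==> gaussian d a b \<in> L2"
 using schwartz_L2[OF gaussian_schwartz[of d 1 a b]] by simp

text \<open>Real Gaussians separate functions, so an identity with \<open>plancherel f\<close> can
  be checked on them, where every transform is explicit. All algebraic properties of
  \<open>plancherel\<close> are obtained this way.\<close>

lemma plancherel_unique:
 fixes f h :: "'a::euclidean_space => complex"
 assumes f: "f \<in> L2" and h: "h \<in> Borel"
  and "\<And>d a. d > 0 ==> integrable lborel (\<lambda>x. h x * gaussian d a 0 x)"
  and eq: "\<And>d a. d > 0 ==> (LI x. h x * gaussian d a 0 x) = (LI x. f x * fourier (gaussian d a 0) x)"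
 shows "AE x in lborel. h x = plancherel f x"
proof -
 note [measurable] = L2_measurable[OF plancherel_L2[OF f]] h
 have i: "integrable lborel (\<lambda>x. plancherel f x * gaussian d a 0 x)" if "d > 0" for d a
  by (rule L2_mult_integrable[OF plancherel_L2[OF f] gaussian_L2[OF that]])
 have "AE x in lborel. h x - plancherel f x = 0"
  by (rule AE_zero_of_gaussians)
   (use assms i plancherel_pairing[OF f gaussian_L2 gaussian_integral(1)] in \<open>auto simp: left_diff_distrib\<close>)
 then show ?thesis by simp
qed

lemma plancherel_plancherel:
 fixes f :: "'a::euclidean_space => complex"
 assumes f: "f \<in> L2"
 shows "AE x in lborel. plancherel (plancherel f) x = of_real ((2 * pi) ^ DIM('a)) * f (- x)"
proof -
 let ?c = "complex_of_real ((2 * pi) ^ DIM('a))"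
 note [measurable] = L2_measurable[OF f]
 have "AE x in lborel. ?c * f (- x) = plancherel (plancherel f) x"
 proof (rule plancherel_unique[OF plancherel_L2[OF f]])
  fix d :: real and a :: 'a assume d: "d > 0"
  show "integrable lborel (\<lambda>x. ?c * f (- x) * gaussian d a 0 x)"
   by (intro L2_mult_integrable L2_scale L2_reflect f gaussian_L2 d)
  let ?g = "gaussian d a 0"
  have A: "1 / (4 * d) > 0" using d by simp
  have "(LI x. plancherel f x * fourier ?g x) = (LI x. f x * fourier (fourier ?g) x)"
   unfolding fourier_gaussian[OF d]
   by (rule plancherel_pairing[OF f L2_scale[OF gaussian_L2[OF A]] integrable_mult_right[OF gaussian_integral(1)[OF A]]])
  also have "... = (LI x. f x * (?c * ?g (- x)))"
   unfolding fourier_fourier_gaussian[OF d] ..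
  also have "... = (LI x. f (- x) * (?c * ?g x))"
   by (subst lborel_integral_minus(2)[symmetric]) simp_all
  finally show "(LI x. ?c * f (- x) * ?g x) = (LI x. plancherel f x * fourier ?g x)"
   by (simp add: mult_ac)
 qed measurable
 then show ?thesis by eventually_elim simp
qed

text \<open>The upper bound applied to the second transform gives the lower bound for the first,
  because the twofold transform is a reflection times a constant.\<close>

lemma plancherel_norm:
 fixes f :: "'a::euclidean_space => complex"
 assumes f: "f \<in> L2"
 shows "L2_norm (plancherel f) = sqrt ((2 * pi) ^ DIM('a)) * L2_norm f"
proof (rule antisym[OF plancherel_norm_le[OF f]])
 let ?K = "sqrt ((2 * pi) ^ DIM('a))"
 note [measurable] = L2_measurable[OF f] L2_measurable[OF plancherel_L2[OF plancherel_L2[OF f]]]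
 have "?K * (?K * L2_norm f) = L2_norm (\<lambda>x. of_real ((2 * pi) ^ DIM('a)) * f (- x))"
  by (simp add: L2_norm_scale L2_norm_reflect norm_power norm_mult)
 also have "... = L2_norm (plancherel (plancherel f))"
  by (rule L2_norm_cong_AE) (use plancherel_plancherel[OF f] in \<open>auto elim!: eventually_mono\<close>)
 also have "... \<le> ?K * L2_norm (plancherel f)" by (rule plancherel_norm_le[OF plancherel_L2[OF f]])
 finally show "?K * L2_norm f \<le> L2_norm (plancherel f)" by simp
qed

lemma plancherel_diff:
 fixes f g :: "'a::euclidean_space => complex"
 assumes f: "f \<in> L2" and g: "g \<in> L2"
 shows "AE x in lborel. plancherel (\<lambda>x. f x - g x) x = plancherel f x - plancherel g x"
proof -
 note [measurable] = L2_measurable[OF plancherel_L2[OF f]] L2_measurable[OF plancherel_L2[OF g]]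
 have "AE x in lborel. plancherel f x - plancherel g x = plancherel (\<lambda>x. f x - g x) x"
 proof (rule plancherel_unique[OF L2_diff[OF f g]])
  fix d :: real and a :: 'a assume d: "d > 0"
  note G = gaussian_L2[OF d, of a 0] gaussian_integral(1)[OF d, of a 0]
  show "integrable lborel (\<lambda>x. (plancherel f x - plancherel g x) * gaussian d a 0 x)"
   by (intro L2_mult_integrable L2_diff plancherel_L2 f g G)
  show "(LI x. (plancherel f x - plancherel g x) * gaussian d a 0 x) = (LI x. (f x - g x) * fourier (gaussian d a 0) x)"
   using plancherel_pairing[OF f G] plancherel_pairing[OF g G]
   by (simp add: left_diff_distrib L2_mult_integrable plancherel_L2 f g G fourier_L2)
 qed measurable
 then show ?thesis by eventually_elim simp
qed

lemma plancherel_scale: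
 fixes f :: "'a::euclidean_space => complex"
 assumes f: "f \<in> L2"
 shows "AE x in lborel. plancherel (\<lambda>x. c * f x) x = c * plancherel f x"
proof -
 note [measurable] = L2_measurable[OF plancherel_L2[OF f]]
 have "AE x in lborel. c * plancherel f x = plancherel (\<lambda>x. c * f x) x"
 proof (rule plancherel_unique[OF L2_scale[OF f]])
  fix d :: real and a :: 'a assume d: "d > 0"
  note G = gaussian_L2[OF d, of a 0] gaussian_integral(1)[OF d, of a 0]
  show "integrable lborel (\<lambda>x. c * plancherel f x * gaussian d a 0 x)"
   by (intro L2_mult_integrable L2_scale plancherel_L2 f G)
  show "(LI x. c * plancherel f x * gaussian d a 0 x) = (LI x. c * f x * fourier (gaussian d a 0) x)"
   using plancherel_pairing[OF f G] by (simp add: mult.assoc)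
 qed measurable
 then show ?thesis by eventually_elim simp
qed

lemma plancherel_cong_AE:
 fixes f g :: "'a::euclidean_space => complex"
 assumes f: "f \<in> L2" and g: "g \<in> L2" and "AE x in lborel. f x = g x"
 shows "AE x in lborel. plancherel f x = plancherel g x"
proof (rule plancherel_unique[OF g])
 show "plancherel f \<in> Borel" by (rule L2_measurable[OF plancherel_L2[OF f]])
 fix d :: real and a :: 'a assume d: "d > 0"
 note G = gaussian_L2[OF d, of a 0] gaussian_integral(1)[OF d, of a 0]
 note [measurable] = L2_measurable[OF f] L2_measurable[OF g] 
 show "integrable lborel (\<lambda>x. plancherel f x * gaussian d a 0 x)"
  by (intro L2_mult_integrable plancherel_L2 f G)
 show "(LI x. plancherel f x * gaussian d a 0 x) = (LI x. g x * fourier (gaussian d a 0) x)"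
  unfolding plancherel_pairing[OF f G]
  by (rule integral_cong_AE) (use assms(3) in \<open>auto elim!: eventually_mono\<close>)
qed

definition inv_plancherel :: "('a::euclidean_space => complex) => 'a => complex" where
 "inv_plancherel U x = plancherel U (- x) / of_real ((2 * pi) ^ DIM('a))"

lemma inv_plancherel_L2: "U \<in> L2 ==> inv_plancherel U \<in> L2"
 using L2_scale[OF L2_reflect[OF plancherel_L2], of U "1 / of_real ((2 * pi) ^ DIM('a))" for U :: "'a::euclidean_space => complex"]
 by (simp add: inv_plancherel_def[abs_def])

lemma inv_plancherel_pairing:
 fixes U :: "'a::euclidean_space => complex"
 assumes U: "U \<in> L2" and h: "h \<in> L2" "integrable lborel h"
 shows "(LI x. inv_plancherel U x * h x) = (LI z. U z * fourier h (- z)) / of_real ((2 * pi) ^ DIM('a))"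
proof -
 note [measurable] = L2_measurable[OF h(1)] L2_measurable[OF plancherel_L2[OF U]]
 have "(LI x. inv_plancherel U x * h x) = (LI x. plancherel U (- x) * h (- (- x))) / of_real ((2 * pi) ^ DIM('a))"
  by (simp add: inv_plancherel_def)
 also have "(LI x. plancherel U (- x) * h (- (- x))) = (LI x. plancherel U x * h (- x))"
  by (rule lborel_integral_minus(2)) measurable
 also have "... = (LI x. U x * fourier (\<lambda>x. h (- x)) x)"
  by (rule plancherel_pairing[OF U L2_reflect[OF h(1)]]) (use h(2) lborel_integral_minus(1)[of h] in simp)
 also have "... = (LI x. U x * fourier h (- x))"
  by (subst fourier_reflect) auto
 finally show ?thesis .
qed

lemma plancherel_inv_plancherel:
 fixes U :: "'a::euclidean_space => complex"
 assumes U: "U \<in> L2"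
 shows "AE x in lborel. plancherel (inv_plancherel U) x = U x"
proof -
 note [measurable] = L2_measurable[OF U]
 have "AE x in lborel. U x = plancherel (inv_plancherel U) x"
 proof (rule plancherel_unique[OF inv_plancherel_L2[OF U]])
  fix d :: real and a :: 'a assume d: "d > 0"
  let ?g = "gaussian d a 0"
  have A: "1 / (4 * d) > 0" using d by simp
  show "integrable lborel (\<lambda>x. U x * ?g x)" by (intro L2_mult_integrable U gaussian_L2 d)
  have "(LI x. inv_plancherel U x * fourier ?g x) = (LI z. U z * fourier (fourier ?g) (- z)) / of_real ((2 * pi) ^ DIM('a))"
   unfolding fourier_gaussian[OF d]
   by (rule inv_plancherel_pairing[OF U L2_scale[OF gaussian_L2[OF A]] integrable_mult_right[OF gaussian_integral(1)[OF A]]])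
  then show "(LI x. U x * ?g x) = (LI x. inv_plancherel U x * fourier ?g x)"
   unfolding fourier_fourier_gaussian[OF d] mult.left_commute[of "U _"] integral_mult_right_zero by simp
 qed measurable
 then show ?thesis by eventually_elim simp
qed

lemma inv_plancherel_norm:
 fixes U :: "'a::euclidean_space => complex"
 assumes U: "U \<in> L2"
 shows "(L2_norm (inv_plancherel U))^2 = (L2_norm U)^2 / (2 * pi) ^ DIM('a)"
proof -
 note [measurable] = L2_measurable[OF U] L2_measurable[OF plancherel_L2[OF inv_plancherel_L2[OF U]]]
 have "L2_norm U = L2_norm (plancherel (inv_plancherel U))"
  by (rule L2_norm_cong_AE) (use plancherel_inv_plancherel[OF U] in \<open>auto elim!: eventually_mono\<close>)
 then show ?thesis unfolding plancherel_norm[OF inv_plancherel_L2[OF U]] by (simp add: power_mult_distrib)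
qed

text \<open>The pairing is bilinear, without conjugation, as suits distributions; hence the
  reflected argument \<open>fourier h (- z)\<close>, which accompanies test functions from here
  on.\<close>

lemma plancherel_parseval:
 fixes f :: "'a::euclidean_space => complex"
 assumes f: "f \<in> L2" and h: "h \<in> L2" "integrable lborel h"
 shows "(LI x. f x * h x) = (LI z. plancherel f z * fourier h (- z)) / of_real ((2 * pi) ^ DIM('a))"
proof -
 note [measurable] = L2_measurable[OF f] L2_measurable[OF h(1)] L2_measurable[OF inv_plancherel_L2[OF plancherel_L2[OF f]]]
 have "AE x in lborel. inv_plancherel (plancherel f) x = f x"
  using AE_lborel_minus[OF plancherel_plancherel[OF f]] by eventually_elim (simp add: inv_plancherel_def)
 then have "(LI x. f x * h x) = (LI x. inv_plancherel (plancherel f) x * h x)"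
  by (intro integral_cong_AE) (auto elim!: eventually_mono)
 then show ?thesis unfolding inv_plancherel_pairing[OF plancherel_L2[OF f] h] .
qed


section \<open>Sobolev spaces on the Fourier side\<close>

lemma represented_by_plancherel:
 fixes f :: "'a::euclidean_space => complex"
 assumes f: "f \<in> L2"
 shows "represented_by (fourier_dist (dist_of f)) (plancherel f)"
 unfolding represented_by_def fourier_dist_def dist_of_def
 using L2_measurable[OF plancherel_L2[OF f]] L2_mult_integrable[OF plancherel_L2[OF f] schwartz_L2]
  plancherel_pairing[OF f schwartz_L2 schwartz_integrable] by simp

text \<open>The choice in \<open>fourier_fun\<close> is determined almost everywhere, since any
  representing function has prescribed pairings with Gaussians.\<close>

lemma fourier_fun_plancherel:
 fixes f :: "'a::euclidean_space => complex"
 assumes f: "f \<in> L2"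
 shows "fourier_fun (dist_of f) \<in> Borel"
  and "AE x in lborel. fourier_fun (dist_of f) x = plancherel f x"
proof -
 have *: "represented_by (fourier_dist (dist_of f)) (fourier_fun (dist_of f))"
  unfolding fourier_fun_def by (rule someI[where P = "represented_by (fourier_dist (dist_of f))", OF represented_by_plancherel[OF f]])
 then show m: "fourier_fun (dist_of f) \<in> Borel" by (simp add: represented_by_def)
 show "AE x in lborel. fourier_fun (dist_of f) x = plancherel f x"
 proof (rule plancherel_unique[OF f m])
  fix d :: real and a :: 'a assume d: "d > 0"
  have S: "gaussian d a 0 \<in> schwartz" using gaussian_schwartz[OF d, of 1 a 0] by simp
  show "integrable lborel (\<lambda>x. fourier_fun (dist_of f) x * gaussian d a 0 x)"
   "(LI x. fourier_fun (dist_of f) x * gaussian d a 0 x) = (LI x. f x * fourier (gaussian d a 0) x)"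
   using * S by (auto simp: represented_by_def dist_of_def fourier_dist_def)
 qed
qed

text \<open>Every Gaussian in frequency comes from a Schwartz test function, so an identity of
  distributions in \<open>x\<close> can be tested against Gaussians in \<open>z\<close>.\<close>

lemma gaussian_is_fourier:
 fixes a b :: "'a::euclidean_space"
 assumes d: "d > 0"
 obtains h where "h \<in> schwartz" "\<And>z. fourier h (- z) = gaussian d a b z"
  "h = (\<lambda>x. fourier (gaussian d a b) x / of_real ((2 * pi) ^ DIM('a)))"
proof -
 let ?c = "1 / complex_of_real ((2 * pi) ^ DIM('a))"
 let ?h = "\<lambda>x. ?c * fourier (gaussian d a b) x"
 have A: "1 / (4 * d) > 0" using d by simp
 have "?h \<in> schwartz"
  unfolding fourier_gaussian[OF d] mult.assoc[symmetric] by (rule gaussian_schwartz[OF A])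
 moreover have "fourier ?h (- z) = gaussian d a b z" for z
  unfolding fourier_scale fourier_fourier_gaussian[OF d] by simp
 ultimately show ?thesis using that by simp
qed

text \<open>Coordinates times the transform are transforms of partial derivatives, which are
  integrable and square integrable. This yields the moments that occur below without showing that
  the transform of a Schwartz function is itself one.\<close>

lemma fourier_schwartz_L2:
 fixes h :: "'a::euclidean_space => complex"
 assumes "h \<in> schwartz"
 shows "(\<lambda>z. fourier h (- z)) \<in> L2"
  "(\<lambda>z. of_real (z \<bullet> b) * fourier h (- z)) \<in> L2"
  "(\<lambda>z. of_real (norm z) * fourier h (- z)) \<in> L2"
proof -
 have F: "\<psi> \<in> schwartz ==> (\<lambda>z. fourier \<psi> (- z)) \<in> L2" for \<psi> :: "'a => complex"
  by (intro L2_reflect fourier_L2 schwartz_integrable schwartz_L2)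
 show 0: "(\<lambda>z. fourier h (- z)) \<in> L2" by (rule F[OF assms])
 have B: "(\<lambda>z. of_real (z \<bullet> e) * fourier h (- z)) \<in> L2" if e: "e \<in> Basis" for e
 proof (rule L2_dominated[OF F[OF schwartz_partial_deriv[OF assms e]], of _ 1])
  show "AE z in lborel. norm (of_real (z \<bullet> e) * fourier h (- z)) \<le> 1 * norm (fourier (partial_deriv e h) (- z))"
   unfolding fourier_partial_deriv[OF assms e] by (simp add: norm_mult)
 qed (use L2_measurable[OF 0] in measurable)
 have "(\<lambda>z. \<Sum>e\<in>A. of_real (b \<bullet> e) * (of_real (z \<bullet> e) * fourier h (- z))) \<in> L2" if "A \<subseteq> Basis" for A
  using finite_subset[OF that finite_Basis] that
 proof (induction A rule: finite_induct)
  case empty then show ?case by (simp add: L2_def)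
 next
  case (insert e A) then show ?case by (simp add: L2_add L2_scale B)
 qed
 from this[of Basis] show "(\<lambda>z. of_real (z \<bullet> b) * fourier h (- z)) \<in> L2"
  by (simp add: euclidean_inner[of _ b] of_real_sum sum_distrib_left sum_distrib_right mult_ac)
 show "(\<lambda>z. of_real (norm z) * fourier h (- z)) \<in> L2"
 proof (rule L2_I)
  have eq: "(norm (of_real (norm z) * fourier h (- z)))^2 = (\<Sum>e\<in>Basis. (norm (of_real (z \<bullet> e) * fourier h (- z)))^2)" for z
   by (simp add: norm_mult power_mult_distrib sum_distrib_right[symmetric] power2_norm_eq_inner euclidean_inner[of z z])
    (simp add: power2_eq_square)
  show "integrable lborel (\<lambda>z. (norm (of_real (norm z) * fourier h (- z)))^2)"
   unfolding eq by (intro Bochner_Integration.integrable_sum L2_integrable B)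
 qed (use L2_measurable[OF 0] in measurable)
qed

lemma deriv_dist_parseval:
 fixes f h :: "'a::euclidean_space => complex"
 assumes f: "f \<in> L2" and h: "h \<in> schwartz" and b: "b \<in> Basis"
 shows "deriv_dist b (dist_of f) h = (LI z. (\<i> * of_real (z \<bullet> b) * plancherel f z) * fourier h (- z)) / of_real ((2 * pi) ^ DIM('a))"
proof -
 have p: "partial_deriv b h \<in> schwartz" by (rule schwartz_partial_deriv[OF h b])
 have "deriv_dist b (dist_of f) h = - ((LI z. plancherel f z * fourier (partial_deriv b h) (- z)) / of_real ((2 * pi) ^ DIM('a)))"
  unfolding deriv_dist_def dist_of_def by (subst plancherel_parseval[OF f schwartz_L2[OF p] schwartz_integrable[OF p]]) simp
 also have "... = (LI z. - (plancherel f z * fourier (partial_deriv b h) (- z))) / of_real ((2 * pi) ^ DIM('a))"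
  by simp
 finally show ?thesis unfolding fourier_partial_deriv[OF h b] by (simp add: mult_ac)
qed

lemma laplace_dist_parseval:
 fixes f h :: "'a::euclidean_space => complex"
 assumes f: "f \<in> L2" and rf: "(\<lambda>z. of_real (norm z) * plancherel f z) \<in> L2" and h: "h \<in> schwartz"
 shows "laplace_dist (dist_of f) h = - (LI z. of_real ((norm z)^2) * plancherel f z * fourier h (- z)) / of_real ((2 * pi) ^ DIM('a))"
proof -
 note [measurable] = L2_measurable[OF plancherel_L2[OF f]] L2_measurable[OF fourier_schwartz_L2(1)[OF h]]
 have 1: "deriv_dist b (deriv_dist b (dist_of f)) h
   = - (LI z. of_real ((z \<bullet> b)^2) * plancherel f z * fourier h (- z)) / of_real ((2 * pi) ^ DIM('a))" if b: "b \<in> Basis" for b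
 proof -
  have p: "partial_deriv b h \<in> schwartz" by (rule schwartz_partial_deriv[OF h b])
  have eq: "\<i> * of_real (z \<bullet> b) * plancherel f z * (\<i> * of_real (- z \<bullet> b) * fourier h (- z))
   = of_real ((z \<bullet> b)^2) * plancherel f z * fourier h (- z)" for z
   by (simp add: power2_eq_square algebra_simps)
  have "deriv_dist b (deriv_dist b (dist_of f)) h = - (deriv_dist b (dist_of f) (partial_deriv b h))"
   by (simp add: deriv_dist_def)
  then show ?thesis unfolding deriv_dist_parseval[OF f p b] fourier_partial_deriv[OF h b] eq by simp
 qed
 \<comment> \<open>Of the two factors \<open>z \<bullet> b\<close>, one is given to
   \<open>plancherel f\<close>, which has one derivative in \<open>L2\<close>, and one to the test
   function.\<close>
 have int: "integrable lborel (\<lambda>z. of_real ((z \<bullet> b)^2) * plancherel f z * fourier h (- z))" if b: "b \<in> Basis" for b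
 proof (rule Bochner_Integration.integrable_bound[OF L2_mult_integrable[OF rf fourier_schwartz_L2(2)[OF h, of b]]])
  show "AE z in lborel. norm (of_real ((z \<bullet> b)^2) * plancherel f z * fourier h (- z))
   \<le> norm (of_real (norm z) * plancherel f z * (of_real (z \<bullet> b) * fourier h (- z)))"
  proof (rule AE_I2)
   fix z :: 'a
   have "\<bar>z \<bullet> b\<bar> * (\<bar>z \<bullet> b\<bar> * (norm (plancherel f z) * norm (fourier h (- z)))) \<le> norm z * (\<bar>z \<bullet> b\<bar> * (norm (plancherel f z) * norm (fourier h (- z))))"
    by (rule mult_right_mono) (use Basis_le_norm[OF b, of z] in auto)
   then show "norm (of_real ((z \<bullet> b)^2) * plancherel f z * fourier h (- z))
   \<le> norm (of_real (norm z) * plancherel f z * (of_real (z \<bullet> b) * fourier h (- z)))"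
    by (simp add: norm_mult power2_eq_square mult_ac del: of_real_power)
  qed
 qed measurable
 have "laplace_dist (dist_of f) h = - (\<Sum>b\<in>Basis. (LI z. of_real ((z \<bullet> b)^2) * plancherel f z * fourier h (- z))) / of_real ((2 * pi) ^ DIM('a))"
  unfolding laplace_dist_def by (simp add: 1 sum_negf sum_divide_distrib)
 also have "(\<Sum>b\<in>Basis. (LI z. of_real ((z \<bullet> b)^2) * plancherel f z * fourier h (- z)))
  = (LI z. (\<Sum>b\<in>Basis. of_real ((z \<bullet> b)^2) * plancherel f z * fourier h (- z)))"
  by (rule Bochner_Integration.integral_sum[symmetric]) (rule int)
 also have "(\<lambda>z. (\<Sum>b\<in>Basis. of_real ((z \<bullet> b)^2) * plancherel f z * fourier h (- z))) = (\<lambda>z. of_real ((norm z)^2) * plancherel f z * fourier h (- z))"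
 proof
  fix z :: 'a
  have "(norm z)^2 = (\<Sum>b\<in>Basis. (z \<bullet> b)^2)"
   by (simp add: power2_norm_eq_inner euclidean_inner[of z z]) (simp add: power2_eq_square)
  then show "(\<Sum>b\<in>Basis. of_real ((z \<bullet> b)^2) * plancherel f z * fourier h (- z)) = of_real ((norm z)^2) * plancherel f z * fourier h (- z)"
   by (simp add: sum_distrib_right)
 qed
 finally show ?thesis .
qed

lemma is_weak_deriv_iff:
 fixes f g :: "'a::euclidean_space => complex"
 assumes f: "f \<in> L2" and g: "g \<in> L2" and b: "b \<in> Basis"
 shows "is_weak_deriv b f g \<longleftrightarrow> (AE z in lborel. plancherel g z = \<i> * of_real (z \<bullet> b) * plancherel f z)"
proof
 note [measurable] = L2_measurable[OF plancherel_L2[OF f]] L2_measurable[OF plancherel_L2[OF g]]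
 assume w: "is_weak_deriv b f g"
 have "AE z in lborel. \<i> * of_real (z \<bullet> b) * plancherel f z = plancherel g z"
 proof (rule plancherel_unique[OF g])
  fix d :: real and a :: 'a assume d: "d > 0"
  have "(\<lambda>x. of_real (x \<bullet> b) * gaussian d a 0 x) \<in> schwartz"
   by (rule gaussian_poly_schwartz[OF _ d, of _ a 0]) (intro gaussian_poly.intros)
  from L2_mult_integrable[OF plancherel_L2[OF f] L2_scale[OF schwartz_L2[OF this], of \<i>]]
  show "integrable lborel (\<lambda>x. \<i> * of_real (x \<bullet> b) * plancherel f x * gaussian d a 0 x)"
   by (simp add: mult_ac)
  obtain h where h: "h \<in> schwartz" "\<And>z. fourier h (- z) = gaussian d a 0 z"
   using gaussian_is_fourier[OF d, of a 0] by metis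
  have "(LI x. \<i> * of_real (x \<bullet> b) * plancherel f x * gaussian d a 0 x) / of_real ((2 * pi) ^ DIM('a)) = dist_of g h"
   using w h(1) deriv_dist_parseval[OF f h(1) b] unfolding h(2) is_weak_deriv_def by simp
  also have "... = (LI x. plancherel g x * gaussian d a 0 x) / of_real ((2 * pi) ^ DIM('a))"
   unfolding dist_of_def plancherel_parseval[OF g schwartz_L2[OF h(1)] schwartz_integrable[OF h(1)]] h(2) ..
  finally show "(LI x. \<i> * of_real (x \<bullet> b) * plancherel f x * gaussian d a 0 x) = (LI x. g x * fourier (gaussian d a 0) x)"
   using plancherel_pairing[OF g gaussian_L2[OF d] gaussian_integral(1)[OF d], of a 0] by simp
 qed measurable
 then show "AE z in lborel. plancherel g z = \<i> * of_real (z \<bullet> b) * plancherel f z" by eventually_elim simp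
next
 note [measurable] = L2_measurable[OF plancherel_L2[OF f]] L2_measurable[OF plancherel_L2[OF g]]
 assume eq: "AE z in lborel. plancherel g z = \<i> * of_real (z \<bullet> b) * plancherel f z"
 show "is_weak_deriv b f g"
  unfolding is_weak_deriv_def
 proof (intro conjI g ballI)
  fix h :: "'a => complex" assume h: "h \<in> schwartz"
  note [measurable] = L2_measurable[OF fourier_schwartz_L2(1)[OF h]]
  have "(LI z. (\<i> * of_real (z \<bullet> b) * plancherel f z) * fourier h (- z)) = (LI z. plancherel g z * fourier h (- z))"
   by (rule integral_cong_AE) (use eq in \<open>auto elim!: eventually_mono\<close>)
  then show "deriv_dist b (dist_of f) h = dist_of g h"
   unfolding deriv_dist_parseval[OF f h b] dist_of_def plancherel_parseval[OF g schwartz_L2[OF h] schwartz_integrable[OF h]] by simp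
 qed
qed

lemma norm_power2_sum_Basis: "(norm (x::'a::euclidean_space))^2 = (\<Sum>b\<in>Basis. (x \<bullet> b)^2)"
 by (simp add: power2_norm_eq_inner euclidean_inner[of x x]) (simp add: power2_eq_square)

lemma L2_norm_plancherel:
 fixes f :: "'a::euclidean_space => complex"
 assumes "f \<in> L2"
 shows "(L2_norm f)^2 = (L2_norm (plancherel f))^2 / (2 * pi) ^ DIM('a)"
 unfolding plancherel_norm[OF assms] by (simp add: power_mult_distrib)

lemma H1_iff:
 fixes f :: "'a::euclidean_space => complex"
 shows "f \<in> H1 \<longleftrightarrow> f \<in> L2 \<and> (\<lambda>z. of_real (norm z) * plancherel f z) \<in> L2"
proof (intro iffI conjI)
 assume H: "f \<in> H1"
 then show f: "f \<in> L2" by (simp add: H1_def)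
 note [measurable] = L2_measurable[OF plancherel_L2[OF f]]
 have B: "(\<lambda>z. of_real (z \<bullet> b) * plancherel f z) \<in> L2" if b: "b \<in> Basis" for b
 proof -
  obtain g where g: "g \<in> L2" "is_weak_deriv b f g" using H b by (auto simp: H1_def is_weak_deriv_def)
  show ?thesis
   by (rule L2_dominated[OF plancherel_L2[OF g(1)], of _ 1])
    (use is_weak_deriv_iff[OF f g(1) b] g(2) in \<open>auto elim!: eventually_mono simp: norm_mult\<close>)
 qed
 have eq: "(norm (of_real (norm z) * plancherel f z))^2 = (\<Sum>e\<in>Basis. (norm (of_real (z \<bullet> e) * plancherel f z))^2)" for z
  by (simp add: norm_mult power_mult_distrib sum_distrib_right[symmetric] norm_power2_sum_Basis[of z])
 show "(\<lambda>z. of_real (norm z) * plancherel f z) \<in> L2"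
  by (rule L2_I, measurable, unfold eq) (intro Bochner_Integration.integrable_sum L2_integrable B)
next
 assume "f \<in> L2 \<and> (\<lambda>z. of_real (norm z) * plancherel f z) \<in> L2"
 then have f: "f \<in> L2" and rf: "(\<lambda>z. of_real (norm z) * plancherel f z) \<in> L2" by auto
 note [measurable] = L2_measurable[OF plancherel_L2[OF f]]
 have "\<exists>g. is_weak_deriv b f g" if b: "b \<in> Basis" for b
 proof -
  have "(\<lambda>z. \<i> * of_real (z \<bullet> b) * plancherel f z) \<in> L2"
   by (rule L2_dominated[OF rf, of _ 1]) (use Basis_le_norm[OF b] in \<open>auto simp: norm_mult intro!: AE_I2 mult_right_mono\<close>)
  then show ?thesis using is_weak_deriv_iff[OF f inv_plancherel_L2 b] plancherel_inv_plancherel by blast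
 qed
 then show "f \<in> H1" using f by (simp add: H1_def)
qed

lemma H1_norm_plancherel:
 fixes f :: "'a::euclidean_space => complex"
 assumes "f \<in> H1"
 shows "(H1_norm f)^2 = ((L2_norm (plancherel f))^2 + (L2_norm (\<lambda>z. of_real (norm z) * plancherel f z))^2) / (2 * pi) ^ DIM('a)"
proof -
 have f: "f \<in> L2" and rf: "(\<lambda>z. of_real (norm z) * plancherel f z) \<in> L2" using assms H1_iff by auto
 note [measurable] = L2_measurable[OF plancherel_L2[OF f]]
 have B: "(\<lambda>z. of_real (z \<bullet> b) * plancherel f z) \<in> L2" if b: "b \<in> Basis" for b
  by (rule L2_dominated[OF rf, of _ 1]) (use Basis_le_norm[OF b] in \<open>auto simp: norm_mult intro!: AE_I2 mult_right_mono\<close>)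
 have w: "(L2_norm (weak_deriv b f))^2 = (L2_norm (\<lambda>z. of_real (z \<bullet> b) * plancherel f z))^2 / (2 * pi) ^ DIM('a)" if b: "b \<in> Basis" for b
 proof -
  have *: "is_weak_deriv b f (weak_deriv b f)"
   using assms b someI_ex[of "is_weak_deriv b f"] unfolding weak_deriv_def H1_def by auto
  then have g: "weak_deriv b f \<in> L2" by (simp add: is_weak_deriv_def)
  note [measurable] = L2_measurable[OF plancherel_L2[OF g]]
  have "L2_norm (plancherel (weak_deriv b f)) = L2_norm (\<lambda>z. \<i> * (of_real (z \<bullet> b) * plancherel f z))"
   by (rule L2_norm_cong_AE) (use is_weak_deriv_iff[OF f g b] * in \<open>auto elim!: eventually_mono\<close>)
  then show ?thesis unfolding L2_norm_plancherel[OF g] L2_norm_scale by simp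
 qed
 have "(\<Sum>b\<in>Basis. (L2_norm (\<lambda>z. of_real (z \<bullet> b) * plancherel f z))^2) = (LI z. (\<Sum>b\<in>Basis. (norm (of_real (z \<bullet> b) * plancherel f z))^2))"
  unfolding L2_norm_power2 by (rule Bochner_Integration.integral_sum[symmetric]) (rule L2_integrable[OF B])
 also have "... = (L2_norm (\<lambda>z. of_real (norm z) * plancherel f z))^2"
  unfolding L2_norm_power2
  by (intro Bochner_Integration.integral_cong refl) (simp add: norm_mult power_mult_distrib sum_distrib_right[symmetric] norm_power2_sum_Basis)
 finally show ?thesis
  unfolding H1_norm_def by (simp add: w sum_nonneg sum_divide_distrib[symmetric] L2_norm_plancherel[OF f] add_divide_distrib)
qed

text \<open>The infimum over an empty set is infinite, so finiteness provides a \<open>g\<close>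
  with \<open>abs_D g\<close> equal to \<open>f\<close>. Testing on Gaussians gives
  \<open>norm z * plancherel g = plancherel f\<close> almost everywhere, and dividing returns a
  function dominated by \<open>plancherel g\<close>.\<close>

lemma plancherel_div_norm_L2:
 fixes f :: "'a::euclidean_space => complex"
 assumes f: "f \<in> L2" and fin: "Hdot_minus1_norm (dist_of f) < \<infinity>"
 shows "(\<lambda>z. plancherel f z / of_real (norm z)) \<in> L2"
proof -
 obtain g where g: "g \<in> L2" "\<And>h. h \<in> schwartz ==> dist_of f h = abs_D g h"
 proof (rule ccontr)
  assume "\<not> thesis"
  then have "{g\<in>L2. \<forall>h\<in>schwartz. dist_of f h = abs_D g h} = {}" using that by blast
  then show False using fin unfolding Hdot_minus1_norm_def by (simp only: image_empty Inf_empty) (simp add: top_ennreal.rep_eq)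
 qed
 note [measurable] = L2_measurable[OF plancherel_L2[OF f]] L2_measurable[OF plancherel_L2[OF g(1)]]
  fourier_fun_plancherel(1)[OF g(1)]
 have "AE z in lborel. of_real (norm z) * plancherel g z = plancherel f z"
 proof (rule plancherel_unique[OF f])
  fix d :: real and a :: 'a assume d: "d > 0"
  let ?G = "gaussian d a 0"
  obtain h where h: "h \<in> schwartz" "\<And>z. fourier h (- z) = ?G z" "h = (\<lambda>x. fourier ?G x / of_real ((2 * pi) ^ DIM('a)))"
   using gaussian_is_fourier[OF d, of a 0] by metis
  show "integrable lborel (\<lambda>x. of_real (norm x) * plancherel g x * ?G x)"
   using L2_mult_integrable[OF plancherel_L2[OF g(1)] fourier_schwartz_L2(3)[OF h(1)]] by (simp add: h(2) mult_ac)
  have "(LI x. f x * fourier ?G x) / of_real ((2 * pi) ^ DIM('a)) = dist_of f h"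
   unfolding dist_of_def h(3) by simp
  also have "... = (LI z. of_real (norm z) * fourier_fun (dist_of g) z * (?G z / of_real ((2 * pi) ^ DIM('a))))"
   unfolding g(2)[OF h(1)] abs_D_def dist_of_def[of "\<lambda>z. of_real (norm z) * fourier_fun (dist_of g) z"] h(2)[symmetric]
   by (simp add: inv_fourier_def fourier_def inner_commute)
  also have "... = (LI z. of_real (norm z) * plancherel g z * (?G z / of_real ((2 * pi) ^ DIM('a))))"
   by (rule integral_cong_AE) (use fourier_fun_plancherel(2)[OF g(1)] in \<open>auto elim!: eventually_mono\<close>)
  finally show "(LI x. of_real (norm x) * plancherel g x * ?G x) = (LI x. f x * fourier ?G x)"
   by simp
 qed measurable
 then have "AE z in lborel. norm (plancherel f z / of_real (norm z)) \<le> 1 * norm (plancherel g z)"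
 proof eventually_elim
  case (elim z)
  show ?case unfolding elim[symmetric] by (simp add: norm_divide norm_mult)
 qed
 then show ?thesis
  by (intro L2_dominated[OF plancherel_L2[OF g(1)], of _ 1]) measurable
qed

section \<open>The Cauchy problem on the Fourier side\<close>

text \<open>\<open>kirchhoff_solution\<close> in frequency, with the time derivative
  \<open>V\<close> as a parameter. The factor \<open>(2 * pi) ^ DIM('a)\<close> in the coefficient
  comes from Plancherel, and continuity in \<open>H1\<close> is split into continuity of
  \<open>U\<close> and of \<open>norm z * U\<close>.\<close>

definition fourier_solution ::
 "('a::euclidean_space => complex) => ('a => complex) => (real => 'a => complex) => (real => 'a => complex) => bool" where
 "fourier_solution F0 F1 U V \<longleftrightarrow>
  (\<forall>t. U t \<in> L2 \<and> V t \<in> L2 \<and> (\<lambda>z. of_real (norm z) * U t z) \<in> L2) \<and>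
  (\<forall>t. ((\<lambda>s. L2_norm (\<lambda>z. U s z - U t z)) \<longlongrightarrow> 0) (at t)) \<and>
  (\<forall>t. ((\<lambda>s. L2_norm (\<lambda>z. of_real (norm z) * (U s z - U t z))) \<longlongrightarrow> 0) (at t)) \<and>
  (\<forall>t. ((\<lambda>s. L2_norm (\<lambda>z. V s z - V t z)) \<longlongrightarrow> 0) (at t)) \<and>
  (\<forall>t. ((\<lambda>h. L2_norm (\<lambda>z. (U (t + h) z - U t z) / of_real h - V t z)) \<longlongrightarrow> 0) (at 0)) \<and>
  (\<forall>t. t \<noteq> 0 \<longrightarrow> (\<forall>g\<in>schwartz.
    ((\<lambda>s. \<integral>z. V s z * fourier g (- z) \<partial>lborel) has_vector_derivative
    - of_real (1 + (L2_norm (U t))^2 / (2 * pi) ^ DIM('a)) * (LI z. of_real ((norm z)^2) * U t z * fourier g (- z))) (at t))) \<and>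
  (AE z in lborel. U 0 z = F0 z) \<and> (AE z in lborel. V 0 z = F1 z)"

lemma has_vector_derivative_rescale:
 fixes c :: complex
 assumes "(f has_vector_derivative D) (at t)" "D * c = E" "\<And>s. f s * c = g s"
 shows "(g has_vector_derivative E) (at t)"
 using has_vector_derivative_mult_left[OF assms(1), of c] assms(2,3) by simp

lemma tendsto_power2_iff:
 fixes f :: "'b => real"
 assumes "\<And>x. f x \<ge> 0"
 shows "((\<lambda>x. (f x)^2) \<longlongrightarrow> 0) F \<longleftrightarrow> (f \<longlongrightarrow> 0) F"
proof
 assume "((\<lambda>x. (f x)^2) \<longlongrightarrow> 0) F"
 from tendsto_real_sqrt[OF this] show "(f \<longlongrightarrow> 0) F" using assms by simp
next
 assume "(f \<longlongrightarrow> 0) F"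
 from tendsto_power[OF this, of 2] show "((\<lambda>x. (f x)^2) \<longlongrightarrow> 0) F" by simp
qed

lemma H1_norm_nonneg [simp]: "H1_norm f \<ge> 0"
 by (simp add: H1_norm_def sum_nonneg)

text \<open>Plancherel changes the norms only by a constant factor, and all topological clauses of
  the definition of a solution say that some norm tends to zero. Squares are taken because the
  identities hold for squared norms.\<close>

lemma plancherel_norms_tendsto:
 fixes g :: "'b => 'a::euclidean_space => complex"
 assumes g: "\<And>s. g s \<in> L2" and G: "\<And>s. G s \<in> Borel" "\<And>s. AE z in lborel. plancherel (g s) z = G s z"
 shows "((\<lambda>s. L2_norm (g s)) \<longlongrightarrow> 0) F \<longleftrightarrow> ((\<lambda>s. L2_norm (G s)) \<longlongrightarrow> 0) F"
  and "(\<And>s. g s \<in> H1) ==> ((\<lambda>s. H1_norm (g s)) \<longlongrightarrow> 0) F \<longleftrightarrow>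
   ((\<lambda>s. L2_norm (G s)) \<longlongrightarrow> 0) F \<and> ((\<lambda>s. L2_norm (\<lambda>z. of_real (norm z) * G s z)) \<longlongrightarrow> 0) F"
proof -
 let ?K = "(2 * pi) ^ DIM('a)"
 have K: "?K > 0" by simp
 have eq1: "L2_norm (plancherel (g s)) = L2_norm (G s)" for s
  by (rule L2_norm_cong_AE) (use L2_measurable[OF plancherel_L2[OF g]] G in auto)
 have eq2: "L2_norm (\<lambda>z. of_real (norm z) * plancherel (g s) z) = L2_norm (\<lambda>z. of_real (norm z) * G s z)" for s
 proof -
  note [measurable] = L2_measurable[OF plancherel_L2[OF g]] G(1)
  show ?thesis by (rule L2_norm_cong_AE) (use G(2)[of s] in \<open>auto elim!: eventually_mono\<close>)
 qed
 have "((\<lambda>s. L2_norm (g s)) \<longlongrightarrow> 0) F \<longleftrightarrow> ((\<lambda>s. (L2_norm (g s))^2) \<longlongrightarrow> 0) F"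
  by (simp add: tendsto_power2_iff)
 also have "... \<longleftrightarrow> ((\<lambda>s. (L2_norm (G s))^2 / ?K) \<longlongrightarrow> 0) F"
  by (simp only: L2_norm_plancherel[OF g] eq1)
 also have "... \<longleftrightarrow> ((\<lambda>s. (L2_norm (G s))^2) \<longlongrightarrow> 0) F"
  using tendsto_mult_right[of "\<lambda>s. (L2_norm (G s))^2 / ?K" 0 F ?K] tendsto_divide[of "\<lambda>s. (L2_norm (G s))^2" 0 F "\<lambda>_. ?K" ?K] K by auto
 finally show 1: "((\<lambda>s. L2_norm (g s)) \<longlongrightarrow> 0) F \<longleftrightarrow> ((\<lambda>s. L2_norm (G s)) \<longlongrightarrow> 0) F"
  by (simp add: tendsto_power2_iff)
 assume H: "\<And>s. g s \<in> H1"
 let ?A = "\<lambda>s. (L2_norm (G s))^2" and ?B = "\<lambda>s. (L2_norm (\<lambda>z. of_real (norm z) * G s z))^2"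
 have "((\<lambda>s. H1_norm (g s)) \<longlongrightarrow> 0) F \<longleftrightarrow> ((\<lambda>s. (H1_norm (g s))^2) \<longlongrightarrow> 0) F"
  by (simp add: tendsto_power2_iff)
 also have "... \<longleftrightarrow> ((\<lambda>s. (?A s + ?B s) / ?K) \<longlongrightarrow> 0) F"
  by (simp only: H1_norm_plancherel[OF H] eq1 eq2)
 also have "... \<longleftrightarrow> ((\<lambda>s. ?A s + ?B s) \<longlongrightarrow> 0) F"
  using tendsto_mult_right[of "\<lambda>s. (?A s + ?B s) / ?K" 0 F ?K] tendsto_divide[of "\<lambda>s. ?A s + ?B s" 0 F "\<lambda>_. ?K" ?K] K by auto
 also have "... \<longleftrightarrow> (?A \<longlongrightarrow> 0) F \<and> (?B \<longlongrightarrow> 0) F"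
 proof (intro iffI conjI)
  assume *: "((\<lambda>s. ?A s + ?B s) \<longlongrightarrow> 0) F"
  show "(?A \<longlongrightarrow> 0) F" "(?B \<longlongrightarrow> 0) F" by (rule Lim_null_comparison[OF _ *]; simp)+
 qed (use tendsto_add[of ?A 0 F ?B 0] in auto)
 finally show "((\<lambda>s. H1_norm (g s)) \<longlongrightarrow> 0) F \<longleftrightarrow>
   ((\<lambda>s. L2_norm (G s)) \<longlongrightarrow> 0) F \<and> ((\<lambda>s. L2_norm (\<lambda>z. of_real (norm z) * G s z)) \<longlongrightarrow> 0) F"
  by (simp add: tendsto_power2_iff)
qed

lemma H1_diff: "f \<in> H1 ==> g \<in> H1 ==> (\<lambda>x. f x - g x) \<in> H1" for f g :: "'a::euclidean_space => complex"
proof -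
 assume "f \<in> H1" "g \<in> H1"
 then have f: "f \<in> L2" "(\<lambda>z. of_real (norm z) * plancherel f z) \<in> L2" and g: "g \<in> L2" "(\<lambda>z. of_real (norm z) * plancherel g z) \<in> L2"
  by (auto simp: H1_iff)
 note [measurable] = L2_measurable[OF plancherel_L2[OF L2_diff[OF f(1) g(1)]]]
 have "(\<lambda>z. of_real (norm z) * plancherel (\<lambda>x. f x - g x) z) \<in> L2"
  by (rule L2_cong_AE[OF L2_diff[OF f(2) g(2)]])
   (use plancherel_diff[OF f(1) g(1)] in \<open>auto elim!: eventually_mono simp: right_diff_distrib\<close>)
 then show "(\<lambda>x. f x - g x) \<in> H1" by (simp add: H1_iff L2_diff f g)
qed

lemma plancherel_difference_quotient:
 fixes u0 u1 v :: "'a::euclidean_space => complex"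
 assumes "u0 \<in> L2" "u1 \<in> L2" "v \<in> L2"
  and U: "AE z in lborel. plancherel u0 z = U0 z" "AE z in lborel. plancherel u1 z = U1 z" "AE z in lborel. plancherel v z = V z"
 shows "(\<lambda>x. (u1 x - u0 x) / c - v x) \<in> L2"
  "AE z in lborel. plancherel (\<lambda>x. (u1 x - u0 x) / c - v x) z = (U1 z - U0 z) / c - V z"
proof -
 have d: "(\<lambda>x. u1 x - u0 x) \<in> L2" "(\<lambda>x. (1 / c) * (u1 x - u0 x)) \<in> L2" by (intro L2_scale L2_diff assms)+
 have "AE z in lborel. plancherel (\<lambda>x. (1 / c) * (u1 x - u0 x) - v x) z = (1 / c) * (U1 z - U0 z) - V z"
  using plancherel_diff[OF d(2) assms(3)] plancherel_scale[OF d(1), of "1 / c"] plancherel_diff[OF assms(2,1)] U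
  by eventually_elim simp
 then show "AE z in lborel. plancherel (\<lambda>x. (u1 x - u0 x) / c - v x) z = (U1 z - U0 z) / c - V z" by simp
 show "(\<lambda>x. (u1 x - u0 x) / c - v x) \<in> L2" using L2_diff[OF d(2) assms(3)] by simp
qed

lemma kirchhoff_solution_of_fourier_solution:
 fixes f0 f1 :: "'a::euclidean_space => complex"
 assumes f: "f0 \<in> L2" "f1 \<in> L2" and sol: "fourier_solution (plancherel f0) (plancherel f1) U V"
 shows "kirchhoff_solution f0 f1 (\<lambda>t. inv_plancherel (U t))"
proof -
 note S = sol[unfolded fourier_solution_def]
 have U: "U t \<in> L2" and V: "V t \<in> L2" and rU: "(\<lambda>z. of_real (norm z) * U t z) \<in> L2" for t using S by blast+
 note [measurable] = L2_measurable[OF U] L2_measurable[OF V]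
 define u where "u t = inv_plancherel (U t)" for t
 define v where "v t = inv_plancherel (V t)" for t
 have u: "u t \<in> L2" and v: "v t \<in> L2" for t unfolding u_def v_def by (intro inv_plancherel_L2 U V)+
 have Pu: "AE z in lborel. plancherel (u t) z = U t z" and Pv: "AE z in lborel. plancherel (v t) z = V t z" for t
  unfolding u_def v_def by (intro plancherel_inv_plancherel U V)+
 note [measurable] = L2_measurable[OF plancherel_L2[OF u]] L2_measurable[OF plancherel_L2[OF v]]
 have ru: "(\<lambda>z. of_real (norm z) * plancherel (u t) z) \<in> L2" for t
  by (rule L2_cong_AE[OF rU[of t]]) (use Pu[of t] in \<open>auto elim!: eventually_mono\<close>)
 then have uH: "u t \<in> H1" for t by (simp add: H1_iff u)
 have Pd: "AE z in lborel. plancherel (\<lambda>x. u s x - u t x) z = U s z - U t z" for s t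
  using plancherel_diff[OF u[of s] u[of t]] Pu[of s] Pu[of t] by eventually_elim simp
 have Pdv: "AE z in lborel. plancherel (\<lambda>x. v s x - v t x) z = V s z - V t z" for s t
  using plancherel_diff[OF v[of s] v[of t]] Pv[of s] Pv[of t] by eventually_elim simp
 have "continuous_H1 u"
  unfolding continuous_H1_def
 proof (intro conjI allI uH)
  fix t
  show "((\<lambda>s. H1_norm (\<lambda>x. u s x - u t x)) \<longlongrightarrow> 0) (at t)"
   by (subst plancherel_norms_tendsto(2)[OF L2_diff[OF u u] _ Pd H1_diff[OF uH uH]]) (use S in auto)
 qed
 moreover have "time_deriv_L2 u v"
  unfolding time_deriv_L2_def
 proof (intro conjI allI u v)
  fix t
  show "((\<lambda>h. L2_norm (\<lambda>x. (u (t + h) x - u t x) / of_real h - v t x)) \<longlongrightarrow> 0) (at 0)"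
   by (subst plancherel_norms_tendsto(1)[OF plancherel_difference_quotient(1)[OF u u v Pu Pu Pv] _ plancherel_difference_quotient(2)[OF u u v Pu Pu Pv]])
    (use S in auto)
 qed
 moreover have "continuous_L2 v"
  unfolding continuous_L2_def
 proof (intro conjI allI v)
  fix t
  show "((\<lambda>s. L2_norm (\<lambda>x. v s x - v t x)) \<longlongrightarrow> 0) (at t)"
   by (subst plancherel_norms_tendsto(1)[OF L2_diff[OF v v] _ Pdv]) (use S in auto)
 qed
 moreover have "has_distr_derivative (\<lambda>s. dist_of (v s))
      (\<lambda>k. of_real (1 + (LI x. (norm (u t x))^2)) * laplace_dist (dist_of (u t)) k) t" if t: "t \<noteq> 0" for t
  unfolding has_distr_derivative_def
 proof
  fix k :: "'a => complex" assume k: "k \<in> schwartz"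
  let ?c = "complex_of_real ((2 * pi) ^ DIM('a))"
  note [measurable] = L2_measurable[OF fourier_schwartz_L2(1)[OF k]]
  have 1: "dist_of (v s) k = (LI z. V s z * fourier k (- z)) / ?c" for s
   unfolding dist_of_def v_def by (rule inv_plancherel_pairing[OF V schwartz_L2[OF k] schwartz_integrable[OF k]])
  have "(LI z. of_real ((norm z)^2) * plancherel (u t) z * fourier k (- z)) = (LI z. of_real ((norm z)^2) * U t z * fourier k (- z))"
   by (rule integral_cong_AE) (use Pu[of t] in \<open>auto elim!: eventually_mono\<close>)
  then have 2: "laplace_dist (dist_of (u t)) k = - (LI z. of_real ((norm z)^2) * U t z * fourier k (- z)) / ?c"
   unfolding laplace_dist_parseval[OF u ru k] by simp
  have 3: "(LI x. (norm (u t x))^2) = (L2_norm (U t))^2 / (2 * pi) ^ DIM('a)"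
   unfolding L2_norm_power2[symmetric] u_def by (rule inv_plancherel_norm[OF U])
  have "((\<lambda>s. \<integral>z. V s z * fourier k (- z) \<partial>lborel) has_vector_derivative
    - of_real (1 + (L2_norm (U t))^2 / (2 * pi) ^ DIM('a)) * (LI z. of_real ((norm z)^2) * U t z * fourier k (- z))) (at t)"
   using S t k by blast
  then show "((\<lambda>s. dist_of (v s) k) has_vector_derivative of_real (1 + (LI x. (norm (u t x))^2)) * laplace_dist (dist_of (u t)) k) (at t)"
   unfolding 1 2 3 by (rule has_vector_derivative_rescale[where c = "1 / ?c"])
    (simp_all only: mult_minus_left mult_minus_right times_divide_eq_right mult_1_right)
 qed
 moreover have "AE x in lborel. u 0 x = f0 x" "AE x in lborel. v 0 x = f1 x"
 proof -
  have *: "AE x in lborel. inv_plancherel W x = g x" if g: "g \<in> L2" and W: "W \<in> L2" "AE z in lborel. W z = plancherel g z" for g W :: "'a => complex"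
   using AE_lborel_minus[OF plancherel_cong_AE[OF W(1) plancherel_L2[OF g] W(2)]] AE_lborel_minus[OF plancherel_plancherel[OF g]]
   by eventually_elim (simp add: inv_plancherel_def)
  show "AE x in lborel. u 0 x = f0 x" "AE x in lborel. v 0 x = f1 x"
   unfolding u_def v_def by (rule *[OF f(1) U], use S in blast) (rule *[OF f(2) V], use S in blast)
 qed
 ultimately show ?thesis unfolding kirchhoff_solution_def u_def[symmetric] by blast
qed

lemma fourier_solution_of_kirchhoff_solution:
 fixes f0 f1 :: "'a::euclidean_space => complex"
 assumes f: "f0 \<in> L2" "f1 \<in> L2" and sol: "kirchhoff_solution f0 f1 u"
 obtains V where "fourier_solution (plancherel f0) (plancherel f1) (\<lambda>t. plancherel (u t)) V"
proof -
 from sol obtain v where H: "continuous_H1 u" and T: "time_deriv_L2 u v" and C: "continuous_L2 v"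
  and E: "\<And>t. t \<noteq> 0 ==> has_distr_derivative (\<lambda>s. dist_of (v s))
      (\<lambda>g. of_real (1 + (LI x. (norm (u t x))^2)) * laplace_dist (dist_of (u t)) g) t"
  and I: "AE x in lborel. u 0 x = f0 x" "AE x in lborel. v 0 x = f1 x"
  unfolding kirchhoff_solution_def by blast
 have uH: "u t \<in> H1" for t using H by (simp add: continuous_H1_def)
 then have u: "u t \<in> L2" and ru: "(\<lambda>z. of_real (norm z) * plancherel (u t) z) \<in> L2" for t by (auto simp: H1_iff)
 have v: "v t \<in> L2" for t using C by (simp add: continuous_L2_def)
 note [measurable] = L2_measurable[OF plancherel_L2[OF u]] L2_measurable[OF plancherel_L2[OF v]]
 have 1: "((\<lambda>s. L2_norm (\<lambda>z. plancherel (u s) z - plancherel (u t) z)) \<longlongrightarrow> 0) (at t)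
  \<and> ((\<lambda>s. L2_norm (\<lambda>z. of_real (norm z) * (plancherel (u s) z - plancherel (u t) z))) \<longlongrightarrow> 0) (at t)" for t
  by (subst plancherel_norms_tendsto(2)[OF L2_diff[OF u u] _ plancherel_diff[OF u u] H1_diff[OF uH uH], symmetric])
   (use H in \<open>auto simp: continuous_H1_def\<close>)
 have 2: "((\<lambda>s. L2_norm (\<lambda>z. plancherel (v s) z - plancherel (v t) z)) \<longlongrightarrow> 0) (at t)" for t
  by (subst plancherel_norms_tendsto(1)[OF L2_diff[OF v v] _ plancherel_diff[OF v v], symmetric])
   (use C in \<open>auto simp: continuous_L2_def\<close>)
 have 3: "((\<lambda>h. L2_norm (\<lambda>z. (plancherel (u (t + h)) z - plancherel (u t) z) / of_real h - plancherel (v t) z)) \<longlongrightarrow> 0) (at 0)" for t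
  by (subst plancherel_norms_tendsto(1)[OF plancherel_difference_quotient(1)[OF u u v AE_I2 AE_I2 AE_I2] _
     plancherel_difference_quotient(2)[OF u u v AE_I2 AE_I2 AE_I2], symmetric])
   (use T in \<open>auto simp: time_deriv_L2_def\<close>)
 have 4: "((\<lambda>s. \<integral>z. plancherel (v s) z * fourier g (- z) \<partial>lborel) has_vector_derivative
    - of_real (1 + (L2_norm (plancherel (u t)))^2 / (2 * pi) ^ DIM('a)) * (LI z. of_real ((norm z)^2) * plancherel (u t) z * fourier g (- z))) (at t)"
  if t: "t \<noteq> 0" and g: "g \<in> schwartz" for t g
 proof -
  let ?c = "complex_of_real ((2 * pi) ^ DIM('a))"
  have c: "?c \<noteq> 0" by simp
  have d: "dist_of (v s) g = (LI z. plancherel (v s) z * fourier g (- z)) / ?c" for s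
   unfolding dist_of_def by (rule plancherel_parseval[OF v schwartz_L2[OF g] schwartz_integrable[OF g]])
  have "((\<lambda>s. dist_of (v s) g) has_vector_derivative of_real (1 + (LI x. (norm (u t x))^2)) * laplace_dist (dist_of (u t)) g) (at t)"
   using E[OF t] g by (simp add: has_distr_derivative_def)
  then show ?thesis
   unfolding d laplace_dist_parseval[OF u ru g] L2_norm_power2[symmetric] L2_norm_plancherel[OF u]
   by (rule has_vector_derivative_rescale[where c = ?c])
    (simp_all only: mult_minus_left mult_minus_right times_divide_eq_right times_divide_eq_left nonzero_mult_div_cancel_right[OF c] minus_divide_left[symmetric])
 qed
 have "fourier_solution (plancherel f0) (plancherel f1) (\<lambda>t. plancherel (u t)) (\<lambda>t. plancherel (v t))"
  unfolding fourier_solution_def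
  using 1 2 3 4 plancherel_L2[OF u] plancherel_L2[OF v] ru plancherel_cong_AE[OF u f(1) I(1)] plancherel_cong_AE[OF v f(2) I(2)]
  by blast
 then show ?thesis by (rule that)
qed


section \<open>Hausdorff measure and polar coordinates\<close>

text \<open>The empty set is set apart for the sake of \<open>s = 0\<close>, where
  \<open>(diameter U / 2) ^ s\<close> would give it the weight of a point.\<close>

definition hausdorff_weight :: "nat => 'a::euclidean_space set => ennreal" where
 "hausdorff_weight s U = (if U = {} then 0 else ennreal (unit_ball_vol (real s) * (diameter U / 2) ^ s))"

lemma hausdorff_premeasure_le:
 assumes "A \<subseteq> (\<Union>i. U i)" "\<And>i. bounded (U i)" "\<And>i. diameter (U i) \<le> \<delta>"
 shows "hausdorff_premeasure s \<delta> A \<le> (\<Sum>i. hausdorff_weight s (U i))"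
 unfolding hausdorff_premeasure_def hausdorff_weight_def[abs_def]
 by (rule INF_lower) (use assms in auto)

lemma hausdorff_premeasure_greatest:
 assumes "\<And>U :: nat => 'a::euclidean_space set. A \<subseteq> (\<Union>i. U i) ==> (\<And>i. bounded (U i)) ==> (\<And>i. diameter (U i) \<le> \<delta>) ==>
  x \<le> (\<Sum>i. hausdorff_weight s (U i))"
 shows "x \<le> hausdorff_premeasure s \<delta> A"
 unfolding hausdorff_premeasure_def hausdorff_weight_def[abs_def, symmetric]
 by (rule INF_greatest) (use assms in \<open>auto simp: hausdorff_weight_def\<close>)

lemma hausdorff_premeasure_close:
 assumes "hausdorff_premeasure s \<delta> A < x"
 obtains U :: "nat => 'a::euclidean_space set" where "A \<subseteq> (\<Union>i. U i)" "\<And>i. bounded (U i)" "\<And>i. diameter (U i) \<le> \<delta>"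
  "(\<Sum>i. hausdorff_weight s (U i)) < x"
 using assms unfolding hausdorff_premeasure_def INF_less_iff hausdorff_weight_def[abs_def] by blast

lemma hausdorff_premeasure_subadditive:
 fixes A :: "nat => 'a::euclidean_space set"
 shows "hausdorff_premeasure s \<delta> (\<Union>n. A n) \<le> (\<Sum>n. hausdorff_premeasure s \<delta> (A n))"
proof (rule ennreal_le_epsilon)
 let ?O = "hausdorff_premeasure s \<delta>"
 fix e :: real assume e: "0 < e" "(\<Sum>n. ?O (A n)) < top"
 then have *: "\<And>n. ?O (A n) < ?O (A n) + e * (1/2)^Suc n"
  by (auto simp add: less_top dest!: ennreal_suminf_lessD)
 have "\<exists>B. A n \<subseteq> (\<Union>i. B i) \<and> (\<forall>i. bounded (B i)) \<and> (\<forall>i. diameter (B i) \<le> \<delta>) \<and> (\<Sum>i. hausdorff_weight s (B i)) \<le> ?O (A n) + e * (1/2)^(Suc n)" for n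
  by (rule hausdorff_premeasure_close[OF *[of n]]) (auto intro: less_imp_le)
 then obtain B where B: "\<And>n. A n \<subseteq> (\<Union>i. B n i)" "\<And>n i. bounded (B n i)" "\<And>n i. diameter (B n i) \<le> \<delta>"
  and Ble: "\<And>n. (\<Sum>i. hausdorff_weight s (B n i)) \<le> ?O (A n) + e * (1/2)^(Suc n)" by metis
 define C where "C = case_prod B o prod_decode"
 have "(\<Union>i. A i) \<subseteq> (\<Union>i. C i)"
  using B(1) by (auto simp add: C_def subset_eq) (metis prod.case prod_encode_inverse)
 then have "?O (\<Union>i. A i) \<le> (\<Sum>i. hausdorff_weight s (C i))"
  by (rule hausdorff_premeasure_le) (auto simp: C_def split_beta B)
 also have "... = (\<Sum>n. \<Sum>i. hausdorff_weight s (B n i))"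
  unfolding C_def comp_def by (rule suminf_ennreal_2dimen[where f = "\<lambda>p. hausdorff_weight s (case_prod B p)"]) simp
 also have "... \<le> (\<Sum>n. ?O (A n) + e * (1/2) ^ Suc n)"
  by (intro suminf_le allI Ble) auto
 also have "... = (\<Sum>n. ?O (A n)) + (\<Sum>n. ennreal e * ennreal ((1/2) ^ Suc n))"
  using e by (subst suminf_add[symmetric]) (auto simp del: ennreal_suminf_cmult simp add: ennreal_mult[symmetric])
 also have "... = (\<Sum>n. ?O (A n)) + e"
  unfolding ennreal_suminf_cmult
  by (subst suminf_ennreal_eq[OF zero_le_power power_half_series]) auto
 finally show "?O (\<Union>i. A i) \<le> (\<Sum>n. ?O (A n)) + e" .
qed

lemma hausdorff_premeasure_le_outer: "\<delta> > 0 ==> hausdorff_premeasure s \<delta> A \<le> hausdorff_outer s A"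
 unfolding hausdorff_outer_def by (rule SUP_upper) simp

lemma hausdorff_premeasure_mono: "A \<subseteq> B ==> hausdorff_premeasure s \<delta> A \<le> hausdorff_premeasure s \<delta> B"
 by (rule hausdorff_premeasure_greatest, rule hausdorff_premeasure_le) auto

lemma hausdorff_premeasure_antimono: "\<delta> \<le> \<epsilon> ==> hausdorff_premeasure s \<epsilon> A \<le> hausdorff_premeasure s \<delta> A"
 by (rule hausdorff_premeasure_greatest, rule hausdorff_premeasure_le) (auto intro: order_trans)

lemma hausdorff_outer_mono: "A \<subseteq> B ==> hausdorff_outer s A \<le> hausdorff_outer s B"
 unfolding hausdorff_outer_def by (intro SUP_mono) (auto intro!: bexI hausdorff_premeasure_mono)

lemma hausdorff_outer_empty: "hausdorff_outer s {} = 0"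
proof -
 have "hausdorff_premeasure s \<delta> {} \<le> 0" if "\<delta> > 0" for \<delta>
  using hausdorff_premeasure_le[of "{}" "\<lambda>_. {}" \<delta> s] that by (simp add: hausdorff_weight_def)
 then have "hausdorff_outer s {} \<le> 0"
  unfolding hausdorff_outer_def by (intro SUP_least) simp
 then show ?thesis by simp
qed

lemma hausdorff_outer_subadditive:
 "hausdorff_outer s (\<Union>n. A n) \<le> (\<Sum>n. hausdorff_outer s (A n))" for A :: "nat => 'a::euclidean_space set"
proof -
 have "hausdorff_premeasure s \<delta> (\<Union>n. A n) \<le> (\<Sum>n. hausdorff_outer s (A n))" if "\<delta> > 0" for \<delta>
  by (rule order_trans[OF hausdorff_premeasure_subadditive]) (intro suminf_le hausdorff_premeasure_le_outer that; simp)
 then show ?thesis unfolding hausdorff_outer_def[of s "\<Union>n. A n"] by (auto intro!: SUP_least)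
qed

lemma hausdorff_outer_Un: "hausdorff_outer s (A \<union> B) \<le> hausdorff_outer s A + hausdorff_outer s B"
 for A :: "'a::euclidean_space set"
proof -
 have "hausdorff_outer s (\<Union>n. binaryset A B n) \<le> (\<Sum>n. hausdorff_outer s (binaryset A B n))"
  by (rule hausdorff_outer_subadditive)
 also have "... = hausdorff_outer s A + hausdorff_outer s B"
  by (rule suminf_binaryset_eq) (rule hausdorff_outer_empty)
 finally show ?thesis by (simp add: UN_binaryset_eq)
qed

text \<open>A set of diameter less than \<open>d\<close> cannot meet both \<open>A\<close> and
  \<open>B\<close>, so a fine cover of the union splits into disjoint families covering
  \<open>A\<close> and \<open>B\<close>. The supremum over scales is then taken separately for the
  two terms, which is possible because premeasures grow as the scale shrinks.\<close>

lemma hausdorff_outer_separated: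
 fixes A B :: "'a::euclidean_space set"
 assumes "d > 0" "\<And>x y. x \<in> A ==> y \<in> B ==> d \<le> dist x y"
 shows "hausdorff_outer s A + hausdorff_outer s B \<le> hausdorff_outer s (A \<union> B)"
proof -
 let ?P = "hausdorff_premeasure s"
 have add: "?P \<delta> A + ?P \<delta> B \<le> ?P \<delta> (A \<union> B)" if "\<delta> < d" for \<delta>
 proof (rule hausdorff_premeasure_greatest)
  fix U :: "nat => 'a set" assume U: "A \<union> B \<subseteq> (\<Union>i. U i)" "\<And>i. bounded (U i)" "\<And>i. diameter (U i) \<le> \<delta>"
  define UA where "UA i = (if U i \<inter> A \<noteq> {} then U i else {})" for i
  define UB where "UB i = (if U i \<inter> B \<noteq> {} then U i else {})" for i
  have \<delta>: "\<delta> \<ge> 0" using U(3)[of 0] diameter_ge_0[OF U(2)[of 0]] by linarith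
  have "?P \<delta> A \<le> (\<Sum>i. hausdorff_weight s (UA i))"
   by (rule hausdorff_premeasure_le) (use U \<delta> in \<open>auto simp: UA_def, blast\<close>)
  moreover have "?P \<delta> B \<le> (\<Sum>i. hausdorff_weight s (UB i))"
   by (rule hausdorff_premeasure_le) (use U \<delta> in \<open>auto simp: UB_def, blast\<close>)
  ultimately have "?P \<delta> A + ?P \<delta> B \<le> (\<Sum>i. hausdorff_weight s (UA i)) + (\<Sum>i. hausdorff_weight s (UB i))"
   by (rule add_mono)
  also have "... = (\<Sum>i. hausdorff_weight s (UA i) + hausdorff_weight s (UB i))"
   by (rule suminf_add) auto
  also have "... \<le> (\<Sum>i. hausdorff_weight s (U i))"
  proof (rule suminf_le)
   fix i
   have "UA i = {} \<or> UB i = {}"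
   proof (rule ccontr)
    assume "\<not> ?thesis"
    then obtain x y where "x \<in> U i" "x \<in> A" "y \<in> U i" "y \<in> B" by (auto simp: UA_def UB_def split: if_splits)
    then have "d \<le> \<delta>" using assms(2) diameter_bounded_bound[OF U(2)[of i]] U(3)[of i] by (meson order_trans)
    then show False using that by simp
   qed
   moreover have "hausdorff_weight s (UA i) \<le> hausdorff_weight s (U i)" "hausdorff_weight s (UB i) \<le> hausdorff_weight s (U i)"
    by (simp_all add: UA_def UB_def hausdorff_weight_def)
   moreover have "hausdorff_weight s ({} :: 'a set) = 0" by (simp add: hausdorff_weight_def)
   ultimately show "hausdorff_weight s (UA i) + hausdorff_weight s (UB i) \<le> hausdorff_weight s (U i)"
    by (metis add.left_neutral add.right_neutral)
  qed auto
  finally show "?P \<delta> A + ?P \<delta> B \<le> (\<Sum>i. hausdorff_weight s (U i))" .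
 qed
 have "?P \<delta> A + ?P \<epsilon> B \<le> hausdorff_outer s (A \<union> B)" if "\<delta> > 0" "\<epsilon> > 0" for \<delta> \<epsilon>
 proof -
  let ?m = "min (d / 2) (min \<delta> \<epsilon>)"
  have "?P \<delta> A + ?P \<epsilon> B \<le> ?P ?m A + ?P ?m B"
   by (intro add_mono hausdorff_premeasure_antimono) auto
  also have "... \<le> ?P ?m (A \<union> B)" by (rule add) (use assms(1) in auto)
  also have "... \<le> hausdorff_outer s (A \<union> B)" by (rule hausdorff_premeasure_le_outer) (use assms(1) that in auto)
  finally show ?thesis .
 qed
 then have "?P \<epsilon> B + ?P \<delta> A \<le> hausdorff_outer s (A \<union> B)" if "\<delta> > 0" "\<epsilon> > 0" for \<delta> \<epsilon>
  using that by (subst add.commute)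
 then have "(SUP \<epsilon>\<in>{0<..}. ?P \<epsilon> B + ?P \<delta> A) \<le> hausdorff_outer s (A \<union> B)" if "\<delta> > 0" for \<delta>
  using that by (intro SUP_least) simp
 then have "hausdorff_outer s B + ?P \<delta> A \<le> hausdorff_outer s (A \<union> B)" if "\<delta> > 0" for \<delta>
  using that unfolding hausdorff_outer_def[of s B]
  by (subst ennreal_SUP_add_left[of "{0<..}" "\<lambda>\<epsilon>. ?P \<epsilon> B" "?P \<delta> A", symmetric]) simp_all
 then have "(SUP \<delta>\<in>{0<..}. ?P \<delta> A + hausdorff_outer s B) \<le> hausdorff_outer s (A \<union> B)"
  by (auto intro!: SUP_least simp: add.commute)
 then show ?thesis unfolding hausdorff_outer_def[of s A]
  using ennreal_SUP_add_left[of "{0<..}" "\<lambda>\<epsilon>. ?P \<epsilon> A" "hausdorff_outer s B"] by simp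
qed

text \<open>Caratheodory's criterion: the shells between consecutive levels of the distance to \<open>C\<close> have
 summable measure, because every other shell is separated from the previous ones.\<close>

lemma hausdorff_outer_closed:
 fixes C E :: "'a::euclidean_space set"
 assumes C: "closed C" "C \<noteq> {}"
 shows "hausdorff_outer s (E \<inter> C) + hausdorff_outer s (E - C) \<le> hausdorff_outer s E"
proof (cases "hausdorff_outer s E = \<infinity>")
 case False
 let ?H = "hausdorff_outer s" and ?g = "\<lambda>x. infdist x C"
 have lip: "\<bar>?g x - ?g y\<bar> \<le> dist x y" for x y
  using infdist_triangle[of x C y] infdist_triangle[of y C x] by (auto simp: dist_commute abs_le_iff)
 \<comment> \<open>Shells at distance about \<open>1 / j\<close> from \<open>C\<close>. A shell
   touches its neighbours, but it has positive distance from all shells whose index differs by at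
   least 2; therefore even and odd indices are summed separately.\<close>
 define R where "R j = {x \<in> E. 1 / real (j + 2) \<le> ?g x \<and> ?g x < 1 / real (j + 1)}" for j :: nat
 define D where "D k = {x \<in> E. 1 / real (k + 1) \<le> ?g x}" for k :: nat
 have sep: "?H (\<Union>i<N. R (2 * i + p)) + ?H (R (2 * N + p)) \<le> ?H ((\<Union>i<N. R (2 * i + p)) \<union> R (2 * N + p))" for N p
 proof (cases "2 * N + p = 0")
  case True then show ?thesis by (simp add: hausdorff_outer_empty)
 next
  case False
  let ?m = "real (2 * N + p)"
  have m: "?m > 0" using False by linarith
  show ?thesis
  proof (rule hausdorff_outer_separated)
   show "0 < 1 / ?m - 1 / (?m + 1)" using divide_strict_left_mono[of ?m "?m + 1" 1] m by simp
   fix x y assume "x \<in> (\<Union>i<N. R (2 * i + p))" "y \<in> R (2 * N + p)"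
   then obtain i where i: "i < N" "1 / real (2 * i + p + 2) \<le> ?g x" and y: "?g y < 1 / (?m + 1)" by (auto simp: R_def add_ac)
   have "real (2 * i + p + 2) \<le> ?m" using i(1) by linarith
   then have "1 / ?m \<le> 1 / real (2 * i + p + 2)" using m by (intro divide_left_mono) auto
   then show "1 / ?m - 1 / (?m + 1) \<le> dist x y" using i(2) y lip[of x y] by linarith
  qed
 qed
 have half: "(\<Sum>i<N. ?H (R (2 * i + p))) \<le> ?H (\<Union>i<N. R (2 * i + p))" for N p
 proof (induction N)
  case (Suc N)
  have "(\<Union>i<Suc N. R (2 * i + p)) = (\<Union>i<N. R (2 * i + p)) \<union> R (2 * N + p)" by (auto simp: less_Suc_eq)
  then show ?case using order_trans[OF add_right_mono[OF Suc] sep[of p N]] by simp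
 qed simp
 have split: "(\<Sum>j<2 * N. ?H (R j)) = (\<Sum>i<N. ?H (R (2 * i + 0))) + (\<Sum>i<N. ?H (R (2 * i + 1)))" for N
  by (induction N) (auto simp: add_ac)
 moreover have "?H (\<Union>i<N. R (2 * i + p)) \<le> ?H E" for N p by (rule hausdorff_outer_mono) (auto simp: R_def)
 ultimately have halfE: "(\<Sum>i<N. ?H (R (2 * i + p))) \<le> ?H E" for N p
  using half by (meson order_trans)
 have h0: "(\<Sum>i<N. ?H (R (2 * i + 0))) \<le> ?H E" for N by (rule halfE)
 have h1: "(\<Sum>i<N. ?H (R (2 * i + 1))) \<le> ?H E" for N by (rule halfE)
 have partial: "(\<Sum>j<2 * N. ?H (R j)) \<le> ?H E + ?H E" for N
  unfolding split by (rule add_mono[OF h0 h1])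
 obtain h where h: "?H E = ennreal h" "h \<ge> 0" using False by (cases "?H E") auto
 have RE: "?H (R j) \<le> ?H E" for j by (rule hausdorff_outer_mono) (auto simp: R_def)
 define r where "r j = enn2real (?H (R j))" for j
 have r: "?H (R j) = ennreal (r j)" "r j \<ge> 0" for j
  using RE[of j] h by (auto simp: r_def less_top le_less_trans intro!: ennreal_enn2real[symmetric])
 have "summable r"
 proof (rule summableI_nonneg_bounded)
  fix n
  have "(\<Sum>j<n. r j) \<le> (\<Sum>j<2 * n. r j)" by (rule sum_mono2) (auto simp: r)
  also have "... \<le> h + h"
   using partial[of n] h r by (simp add: sum_ennreal ennreal_plus[symmetric] del: ennreal_plus)
  finally show "sum r {..<n} \<le> h + h" .
 qed (rule r)
 have tail: "?H (E \<inter> C) + ?H (E - C) \<le> ?H E + ennreal (\<Sum>j. r (j + k))" for k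
 proof -
  have "E - C \<subseteq> D k \<union> (\<Union>j. R (j + k))"
  proof
   fix x assume x: "x \<in> E - C"
   then have g: "?g x > 0" using C by (metis DiffE in_closed_iff_infdist_zero infdist_nonneg less_eq_real_def)
   show "x \<in> D k \<union> (\<Union>j. R (j + k))"
   proof (cases "1 / real (k + 1) \<le> ?g x")
    case True then show ?thesis using x by (simp add: D_def)
   next
    case False
    define n where "n = nat \<lfloor>1 / ?g x\<rfloor>"
    have n0: "1 / ?g x > real (k + 1)" using False g by (simp add: field_simps)
    have n1: "real n \<le> 1 / ?g x" "1 / ?g x < real n + 1" using g unfolding n_def by (auto simp: of_nat_floor)
    have nk: "n \<ge> k + 1" using n0 g unfolding n_def by (simp add: le_nat_floor)
    show ?thesis
    \<comment> \<open>The shells are half open: a distance equal to \<open>1 / n\<close> belongs to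
      index \<open>n - 2\<close>, and one strictly between \<open>1 / (n + 1)\<close> and
      \<open>1 / n\<close> to index \<open>n - 1\<close>.\<close>
    proof (cases "real n = 1 / ?g x")
     case True
     then have "n \<ge> k + 2" using n0 nk by (cases "n = k + 1") auto
     moreover have gx: "?g x = 1 / real n" unfolding True by simp
     ultimately have "x \<in> R ((n - 2 - k) + k)" using x unfolding R_def gx
      by (auto simp: gx of_nat_diff intro!: divide_strict_left_mono)
     then show ?thesis by blast
    next
     case ne: False
     then have lt: "real n < 1 / ?g x" using n1 by simp
     have "?g x < 1 / real n" using lt g nk by (simp add: field_simps)
     moreover have "1 / real (n + 1) \<le> ?g x" using n1(2) g by (simp add: field_simps)
     ultimately have "x \<in> R ((n - 1 - k) + k)" using x nk by (auto simp: R_def of_nat_diff)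
     then show ?thesis by blast
    qed
   qed
  qed
  then have "?H (E - C) \<le> ?H (D k \<union> (\<Union>j. R (j + k)))" by (rule hausdorff_outer_mono)
  also have "... \<le> ?H (D k) + ?H (\<Union>j. R (j + k))" by (rule hausdorff_outer_Un)
  also have "?H (\<Union>j. R (j + k)) \<le> (\<Sum>j. ?H (R (j + k)))" by (rule hausdorff_outer_subadditive)
  also have "(\<Sum>j. ?H (R (j + k))) = ennreal (\<Sum>j. r (j + k))"
   unfolding r(1) by (rule suminf_ennreal2) (use r \<open>summable r\<close> in \<open>auto simp: summable_iff_shift\<close>)
  finally have 1: "?H (E - C) \<le> ?H (D k) + ennreal (\<Sum>j. r (j + k))" by (simp add: add_left_mono)
  have "?H (E \<inter> C) + ?H (D k) \<le> ?H ((E \<inter> C) \<union> D k)"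
  proof (rule hausdorff_outer_separated)
   show "0 < 1 / real (k + 1)" by simp
   fix x y assume "x \<in> E \<inter> C" "y \<in> D k"
   then have "?g x = 0" "1 / real (k + 1) \<le> ?g y" by (auto simp: D_def)
   then show "1 / real (k + 1) \<le> dist x y" using lip[of x y] by linarith
  qed
  also have "... \<le> ?H E" by (rule hausdorff_outer_mono) (auto simp: D_def)
  finally have 2: "?H (E \<inter> C) + ?H (D k) \<le> ?H E" .
  have "?H (E \<inter> C) + ?H (E - C) \<le> ?H (E \<inter> C) + (?H (D k) + ennreal (\<Sum>j. r (j + k)))" using 1 by (rule add_left_mono)
  also have "... \<le> ?H E + ennreal (\<Sum>j. r (j + k))" using 2 by (simp add: add.assoc[symmetric] add_right_mono)
  finally show ?thesis .
 qed
 have "(\<lambda>k. ?H E + ennreal (\<Sum>j. r (j + k))) \<longlonglongrightarrow> ?H E + ennreal 0"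
  by (intro tendsto_intros suminf_exist_split2 \<open>summable r\<close>)
 then show ?thesis using tail by (intro LIMSEQ_le_const[of _ "?H E"]) auto
qed simp

text \<open>\<open>measure_of\<close> returns the given set function only if that is a measure on
  the Borel sets. Caratheodory's lambda system is a sigma-algebra on which the outer measure is
  additive, and it contains the closed sets.\<close>

lemma hausdorff_measure_emeasure:
 assumes "A \<in> sets (borel :: 'a::euclidean_space measure)"
 shows "emeasure (hausdorff_measure s) A = hausdorff_outer s A"
proof -
 let ?H = "hausdorff_outer s :: 'a set => ennreal"
 interpret P: sigma_algebra UNIV "Pow UNIV :: 'a set set" by (rule sigma_algebra_Pow)
 have oms: "outer_measure_space (Pow UNIV) ?H"
  unfolding outer_measure_space_def positive_def increasing_def countably_subadditive_def
  by (auto simp: hausdorff_outer_empty hausdorff_outer_mono hausdorff_outer_subadditive)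
 define L where "L = lambda_system UNIV (Pow UNIV) ?H"
 have L: "measure_space UNIV L ?H" unfolding L_def by (rule P.caratheodory_lemma[OF oms])
 then interpret L: sigma_algebra UNIV L by (simp add: measure_space_def)
 have "closed C ==> C \<in> L" for C
 proof (cases "C = {}")
  case False
  assume C: "closed C"
  have "?H (C \<inter> x) + ?H ((UNIV - C) \<inter> x) = ?H x" for x
  proof (rule antisym)
   have "(UNIV - C) \<inter> x = x - C" "C \<inter> x = x \<inter> C" by auto
   then show "?H (C \<inter> x) + ?H ((UNIV - C) \<inter> x) \<le> ?H x" using hausdorff_outer_closed[OF C False, of s x] by simp
   have "x = (C \<inter> x) \<union> ((UNIV - C) \<inter> x)" by auto
   then show "?H x \<le> ?H (C \<inter> x) + ?H ((UNIV - C) \<inter> x)" using hausdorff_outer_Un by metis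
  qed
  then show "C \<in> L" by (simp add: L_def lambda_system_def)
 qed auto
 then have "sigma_sets UNIV (Collect closed) \<subseteq> L" by (intro L.sigma_sets_subset) auto
 then have BL: "sets borel \<subseteq> L" by (simp add: borel_eq_closed)
 show ?thesis
  unfolding hausdorff_measure_def
 proof (rule emeasure_measure_of_sigma)
  show "sigma_algebra UNIV (sets (borel :: 'a measure))" using sets.sigma_algebra_axioms[of "borel :: 'a measure"] by simp
  show "positive (sets borel) ?H" by (simp add: positive_def hausdorff_outer_empty)
  show "countably_additive (sets borel) ?H"
   using L BL unfolding measure_space_def countably_additive_def by blast
 qed fact
qed

lemma sets_hausdorff_measure [simp, measurable_cong]: "sets (hausdorff_measure s) = sets (borel :: 'a::euclidean_space measure)"
 unfolding hausdorff_measure_def by (simp add: sets.sigma_sets_eq[of "borel :: 'a measure", simplified])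

lemma space_hausdorff_measure [simp]: "space (hausdorff_measure s) = UNIV"
 unfolding hausdorff_measure_def by simp

section \<open>Cones over subsets of the sphere\<close>

text \<open>The cone over a set of diameter at most \<open>d\<close> stays close to the segment
  through one of its points \<open>w\<close>. About \<open>1 / d\<close> balls of radius
  \<open>2 d\<close> with centres spaced by \<open>d\<close> along this segment cover it, with total
  volume of order \<open>d ^ (n - 1)\<close> in dimension \<open>n\<close>. Since
  \<open>(N + 1) d <= 1 + d <= 3\<close>, the factor 5 is generous.\<close>

lemma cone_cover:
 fixes U :: "'a::euclidean_space set"
 assumes U: "bounded U" "diameter U \<le> d" and d: "0 < d" "d \<le> 2"
 shows "\<exists>B\<in>sets lborel. {x. x \<noteq> 0 \<and> norm x \<le> 1 \<and> x /\<^sub>R norm x \<in> U} \<subseteq> B \<and>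
  emeasure lborel B \<le> ennreal (5 * 2 ^ DIM('a) * unit_ball_vol (real DIM('a)) * d ^ (DIM('a) - 1))"
proof (cases "U \<inter> sphere 0 1 = {}")
 case True
 have "{x. x \<noteq> 0 \<and> norm x \<le> 1 \<and> x /\<^sub>R norm x \<in> U} = {}"
 proof (rule ccontr)
  assume "\<not> ?thesis"
  then obtain x where "x \<noteq> 0" "x /\<^sub>R norm x \<in> U" by auto
  then have "x /\<^sub>R norm x \<in> U \<inter> sphere 0 1" by simp
  then show False using True by blast
 qed
 then show ?thesis by (intro bexI[of _ "{}"]) auto
next
 case False
 then obtain w where w: "w \<in> U" "norm w = 1" by auto
 define N where "N = nat \<lfloor>1 / d\<rfloor>"
 define B where "B = (\<Union>k\<le>N. cball ((real k * d) *\<^sub>R w) (2 * d))"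
 have sub: "{x. x \<noteq> 0 \<and> norm x \<le> 1 \<and> x /\<^sub>R norm x \<in> U} \<subseteq> B"
 proof safe
  fix x :: 'a assume x: "x \<noteq> 0" "norm x \<le> 1" "x /\<^sub>R norm x \<in> U"
  define k where "k = nat \<lfloor>norm x / d\<rfloor>"
  have "norm x / d \<le> 1 / d" using x d by (simp add: divide_right_mono)
  then have kN: "k \<le> N" unfolding k_def N_def by (intro nat_mono floor_mono)
  have k: "real k \<le> norm x / d" "norm x / d < real k + 1"
   using d unfolding k_def by (auto simp: of_nat_floor)
  then have k': "\<bar>norm x - real k * d\<bar> \<le> d" using d by (auto simp: field_simps abs_le_iff)
  have "norm (x /\<^sub>R norm x - w) \<le> d"
   using diameter_bounded_bound[OF U(1) x(3) w(1)] U(2) by (simp add: dist_norm)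
  then have 1: "norm (norm x *\<^sub>R (x /\<^sub>R norm x - w)) \<le> d"
   using x d mult_mono[of "norm x" 1 "norm (x /\<^sub>R norm x - w)" d] by simp
  have "x - (real k * d) *\<^sub>R w = norm x *\<^sub>R (x /\<^sub>R norm x - w) + (norm x - real k * d) *\<^sub>R w"
   using x by (simp add: scaleR_diff_right scaleR_diff_left)
  then have "norm (x - (real k * d) *\<^sub>R w) \<le> d + d"
   using 1 k' w(2) norm_triangle_le[of "norm x *\<^sub>R (x /\<^sub>R norm x - w)" "(norm x - real k * d) *\<^sub>R w" "d + d"] by (simp add: add_mono)
  then show "x \<in> B" using kN unfolding B_def by (auto simp: dist_norm norm_minus_commute intro!: bexI[of _ k])
 qed
 have "emeasure lborel B \<le> (\<Sum>k\<le>N. emeasure lborel (cball ((real k * d) *\<^sub>R w) (2 * d)))"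
  unfolding B_def by (rule emeasure_subadditive_finite) auto
 also have "... = ennreal (real (Suc N) * (unit_ball_vol (real DIM('a)) * (2 * d) ^ DIM('a)))"
  using d by (simp add: emeasure_cball ennreal_mult ennreal_of_nat_eq_real_of_nat)
 also have "... \<le> ennreal (5 * 2 ^ DIM('a) * unit_ball_vol (real DIM('a)) * d ^ (DIM('a) - 1))"
 proof (rule ennreal_leI)
  have "real N \<le> 1 / d" using d unfolding N_def by (simp add: of_nat_floor)
  then have "real (Suc N) * d \<le> 5" using d by (simp add: field_simps)
  then have "(real (Suc N) * d) * (unit_ball_vol (real DIM('a)) * 2 ^ DIM('a) * d ^ (DIM('a) - 1))
   \<le> 5 * (unit_ball_vol (real DIM('a)) * 2 ^ DIM('a) * d ^ (DIM('a) - 1))"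
   using d by (intro mult_right_mono) auto
  moreover have "d ^ DIM('a) = d * d ^ (DIM('a) - 1)" by (metis DIM_positive power_minus_mult mult.commute)
  ultimately show "real (Suc N) * (unit_ball_vol (real DIM('a)) * (2 * d) ^ DIM('a)) \<le> 5 * 2 ^ DIM('a) * unit_ball_vol (real DIM('a)) * d ^ (DIM('a) - 1)"
   by (simp only: power_mult_distrib mult_ac)
 qed
 finally show ?thesis using sub by (intro bexI[of _ B]) (auto simp: B_def)
qed

definition cone_constant :: "'a::euclidean_space itself => real" where
 "cone_constant _ = 5 * 2 ^ DIM('a) * unit_ball_vol (real DIM('a)) * 2 ^ (DIM('a) - 1) / unit_ball_vol (real (DIM('a) - 1))"

lemma cone_constant_nonneg: "cone_constant TYPE('a::euclidean_space) \<ge> 0"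
 by (simp add: cone_constant_def)

text \<open>A one-sided comparison up to a constant takes the place of the exact relation between
  Hausdorff measure on the sphere and volume: every cover of the spherical set by small sets gives a
  cover of the cone by balls.\<close>

lemma emeasure_cone_le:
 fixes A :: "'a::euclidean_space set"
 assumes A: "A \<in> sets borel"
 shows "emeasure lborel {x. x \<noteq> 0 \<and> norm x \<le> 1 \<and> x /\<^sub>R norm x \<in> A}
  \<le> ennreal (cone_constant TYPE('a)) * hausdorff_outer (DIM('a) - 1) (A \<inter> sphere 0 1)"
proof -
 let ?s = "DIM('a) - 1" and ?c = "5 * 2 ^ DIM('a) * unit_ball_vol (real DIM('a))"
 let ?K = "ennreal (cone_constant TYPE('a))"
 let ?cone = "\<lambda>A. {x::'a. x \<noteq> 0 \<and> norm x \<le> 1 \<and> x /\<^sub>R norm x \<in> A}"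
 have c: "?c > 0" by (simp add: unit_ball_vol_pos)
 have v: "unit_ball_vol (real ?s) > 0" by (rule unit_ball_vol_pos) simp
 have "emeasure lborel (?cone A) \<le> ?K * (\<Sum>i. hausdorff_weight ?s (U i))"
  if U: "A \<inter> sphere 0 1 \<subseteq> (\<Union>i. U i)" "\<And>i. bounded (U i)" "\<And>i. diameter (U i) \<le> 1" for U :: "nat => 'a set"
 proof (rule ennreal_le_epsilon)
  fix e :: real assume e: "e > 0"
  have "\<exists>B\<in>sets lborel. ?cone (U i) \<subseteq> B \<and> emeasure lborel B \<le> ?K * hausdorff_weight ?s (U i) + e * (1/2) ^ Suc i" for i
  proof (cases "U i = {}")
   case True then show ?thesis by (intro bexI[of _ "{}"]) auto
  next
   case False
   let ?d = "diameter (U i)"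
   have d0: "?d \<ge> 0" by (rule diameter_ge_0[OF U(2)])
   \<comment> \<open>A covering set may be a single point, but the cone estimate needs a positive
     diameter; \<open>?d\<close> is enlarged slightly, at a cost below the error reserved for index
     \<open>i\<close>.\<close>
   have "((\<lambda>d. ?c * d ^ ?s) \<longlongrightarrow> ?c * ?d ^ ?s) (at_right ?d)" by (intro tendsto_intros)
   then have "\<forall>\<^sub>F d in at_right ?d. ?c * d ^ ?s < ?c * ?d ^ ?s + e * (1/2) ^ Suc i"
    using e by (intro order_tendstoD(2)) auto
   moreover have "\<forall>\<^sub>F d in at_right ?d. ?d < d \<and> d < 2"
    using U(3)[of i] by (intro eventually_at_rightI[of ?d 2]) auto
   ultimately have "\<forall>\<^sub>F d in at_right ?d. ?c * d ^ ?s < ?c * ?d ^ ?s + e * (1/2) ^ Suc i \<and> ?d < d \<and> d < 2"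
    by eventually_elim simp
   then obtain d where d: "?c * d ^ ?s < ?c * ?d ^ ?s + e * (1/2) ^ Suc i" "?d < d" "d < 2"
    by (auto dest!: eventually_happens)
   obtain B where B: "B \<in> sets lborel" "?cone (U i) \<subseteq> B" "emeasure lborel B \<le> ennreal (?c * d ^ ?s)"
    using cone_cover[OF U(2), of i d] d d0 by auto
   have "ennreal (?c * d ^ ?s) \<le> ennreal (?c * ?d ^ ?s + e * (1/2) ^ Suc i)" using d(1) by (intro ennreal_leI) simp
   also have "... = ennreal (?c * ?d ^ ?s) + e * (1/2) ^ Suc i" using c d0 e by (intro ennreal_plus) auto
   also have "ennreal (?c * ?d ^ ?s) = ?K * hausdorff_weight ?s (U i)"
   proof -
    have "cone_constant TYPE('a) * (unit_ball_vol (real ?s) * (?d / 2) ^ ?s) = ?c * ?d ^ ?s"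
    proof -
     have aux: "c * 2 ^ s / V * (V * (d / 2) ^ s) = c * d ^ s" if "V > 0" for c V d :: real and s
      using that by (simp add: power_divide)
     show ?thesis unfolding cone_constant_def by (rule aux[OF v])
    qed
    then show ?thesis using False v d0 cone_constant_nonneg[where 'a='a]
     by (simp add: hausdorff_weight_def ennreal_mult[symmetric])
   qed
   finally show ?thesis using B by (meson order_trans)
  qed
  then have "\<forall>i. \<exists>B. B \<in> sets lborel \<and> ?cone (U i) \<subseteq> B \<and> emeasure lborel B \<le> ?K * hausdorff_weight ?s (U i) + e * (1/2) ^ Suc i"
   unfolding Bex_def by (rule allI)
  from choice[OF this] obtain B where B': "\<forall>i. B i \<in> sets lborel \<and> ?cone (U i) \<subseteq> B i \<and> emeasure lborel (B i) \<le> ?K * hausdorff_weight ?s (U i) + e * (1/2) ^ Suc i"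
   by (elim exE)
  note B = B'[THEN spec, THEN conjunct1] B'[THEN spec, THEN conjunct2, THEN conjunct1] B'[THEN spec, THEN conjunct2, THEN conjunct2]
  have "?cone A \<subseteq> (\<Union>i. B i)"
  proof safe
   fix x :: 'a assume x: "x \<noteq> 0" "norm x \<le> 1" "x /\<^sub>R norm x \<in> A"
   then have "x /\<^sub>R norm x \<in> A \<inter> sphere 0 1" by simp
   then obtain i where "x /\<^sub>R norm x \<in> U i" using U(1) by blast
   then have "x \<in> ?cone (U i)" using x by simp
   then show "x \<in> (\<Union>i. B i)" using B(2) by blast
  qed
  then have "emeasure lborel (?cone A) \<le> emeasure lborel (\<Union>i. B i)" by (rule emeasure_mono) (use B(1) in auto)
  also have "... \<le> (\<Sum>i. emeasure lborel (B i))" by (rule emeasure_subadditive_countably) (use B(1) in auto)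
  also have "... \<le> (\<Sum>i. ?K * hausdorff_weight ?s (U i) + e * (1/2) ^ Suc i)" by (intro suminf_le B) auto
  also have "... = (\<Sum>i. ?K * hausdorff_weight ?s (U i)) + (\<Sum>i. ennreal e * ennreal ((1/2) ^ Suc i))"
   using e by (subst suminf_add[symmetric]) (auto simp del: ennreal_suminf_cmult simp add: ennreal_mult[symmetric])
  also have "... = ?K * (\<Sum>i. hausdorff_weight ?s (U i)) + e"
   unfolding ennreal_suminf_cmult
   by (subst suminf_ennreal_eq[OF zero_le_power power_half_series]) auto
  finally show "emeasure lborel (?cone A) \<le> ?K * (\<Sum>i. hausdorff_weight ?s (U i)) + e" .
 qed
 note cover = this
 have "emeasure lborel (?cone A) \<le> ?K * hausdorff_premeasure ?s 1 (A \<inter> sphere 0 1)"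
 proof (rule ennreal_le_epsilon)
  let ?P = "hausdorff_premeasure ?s 1 (A \<inter> sphere 0 1)"
  fix e :: real assume e: "e > 0" and fin: "?K * ?P < top"
  have K: "cone_constant TYPE('a) > 0" using c v by (simp add: cone_constant_def)
  then have "?P \<noteq> top" using fin by (auto simp: ennreal_mult_top)
  then have close: "?P < ?P + ennreal (e / cone_constant TYPE('a))" using e K by (auto simp: less_top)
  have "\<exists>U. A \<inter> sphere 0 1 \<subseteq> (\<Union>i. U i) \<and> (\<forall>i. bounded (U i)) \<and> (\<forall>i. diameter (U i) \<le> 1) \<and>
   (\<Sum>i. hausdorff_weight ?s (U i)) < ?P + ennreal (e / cone_constant TYPE('a))"
   by (rule hausdorff_premeasure_close[OF close]) auto
  then obtain U :: "nat => 'a set" where U: "A \<inter> sphere 0 1 \<subseteq> (\<Union>i. U i)" "\<And>i. bounded (U i)" "\<And>i. diameter (U i) \<le> 1"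
   "(\<Sum>i. hausdorff_weight ?s (U i)) < ?P + ennreal (e / cone_constant TYPE('a))"
   by auto
  have "emeasure lborel (?cone A) \<le> ?K * (\<Sum>i. hausdorff_weight ?s (U i))" by (rule cover[OF U(1-3)])
  also have "... \<le> ?K * (?P + ennreal (e / cone_constant TYPE('a)))" using U(4) by (intro mult_left_mono) auto
  also have "... = ?K * ?P + e" using e K by (simp add: distrib_left ennreal_mult[symmetric])
  finally show "emeasure lborel (?cone A) \<le> ?K * ?P + e" .
 qed
 also have "... \<le> ?K * hausdorff_outer ?s (A \<inter> sphere 0 1)"
  by (intro mult_left_mono hausdorff_premeasure_le_outer) auto
 finally show ?thesis .
qed

text \<open>The set inequality compares two measures: the image of Lebesgue measure on the punctured
  ball under radial projection, and a multiple of the measure on the sphere. Integrals of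
  nonnegative functions are monotone in the measure.\<close>

lemma nn_integral_cone_le:
 fixes \<Phi> :: "'a::euclidean_space => ennreal"
 assumes [measurable]: "\<Phi> \<in> Borel"
 shows "(NI z. indicator {z. z \<noteq> 0 \<and> norm z \<le> 1} z * \<Phi> (z /\<^sub>R norm z))
  \<le> ennreal (cone_constant TYPE('a)) * (\<integral>\<^sup>+w. \<Phi> w \<partial>sphere_measure)"
proof -
 let ?s = "DIM('a) - 1" and ?K = "ennreal (cone_constant TYPE('a))"
 let ?B = "{z::'a. z \<noteq> 0 \<and> norm z \<le> 1}"
 have [measurable]: "sphere (0::'a) 1 \<in> sets borel" by simp
 define M where "M = distr (density lborel (indicator ?B)) borel (\<lambda>z::'a. z /\<^sub>R norm z)"
 define N where "N = density (hausdorff_measure ?s) (\<lambda>w::'a. ?K * indicator (sphere 0 1) w)"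
 have "nn_integral M \<Phi> \<le> nn_integral N \<Phi>"
 proof (rule nn_integral_mono_measure)
  show sets: "sets M = sets N" by (simp add: M_def N_def)
  show "M \<le> N"
   unfolding le_measure[OF sets]
  proof
   fix A assume "A \<in> sets M"
   then have A [measurable]: "A \<in> sets borel" by (simp add: M_def)
   have "emeasure M A = emeasure lborel {x. x \<noteq> 0 \<and> norm x \<le> 1 \<and> x /\<^sub>R norm x \<in> A}"
   proof -
    have "emeasure M A = (NI z. indicator ?B z * indicator ((\<lambda>z. z /\<^sub>R norm z) -` A) z)"
    proof -
     have "(\<lambda>z::'a. z /\<^sub>R norm z) \<in> Borel" by measurable
     from measurable_sets[OF this A] have "(\<lambda>z::'a. z /\<^sub>R norm z) -` A \<in> sets borel" by simp
     then show ?thesis unfolding M_def by (subst emeasure_distr) (simp_all add: emeasure_density)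
    qed
    also have "... = (NI z. indicator {x. x \<noteq> 0 \<and> norm x \<le> 1 \<and> x /\<^sub>R norm x \<in> A} z)"
     by (intro nn_integral_cong) (auto simp: indicator_def)
    finally show ?thesis by simp
   qed
   also have "... \<le> ?K * hausdorff_outer ?s (A \<inter> sphere 0 1)" by (rule emeasure_cone_le[OF A])
   also have "... = (\<integral>\<^sup>+w. ?K * indicator (A \<inter> sphere 0 1) w \<partial>hausdorff_measure ?s)"
    using A by (subst nn_integral_cmult_indicator) (auto simp: hausdorff_measure_emeasure)
   also have "... = emeasure N A"
    unfolding N_def using A by (subst emeasure_density) (auto intro!: nn_integral_cong simp: indicator_def)
   finally show "emeasure M A \<le> emeasure N A" .
  qed
 qed
 also have "nn_integral N \<Phi> = (\<integral>\<^sup>+w. ?K * (\<Phi> w * indicator (sphere 0 1) w) \<partial>hausdorff_measure ?s)"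
  unfolding N_def by (subst nn_integral_density) (simp_all add: mult_ac)
 also have "... = ?K * (\<integral>\<^sup>+w. \<Phi> w * indicator (sphere 0 1) w \<partial>hausdorff_measure ?s)"
  by (rule nn_integral_cmult) measurable
 also have "(\<integral>\<^sup>+w. \<Phi> w * indicator (sphere 0 1) w \<partial>hausdorff_measure ?s) = (\<integral>\<^sup>+w. \<Phi> w \<partial>sphere_measure)"
  unfolding sphere_measure_def by (rule nn_integral_restrict_space[symmetric]) simp
 also have "nn_integral M \<Phi> = (NI z. indicator ?B z * \<Phi> (z /\<^sub>R norm z))"
  unfolding M_def by (subst nn_integral_distr) (auto simp: nn_integral_density)
 finally show ?thesis .
qed

text \<open>Integrating \<open>f (s z)\<close> over all dilations \<open>s\<close> of the unit ball, with a weight homogeneous of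
 the right degree, counts every point \<open>1/n\<close> times.\<close>

definition dilation_weight :: "real \<times> 'a::euclidean_space => ennreal" where
 "dilation_weight p = ennreal (fst p ^ (DIM('a) - 1) * norm (snd p) ^ DIM('a)) *
  indicator {p. 0 < fst p \<and> snd p \<noteq> 0 \<and> norm (snd p) \<le> 1} p"

lemma dilation_weight_measurable [measurable]: "dilation_weight \<in> borel_measurable (borel \<Otimes>\<^sub>M borel)"
 unfolding dilation_weight_def[abs_def] by measurable

lemma distr_dilation:
 "distr (density (lborel \<Otimes>\<^sub>M lborel) dilation_weight) borel (\<lambda>(s, z). s *\<^sub>R z)
  = density (lborel :: 'a::euclidean_space measure) (\<lambda>_. ennreal (1 / real DIM('a)))"
proof (rule measure_eqI)
 let ?n = "DIM('a)"
 fix A :: "'a set" assume "A \<in> sets (distr (density (lborel \<Otimes>\<^sub>M lborel) dilation_weight) borel (\<lambda>(s, z). s *\<^sub>R z))"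
 then have [measurable]: "A \<in> sets borel" by simp
 have "emeasure (distr (density (lborel \<Otimes>\<^sub>M lborel) dilation_weight) borel (\<lambda>(s, z). s *\<^sub>R z)) A
  = (\<integral>\<^sup>+p. dilation_weight p * indicator A (fst p *\<^sub>R snd p) \<partial>(lborel \<Otimes>\<^sub>M lborel))"
  by (subst nn_integral_indicator[symmetric], simp, subst nn_integral_distr) (auto simp: nn_integral_density split_beta)
 also have "... = (\<integral>\<^sup>+s. \<integral>\<^sup>+z. dilation_weight (s, z) * indicator A (s *\<^sub>R z) \<partial>lborel \<partial>lborel)"
  by (subst lborel.nn_integral_fst[symmetric]) simp_all
 also have "... = (\<integral>\<^sup>+s. \<integral>\<^sup>+x. ennreal (norm x ^ ?n * (inverse s) ^ (?n + 1)) * indicator {norm x..} s * indicator {0<..} s * indicator (A - {0}) x \<partial>lborel \<partial>lborel)"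
 proof (rule nn_integral_cong)
  fix s :: real
  show "(NI z. dilation_weight (s, z) * indicator A (s *\<^sub>R z)) = (NI x. ennreal (norm x ^ ?n * (inverse s) ^ (?n + 1)) * indicator {norm x..} s * indicator {0<..} s * indicator (A - {0}) x)"
  proof (cases "s > 0")
   case True
   have *: "lborel = density (distr lborel borel (\<lambda>x::'a. 0 + s *\<^sub>R x)) (\<lambda>_. ennreal (\<bar>s\<bar> ^ DIM('a)))"
    using lborel_affine[of s "0::'a"] True by (simp add: ennreal_power)
   have "(NI x. ennreal (norm x ^ ?n * (inverse s) ^ (?n + 1)) * indicator {norm x..} s * indicator {0<..} s * indicator (A - {0}) x)
    = (NI z. ennreal (s ^ ?n) * (ennreal (norm (s *\<^sub>R z) ^ ?n * (inverse s) ^ (?n + 1)) * indicator {norm (s *\<^sub>R z)..} s * indicator {0<..} s * indicator (A - {0}) (s *\<^sub>R z)))"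
   proof -
    define h where "h x = ennreal (norm x ^ ?n * (inverse s) ^ (?n + 1)) * indicator {r. r \<le> s} (norm x) * indicator {0<..} s * indicator (A - {0}) x" for x
    have [measurable]: "h \<in> Borel" unfolding h_def[abs_def] by measurable
    have "(NI x. h x) = (NI z. ennreal (s ^ ?n) * h (s *\<^sub>R z))"
     by (subst *) (use True in \<open>simp add: nn_integral_density nn_integral_distr\<close>)
    moreover have i: "(indicator {r. r \<le> s} (norm x) :: ennreal) = indicator {norm x..} s" for x :: 'a by (simp add: indicator_def)
    ultimately show ?thesis unfolding h_def i by (simp only:)
   qed
   also have "... = (NI z. dilation_weight (s, z) * indicator A (s *\<^sub>R z))"
   proof (rule nn_integral_cong)
    fix z :: 'a
    have "s ^ ?n * (norm (s *\<^sub>R z) ^ ?n * (inverse s) ^ (?n + 1)) = s ^ (?n - 1) * norm z ^ ?n"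
    proof -
     have "s ^ ?n = s * s ^ (?n - 1)" by (metis DIM_positive power_minus_mult mult.commute)
     then show ?thesis using True by (simp add: power_mult_distrib power_inverse field_simps)
    qed
    then have "ennreal (s ^ ?n) * ennreal (norm (s *\<^sub>R z) ^ ?n * (inverse s) ^ (?n + 1)) = ennreal (s ^ (?n - 1) * norm z ^ ?n)"
     using True by (subst ennreal_mult[symmetric]) auto
    moreover have "indicator {norm (s *\<^sub>R z)..} s * indicator {0<..} s * indicator (A - {0}) (s *\<^sub>R z) = indicator {p. 0 < fst p \<and> snd p \<noteq> 0 \<and> norm (snd p) \<le> 1} (s, z) * (indicator A (s *\<^sub>R z) :: ennreal)"
     using True by (auto simp: indicator_def)
    ultimately show "ennreal (s ^ ?n) * (ennreal (norm (s *\<^sub>R z) ^ ?n * (inverse s) ^ (?n + 1)) * indicator {norm (s *\<^sub>R z)..} s * indicator {0<..} s * indicator (A - {0}) (s *\<^sub>R z))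
     = dilation_weight (s, z) * indicator A (s *\<^sub>R z)"
     by (simp add: dilation_weight_def mult.assoc[symmetric]) (simp add: mult.assoc)
   qed
   finally show ?thesis by simp
  next
   case False then show ?thesis by (simp add: dilation_weight_def)
  qed
 qed
 also have "... = (\<integral>\<^sup>+x. \<integral>\<^sup>+s. ennreal (norm x ^ ?n * (inverse s) ^ (?n + 1)) * indicator {norm x..} s * indicator {0<..} s * indicator (A - {0}) x \<partial>lborel \<partial>lborel)"
 proof (rule lborel_pair.Fubini'[symmetric])
  have [measurable]: "Measurable.pred (borel \<Otimes>\<^sub>M borel) (\<lambda>x::real \<times> 'a. norm (snd x) \<le> fst x)" by measurable
  have "(\<lambda>p. ennreal (norm (snd p) ^ ?n * (inverse (fst p)) ^ (?n + 1)) * indicator {p. norm (snd p) \<le> fst p} p * indicator {p. 0 < fst p} p * indicator {p. snd p \<in> A - {0}} p) \<in> borel_measurable (borel \<Otimes>\<^sub>M (borel :: 'a measure))"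
   by measurable
  then show "(\<lambda>(s, x). ennreal (norm x ^ ?n * (inverse s) ^ (?n + 1)) * indicator {norm x..} s * indicator {0<..} s * indicator (A - {0}) x) \<in> borel_measurable (lborel \<Otimes>\<^sub>M (lborel :: 'a measure))"
   by (simp add: split_beta indicator_def cong: measurable_cong_sets)
 qed
 also have "... = (NI x. ennreal (1 / real ?n) * indicator (A - {0}) x)"
 proof (rule nn_integral_cong)
  fix x :: 'a
  show "(NI s. ennreal (norm x ^ ?n * (inverse s) ^ (?n + 1)) * indicator {norm x..} s * indicator {0<..} s * indicator (A - {0}) x) = ennreal (1 / real ?n) * indicator (A - {0}) x"
  proof (cases "x \<in> A - {0}")
   case True
   then have x: "norm x > 0" by simp
   have "(NI s. ennreal (norm x ^ ?n * (inverse s) ^ (?n + 1)) * indicator {norm x..} s * indicator {0<..} s * indicator (A - {0}) x)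
    = (NI s. ennreal (norm x ^ ?n * (inverse s) ^ (?n + 1)) * indicator {norm x..} s)"
   proof (rule nn_integral_cong)
    fix s
    have "norm x \<le> s ==> 0 < s" using x by linarith
    then show "ennreal (norm x ^ ?n * (inverse s) ^ (?n + 1)) * indicator {norm x..} s * indicator {0<..} s * indicator (A - {0}) x
     = ennreal (norm x ^ ?n * (inverse s) ^ (?n + 1)) * indicator {norm x..} s"
     using True by (cases "norm x \<le> s") simp_all
   qed
   \<comment> \<open>For fixed \<open>x\<close> the dilations that reach it are the
     \<open>s >= norm x\<close>, and the integral of \<open>norm x ^ n * s ^ (- n - 1)\<close> over
     them is \<open>1 / n\<close> for every \<open>x\<close>; the powers in the weight were chosen
     for this.\<close>
   also have "... = ennreal (0 - (- (norm x ^ ?n * (inverse (norm x)) ^ ?n / real ?n)))"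
   proof (rule nn_integral_FTC_atLeast[where F = "\<lambda>s. - (norm x ^ ?n * (inverse s) ^ ?n / real ?n)"])
    fix s assume s: "norm x \<le> s"
    then have s0: "s > 0" using x by linarith
    have "((\<lambda>s. - (norm x ^ ?n * (inverse s) ^ ?n / real ?n)) has_field_derivative - (norm x ^ ?n * (real ?n * (inverse s) ^ (?n - 1) * - (inverse (s ^ Suc (Suc 0)))) / real ?n)) (at s)"
     using s0 by (auto intro!: derivative_eq_intros simp: power2_eq_square)
    moreover have "(inverse s) ^ (?n - 1) * inverse (s ^ Suc (Suc 0)) = (inverse s) ^ (?n + 1)"
     by (metis DIM_positive One_nat_def Suc_pred add_Suc_shift power_add power_inverse add.right_neutral add_Suc_right numeral_nat(7))
    moreover have "- (norm x ^ ?n * (real ?n * (inverse s) ^ (?n - 1) * - (inverse (s ^ Suc (Suc 0)))) / real ?n)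
     = norm x ^ ?n * ((inverse s) ^ (?n - 1) * inverse (s ^ Suc (Suc 0)))" by simp
    ultimately show "((\<lambda>s. - (norm x ^ ?n * (inverse s) ^ ?n / real ?n)) has_real_derivative norm x ^ ?n * inverse s ^ (?n + 1)) (at s)"
     by (simp only:)
    show "0 \<le> norm x ^ ?n * inverse s ^ (?n + 1)" using s0 by simp
   next
    have "((\<lambda>s::real. inverse s) \<longlongrightarrow> 0) at_top" by (rule tendsto_inverse_0_at_top) (rule filterlim_ident)
    then have "((\<lambda>s::real. inverse s ^ ?n) \<longlongrightarrow> 0 ^ ?n) at_top" by (rule tendsto_power)
    then have "((\<lambda>s::real. inverse s ^ ?n) \<longlongrightarrow> 0) at_top" unfolding zero_power[OF DIM_positive] .
    then have "((\<lambda>s. - (norm x ^ ?n * inverse s ^ ?n / real ?n)) \<longlongrightarrow> - (norm x ^ ?n * 0 / real ?n)) at_top" by (intro tendsto_intros) auto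
    then show "((\<lambda>s. - (norm x ^ ?n * inverse s ^ ?n / real ?n)) \<longlongrightarrow> 0) at_top" by simp
   qed measurable
   also have "norm x ^ ?n * (inverse (norm x)) ^ ?n = 1" using x by (simp add: power_mult_distrib[symmetric])
   finally show ?thesis using True by simp
  next
   case False
   then have "indicator (A - {0}) x = (0 :: ennreal)" by (simp add: indicator_def)
   then show ?thesis by simp
  qed
 qed
 also have "... = (NI x. ennreal (1 / real ?n) * indicator A x)"
 proof (rule nn_integral_cong_AE)
  show "AE x in lborel. ennreal (1 / real ?n) * indicator (A - {0}) x = ennreal (1 / real ?n) * indicator A x"
   using AE_lborel_singleton[of "0::'a"] by eventually_elim (simp add: indicator_def)
 qed
 also have "... = emeasure (density lborel (\<lambda>_. ennreal (1 / real ?n))) A"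
  by (subst emeasure_density) auto
 finally show "emeasure (distr (density (lborel \<Otimes>\<^sub>M lborel) dilation_weight) borel (\<lambda>(s, z). s *\<^sub>R z)) A
  = emeasure (density (lborel :: 'a measure) (\<lambda>_. ennreal (1 / real DIM('a)))) A" .
qed simp

text \<open>Averaging over dilations writes the integral as one over the unit ball whose value at
  \<open>z\<close> is the radial integral of \<open>f\<close> along the direction of
  \<open>z\<close>. Absolute values are taken only after the radial integration, so oscillation in
  the radius is preserved; this is the order of operations in the norm of the class
  \<open>Y\<close>.\<close>

lemma polar_bound:
 fixes f :: "'a::euclidean_space => complex"
 assumes f: "integrable lborel f"
 shows "ennreal (norm (LI x. f x)) \<le> ennreal (real DIM('a) * cone_constant TYPE('a)) *
  (\<integral>\<^sup>+w. ennreal (norm (LINT \<rho>:{0<..}|lborel. f (\<rho> *\<^sub>R w) * of_real (\<rho> ^ (DIM('a) - 1)))) \<partial>sphere_measure)"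
proof -
 let ?n = "DIM('a)"
 let ?B = "{z::'a. z \<noteq> 0 \<and> norm z \<le> 1}"
 note [measurable] = borel_measurable_integrable[OF f, simplified]
 define w where "w p = fst p ^ (?n - 1) * norm (snd p) ^ ?n * indicator {p. 0 < fst p \<and> snd p \<noteq> 0 \<and> norm (snd p) \<le> 1} p" for p :: "real \<times> 'a"
 have [measurable]: "w \<in> borel_measurable (borel \<Otimes>\<^sub>M borel)" unfolding w_def by measurable
 have w: "dilation_weight p = ennreal (w p)" "w p \<ge> 0" for p :: "real \<times> 'a"
  by (auto simp: w_def dilation_weight_def indicator_def)
 define \<Phi> where "\<Phi> v = (LINT \<rho>:{0<..}|lborel. f (\<rho> *\<^sub>R v) * of_real (\<rho> ^ (?n - 1)))" for v
 have [measurable]: "\<Phi> \<in> Borel" unfolding \<Phi>_def[abs_def] set_lebesgue_integral_def by measurable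
 have "integrable (density lborel (\<lambda>_. ennreal (1 / real ?n))) f" using f by (subst integrable_density) auto
 then have int: "integrable (lborel \<Otimes>\<^sub>M lborel) (\<lambda>p. w p *\<^sub>R f (fst p *\<^sub>R snd p))"
  unfolding distr_dilation[symmetric] w(1) by (subst (asm) integrable_distr_eq) (auto simp: integrable_density w(2) split_beta)
 have "(1 / real ?n) *\<^sub>R (LI x. f x) = (\<integral>x. f x \<partial>density lborel (\<lambda>_. ennreal (1 / real ?n)))"
  by (subst integral_density) auto
 also have "... = (\<integral>p. w p *\<^sub>R f (fst p *\<^sub>R snd p) \<partial>(lborel \<Otimes>\<^sub>M lborel))"
  unfolding distr_dilation[symmetric] w(1) by (subst integral_distr) (auto simp: integral_density w(2) split_beta)
 also have "... = (LI z. (LI s. w (s, z) *\<^sub>R f (s *\<^sub>R z)))"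
 proof -
  have eq: "(\<lambda>p. w p *\<^sub>R f (fst p *\<^sub>R snd p)) = (\<lambda>(s, z). w (s, z) *\<^sub>R f (s *\<^sub>R z))" by auto
  show ?thesis unfolding eq by (rule lborel_pair.integral_snd[OF int[unfolded eq], symmetric])
 qed
 also have "... = (LI z. indicator ?B z *\<^sub>R \<Phi> (z /\<^sub>R norm z))"
 proof (rule Bochner_Integration.integral_cong[OF refl])
  fix z :: 'a
  show "(LI s. w (s, z) *\<^sub>R f (s *\<^sub>R z)) = indicator ?B z *\<^sub>R \<Phi> (z /\<^sub>R norm z)"
  proof (cases "z \<in> ?B")
   case True
   then have z: "norm z > 0" by simp
   have "(LI s. w (s, z) *\<^sub>R f (s *\<^sub>R z)) = \<bar>1 / norm z\<bar> *\<^sub>R (LI \<rho>. w (0 + (1 / norm z) * \<rho>, z) *\<^sub>R f ((0 + (1 / norm z) * \<rho>) *\<^sub>R z))"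
    by (rule lborel_integral_real_affine) (use z in simp)
   also have "... = (LI \<rho>. (1 / norm z) *\<^sub>R (w (0 + (1 / norm z) * \<rho>, z) *\<^sub>R f ((0 + (1 / norm z) * \<rho>) *\<^sub>R z)))"
    unfolding integral_scaleR_right by simp
   also have "... = \<Phi> (z /\<^sub>R norm z)"
    unfolding \<Phi>_def set_lebesgue_integral_def
   proof (rule Bochner_Integration.integral_cong[OF refl])
    fix \<rho> :: real
    have "norm z ^ ?n = norm z * norm z ^ (?n - 1)" by (metis DIM_positive power_minus_mult mult.commute)
    then have "1 / norm z * w (1 / norm z * \<rho>, z) = indicator {0<..} \<rho> * \<rho> ^ (?n - 1)"
     using True z by (simp add: w_def indicator_def power_mult_distrib power_divide zero_less_divide_iff)
    then show "(1 / norm z) *\<^sub>R (w (0 + (1 / norm z) * \<rho>, z) *\<^sub>R f ((0 + (1 / norm z) * \<rho>) *\<^sub>R z))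
     = indicator {0<..} \<rho> *\<^sub>R (f (\<rho> *\<^sub>R (z /\<^sub>R norm z)) * of_real (\<rho> ^ (?n - 1)))"
    proof -
     assume eq: "1 / norm z * w (1 / norm z * \<rho>, z) = indicator {0<..} \<rho> * \<rho> ^ (?n - 1)"
     have "(1 / norm z) *\<^sub>R (w (0 + (1 / norm z) * \<rho>, z) *\<^sub>R f ((0 + (1 / norm z) * \<rho>) *\<^sub>R z))
      = (1 / norm z * w (1 / norm z * \<rho>, z)) *\<^sub>R f (\<rho> *\<^sub>R (z /\<^sub>R norm z))"
      by (simp add: divide_inverse mult.commute)
     then show ?thesis unfolding eq by (simp add: scaleR_conv_of_real mult_ac)
    qed
   qed
   finally show ?thesis using True by simp
  qed (simp add: w_def)
 qed
 finally have eq: "(LI x. f x) = real ?n *\<^sub>R (LI z. indicator ?B z *\<^sub>R \<Phi> (z /\<^sub>R norm z))"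
  by (metis (no_types, lifting) DIM_positive divide_self_if mult.right_neutral nat_less_le of_nat_0_eq_iff scaleR_one scaleR_scaleR times_divide_eq_right)
 have "ennreal (norm (LI z. indicator ?B z *\<^sub>R \<Phi> (z /\<^sub>R norm z))) \<le> (NI z. ennreal (norm (indicator ?B z *\<^sub>R \<Phi> (z /\<^sub>R norm z))))"
 \<comment> \<open>For a non-integrable function the integral is 0 by convention, and the bound is
   trivial.\<close>
 proof (cases "integrable lborel (\<lambda>z. indicator ?B z *\<^sub>R \<Phi> (z /\<^sub>R norm z))")
  case True then show ?thesis by (rule integral_norm_bound_ennreal)
 qed (simp add: not_integrable_integral_eq)
 also have "... = (NI z. indicator ?B z * ennreal (norm (\<Phi> (z /\<^sub>R norm z))))"
  by (intro nn_integral_cong) (auto simp: indicator_def)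
 also have "... \<le> ennreal (cone_constant TYPE('a)) * (\<integral>\<^sup>+w. ennreal (norm (\<Phi> w)) \<partial>sphere_measure)"
  by (rule nn_integral_cone_le) measurable
 finally show ?thesis
  unfolding eq \<Phi>_def[symmetric] norm_scaleR using cone_constant_nonneg[where 'a='a]
  by (simp add: ennreal_mult mult.assoc mult_left_mono)
qed


section \<open>Primitives\<close>

definition seg :: "real => real set" where
 "seg t = {min 0 t..max 0 t}"

text \<open>The oriented integral from 0 to \<open>t\<close>, with the orientation as a factor under
  an integral over the whole line: dependence on \<open>t\<close> is then handled by dominated
  convergence, and both signs of \<open>t\<close> are treated alike.\<close>

definition primitive :: "(real => 'b::{banach, second_countable_topology}) => real => 'b" where
 "primitive f t = (LI s. (if 0 < s \<and> s < t then 1 else if t < s \<and> s < 0 then -1 else 0 :: real) *\<^sub>R f s)"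

lemma primitive_eq_interval: "primitive f t = (LBINT s=ereal 0..ereal t. f s)"
proof (cases "0 \<le> t")
 case True
 then have "primitive f t = (LI s. indicator {0<..<t} s *\<^sub>R f s)"
  unfolding primitive_def by (intro Bochner_Integration.integral_cong) (auto simp: indicator_def)
 moreover have "(LBINT s=ereal 0..ereal t. f s) = (LI s. indicator {0<..<t} s *\<^sub>R f s)"
  unfolding interval_lebesgue_integral_def set_lebesgue_integral_def using True by (simp add: einterval_eq)
 ultimately show ?thesis by simp
next
 case False
 then have "primitive f t = (LI s. - (indicator {t<..<0} s *\<^sub>R f s))"
  unfolding primitive_def by (intro Bochner_Integration.integral_cong) (auto simp: indicator_def)
 moreover have "(LBINT s=ereal 0..ereal t. f s) = - (LI s. indicator {t<..<0} s *\<^sub>R f s)"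
  unfolding interval_lebesgue_integral_def set_lebesgue_integral_def using False by (simp add: einterval_eq)
 ultimately show ?thesis by simp
qed

lemma primitive_0 [simp]: "primitive f 0 = 0"
proof -
 have "(\<lambda>s. (if 0 < s \<and> s < 0 then 1 else if 0 < s \<and> s < 0 then -1 else 0 :: real) *\<^sub>R f s) = (\<lambda>_. 0)"
 proof
  fix s :: real
  have "\<not> (0 < s \<and> s < 0)" by linarith
  then show "(if 0 < s \<and> s < 0 then 1 else if 0 < s \<and> s < 0 then -1 else 0 :: real) *\<^sub>R f s = 0" by auto
 qed
 then show ?thesis unfolding primitive_def by simp
qed

lemma has_vector_derivative_primitive:
 fixes f :: "real => 'b::euclidean_space"
 assumes "continuous_on UNIV f"
 shows "(primitive f has_vector_derivative f t) (at t)"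
proof -
 let ?a = "min 0 t - 1" and ?b = "max 0 t + 1"
 have "((\<lambda>u. LBINT y=ereal 0..ereal u. f y) has_vector_derivative f t) (at t within {?a..?b})"
  by (rule interval_integral_FTC2) (use assms in \<open>auto intro: continuous_on_subset\<close>)
 then have "(primitive f has_vector_derivative f t) (at t within {?a..?b})"
  by (simp add: primitive_eq_interval[abs_def])
 moreover have "at t within {?a..?b} = at t" by (rule at_within_Icc_at) auto
 ultimately show ?thesis by simp
qed

lemma continuous_on_primitive:
 fixes f :: "real => 'b::euclidean_space"
 assumes "continuous_on UNIV f" shows "continuous_on UNIV (primitive f)"
 using has_vector_derivative_primitive[OF assms]
 by (meson continuous_at_imp_continuous_on has_vector_derivative_continuous)

lemma eq_primitive:
 fixes f g :: "real => 'b::euclidean_space"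
 assumes f: "continuous_on UNIV f" and g: "\<And>t. (g has_vector_derivative f t) (at t)"
 shows "g t = g 0 + primitive f t"
proof -
 have "((\<lambda>t. g t - primitive f t) has_vector_derivative 0) (at t within UNIV)" for t
  using has_vector_derivative_diff[OF g has_vector_derivative_primitive[OF f]] by simp
 from has_vector_derivative_zero_constant[OF convex_UNIV this]
 obtain c where c: "\<And>t. g t - primitive f t = c" by auto
 from c[of 0] c[of t] show ?thesis by (simp add: algebra_simps)
qed

lemma set_integrable_seg:
 fixes f :: "real => 'b::euclidean_space"
 assumes "continuous_on UNIV f" shows "set_integrable lborel (seg t) f"
 unfolding seg_def by (rule borel_integrable_atLeastAtMost') (rule continuous_on_subset[OF assms], simp)

lemma norm_primitive_le:
 fixes f :: "real => 'b::euclidean_space"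
 assumes f: "continuous_on UNIV f" and g: "set_integrable lborel (seg t) g"
  and le: "\<And>s. s \<in> seg t ==> norm (f s) \<le> g s"
 shows "norm (primitive f t) \<le> (LINT s:seg t|lborel. g s)"
 unfolding primitive_def set_lebesgue_integral_def
proof (rule Bochner_Integration.integral_norm_bound_integral)
 have [measurable]: "f \<in> Borel" by (rule borel_measurable_continuous_onI[OF f])
 show "integrable lborel (\<lambda>s. indicator (seg t) s *\<^sub>R g s)" using g by (simp add: set_integrable_def)
 show le2: "norm ((if 0 < s \<and> s < t then 1 else if t < s \<and> s < 0 then -1 else 0 :: real) *\<^sub>R f s) \<le> indicator (seg t) s *\<^sub>R g s" for s
  using le[of s] order_trans[OF norm_ge_zero le[of s]] by (auto simp: seg_def indicator_def)
 have "norm ((if 0 < s \<and> s < t then 1 else if t < s \<and> s < 0 then -1 else 0 :: real) *\<^sub>R f s) \<le> norm (indicator (seg t) s *\<^sub>R g s)" for s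
  using order_trans[OF le2[of s] abs_ge_self] by (simp only: real_norm_def)
 then show "integrable lborel (\<lambda>s. (if 0 < s \<and> s < t then 1 else if t < s \<and> s < 0 then -1 else 0 :: real) *\<^sub>R f s)"
  by (intro Bochner_Integration.integrable_bound[OF \<open>integrable lborel (\<lambda>s. indicator (seg t) s *\<^sub>R g s)\<close>] AE_I2) measurable
qed

lemma set_integral_seg_le:
 fixes g :: "real => real"
 assumes "integrable lborel g" "\<And>s. g s \<ge> 0"
 shows "set_integrable lborel (seg t) g" "(LINT s:seg t|lborel. g s) \<le> (LI s. g s)"
proof -
 show i: "set_integrable lborel (seg t) g"
  unfolding set_integrable_def by (rule integrable_mult_indicator) (use assms in \<open>auto simp: seg_def\<close>)
 show "(LINT s:seg t|lborel. g s) \<le> (LI s. g s)"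
  unfolding set_lebesgue_integral_def
  by (rule integral_mono) (use i assms in \<open>auto simp: set_integrable_def indicator_def\<close>)
qed

lemma norm_primitive_le_integral:
 fixes f :: "real => 'b::euclidean_space"
 assumes "continuous_on UNIV f" "integrable lborel g" "\<And>s. norm (f s) \<le> g s"
 shows "norm (primitive f t) \<le> (LI s. g s)"
proof -
 have g: "g s \<ge> 0" for s using assms(3)[of s] norm_ge_zero[of "f s"] by linarith
 show ?thesis
  by (rule order_trans[OF norm_primitive_le[OF assms(1) set_integral_seg_le(1)[OF assms(2) g] assms(3)] set_integral_seg_le(2)[OF assms(2) g]])
qed

text \<open>The orientation factor converges for every \<open>s\<close> other than the limiting
  time, a null set, and \<open>k\<close> dominates. Joint continuity is what makes the amplitudes
  Borel in time and frequency together.\<close>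

lemma continuous_on_primitive_param:
 fixes g :: "real \<times> real => complex"
 assumes g: "continuous_on UNIV g" and k: "integrable lborel k" and le: "\<And>s r. norm (g (s, r)) \<le> k s"
 shows "continuous_on UNIV (\<lambda>(t, r). primitive (\<lambda>s. g (s, r)) t)"
proof (rule continuous_on_sequentiallyI)
 fix x :: "nat => real \<times> real" and a assume "x \<longlonglongrightarrow> a"
 then have x: "(\<lambda>n. fst (x n)) \<longlonglongrightarrow> fst a" "(\<lambda>n. snd (x n)) \<longlonglongrightarrow> snd a" by (auto intro: tendsto_fst tendsto_snd)
 let ?J = "\<lambda>t s. (if 0 < s \<and> s < t then 1 else if t < s \<and> s < 0 then -1 else 0 :: real)"
 have [measurable]: "(\<lambda>s. g (s, r)) \<in> Borel" for r
  by (intro borel_measurable_continuous_onI continuous_on_compose2[OF g] continuous_intros) auto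
 have "(\<lambda>n. \<integral>s. ?J (fst (x n)) s *\<^sub>R g (s, snd (x n)) \<partial>lborel) \<longlonglongrightarrow> (LI s. ?J (fst a) s *\<^sub>R g (s, snd a))"
 proof (rule integral_dominated_convergence[where w = k])
  show "AE s in lborel. (\<lambda>n. ?J (fst (x n)) s *\<^sub>R g (s, snd (x n))) \<longlonglongrightarrow> ?J (fst a) s *\<^sub>R g (s, snd a)"
   using AE_lborel_singleton[of "fst a"]
  proof eventually_elim
   case (elim s)
   have "\<forall>\<^sub>F n in sequentially. ?J (fst (x n)) s = ?J (fst a) s"
   proof (cases "s < fst a")
    case True
    from order_tendstoD(1)[OF x(1) this] show ?thesis by eventually_elim (use True in auto)
   next
    case False
    then have "fst a < s" using elim by simp
    from order_tendstoD(2)[OF x(1) this] show ?thesis by eventually_elim (use False elim in auto)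
   qed
   then have "(\<lambda>n. ?J (fst (x n)) s) \<longlonglongrightarrow> ?J (fst a) s" by (rule tendsto_eventually)
   moreover have "(\<lambda>n. g (s, snd (x n))) \<longlonglongrightarrow> g (s, snd a)"
    by (rule continuous_on_tendsto_compose[OF g]) (use x in \<open>auto intro: tendsto_intros\<close>)
   ultimately show ?case by (rule tendsto_scaleR)
  qed
  show "AE s in lborel. norm (?J (fst (x n)) s *\<^sub>R g (s, snd (x n))) \<le> k s" for n
   using le order_trans[OF norm_ge_zero le] by (intro AE_I2) auto
 qed (use k in auto)
 then show "(\<lambda>n. (case x n of (t, r) => primitive (\<lambda>s. g (s, r)) t)) \<longlonglongrightarrow> (case a of (t, r) => primitive (\<lambda>s. g (s, r)) t)"
  by (simp add: primitive_def split_beta)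
qed

section \<open>Amplitudes of the oscillator\<close>

text \<open>In the variables of slowly varying amplitude, the oscillator with a time-dependent speed becomes
 a system whose coefficients are bounded by the logarithmic derivative of the speed, uniformly in the
 frequency. As that is small in mean, the integral equation is a contraction on all of time.\<close>

lemma amplitude_exists:
 fixes \<kappa> l :: "real => real"
 assumes \<kappa>: "continuous_on UNIV \<kappa>" "integrable lborel \<kappa>" "(LI s. \<bar>\<kappa> s\<bar>) \<le> 1 / 2"
  and l: "continuous_on UNIV l"
 shows "\<exists>d \<gamma> :: real => real => complex.
  continuous_on UNIV (\<lambda>(t, r). d t r) \<and> continuous_on UNIV (\<lambda>(t, r). \<gamma> t r) \<and>
  (\<forall>t r. norm (d t r) \<le> 2 \<and> norm (\<gamma> t r) \<le> 2 \<and>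
   ((\<lambda>t. d t r) has_vector_derivative of_real (\<kappa> t / 2) * cis (2 * r * l t) * \<gamma> t r) (at t) \<and>
   ((\<lambda>t. \<gamma> t r) has_vector_derivative of_real (\<kappa> t / 2) * cis (- (2 * r * l t)) * d t r) (at t)) \<and>
  (\<forall>r. d 0 r = 1 \<and> \<gamma> 0 r = 0)"
proof -
 define e where "e w s r = of_real (\<kappa> s / 2) * cis (w * (2 * r * l s))" for w s r :: real
 have e: "continuous_on UNIV (\<lambda>(s, r). e w s r)" for w
  unfolding e_def cis_conv_exp split_beta
  by (intro continuous_intros continuous_on_compose2[OF \<kappa>(1)] continuous_on_compose2[OF l]) auto
 have ne: "norm (e w s r) = \<bar>\<kappa> s\<bar> / 2" for w s r by (simp add: e_def norm_mult)
 define A where "A w f = (\<lambda>(t, r). primitive (\<lambda>s. e w s r * f (s, r)) t)" for w :: real and f :: "real \<times> real => complex"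
 have cont1: "continuous_on UNIV (\<lambda>(s, r). e w s r * f (s, r))" if "continuous_on UNIV f" for w f
  unfolding split_beta by (intro continuous_intros continuous_on_compose2[OF that] continuous_on_compose2[OF e, of _ "\<lambda>x. x", unfolded split_beta]) auto
 have cont2: "continuous_on UNIV (\<lambda>s. e w s r * f (s, r))" if "continuous_on UNIV f" for w r f
 proof -
  have "continuous_on UNIV (\<lambda>s. (s, r))" by (intro continuous_intros)
  from continuous_on_compose2[OF cont1[OF that, of w] this] show ?thesis by simp
 qed
 \<comment> \<open>The kernel carries \<open>\<kappa> / 2\<close> and the mean of
   \<open>\<bar>\<kappa>\<bar>\<close> is at most 1/2, so each of the two integral operators has
   norm at most 1/4, whatever the frequency.\<close>
 have ki: "integrable lborel (\<lambda>s. \<bar>\<kappa> s\<bar> / 2 * M)" for M using \<kappa>(2) by simp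
 have kM: "(LI s. \<bar>\<kappa> s\<bar> / 2 * M) \<le> M / 4" if "M \<ge> 0" for M
  using mult_right_mono[OF \<kappa>(3), of "M / 2"] that by simp
 have A_cont: "continuous_on UNIV (A w f)" if "continuous_on UNIV f" "\<And>x. norm (f x) \<le> M" for w f M
  unfolding A_def using continuous_on_primitive_param[OF cont1[OF that(1), of w] ki[of M]]
  by (simp add: norm_mult ne mult_left_mono that(2))
 have A_bound: "norm (A w f x) \<le> M / 4" if f: "continuous_on UNIV f" "\<And>x. norm (f x) \<le> M" for w f M x
 proof -
  have "M \<ge> 0" using order_trans[OF norm_ge_zero f(2)] .
  have "norm (A w f x) \<le> (LI s. \<bar>\<kappa> s\<bar> / 2 * M)"
   unfolding A_def split_beta
   by (rule norm_primitive_le_integral[OF cont2[OF f(1)] ki]) (simp add: norm_mult ne mult_left_mono f(2))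
  then show ?thesis using kM[OF \<open>M \<ge> 0\<close>] by linarith
 qed
 have A_diff: "A w f x - A w g x = A w (\<lambda>x. f x - g x) x" if "continuous_on UNIV f" "continuous_on UNIV g" for w f g x
 proof -
  let ?f = "\<lambda>s. e w s (snd x) * f (s, snd x)" and ?g = "\<lambda>s. e w s (snd x) * g (s, snd x)"
  have fg: "continuous_on UNIV (\<lambda>x. f x - g x)" by (intro continuous_intros that)
  have "((\<lambda>t. primitive ?f t - primitive ?g t) has_vector_derivative ?f t - ?g t) (at t)" for t
   by (intro has_vector_derivative_diff has_vector_derivative_primitive cont2 that)
  then have "((\<lambda>t. primitive ?f t - primitive ?g t) has_vector_derivative e w t (snd x) * (f (t, snd x) - g (t, snd x))) (at t)" for t
   by (simp add: right_diff_distrib)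
  from eq_primitive[OF cont2[OF fg] this, of "fst x"] show ?thesis by (simp add: A_def split_beta)
 qed
 \<comment> \<open>The integral equation for both amplitudes on the space of bounded continuous
   functions of time and frequency. A pair is bounded by the sum of its components, so the
   contraction constant is 1/4 + 1/4.\<close>
 define \<Gamma> where "\<Gamma> u = Bcontfun (\<lambda>x. (1 + A 1 (\<lambda>x. snd (apply_bcontfun u x)) x, A (-1) (\<lambda>x. fst (apply_bcontfun u x)) x))"
  for u :: "(real \<times> real) \<Rightarrow>\<^sub>C (complex \<times> complex)"
 have cu: "continuous_on UNIV (\<lambda>x. fst (apply_bcontfun u x))" "continuous_on UNIV (\<lambda>x. snd (apply_bcontfun u x))" for u :: "(real \<times> real) \<Rightarrow>\<^sub>C (complex \<times> complex)"
  by (intro continuous_intros continuous_on_apply_bcontfun)+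
 have nu: "norm (fst (apply_bcontfun u x)) \<le> norm u" "norm (snd (apply_bcontfun u x)) \<le> norm u" for u :: "(real \<times> real) \<Rightarrow>\<^sub>C (complex \<times> complex)" and x
  using norm_bounded[of u x] norm_fst_le[of "fst (apply_bcontfun u x)" "snd (apply_bcontfun u x)"]
   norm_snd_le[of "snd (apply_bcontfun u x)" "fst (apply_bcontfun u x)"] by auto
 have \<Gamma>: "apply_bcontfun (\<Gamma> u) x = (1 + A 1 (\<lambda>x. snd (apply_bcontfun u x)) x, A (-1) (\<lambda>x. fst (apply_bcontfun u x)) x)" for u x
 proof -
  have "(\<lambda>x. (1 + A 1 (\<lambda>x. snd (apply_bcontfun u x)) x, A (-1) (\<lambda>x. fst (apply_bcontfun u x)) x)) \<in> bcontfun"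
  proof (rule bcontfun_normI)
   show "continuous_on UNIV (\<lambda>x. (1 + A 1 (\<lambda>x. snd (apply_bcontfun u x)) x, A (-1) (\<lambda>x. fst (apply_bcontfun u x)) x))"
    by (intro continuous_on_Pair continuous_on_add continuous_on_const A_cont[OF cu(1) nu(1)] A_cont[OF cu(2) nu(2)])
   show "norm (1 + A 1 (\<lambda>x. snd (apply_bcontfun u x)) x, A (-1) (\<lambda>x. fst (apply_bcontfun u x)) x) \<le> (1 + norm u / 4) + norm u / 4" for x
    by (intro order_trans[OF norm_Pair_le] add_mono order_trans[OF norm_triangle_ineq] A_bound[OF cu(1) nu(1)] A_bound[OF cu(2) nu(2)]) simp
  qed
  then show ?thesis unfolding \<Gamma>_def by (simp add: Bcontfun_inverse)
 qed
 have "dist (\<Gamma> u) (\<Gamma> v) \<le> 1 / 2 * dist u v" for u v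
 proof (rule dist_bound)
  fix x
  have "norm (A 1 (\<lambda>x. snd (apply_bcontfun u x) - snd (apply_bcontfun v x)) x) \<le> dist u v / 4"
   by (rule A_bound) (auto intro!: continuous_intros cu order_trans[OF dist_snd_le dist_bounded] simp flip: dist_norm)
  moreover have "norm (A (-1) (\<lambda>x. fst (apply_bcontfun u x) - fst (apply_bcontfun v x)) x) \<le> dist u v / 4"
   by (rule A_bound) (auto intro!: continuous_intros cu order_trans[OF dist_fst_le dist_bounded] simp flip: dist_norm)
  ultimately have "norm (A 1 (\<lambda>x. snd (apply_bcontfun u x) - snd (apply_bcontfun v x)) x, A (-1) (\<lambda>x. fst (apply_bcontfun u x) - fst (apply_bcontfun v x)) x) \<le> dist u v / 4 + dist u v / 4"
   by (intro order_trans[OF norm_Pair_le] add_mono)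
  then show "dist (apply_bcontfun (\<Gamma> u) x) (apply_bcontfun (\<Gamma> v) x) \<le> 1 / 2 * dist u v"
   unfolding \<Gamma> dist_norm by (simp add: A_diff cu)
 qed
 then obtain u where u: "\<Gamma> u = u" using banach_fix_type[of "1/2" \<Gamma>] by auto
 define d where "d t r = fst (apply_bcontfun u (t, r))" for t r
 define \<gamma> where "\<gamma> t r = snd (apply_bcontfun u (t, r))" for t r
 have d: "d t r = 1 + primitive (\<lambda>s. e 1 s r * \<gamma> s r) t" and \<gamma>: "\<gamma> t r = primitive (\<lambda>s. e (-1) s r * d s r) t" for t r
  using \<Gamma>[of u "(t, r)"] unfolding u d_def \<gamma>_def by (simp_all add: A_def)
 \<comment> \<open>The fixed point equation bounds its own solution: half of \<open>norm u\<close>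
   is absorbed, which leaves the bound 2.\<close>
 have "norm u \<le> 1 + norm u / 4 + norm u / 4"
 proof (rule norm_bound)
  fix x
  have "norm (1 + A 1 (\<lambda>x. snd (apply_bcontfun u x)) x, A (-1) (\<lambda>x. fst (apply_bcontfun u x)) x) \<le> (1 + norm u / 4) + norm u / 4"
   by (intro order_trans[OF norm_Pair_le] add_mono order_trans[OF norm_triangle_ineq] A_bound[OF cu(1) nu(1)] A_bound[OF cu(2) nu(2)]) simp
  then show "norm (apply_bcontfun u x) \<le> 1 + norm u / 4 + norm u / 4" using \<Gamma>[of u x] u by simp
 qed
 then have nu2: "norm u \<le> 2" by simp
 have c: "continuous_on UNIV (\<lambda>(t, r). d t r)" "continuous_on UNIV (\<lambda>(t, r). \<gamma> t r)"
  using cu[of u] by (simp_all add: d_def \<gamma>_def split_beta)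
 have b: "norm (d t r) \<le> 2" "norm (\<gamma> t r) \<le> 2" for t r
  using nu[of u "(t, r)"] nu2 by (auto simp: d_def \<gamma>_def)
 have d1: "((\<lambda>t. d t r) has_vector_derivative of_real (\<kappa> t / 2) * cis (2 * r * l t) * \<gamma> t r) (at t)" for t r
  unfolding d[abs_def] using has_vector_derivative_add[OF has_vector_derivative_const[of 1] has_vector_derivative_primitive[OF cont2[OF cu(2)[of u], of 1 r]]]
  by (simp add: \<gamma>_def e_def)
 have d2: "((\<lambda>t. \<gamma> t r) has_vector_derivative of_real (\<kappa> t / 2) * cis (- (2 * r * l t)) * d t r) (at t)" for t r
  unfolding \<gamma>[abs_def] using has_vector_derivative_primitive[OF cont2[OF cu(1)[of u], of "-1" r]]
  by (simp add: d_def e_def)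
 have z: "d 0 r = 1" "\<gamma> 0 r = 0" for r by (simp_all add: d[of 0] \<gamma>[of 0])
 show ?thesis by (intro exI[of _ d] exI[of _ \<gamma>] conjI allI c b d1 d2 z)
qed

section \<open>Integrability in time\<close>

lemma nn_integral_lborel_shift:
 fixes f :: "real => ennreal"
 assumes [measurable]: "f \<in> Borel"
 shows "(NI x. f (x + t)) = (NI x. f x)" "(NI x. f (- x)) = (NI x. f x)"
 using nn_integral_real_affine[of f 1 t] nn_integral_real_affine[of f "-1" 0] by (simp_all add: add.commute)

text \<open>The window \<open>\<bar>r\<bar> \<le> L - 2 \<bar>d t\<bar>\<close> shrinks exactly as fast as the arguments below are shifted, so
 a bound on the truncated integrals, which are finite, closes without any a priori integrability.\<close>

lemma window_bound:
 fixes A B :: "real => real => ennreal" and d :: "real => real" and k :: "real => ennreal"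
 assumes [measurable]: "(\<lambda>(s, r). A s r) \<in> borel_measurable (borel \<Otimes>\<^sub>M borel)" "(\<lambda>(s, r). B s r) \<in> borel_measurable (borel \<Otimes>\<^sub>M borel)"
  "d \<in> Borel" "k \<in> Borel" "A0 \<in> Borel" "B0 \<in> Borel"
  and d: "\<And>s t. s \<in> seg t ==> \<bar>d t - d s\<bar> + \<bar>d s\<bar> \<le> \<bar>d t\<bar>"
  and A: "\<And>t r. A t r \<le> A0 r + (NI s. indicator (seg t) s * k s * (B s r + B s (- r)))"
  and B: "\<And>t r. 2 * B t r \<le> 2 * B0 (r - 2 * d t) + (NI s. indicator (seg t) s * k s * A s (r + 2 * d s - 2 * d t))"
  and M: "\<And>t r. A t r \<le> ennreal M" "\<And>t r. B t r \<le> ennreal M"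
  and N: "(NI r. A0 r) \<le> ennreal N" "(NI r. B0 r) \<le> ennreal N" "N \<ge> 0"
  and k: "(NI s. k s) \<le> ennreal (1 / 4)"
 shows "(NI r. A t r) \<le> ennreal (4 * N)"
proof -
 have [measurable]: "seg t \<in> sets borel" for t by (simp add: seg_def)
 \<comment> \<open>The combination \<open>A + 2 B\<close> closes up: \<open>B\<close> enters the
   bound for \<open>A\<close> twice, at \<open>r\<close> and at \<open>- r\<close>, and
   \<open>A\<close> enters the bound for \<open>2 B\<close> once.\<close>
 define n where "n L t = (NI r. indicator {r. \<bar>r\<bar> \<le> L - 2 * \<bar>d t\<bar>} r * (A t r + 2 * B t r))" for L t
 have nL: "n L t \<le> ennreal (3 * N) + (NI s. indicator (seg t) s * k s * n L s)" for L t
 proof -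
  let ?i = "\<lambda>t r. indicator {r. \<bar>r\<bar> \<le> L - 2 * \<bar>d t\<bar>} r :: ennreal"
  have "n L t \<le> (NI r. (A0 r + 2 * B0 (r - 2 * d t)) + (NI s. indicator (seg t) s * k s * (?i t r * (B s r + B s (- r)) + ?i t r * A s (r + 2 * d s - 2 * d t))))"
   unfolding n_def
  proof (rule nn_integral_mono)
   fix r
   have "?i t r * (A t r + 2 * B t r) \<le> ?i t r * ((A0 r + (NI s. indicator (seg t) s * k s * (B s r + B s (- r)))) + (2 * B0 (r - 2 * d t) + (NI s. indicator (seg t) s * k s * A s (r + 2 * d s - 2 * d t))))"
    by (intro mult_left_mono add_mono A B) simp
   also have "... \<le> (A0 r + 2 * B0 (r - 2 * d t)) + (?i t r * (NI s. indicator (seg t) s * k s * (B s r + B s (- r))) + ?i t r * (NI s. indicator (seg t) s * k s * A s (r + 2 * d s - 2 * d t)))"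
    by (cases "\<bar>r\<bar> \<le> L - 2 * \<bar>d t\<bar>") (simp_all add: add_ac)
   also have "?i t r * (NI s. indicator (seg t) s * k s * (B s r + B s (- r))) + ?i t r * (NI s. indicator (seg t) s * k s * A s (r + 2 * d s - 2 * d t))
    = (NI s. indicator (seg t) s * k s * (?i t r * (B s r + B s (- r)) + ?i t r * A s (r + 2 * d s - 2 * d t)))"
   proof (cases "\<bar>r\<bar> \<le> L - 2 * \<bar>d t\<bar>")
    case True
    have "(NI s. indicator (seg t) s * k s * (B s r + B s (- r))) + (NI s. indicator (seg t) s * k s * A s (r + 2 * d s - 2 * d t))
     = (NI s. indicator (seg t) s * k s * (B s r + B s (- r)) + indicator (seg t) s * k s * A s (r + 2 * d s - 2 * d t))"
     by (rule nn_integral_add[symmetric]) measurable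
    then show ?thesis using True by (simp add: distrib_left[of "indicator (seg t) _ * k _"])
   qed simp
   finally show "?i t r * (A t r + 2 * B t r) \<le> (A0 r + 2 * B0 (r - 2 * d t)) + (NI s. indicator (seg t) s * k s * (?i t r * (B s r + B s (- r)) + ?i t r * A s (r + 2 * d s - 2 * d t)))" .
  qed
  also have "... = (NI r. A0 r + 2 * B0 (r - 2 * d t)) + (\<integral>\<^sup>+r. \<integral>\<^sup>+s. indicator (seg t) s * k s * (?i t r * (B s r + B s (- r)) + ?i t r * A s (r + 2 * d s - 2 * d t)) \<partial>lborel \<partial>lborel)"
   by (rule nn_integral_add) measurable
  also have "(\<integral>\<^sup>+r. \<integral>\<^sup>+s. indicator (seg t) s * k s * (?i t r * (B s r + B s (- r)) + ?i t r * A s (r + 2 * d s - 2 * d t)) \<partial>lborel \<partial>lborel)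
   = (\<integral>\<^sup>+s. \<integral>\<^sup>+r. indicator (seg t) s * k s * (?i t r * (B s r + B s (- r)) + ?i t r * A s (r + 2 * d s - 2 * d t)) \<partial>lborel \<partial>lborel)"
   by (rule lborel_pair.Fubini') measurable
  also have "(NI r. A0 r + 2 * B0 (r - 2 * d t)) \<le> ennreal (3 * N)"
  proof -
   have "(NI r. A0 r + 2 * B0 (r - 2 * d t)) = (NI r. A0 r) + 2 * (NI r. B0 (r - 2 * d t))"
    by (simp add: nn_integral_add nn_integral_cmult)
   also have "(NI r. B0 (r - 2 * d t)) = (NI r. B0 r)"
    using nn_integral_lborel_shift(1)[of B0 "- 2 * d t"] by simp
   also have "(NI r. A0 r) + 2 * (NI r. B0 r) \<le> ennreal N + 2 * ennreal N"
    by (intro add_mono mult_left_mono N) simp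
   also have "... = ennreal N + ennreal (2 * N)" using ennreal_mult[of 2 N] N(3) by simp
   also have "... = ennreal (3 * N)" using N(3) by (subst ennreal_plus[symmetric]) auto
   finally show ?thesis .
  qed
  also have "(\<integral>\<^sup>+s. \<integral>\<^sup>+r. indicator (seg t) s * k s * (?i t r * (B s r + B s (- r)) + ?i t r * A s (r + 2 * d s - 2 * d t)) \<partial>lborel \<partial>lborel) \<le> (NI s. indicator (seg t) s * k s * n L s)"
  proof (rule nn_integral_mono)
   fix s
   show "(NI r. indicator (seg t) s * k s * (?i t r * (B s r + B s (- r)) + ?i t r * A s (r + 2 * d s - 2 * d t))) \<le> indicator (seg t) s * k s * n L s"
   proof (cases "s \<in> seg t")
    case True
    \<comment> \<open>If \<open>\<bar>r\<bar> <= L - 2 \<bar>d t\<bar>\<close> then both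
      \<open>r\<close> and \<open>r + 2 (d s - d t)\<close> lie in the window of time
      \<open>s\<close>.\<close>
    note th = d[OF True]
    have i1: "?i t r \<le> ?i s r" for r using th by (auto simp: indicator_def)
    have i2: "?i t r \<le> ?i s (r + (2 * d s - 2 * d t))" for r using th by (auto simp: indicator_def)
    have "(NI r. ?i t r * (B s r + B s (- r)) + ?i t r * A s (r + 2 * d s - 2 * d t))
     \<le> (NI r. (?i s r * B s r + ?i s (- r) * B s (- r)) + ?i s (r + (2 * d s - 2 * d t)) * A s (r + (2 * d s - 2 * d t)))"
    proof (rule nn_integral_mono, rule add_mono)
     fix r
     have "?i t r * (B s r + B s (- r)) = ?i t r * B s r + ?i t (- r) * B s (- r)" by (simp add: distrib_left indicator_def)
     also have "... \<le> ?i s r * B s r + ?i s (- r) * B s (- r)" by (intro add_mono mult_right_mono i1) auto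
     finally show "?i t r * (B s r + B s (- r)) \<le> ?i s r * B s r + ?i s (- r) * B s (- r)" .
     have "?i t r * A s (r + (2 * d s - 2 * d t)) \<le> ?i s (r + (2 * d s - 2 * d t)) * A s (r + (2 * d s - 2 * d t))"
      by (intro mult_right_mono i2) auto
     then show "?i t r * A s (r + 2 * d s - 2 * d t) \<le> ?i s (r + (2 * d s - 2 * d t)) * A s (r + (2 * d s - 2 * d t))"
      by (simp add: add_diff_eq)
    qed
    also have "... = n L s"
    proof -
     define P where "P r = ?i s r * B s r" for r
     define Q where "Q r = ?i s r * A s r" for r
     have [measurable]: "P \<in> Borel" "Q \<in> Borel"
      unfolding P_def[abs_def] Q_def[abs_def] by measurable
     have "(NI r. (P r + P (- r)) + Q (r + (2 * d s - 2 * d t)))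
      = ((NI r. P r) + (NI r. P (- r))) + (NI r. Q (r + (2 * d s - 2 * d t)))"
      by (simp add: nn_integral_add)
     also have "... = (NI r. Q r) + 2 * (NI r. P r)"
      by (simp only: nn_integral_lborel_shift \<open>P \<in> _\<close> \<open>Q \<in> _\<close> mult_2 add.commute)
     also have "... = (NI r. Q r + 2 * P r)" by (simp add: nn_integral_add nn_integral_cmult)
     also have "... = n L s" unfolding n_def P_def Q_def by (intro nn_integral_cong) (simp add: distrib_left mult.left_commute)
     finally show ?thesis unfolding P_def Q_def .
    qed
    finally have le: "(NI r. ?i t r * (B s r + B s (- r)) + ?i t r * A s (r + 2 * d s - 2 * d t)) \<le> n L s" .
    show ?thesis by (subst nn_integral_cmult, measurable) (rule mult_left_mono[OF le], simp)
   qed simp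
  qed
  finally show ?thesis by (simp add: add_mono)
 qed
 have n4: "n L t \<le> ennreal (4 * N)" for L t
 proof -
  \<comment> \<open>The supremum over all times is finite because the window is bounded and
    \<open>M\<close> bounds the integrand. Hence \<open>\<Sigma> <= 3 N + \<Sigma> / 4\<close> may
    be solved for \<open>\<Sigma>\<close>, and \<open>M\<close> drops out of the result.\<close>
  define \<Sigma> where "\<Sigma> = (SUP t. n L t)"
  have "n L t \<le> ennreal (3 * \<bar>M\<bar> * (2 * \<bar>L\<bar>))" for t
  proof -
   have "n L t \<le> (NI r. ennreal (3 * \<bar>M\<bar>) * indicator {- \<bar>L\<bar>..\<bar>L\<bar>} r)"
    unfolding n_def
   proof (rule nn_integral_mono)
    fix r
    have "A t r + 2 * B t r \<le> ennreal \<bar>M\<bar> + 2 * ennreal \<bar>M\<bar>"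
     by (intro add_mono mult_left_mono order_trans[OF M(1)] order_trans[OF M(2)] ennreal_leI) auto
    also have "... = ennreal \<bar>M\<bar> + ennreal (2 * \<bar>M\<bar>)" using ennreal_mult[of 2 "\<bar>M\<bar>"] by simp
    also have "... = ennreal (3 * \<bar>M\<bar>)" by (subst ennreal_plus[symmetric]) auto
    finally show "indicator {r. \<bar>r\<bar> \<le> L - 2 * \<bar>d t\<bar>} r * (A t r + 2 * B t r) \<le> ennreal (3 * \<bar>M\<bar>) * indicator {- \<bar>L\<bar>..\<bar>L\<bar>} r"
     by (auto simp: indicator_def)
   qed
   also have "... = ennreal (3 * \<bar>M\<bar> * (2 * \<bar>L\<bar>))"
    by (subst nn_integral_cmult_indicator) (auto simp: ennreal_mult[symmetric])
   finally show ?thesis .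
  qed
  then have "\<Sigma> \<le> ennreal (3 * \<bar>M\<bar> * (2 * \<bar>L\<bar>))" unfolding \<Sigma>_def by (auto intro: SUP_least)
  then obtain w where w: "\<Sigma> = ennreal w" "w \<ge> 0" by (cases \<Sigma>) (auto simp: top_unique)
  have "n L t \<le> ennreal (3 * N) + ennreal (1/4) * \<Sigma>" for t
  proof -
   have "(NI s. indicator (seg t) s * k s * n L s) \<le> (NI s. k s * \<Sigma>)"
    by (rule nn_integral_mono) (auto simp: \<Sigma>_def indicator_def intro!: mult_left_mono SUP_upper)
   also have "... = (NI s. k s) * \<Sigma>" by (rule nn_integral_multc) measurable
   also have "... \<le> ennreal (1/4) * \<Sigma>" by (rule mult_right_mono[OF k]) simp
   finally show ?thesis using nL[of L t] by (meson add_left_mono order_trans)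
  qed
  then have "\<Sigma> \<le> ennreal (3 * N) + ennreal (1/4) * \<Sigma>" unfolding \<Sigma>_def by (auto intro: SUP_least)
  then have "ennreal w \<le> ennreal (3 * N + w / 4)"
   using w N(3) unfolding w(1) by (simp add: ennreal_mult[symmetric] ennreal_plus[symmetric] del: ennreal_plus)
  then have "w \<le> 3 * N + w / 4" using w(2) N(3) by (subst (asm) ennreal_le_iff) auto
  then have "w \<le> 4 * N" by linarith
  then have "\<Sigma> \<le> ennreal (4 * N)" unfolding w(1) by (rule ennreal_leI)
  moreover have "n L t \<le> \<Sigma>" unfolding \<Sigma>_def by (rule SUP_upper) simp
  ultimately show ?thesis by simp
 qed
 show ?thesis
 proof (rule nn_integral_le_of_tendsto)
  show "AE r in lborel. (\<lambda>j. indicator {r. \<bar>r\<bar> \<le> real j} r * A t r) \<longlonglongrightarrow> A t r"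
  proof (intro AE_I2 tendsto_eventually)
   fix r :: real
   show "\<forall>\<^sub>F j in sequentially. indicator {r. \<bar>r\<bar> \<le> real j} r * A t r = A t r"
    using eventually_ge_at_top[of "nat \<lceil>\<bar>r\<bar>\<rceil>"] by eventually_elim (auto simp: indicator_def nat_ceiling_le_eq)
  qed
  show "\<forall>\<^sub>F j in sequentially. (NI r. indicator {r. \<bar>r\<bar> \<le> real j} r * A t r) \<le> ennreal (4 * N)"
  proof (intro always_eventually allI)
   fix j
   have "(NI r. indicator {r. \<bar>r\<bar> \<le> real j} r * A t r) \<le> n (real j + 2 * \<bar>d t\<bar>) t"
    unfolding n_def
   proof (rule nn_integral_mono)
    fix r
    have "A t r + 0 \<le> A t r + 2 * B t r" by (rule add_left_mono) simp
    then have "A t r \<le> A t r + 2 * B t r" by simp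
    then show "indicator {r. \<bar>r\<bar> \<le> real j} r * A t r \<le> indicator {r. \<bar>r\<bar> \<le> real j + 2 * \<bar>d t\<bar> - 2 * \<bar>d t\<bar>} r * (A t r + 2 * B t r)"
     by (simp add: mult_left_mono)
   qed
   then show "(NI r. indicator {r. \<bar>r\<bar> \<le> real j} r * A t r) \<le> ennreal (4 * N)" using n4 order_trans by blast
  qed
 qed measurable
qed

text \<open>The map from \<open>t\<close> to \<open>2 * d t\<close> has derivative at least 1, so
  integrating over time costs no more than integrating over the argument. This is how bounds in
  \<open>r\<close> become bounds in time.\<close>

lemma nn_integral_speed_substitution:
 fixes c d :: "real => real" and g :: "real => ennreal"
 assumes c: "continuous_on UNIV c" "\<And>t. c t \<ge> 1 / 2" and d: "\<And>t. (d has_vector_derivative c t) (at t)"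
  and [measurable]: "g \<in> Borel"
 shows "(NI t. g (a - 2 * d t)) \<le> (NI x. g x)"
proof (rule nn_integral_le_of_tendsto)
 have "continuous_on UNIV d"
  using d by (meson continuous_at_imp_continuous_on has_vector_derivative_continuous)
 then have [measurable]: "d \<in> Borel" by (rule borel_measurable_continuous_onI)
 show "(\<lambda>t. g (a - 2 * d t) * indicator {- real (Suc j)..real (Suc j)} t) \<in> borel_measurable lborel" for j by measurable
 show "AE t in lborel. (\<lambda>j. g (a - 2 * d t) * indicator {- real (Suc j)..real (Suc j)} t) \<longlonglongrightarrow> g (a - 2 * d t)"
 proof (intro AE_I2 tendsto_eventually)
  fix t :: real
  show "\<forall>\<^sub>F j in sequentially. g (a - 2 * d t) * indicator {- real (Suc j)..real (Suc j)} t = g (a - 2 * d t)"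
   using eventually_ge_at_top[of "nat \<lceil>\<bar>t\<bar>\<rceil>"]
  proof eventually_elim
   case (elim j)
   then have "\<bar>t\<bar> \<le> real j" by (simp add: nat_ceiling_le_eq)
   then show ?case by (auto simp: indicator_def abs_le_iff)
  qed
 qed
 show "\<forall>\<^sub>F j in sequentially. (NI t. g (a - 2 * d t) * indicator {- real (Suc j)..real (Suc j)} t) \<le> (NI x. g x)"
 proof (intro always_eventually allI)
  fix j
  let ?I = "{- real (Suc j)..real (Suc j)}"
  have "(NI t. g (a - 2 * d t) * indicator ?I t) \<le> (NI t. g (- (- a + 2 * d t)) * ennreal (2 * c t) * indicator ?I t)"
  proof (rule nn_integral_mono)
   fix t
   have "1 \<le> ennreal (2 * c t)" using c(2)[of t] by (simp add: ennreal_ge_1)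
   then have "g (a - 2 * d t) * 1 \<le> g (a - 2 * d t) * ennreal (2 * c t)" by (rule mult_left_mono) simp
   then show "g (a - 2 * d t) * indicator ?I t \<le> g (- (- a + 2 * d t)) * ennreal (2 * c t) * indicator ?I t"
    by (simp add: mult_right_mono)
  qed
  also have "... = (NI x. g (- x) * indicator {- a + 2 * d (- real (Suc j))..- a + 2 * d (real (Suc j))} x)"
  proof (rule nn_integral_substitution_aux[symmetric, where f = "\<lambda>x. g (- x)" and g = "\<lambda>t. - a + 2 * d t"])
   show "((\<lambda>t. - a + 2 * d t) has_real_derivative 2 * c t) (at t)" for t
    using d[of t] by (auto intro!: derivative_eq_intros simp: has_real_derivative_iff_has_vector_derivative)
   show "continuous_on ?I (\<lambda>t. 2 * c t)" by (intro continuous_intros continuous_on_subset[OF c(1)]) simp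
   show "2 * c t \<ge> 0" for t using c(2)[of t] by linarith
  qed simp_all
  also have "... \<le> (NI x. g (- x))" by (rule nn_integral_mono) (simp add: indicator_def)
  also have "... = (NI x. g x)" by (rule nn_integral_lborel_shift(2)) simp
  finally show "(NI t. g (a - 2 * d t) * indicator ?I t) \<le> (NI x. g x)" .
 qed
qed


section \<open>Integrals depending on time\<close>

lemma continuous_on_integral:
 fixes f :: "real => 'a::euclidean_space => complex"
 assumes "\<And>t. f t \<in> Borel" "\<And>z. continuous_on UNIV (\<lambda>t. f t z)"
  and "integrable lborel g" "\<And>t z. norm (f t z) \<le> g z"
 shows "continuous_on UNIV (\<lambda>t. \<integral>z. f t z \<partial>lborel)"
proof (rule continuous_on_sequentiallyI)
 fix u :: "nat => real" and a assume u: "u \<longlonglongrightarrow> a"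
 show "(\<lambda>n. \<integral>z. f (u n) z \<partial>lborel) \<longlonglongrightarrow> (LI z. f a z)"
 proof (rule integral_dominated_convergence[where w = g])
  show "AE z in lborel. (\<lambda>n. f (u n) z) \<longlonglongrightarrow> f a z"
   using continuous_on_tendsto_compose[OF assms(2) u] by simp
 qed (use assms in auto)
qed

lemma difference_quotient_tendsto_iff:
 fixes F :: "real => complex"
 shows "((\<lambda>h. (F (t + h) - F t) /\<^sub>R h) \<longlongrightarrow> D) (at 0) \<longleftrightarrow> (F has_vector_derivative D) (at t)"
proof -
 have "((\<lambda>h. (F (t + h) - F t) /\<^sub>R h) \<longlongrightarrow> D) (at 0) \<longleftrightarrow> ((\<lambda>h. norm ((F (t + h) - F t) /\<^sub>R h - D)) \<longlongrightarrow> 0) (at 0)"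
  by (subst LIM_zero_iff[symmetric], subst tendsto_norm_zero_iff) simp
 also have "... \<longleftrightarrow> ((\<lambda>h. norm (F (t + h) - F t - h *\<^sub>R D) / norm h) \<longlongrightarrow> 0) (at 0)"
 proof (rule tendsto_cong, unfold eventually_at_filter, intro always_eventually allI impI)
  fix h :: real assume h: "h \<noteq> 0"
  have "(F (t + h) - F t) /\<^sub>R h - D = (F (t + h) - F t - h *\<^sub>R D) /\<^sub>R h"
   using h by (simp add: scaleR_diff_right)
  then show "norm ((F (t + h) - F t) /\<^sub>R h - D) = norm (F (t + h) - F t - h *\<^sub>R D) / norm h"
   by (simp add: divide_inverse mult.commute)
 qed
 also have "... \<longleftrightarrow> (F has_vector_derivative D) (at t)"
  unfolding has_vector_derivative_def has_derivative_at by (simp add: bounded_linear_scaleR_left)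
 finally show ?thesis .
qed

text \<open>The majorant is local in time, because in the applications it contains the rate, which
  is continuous and hence bounded only on bounded intervals.\<close>

lemma has_vector_derivative_integral:
 fixes f f' :: "real => 'a::euclidean_space => complex"
 assumes int: "\<And>t. integrable lborel (f t)"
  and deriv: "\<And>t z. ((\<lambda>t. f t z) has_vector_derivative f' t z) (at t)"
  and meas: "f' t \<in> Borel"
  and g: "integrable lborel g" "\<And>s z. \<bar>s - t\<bar> \<le> 1 ==> norm (f' s z) \<le> g z"
 shows "((\<lambda>t. \<integral>z. f t z \<partial>lborel) has_vector_derivative (LI z. f' t z)) (at t)"
proof -
 note quot = difference_quotient_tendsto_iff[where t = t]
 have fm: "f s \<in> Borel" for s using borel_measurable_integrable[OF int] by simp
 show ?thesis
  unfolding quot[symmetric] tendsto_at_iff_sequentially comp_def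
 proof (intro allI impI)
  fix X :: "nat => real" assume X: "\<forall>i. X i \<in> UNIV - {0}" "X \<longlonglongrightarrow> 0"
  have "\<forall>\<^sub>F i in sequentially. norm (X i) < 1" using order_tendstoD(2)[OF tendsto_norm_zero[OF X(2)], of 1] by simp
  then obtain K where K: "\<And>i. i \<ge> K ==> \<bar>X i\<bar> < 1" by (auto simp: eventually_sequentially)
  have "(\<lambda>i. \<integral>z. (f (t + X (i + K)) z - f t z) /\<^sub>R X (i + K) \<partial>lborel) \<longlonglongrightarrow> (LI z. f' t z)"
  proof (rule integral_dominated_convergence[where w = g])
   show "AE z in lborel. (\<lambda>i. (f (t + X (i + K)) z - f t z) /\<^sub>R X (i + K)) \<longlonglongrightarrow> f' t z"
   proof (rule AE_I2)
    fix z
    have "((\<lambda>h. (f (t + h) z - f t z) /\<^sub>R h) \<longlongrightarrow> f' t z) (at 0)" by (rule iffD2[OF quot[where F = "\<lambda>s. f s z"] deriv])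
    then have "(\<lambda>i. (f (t + X i) z - f t z) /\<^sub>R X i) \<longlonglongrightarrow> f' t z"
     by (rule filterlim_compose) (use X in \<open>auto simp: filterlim_at\<close>)
    then show "(\<lambda>i. (f (t + X (i + K)) z - f t z) /\<^sub>R X (i + K)) \<longlonglongrightarrow> f' t z" by (rule LIMSEQ_ignore_initial_segment)
   qed
   show "AE z in lborel. norm ((f (t + X (i + K)) z - f t z) /\<^sub>R X (i + K)) \<le> g z" for i
   proof (rule AE_I2)
    fix z
    let ?h = "X (i + K)"
    have h: "\<bar>?h\<bar> < 1" "?h \<noteq> 0" using K[of "i + K"] X(1) by auto
    have "norm (f (t + ?h) z - f t z) \<le> g z * norm (t + ?h - t)"
    proof (rule differentiable_bound[of "{t - 1..t + 1}" "\<lambda>s. f s z" "\<lambda>s d. d *\<^sub>R f' s z"])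
     fix s assume s: "s \<in> {t - 1..t + 1}"
     show "((\<lambda>s. f s z) has_derivative (\<lambda>d. d *\<^sub>R f' s z)) (at s within {t - 1..t + 1})"
      using deriv[of z s] by (simp add: has_vector_derivative_def has_derivative_at_withinI)
     have "norm (f' s z) \<le> g z" by (rule g(2)) (use s in auto)
     then show "onorm (\<lambda>d. d *\<^sub>R f' s z) \<le> g z"
      by (intro order_trans[OF onorm_le[of _ "norm (f' s z)"]]) (auto simp: mult.commute)
    qed (use h in auto)
    then show "norm ((f (t + ?h) z - f t z) /\<^sub>R ?h) \<le> g z"
    proof -
     assume le: "norm (f (t + ?h) z - f t z) \<le> g z * norm (t + ?h - t)"
     have "norm ((f (t + ?h) z - f t z) /\<^sub>R ?h) = norm (f (t + ?h) z - f t z) / \<bar>?h\<bar>"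
      by (simp add: divide_inverse mult.commute)
     then show ?thesis using le h by (simp add: pos_divide_le_eq)
    qed
   qed
  qed (use meas g fm in auto)
  also have "(\<lambda>i. \<integral>z. (f (t + X (i + K)) z - f t z) /\<^sub>R X (i + K) \<partial>lborel) = (\<lambda>i. ((LI z. f (t + X (i + K)) z) - (LI z. f t z)) /\<^sub>R X (i + K))"
   using int by simp
  finally show "(\<lambda>i. ((LI z. f (t + X i) z) - (LI z. f t z)) /\<^sub>R X i) \<longlonglongrightarrow> (LI z. f' t z)"
   by (rule LIMSEQ_offset)
 qed
qed

lemma bounded_near:
 fixes f :: "real => real"
 assumes "continuous_on UNIV f"
 obtains K where "K \<ge> 0" "\<And>s. \<bar>s - t\<bar> \<le> 1 ==> \<bar>f s\<bar> \<le> K"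
proof -
 have "compact (f ` {t - 1..t + 1})"
  by (intro compact_continuous_image continuous_on_subset[OF assms]) auto
 then have "bounded (f ` {t - 1..t + 1})" by (rule compact_imp_bounded)
 then obtain K where "\<forall>x\<in>f ` {t - 1..t + 1}. norm x \<le> K" unfolding bounded_iff by (elim exE)
 then have K: "\<bar>f s\<bar> \<le> K" if "\<bar>s - t\<bar> \<le> 1" for s using that by (auto simp: abs_le_iff)
 from K[of t] have "K \<ge> 0" by auto
 then show ?thesis using K by (rule that)
qed

lemma nn_norm_primitive_le:
 fixes f :: "real => complex"
 assumes f: "continuous_on UNIV f"
 shows "ennreal (norm (primitive f t)) \<le> (NI s. indicator (seg t) s * ennreal (norm (f s)))"
proof -
 have i: "set_integrable lborel (seg t) (\<lambda>s. norm (f s))"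
  by (rule set_integrable_seg) (intro continuous_intros f)
 have "ennreal (norm (primitive f t)) \<le> ennreal (LINT s:seg t|lborel. norm (f s))"
  by (intro ennreal_leI norm_primitive_le f i) simp
 also have "... = (NI s. ennreal (indicator (seg t) s *\<^sub>R norm (f s)))"
  unfolding set_lebesgue_integral_def
  by (rule nn_integral_eq_integral[symmetric]) (use i in \<open>auto simp: set_integrable_def\<close>)
 also have "... = (NI s. indicator (seg t) s * ennreal (norm (f s)))"
  by (intro nn_integral_cong) (auto simp: indicator_def)
 finally show ?thesis .
qed

section \<open>The map on speeds\<close>

text \<open>The first column of the fundamental matrix of the amplitude system. By conjugation the
  second column is \<open>cnj \<gamma>\<close>, \<open>cnj d\<close>, so this one pair yields the
  solution for arbitrary initial amplitudes.\<close>

definition amplitude_pair :: "(real => real) => (real => real) => (real => real => complex) \<times> (real => real => complex) => bool" where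
 "amplitude_pair \<kappa> l p \<longleftrightarrow> (case p of (d, \<gamma>) =>
  continuous_on UNIV (\<lambda>(t, r). d t r) \<and> continuous_on UNIV (\<lambda>(t, r). \<gamma> t r) \<and>
  (\<forall>t r. norm (d t r) \<le> 2 \<and> norm (\<gamma> t r) \<le> 2 \<and>
   ((\<lambda>t. d t r) has_vector_derivative of_real (\<kappa> t / 2) * cis (2 * r * l t) * \<gamma> t r) (at t) \<and>
   ((\<lambda>t. \<gamma> t r) has_vector_derivative of_real (\<kappa> t / 2) * cis (- (2 * r * l t)) * d t r) (at t)) \<and>
  (\<forall>r. d 0 r = 1 \<and> \<gamma> 0 r = 0))"

text \<open>\<open>V0\<close> and \<open>W0\<close> are the initial amplitudes, \<open>c0\<close>
  the initial speed, and \<open>m\<close> the factor in front of the squared norm in frequency. The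
  two integrals bounded by \<open>N\<close> are those of \<open>A\<close> and \<open>B\<close> at
  time zero. The condition \<open>24 * m * N <= 1\<close> is what returns the bound 1/8 for the
  image of \<open>T\<close>.\<close>

locale profile =
 fixes V0 W0 :: "'a::euclidean_space => complex" and m c0 N :: real
 assumes V0_measurable [measurable]: "V0 \<in> Borel"
  and W0_measurable [measurable]: "W0 \<in> Borel"
  and X_integrable: "integrable lborel (\<lambda>z. (norm (V0 z) + norm (W0 z))^2)"
  and rX_integrable: "integrable lborel (\<lambda>z. (norm z)^2 * (norm (V0 z) + norm (W0 z))^2)"
  and m: "m \<ge> 0" and c0: "1 \<le> c0" "c0 \<le> 2" and N: "N \<ge> 0" "24 * m * N \<le> 1"
  and N_bound: "(NI r. ennreal (norm (LI z. of_real (norm z) * cis (r * norm z) * (V0 z * cnj (V0 z) + W0 z * cnj (W0 z))))) \<le> ennreal N"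
   "(NI r. ennreal (norm (LI z. of_real (norm z) * cis (r * norm z) * (V0 z * cnj (W0 z))))) \<le> ennreal N"
begin

definition X :: "'a => real" where "X z = norm (V0 z) + norm (W0 z)"

text \<open>With \<open>c0\<close> between 1 and 2, the bound 1/8 keeps the speed between 7/8 and
  17/8 and the mean of the absolute rate below 1/7: within the 1/2 asked for by the amplitudes and
  the 1/4 asked for by the window estimate.\<close>

definition admissible :: "(real => real) => bool" where
 "admissible q \<longleftrightarrow> continuous_on UNIV q \<and> integrable lborel q \<and> (LI t. \<bar>q t\<bar>) \<le> 1 / 8"

definition speed :: "(real => real) => real => real" where "speed q t = c0 + primitive q t"
definition rate :: "(real => real) => real => real" where "rate q t = q t / speed q t"
definition phase :: "(real => real) => real => real" where "phase q = primitive (speed q)"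
definition amp :: "(real => real) => (real => real => complex) \<times> (real => real => complex)" where
 "amp q = (SOME p. amplitude_pair (rate q) (phase q) p)"
text \<open>The frequency enters the amplitude system through its norm only, so one family of
  solutions indexed by a real number serves all \<open>z\<close>, and initial data factor out
  linearly.\<close>

definition V :: "(real => real) => real => 'a => complex" where
 "V q t z = fst (amp q) t (norm z) * V0 z + cnj (snd (amp q) t (norm z)) * W0 z"
definition W :: "(real => real) => real => 'a => complex" where
 "W q t z = snd (amp q) t (norm z) * V0 z + cnj (fst (amp q) t (norm z)) * W0 z"
definition S :: "(real => real) => real => 'a => complex" where
 "S q t z = V q t z * cnj (V q t z) + W q t z * cnj (W q t z)"
definition Z :: "(real => real) => real => 'a => complex" where
 "Z q t z = V q t z * cnj (W q t z)"
definition A :: "(real => real) => real => real => complex" where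
 "A q t r = (LI z. of_real (norm z) * cis (r * norm z) * S q t z)"
text \<open>The radial transform of \<open>Z\<close> with the phase already included, so that the
  equation for \<open>A\<close> contains \<open>B\<close> at \<open>r\<close> and \<open>- r\<close>
  without any translation, and \<open>B q t 0\<close> is the transform at
  \<open>- 2 * phase q t\<close>.\<close>

definition B :: "(real => real) => real => real => complex" where
 "B q t r = (LI z. of_real (norm z) * cis ((r - 2 * phase q t) * norm z) * Z q t z)"

text \<open>At a fixed point of \<open>T\<close>, \<open>2 c q\<close> is the time derivative of \<open>m \<parallel>y\<parallel>\<^sup>2\<close>.\<close>

definition T :: "(real => real) => real => real" where
 "T q t = m * c0 / (2 * speed q t) * Im (B q t 0)"

lemma X_measurable [measurable]: "X \<in> Borel"
 unfolding X_def[abs_def] by measurable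

lemma X_nonneg: "X z \<ge> 0" by (simp add: X_def)

lemma X_moments: "integrable lborel (\<lambda>z. (X z)^2)" "integrable lborel (\<lambda>z. (norm z)^2 * (X z)^2)"
 "integrable lborel (\<lambda>z. norm z * (X z)^2)"
proof -
 show 1: "integrable lborel (\<lambda>z. (X z)^2)" "integrable lborel (\<lambda>z. (norm z)^2 * (X z)^2)"
  unfolding X_def using X_integrable rX_integrable by auto
 show "integrable lborel (\<lambda>z. norm z * (X z)^2)"
 proof (rule Bochner_Integration.integrable_bound[OF Bochner_Integration.integrable_add[OF 1]])
  have "norm z * (X z)^2 \<le> (X z)^2 + (norm z)^2 * (X z)^2" for z
  proof -
   have "2 * norm z \<le> 1 + (norm z)^2" using sum_squares_bound[of "norm z" 1] by simp
   then have "norm z \<le> 1 + (norm z)^2" using norm_ge_zero[of z] by linarith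
   from mult_right_mono[OF this, of "(X z)^2"] show ?thesis by (simp add: distrib_right)
  qed
  then show "AE z in lborel. norm (norm z * (X z)^2) \<le> norm ((X z)^2 + (norm z)^2 * (X z)^2)" by simp
 qed measurable
qed

context
 fixes q assumes q: "admissible q"
begin

lemma q_props: "continuous_on UNIV q" "integrable lborel q" "(LI t. \<bar>q t\<bar>) \<le> 1 / 8"
 using q by (auto simp: admissible_def)

lemma speed_deriv: "(speed q has_vector_derivative q t) (at t)"
 unfolding speed_def[abs_def]
 using has_vector_derivative_add[OF has_vector_derivative_const has_vector_derivative_primitive[OF q_props(1)]] by simp

lemma speed_continuous: "continuous_on UNIV (speed q)"
 unfolding speed_def[abs_def] by (intro continuous_intros continuous_on_primitive q_props)

lemma speed_bounds: "7 / 8 \<le> speed q t" "speed q t \<le> 17 / 8" "\<bar>speed q t - c0\<bar> \<le> 1 / 8"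
proof -
 have "\<bar>primitive q t\<bar> \<le> (LI t. \<bar>q t\<bar>)"
  using norm_primitive_le_integral[OF q_props(1), of "\<lambda>s. \<bar>q s\<bar>" t] q_props(2) by simp
 then have "\<bar>primitive q t\<bar> \<le> 1 / 8" using q_props(3) by linarith
 then show "7 / 8 \<le> speed q t" "speed q t \<le> 17 / 8" "\<bar>speed q t - c0\<bar> \<le> 1 / 8"
  using c0 unfolding speed_def by (auto simp: abs_le_iff)
qed

lemma speed_pos: "speed q t > 0" using speed_bounds(1)[of t] by linarith

lemma rate_continuous: "continuous_on UNIV (rate q)"
 unfolding rate_def[abs_def] using speed_pos by (intro continuous_intros q_props speed_continuous) (auto simp: less_imp_neq[symmetric])

lemma rate_le: "\<bar>rate q t\<bar> \<le> 8 / 7 * \<bar>q t\<bar>"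
proof -
 have "\<bar>q t\<bar> / speed q t \<le> \<bar>q t\<bar> / (7 / 8)" by (rule divide_left_mono) (use speed_bounds(1)[of t] speed_pos[of t] in auto)
 then show ?thesis using speed_pos[of t] by (simp add: rate_def)
qed

lemma rate_integrable: "integrable lborel (rate q)" "(LI t. \<bar>rate q t\<bar>) \<le> 1 / 7"
proof -
 have [measurable]: "rate q \<in> Borel" by (rule borel_measurable_continuous_onI[OF rate_continuous])
 have i: "integrable lborel (\<lambda>t. 8 / 7 * \<bar>q t\<bar>)" using q_props(2) by simp
 show "integrable lborel (rate q)"
  by (rule Bochner_Integration.integrable_bound[OF i]) (use rate_le in auto)
 then have "(LI t. \<bar>rate q t\<bar>) \<le> (LI t. 8 / 7 * \<bar>q t\<bar>)"
  by (intro integral_mono i rate_le) simp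
 then show "(LI t. \<bar>rate q t\<bar>) \<le> 1 / 7" using q_props(3) by simp
qed

lemma phase_deriv: "(phase q has_vector_derivative speed q t) (at t)"
 unfolding phase_def by (rule has_vector_derivative_primitive[OF speed_continuous])

lemma phase_continuous: "continuous_on UNIV (phase q)"
 unfolding phase_def by (rule continuous_on_primitive[OF speed_continuous])

lemma phase_0 [simp]: "phase q 0 = 0" by (simp add: phase_def)

lemma phase_mono: "s \<le> t ==> phase q s \<le> phase q t"
 by (rule DERIV_nonneg_imp_nondecreasing)
  (use phase_deriv speed_pos in \<open>auto simp: has_real_derivative_iff_has_vector_derivative intro: less_imp_le\<close>)

lemma phase_seg: "s \<in> seg t ==> \<bar>phase q t - phase q s\<bar> + \<bar>phase q s\<bar> \<le> \<bar>phase q t\<bar>"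
 using phase_mono[of s t] phase_mono[of t s] phase_mono[of 0 s] phase_mono[of s 0]
 unfolding seg_def by (cases "0 \<le> t") (auto simp: min_def max_def)

lemma amp: "amplitude_pair (rate q) (phase q) (amp q)"
proof -
 have "\<exists>p. amplitude_pair (rate q) (phase q) p"
  using amplitude_exists[OF rate_continuous rate_integrable(1) _ phase_continuous] rate_integrable(2)
  unfolding amplitude_pair_def by auto
 then show ?thesis unfolding amp_def by (rule someI_ex)
qed

lemma amp_props:
 "continuous_on UNIV (\<lambda>(t, r). fst (amp q) t r)" "continuous_on UNIV (\<lambda>(t, r). snd (amp q) t r)"
 "norm (fst (amp q) t r) \<le> 2" "norm (snd (amp q) t r) \<le> 2"
 "((\<lambda>t. fst (amp q) t r) has_vector_derivative of_real (rate q t / 2) * cis (2 * r * phase q t) * snd (amp q) t r) (at t)"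
 "((\<lambda>t. snd (amp q) t r) has_vector_derivative of_real (rate q t / 2) * cis (- (2 * r * phase q t)) * fst (amp q) t r) (at t)"
 "fst (amp q) 0 r = 1" "snd (amp q) 0 r = 0"
 using amp unfolding amplitude_pair_def by (auto simp: split_beta)

lemma amp_measurable [measurable]:
 "(\<lambda>(t, r). fst (amp q) t r) \<in> borel_measurable (borel \<Otimes>\<^sub>M borel)"
 "(\<lambda>(t, r). snd (amp q) t r) \<in> borel_measurable (borel \<Otimes>\<^sub>M borel)"
 using borel_measurable_continuous_onI[OF amp_props(1)] borel_measurable_continuous_onI[OF amp_props(2)]
 by (simp_all add: borel_prod)

lemma cnj_measurable [measurable]: "cnj \<in> Borel"
 by (intro borel_measurable_continuous_onI continuous_intros)

lemma VW_measurable [measurable]: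
 "(\<lambda>(t, z). V q t z) \<in> borel_measurable (borel \<Otimes>\<^sub>M borel)" "(\<lambda>(t, z). W q t z) \<in> borel_measurable (borel \<Otimes>\<^sub>M borel)"
 unfolding V_def W_def by measurable

lemma VW_0: "V q 0 z = V0 z" "W q 0 z = W0 z"
 by (simp_all add: V_def W_def amp_props)

lemma VW_le: "norm (V q t z) \<le> 2 * X z" "norm (W q t z) \<le> 2 * X z"
proof -
 have *: "norm (a * V0 z + b * W0 z) \<le> 2 * X z" if "norm a \<le> 2" "norm b \<le> 2" for a b
  using norm_triangle_ineq[of "a * V0 z" "b * W0 z"] mult_right_mono[OF that(1), of "norm (V0 z)"] mult_right_mono[OF that(2), of "norm (W0 z)"]
  by (simp add: X_def norm_mult)
 show "norm (V q t z) \<le> 2 * X z" "norm (W q t z) \<le> 2 * X z"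
  unfolding V_def W_def by (rule *; simp add: amp_props)+
qed

lemma VW_deriv:
 "((\<lambda>t. V q t z) has_vector_derivative of_real (rate q t / 2) * cis (2 * norm z * phase q t) * W q t z) (at t)"
 "((\<lambda>t. W q t z) has_vector_derivative of_real (rate q t / 2) * cis (- (2 * norm z * phase q t)) * V q t z) (at t)"
proof -
 note d = amp_props(5,6)[of "norm z" t]
 have c: "((\<lambda>t. cnj (f t)) has_vector_derivative cnj f') (at t)" if "(f has_vector_derivative f') (at t)" for f f'
  using bounded_linear.has_vector_derivative[OF bounded_linear_cnj that] .
 show "((\<lambda>t. V q t z) has_vector_derivative of_real (rate q t / 2) * cis (2 * norm z * phase q t) * W q t z) (at t)"
  unfolding V_def W_def
  by (rule has_vector_derivative_eq_rhs[OF has_vector_derivative_add[OF has_vector_derivative_mult_left[OF d(1), of "V0 z"] has_vector_derivative_mult_left[OF c[OF d(2)], of "W0 z"]]])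
   (simp add: cis_cnj algebra_simps add_divide_distrib)
 show "((\<lambda>t. W q t z) has_vector_derivative of_real (rate q t / 2) * cis (- (2 * norm z * phase q t)) * V q t z) (at t)"
  unfolding V_def W_def
  by (rule has_vector_derivative_eq_rhs[OF has_vector_derivative_add[OF has_vector_derivative_mult_left[OF d(2), of "V0 z"] has_vector_derivative_mult_left[OF c[OF d(1)], of "W0 z"]]])
   (simp add: cis_cnj algebra_simps add_divide_distrib)
qed

text \<open>The quadratic quantities form a closed system: the derivatives of the two squared
  amplitudes involve only \<open>Z\<close>, and that of \<open>Z\<close> involves only their sum
  \<open>S\<close>. Apart from the rate, the coefficients are characters in \<open>norm z\<close>,
  so under the radial transform they turn into translations.\<close>

lemma SZ_deriv:
 "((\<lambda>t. S q t z) has_vector_derivative of_real (rate q t) * (cis (- (2 * norm z * phase q t)) * Z q t z + cnj (cis (- (2 * norm z * phase q t)) * Z q t z))) (at t)"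
 "((\<lambda>t. Z q t z) has_vector_derivative of_real (rate q t / 2) * cis (2 * norm z * phase q t) * S q t z) (at t)"
proof -
 have c: "((\<lambda>t. cnj (f t)) has_vector_derivative cnj f') (at t)" if "(f has_vector_derivative f') (at t)" for f f'
  using bounded_linear.has_vector_derivative[OF bounded_linear_cnj that] .
 let ?e = "cis (2 * norm z * phase q t)" and ?f = "cis (- (2 * norm z * phase q t))"
 have e: "?f = cnj ?e" by (simp add: cis_cnj)
 note d = VW_deriv[of z t, unfolded e]
 show "((\<lambda>t. S q t z) has_vector_derivative of_real (rate q t) * (?f * Z q t z + cnj (?f * Z q t z))) (at t)"
  unfolding S_def Z_def e
  by (rule has_vector_derivative_eq_rhs[OF has_vector_derivative_add[OF has_vector_derivative_mult[OF d(1) c[OF d(1)]] has_vector_derivative_mult[OF d(2) c[OF d(2)]]]])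
   (simp add: field_simps)
 show "((\<lambda>t. Z q t z) has_vector_derivative of_real (rate q t / 2) * ?e * S q t z) (at t)"
  unfolding S_def Z_def
  by (rule has_vector_derivative_eq_rhs[OF has_vector_derivative_mult[OF d(1) c[OF d(2)]]]) (simp add: field_simps)
qed

lemma SZ_measurable [measurable]:
 "(\<lambda>(t, z). S q t z) \<in> borel_measurable (borel \<Otimes>\<^sub>M borel)" "(\<lambda>(t, z). Z q t z) \<in> borel_measurable (borel \<Otimes>\<^sub>M borel)"
 unfolding S_def Z_def by measurable

lemma SZ_le: "norm (S q t z) \<le> 8 * (X z)^2" "norm (Z q t z) \<le> 4 * (X z)^2"
proof -
 have *: "norm (a * b) \<le> 4 * (X z)^2" if "norm a \<le> 2 * X z" "norm b \<le> 2 * X z" for a b :: complex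
  using mult_mono[OF that] by (simp add: norm_mult power2_eq_square X_nonneg)
 show "norm (Z q t z) \<le> 4 * (X z)^2" unfolding Z_def by (rule *) (simp_all add: VW_le)
 have "norm (V q t z * cnj (V q t z)) \<le> 4 * (X z)^2" "norm (W q t z * cnj (W q t z)) \<le> 4 * (X z)^2"
  by (rule *; simp add: VW_le)+
 then show "norm (S q t z) \<le> 8 * (X z)^2" unfolding S_def by (intro norm_triangle_le) linarith
qed

lemma SZ_continuous: "continuous_on UNIV (\<lambda>t. S q t z)" "continuous_on UNIV (\<lambda>t. Z q t z)"
 using SZ_deriv by (meson continuous_at_imp_continuous_on has_vector_derivative_continuous)+

lemma phase_measurable [measurable]: "phase q \<in> Borel"
 by (rule borel_measurable_continuous_onI[OF phase_continuous])

lemma AB_measurable [measurable]: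
 "(\<lambda>(t, r). A q t r) \<in> borel_measurable (borel \<Otimes>\<^sub>M borel)" "(\<lambda>(t, r). B q t r) \<in> borel_measurable (borel \<Otimes>\<^sub>M borel)"
 unfolding A_def B_def by measurable

lemma hat_integrable:
 assumes [measurable]: "f \<in> Borel" and le: "\<And>z. norm (f z) \<le> C * (X z)^2"
 shows "integrable lborel (\<lambda>z. of_real (norm z) * cis (r * norm z) * f z)"
  "norm (LI z. of_real (norm z) * cis (r * norm z) * f z) \<le> C * (LI z. norm z * (X z)^2)"
proof -
 have b: "norm (of_real (norm z) * cis (r * norm z) * f z) \<le> C * (norm z * (X z)^2)" for z
  using mult_left_mono[OF le[of z], of "norm z"] by (simp add: norm_mult mult_ac)
 have i: "integrable lborel (\<lambda>z. C * (norm z * (X z)^2))" using X_moments(3) by simp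
 show 1: "integrable lborel (\<lambda>z. of_real (norm z) * cis (r * norm z) * f z)"
  by (rule Bochner_Integration.integrable_bound[OF i]) (use order_trans[OF b abs_ge_self] in auto)
 show "norm (LI z. of_real (norm z) * cis (r * norm z) * f z) \<le> C * (LI z. norm z * (X z)^2)"
  using Bochner_Integration.integral_norm_bound_integral[OF 1 i b] by simp
qed

lemma AB_le: "norm (A q t r) \<le> 8 * (LI z. norm z * (X z)^2)" "norm (B q t r) \<le> 4 * (LI z. norm z * (X z)^2)"
 unfolding A_def B_def by (rule hat_integrable(2), measurable, rule SZ_le)+

lemma A_deriv:
 "((\<lambda>t. A q t r) has_vector_derivative of_real (rate q t) * (B q t r + cnj (B q t (- r)))) (at t)"
proof -
 obtain K where K: "K \<ge> 0" "\<And>s. \<bar>s - t\<bar> \<le> 1 ==> \<bar>rate q s\<bar> \<le> K" using bounded_near[OF rate_continuous, of t] by blast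
 let ?P = "\<lambda>t z. cis (- (2 * norm z * phase q t)) * Z q t z"
 let ?f' = "\<lambda>t z. of_real (norm z) * cis (r * norm z) * (of_real (rate q t) * (?P t z + cnj (?P t z)))"
 have "((\<lambda>t. A q t r) has_vector_derivative (LI z. ?f' t z)) (at t)"
  unfolding A_def
 proof (rule has_vector_derivative_integral[where g = "\<lambda>z. (8 * K) * (norm z * (X z)^2)"])
  show "integrable lborel (\<lambda>z. complex_of_real (norm z) * cis (r * norm z) * S q t z)" for t
   by (rule hat_integrable(1), measurable, rule SZ_le)
  show "((\<lambda>t. complex_of_real (norm z) * cis (r * norm z) * S q t z) has_vector_derivative ?f' t z) (at t)" for t z
   by (rule has_vector_derivative_mult_right) (rule SZ_deriv(1))
  show "integrable lborel (\<lambda>z. (8 * K) * (norm z * (X z)^2))" using X_moments(3) by simp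
  fix s z assume s: "\<bar>s - t\<bar> \<le> 1"
  have "norm (?P s z + cnj (?P s z)) \<le> 8 * (X z)^2"
   using SZ_le(2)[of s z] by (intro norm_triangle_le) (simp add: norm_mult)
  from mult_mono[OF K(2)[OF s] this K(1)] have "\<bar>rate q s\<bar> * norm (?P s z + cnj (?P s z)) \<le> K * (8 * (X z)^2)" by simp
  from mult_left_mono[OF this, of "norm z"] show "norm (?f' s z) \<le> (8 * K) * (norm z * (X z)^2)"
   by (simp add: norm_mult mult_ac)
 qed measurable
 moreover have "(LI z. ?f' t z) = of_real (rate q t) * (B q t r + cnj (B q t (- r)))"
 proof -
  let ?b = "\<lambda>r z. of_real (norm z) * cis ((r - 2 * phase q t) * norm z) * Z q t z"
  have b: "integrable lborel (?b r)" for r by (rule hat_integrable(1), measurable, rule SZ_le)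
  have ci: "integrable lborel (\<lambda>z. cnj (?b r z))" for r
   by (rule Bochner_Integration.integrable_bound[OF b[of r]]) (auto simp: norm_mult)
  have ce: "(LI z. cnj (?b r z)) = cnj (B q t r)" for r
   unfolding B_def by (rule integral_bounded_linear[OF bounded_linear_cnj b])
  have "?f' t z = of_real (rate q t) * (?b r z + cnj (?b (- r) z))" for z
  proof -
   have 1: "cis ((r - 2 * phase q t) * norm z) = cis (r * norm z) * cis (- (2 * norm z * phase q t))"
    by (simp add: cis_mult algebra_simps)
   have 2: "cnj (cis ((- r - 2 * phase q t) * norm z)) = cis (r * norm z) * cnj (cis (- (2 * norm z * phase q t)))"
    by (simp add: cis_mult cis_cnj algebra_simps)
   show ?thesis unfolding complex_cnj_mult 1 2 by (simp add: algebra_simps)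
  qed
  then have "(LI z. ?f' t z) = (LI z. of_real (rate q t) * (?b r z + cnj (?b (- r) z)))"
   by (rule Bochner_Integration.integral_cong[OF refl])
  also have "... = of_real (rate q t) * ((LI z. ?b r z) + (LI z. cnj (?b (- r) z)))"
   unfolding integral_mult_right_zero Bochner_Integration.integral_add[OF b ci] ..
  finally show ?thesis unfolding ce B_def[symmetric] .
 qed
 ultimately show ?thesis by simp
qed

lemma A_phase_continuous: "continuous_on UNIV (\<lambda>s. A q s (2 * phase q s + a))"
 unfolding A_def
proof (rule continuous_on_integral[where g = "\<lambda>z. 8 * (norm z * (X z)^2)"])
 show "integrable lborel (\<lambda>z. 8 * (norm z * (X z)^2))" using X_moments(3) by simp
 show "continuous_on UNIV (\<lambda>t. complex_of_real (norm z) * cis ((2 * phase q t + a) * norm z) * S q t z)" for z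
  unfolding cis_conv_exp by (intro continuous_intros phase_continuous SZ_continuous)
 show "norm (complex_of_real (norm z) * cis ((2 * phase q t + a) * norm z) * S q t z) \<le> 8 * (norm z * (X z)^2)" for t z
  using mult_left_mono[OF SZ_le(1)[of t z], of "norm z"] by (simp add: norm_mult mult_ac)
qed measurable

lemma B_continuous: "continuous_on UNIV (\<lambda>s. B q s r)"
 unfolding B_def
proof (rule continuous_on_integral[where g = "\<lambda>z. 4 * (norm z * (X z)^2)"])
 show "integrable lborel (\<lambda>z. 4 * (norm z * (X z)^2))" using X_moments(3) by simp
 show "continuous_on UNIV (\<lambda>t. complex_of_real (norm z) * cis ((r - 2 * phase q t) * norm z) * Z q t z)" for z
  unfolding cis_conv_exp by (intro continuous_intros phase_continuous SZ_continuous)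
 show "norm (complex_of_real (norm z) * cis ((r - 2 * phase q t) * norm z) * Z q t z) \<le> 4 * (norm z * (X z)^2)" for t z
  using mult_left_mono[OF SZ_le(2)[of t z], of "norm z"] by (simp add: norm_mult mult_ac)
qed measurable

lemma A_eq: "A q t r = A q 0 r + primitive (\<lambda>s. of_real (rate q s) * (B q s r + cnj (B q s (- r)))) t"
 by (rule eq_primitive[OF _ A_deriv]) (intro continuous_intros rate_continuous B_continuous)

lemma B_eq: "B q t r = B q 0 (r - 2 * phase q t) + primitive (\<lambda>s. of_real (rate q s / 2) * A q s (2 * phase q s + (r - 2 * phase q t))) t"
proof -
 \<comment> \<open>The argument is frozen at its final value and only \<open>Z\<close> is
   differentiated in \<open>s\<close>; the character in the derivative of \<open>Z\<close> then
   shifts \<open>A\<close> from \<open>?w\<close> to \<open>2 * phase q s + ?w\<close>.\<close>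
 let ?w = "r - 2 * phase q t"
 define G where "G s = (LI z. of_real (norm z) * cis (?w * norm z) * Z q s z)" for s
 have "(G has_vector_derivative of_real (rate q s / 2) * A q s (2 * phase q s + ?w)) (at s)" for s
 proof -
  obtain K where K: "K \<ge> 0" "\<And>u. \<bar>u - s\<bar> \<le> 1 ==> \<bar>rate q u\<bar> \<le> K" using bounded_near[OF rate_continuous, of s] by blast
  let ?f' = "\<lambda>s z. of_real (norm z) * cis (?w * norm z) * (of_real (rate q s / 2) * cis (2 * norm z * phase q s) * S q s z)"
  have "(G has_vector_derivative (LI z. ?f' s z)) (at s)"
   unfolding G_def[abs_def]
  proof (rule has_vector_derivative_integral[where g = "\<lambda>z. (4 * K) * (norm z * (X z)^2)"])
   show "integrable lborel (\<lambda>z. complex_of_real (norm z) * cis (?w * norm z) * Z q s z)" for s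
    by (rule hat_integrable(1), measurable, rule SZ_le)
   show "((\<lambda>s. complex_of_real (norm z) * cis (?w * norm z) * Z q s z) has_vector_derivative ?f' s z) (at s)" for s z
    by (rule has_vector_derivative_mult_right) (rule SZ_deriv(2))
   show "integrable lborel (\<lambda>z. (4 * K) * (norm z * (X z)^2))" using X_moments(3) by simp
   fix u z assume u: "\<bar>u - s\<bar> \<le> 1"
   from mult_mono[OF K(2)[OF u] SZ_le(1) K(1), of u z] have "\<bar>rate q u\<bar> * norm (S q u z) \<le> K * (8 * (X z)^2)" by simp
   from mult_left_mono[OF this, of "norm z / 2"] show "norm (?f' u z) \<le> (4 * K) * (norm z * (X z)^2)"
    by (simp add: norm_mult mult_ac)
  qed measurable
  moreover have "?f' s z = of_real (rate q s / 2) * (of_real (norm z) * cis ((2 * phase q s + ?w) * norm z) * S q s z)" for z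
  proof -
   have "cis ((2 * phase q s + ?w) * norm z) = cis (?w * norm z) * cis (2 * norm z * phase q s)"
    by (simp add: cis_mult algebra_simps)
   then show ?thesis by (simp only: mult_ac)
  qed
  then have "(LI z. ?f' s z) = of_real (rate q s / 2) * A q s (2 * phase q s + ?w)"
   unfolding A_def integral_mult_right_zero[symmetric] by (rule Bochner_Integration.integral_cong[OF refl])
  ultimately show ?thesis by simp
 qed
 from eq_primitive[OF _ this, of t] have "G t = G 0 + primitive (\<lambda>s. of_real (rate q s / 2) * A q s (2 * phase q s + ?w)) t"
  by (simp add: continuous_intros rate_continuous A_phase_continuous)
 then show ?thesis by (simp add: G_def B_def)
qed

lemma rate_nn: "(NI s. ennreal \<bar>rate q s\<bar>) \<le> ennreal (1 / 4)"
proof -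
 have "(NI s. ennreal \<bar>rate q s\<bar>) = ennreal (LI s. \<bar>rate q s\<bar>)"
  by (rule nn_integral_eq_integral) (use rate_integrable in auto)
 also have "... \<le> ennreal (1 / 4)" by (rule ennreal_leI) (use rate_integrable(2) in linarith)
 finally show ?thesis .
qed

lemma AB_0_nn:
 "(NI r. ennreal (norm (A q 0 r))) \<le> ennreal N" "(NI r. ennreal (norm (B q 0 r))) \<le> ennreal N"
 using N_bound by (simp_all add: A_def B_def S_def Z_def VW_0)

lemma rate_measurable [measurable]: "rate q \<in> Borel"
 by (rule borel_measurable_continuous_onI[OF rate_continuous])

lemma B_nn_le: "2 * ennreal (norm (B q t r)) \<le> 2 * ennreal (norm (B q 0 (r - 2 * phase q t))) + (NI s. indicator (seg t) s * ennreal \<bar>rate q s\<bar> * ennreal (norm (A q s (r + 2 * phase q s - 2 * phase q t))))"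
proof -
 let ?p = "\<lambda>s. of_real (rate q s / 2) * A q s (2 * phase q s + (r - 2 * phase q t))"
 have c: "continuous_on UNIV ?p" by (intro continuous_intros rate_continuous A_phase_continuous) simp
 have [measurable]: "?p \<in> Borel" by (rule borel_measurable_continuous_onI[OF c])
 have [measurable]: "seg t \<in> sets borel" by (simp add: seg_def)
 have "ennreal (norm (B q t r)) \<le> ennreal (norm (B q 0 (r - 2 * phase q t))) + ennreal (norm (primitive ?p t))"
  by (subst B_eq, subst ennreal_plus[symmetric]) (auto intro!: ennreal_leI norm_triangle_ineq simp del: ennreal_plus)
 also have "ennreal (norm (primitive ?p t)) \<le> (NI s. indicator (seg t) s * ennreal (norm (?p s)))"
  by (rule nn_norm_primitive_le[OF c])
 finally have "2 * ennreal (norm (B q t r)) \<le> 2 * (ennreal (norm (B q 0 (r - 2 * phase q t))) + (NI s. indicator (seg t) s * ennreal (norm (?p s))))"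
  by - (rule mult_left_mono, erule meta_mp, auto intro: add_left_mono)
 also have "... = 2 * ennreal (norm (B q 0 (r - 2 * phase q t))) + (NI s. 2 * (indicator (seg t) s * ennreal (norm (?p s))))"
  by (subst nn_integral_cmult) (auto simp: distrib_left)
 also have "(NI s. 2 * (indicator (seg t) s * ennreal (norm (?p s)))) = (NI s. indicator (seg t) s * ennreal \<bar>rate q s\<bar> * ennreal (norm (A q s (r + 2 * phase q s - 2 * phase q t))))"
 proof (rule nn_integral_cong)
  fix s
  have "2 * ennreal (norm (?p s)) = ennreal 2 * ennreal (norm (?p s))" by (simp only: ennreal_numeral)
  also have "... = ennreal (2 * norm (?p s))" by (rule ennreal_mult[symmetric]) simp_all
  also have "2 * norm (?p s) = \<bar>rate q s\<bar> * norm (A q s (r + 2 * phase q s - 2 * phase q t))"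
   by (simp add: norm_mult add_ac diff_add_eq add_diff_eq)
  finally have e: "2 * ennreal (norm (?p s)) = ennreal \<bar>rate q s\<bar> * ennreal (norm (A q s (r + 2 * phase q s - 2 * phase q t)))"
   by (simp add: ennreal_mult)
  show "2 * (indicator (seg t) s * ennreal (norm (?p s))) = indicator (seg t) s * ennreal \<bar>rate q s\<bar> * ennreal (norm (A q s (r + 2 * phase q s - 2 * phase q t)))"
   unfolding mult.assoc e[symmetric] by (rule mult.left_commute)
 qed
 finally show ?thesis .
qed

text \<open>The monotone phase meets the geometric condition of the window estimate. The moment of
  the data serves as the crude uniform bound there; the conclusion contains only
  \<open>N\<close>.\<close>

lemma A_nn: "(NI r. ennreal (norm (A q t r))) \<le> ennreal (4 * N)"
proof (rule window_bound[where B = "\<lambda>t r. ennreal (norm (B q t r))" and d = "phase q" and k = "\<lambda>s. ennreal \<bar>rate q s\<bar>"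
   and ?A0.0 = "\<lambda>r. ennreal (norm (A q 0 r))" and ?B0.0 = "\<lambda>r. ennreal (norm (B q 0 r))" and M = "8 * (LI z. norm z * (X z)^2)"])
 show "\<bar>phase q t - phase q s\<bar> + \<bar>phase q s\<bar> \<le> \<bar>phase q t\<bar>" if "s \<in> seg t" for s t by (rule phase_seg[OF that])
 show "ennreal (norm (A q t r)) \<le> ennreal (norm (A q 0 r)) + (NI s. indicator (seg t) s * ennreal \<bar>rate q s\<bar> * (ennreal (norm (B q s r)) + ennreal (norm (B q s (- r)))))" for t r
 proof -
  let ?p = "\<lambda>s. of_real (rate q s) * (B q s r + cnj (B q s (- r)))"
  have c: "continuous_on UNIV ?p" by (intro continuous_intros rate_continuous B_continuous)
  have "ennreal (norm (A q t r)) \<le> ennreal (norm (A q 0 r)) + ennreal (norm (primitive ?p t))"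
   by (subst A_eq, subst ennreal_plus[symmetric]) (auto intro!: ennreal_leI norm_triangle_ineq simp del: ennreal_plus)
  also have "ennreal (norm (primitive ?p t)) \<le> (NI s. indicator (seg t) s * ennreal (norm (?p s)))"
   by (rule nn_norm_primitive_le[OF c])
  also have "... \<le> (NI s. indicator (seg t) s * ennreal \<bar>rate q s\<bar> * (ennreal (norm (B q s r)) + ennreal (norm (B q s (- r)))))"
  proof (rule nn_integral_mono)
   fix s
   have "norm (?p s) \<le> \<bar>rate q s\<bar> * (norm (B q s r) + norm (B q s (- r)))"
    using norm_triangle_ineq[of "B q s r" "cnj (B q s (- r))"] by (simp add: norm_mult mult_left_mono)
   then have "ennreal (norm (?p s)) \<le> ennreal \<bar>rate q s\<bar> * (ennreal (norm (B q s r)) + ennreal (norm (B q s (- r))))"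
    by (subst ennreal_plus[symmetric], simp, simp, subst ennreal_mult[symmetric]) (auto intro!: ennreal_leI)
   then show "indicator (seg t) s * ennreal (norm (?p s)) \<le> indicator (seg t) s * ennreal \<bar>rate q s\<bar> * (ennreal (norm (B q s r)) + ennreal (norm (B q s (- r))))"
    unfolding mult.assoc by (rule mult_left_mono) simp
  qed
  finally show ?thesis by (simp add: add_left_mono)
 qed
 have I: "0 \<le> (LI z. norm z * (X z)^2)" by (simp add: integral_nonneg_AE)
 show "ennreal (norm (A q t r)) \<le> ennreal (8 * (LI z. norm z * (X z)^2))" for t r by (rule ennreal_leI[OF AB_le(1)])
 show "ennreal (norm (B q t r)) \<le> ennreal (8 * (LI z. norm z * (X z)^2))" for t r
  by (rule ennreal_leI) (use AB_le(2)[of t r] I in linarith)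
qed (use N AB_0_nn rate_nn B_nn_le in \<open>auto simp: split_beta\<close>)

text \<open>At \<open>r = 0\<close> the arguments in the equation for \<open>B\<close> are
  translates of \<open>- 2 * phase q t\<close>, so the time integral becomes an integral over the
  line. The initial term contributes \<open>2 N\<close>, the other one at most 1/4 times
  \<open>4 N\<close>, and halving the sum gives the bound.\<close>

lemma B_time_nn: "(NI t. ennreal (norm (B q t 0))) \<le> ennreal (3 / 2 * N)"
proof -
 let ?k = "\<lambda>s. ennreal \<bar>rate q s\<bar>"
 have c: "speed q t \<ge> 1 / 2" for t using speed_bounds(1)[of t] by linarith
 have "2 * (NI t. ennreal (norm (B q t 0))) = (NI t. 2 * ennreal (norm (B q t 0)))"
  by (rule nn_integral_cmult[symmetric]) measurable
 also have "... \<le> (NI t. 2 * ennreal (norm (B q 0 (0 - 2 * phase q t))) + (NI s. ?k s * ennreal (norm (A q s (2 * phase q s - 2 * phase q t)))))"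
 proof (rule nn_integral_mono)
  fix t
  have "(NI s. indicator (seg t) s * ?k s * ennreal (norm (A q s (0 + 2 * phase q s - 2 * phase q t)))) \<le> (NI s. ?k s * ennreal (norm (A q s (2 * phase q s - 2 * phase q t))))"
   by (rule nn_integral_mono) (simp add: indicator_def)
  then show "2 * ennreal (norm (B q t 0)) \<le> 2 * ennreal (norm (B q 0 (0 - 2 * phase q t))) + (NI s. ?k s * ennreal (norm (A q s (2 * phase q s - 2 * phase q t))))"
   by (rule order_trans[OF B_nn_le[of t 0] add_left_mono])
 qed
 also have "... = 2 * (NI t. ennreal (norm (B q 0 (0 - 2 * phase q t)))) + (\<integral>\<^sup>+t. \<integral>\<^sup>+s. ?k s * ennreal (norm (A q s (2 * phase q s - 2 * phase q t))) \<partial>lborel \<partial>lborel)"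
  by (subst nn_integral_add) (simp_all add: nn_integral_cmult)
 also have "(\<integral>\<^sup>+t. \<integral>\<^sup>+s. ?k s * ennreal (norm (A q s (2 * phase q s - 2 * phase q t))) \<partial>lborel \<partial>lborel) = (\<integral>\<^sup>+s. \<integral>\<^sup>+t. ?k s * ennreal (norm (A q s (2 * phase q s - 2 * phase q t))) \<partial>lborel \<partial>lborel)"
  by (rule lborel_pair.Fubini') measurable
 also have "... \<le> (NI s. ?k s * ennreal (4 * N))"
 proof (rule nn_integral_mono)
  fix s
  have "(NI t. ennreal (norm (A q s (2 * phase q s - 2 * phase q t)))) \<le> ennreal (4 * N)"
   by (rule order_trans[OF nn_integral_speed_substitution[OF speed_continuous c phase_deriv] A_nn]) measurable
  then show "(NI t. ?k s * ennreal (norm (A q s (2 * phase q s - 2 * phase q t)))) \<le> ?k s * ennreal (4 * N)"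
   by (subst nn_integral_cmult, measurable) (rule mult_left_mono, auto)
 qed
 also have "... = (NI s. ?k s) * ennreal (4 * N)" by (rule nn_integral_multc) measurable
 also have "... \<le> ennreal (1 / 4) * ennreal (4 * N)" by (rule mult_right_mono[OF rate_nn]) simp
 also have "ennreal (1 / 4) * ennreal (4 * N) = ennreal N" using N by (simp add: ennreal_mult[symmetric])
 also have "(NI t. ennreal (norm (B q 0 (0 - 2 * phase q t)))) \<le> ennreal N"
  by (rule order_trans[OF nn_integral_speed_substitution[OF speed_continuous c phase_deriv] AB_0_nn(2)]) measurable
 finally have "2 * (NI t. ennreal (norm (B q t 0))) \<le> 2 * ennreal N + ennreal N"
  by (simp add: mult_left_mono add_right_mono)
 also have "2 * ennreal N = ennreal (2 * N)" using N by (simp add: ennreal_mult)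
 also have "ennreal (2 * N) + ennreal N = ennreal (3 * N)" using N by (subst ennreal_plus[symmetric]) auto
 finally have *: "2 * (NI t. ennreal (norm (B q t 0))) \<le> ennreal (3 * N)" .
 show ?thesis
 proof (cases "\<integral>\<^sup>+t. ennreal (norm (B q t 0)) \<partial>lborel")
  case (real b)
  then have "ennreal (2 * b) \<le> ennreal (3 * N)" using * by (simp add: ennreal_mult)
  then have "2 * b \<le> 3 * N" using N by simp
  then show ?thesis using real by (simp add: ennreal_leI)
 next
  case top then show ?thesis using * by (simp add: ennreal_mult_top top_unique)
 qed
qed

lemma T_admissible: "admissible (T q)"
proof -
 have cont: "continuous_on UNIV (T q)"
  unfolding T_def[abs_def] using speed_pos by (intro continuous_intros speed_continuous B_continuous) (auto simp: less_imp_neq[symmetric])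
 then have [measurable]: "T q \<in> Borel" by (rule borel_measurable_continuous_onI)
 \<comment> \<open>Here \<open>c0 / (2 * speed q t) <= 8 / 7\<close>, rounded up to 2; together with
   the time integral of \<open>B\<close> the mean of \<open>\<bar>T q\<bar>\<close> is at most
   \<open>3 * m * N\<close>.\<close>
 have le: "\<bar>T q t\<bar> \<le> 2 * m * norm (B q t 0)" for t
 proof -
  have "c0 / (2 * speed q t) \<le> 2 / (2 * (7 / 8))"
   using c0 speed_bounds(1)[of t] by (intro frac_le) auto
  then have "c0 / (2 * speed q t) \<le> 2" by simp
  then have "m * (c0 / (2 * speed q t)) \<le> m * 2" using m by (rule mult_left_mono)
  moreover have "\<bar>Im (B q t 0)\<bar> \<le> norm (B q t 0)" by (rule abs_Im_le_cmod)
  moreover have "m * (c0 / (2 * speed q t)) \<ge> 0" using m c0 speed_pos[of t] by simp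
  ultimately have "m * (c0 / (2 * speed q t)) * \<bar>Im (B q t 0)\<bar> \<le> m * 2 * norm (B q t 0)"
   using m by (intro mult_mono[where b = "m * 2"]) simp_all
  then show ?thesis using m c0 speed_pos[of t] by (simp add: T_def abs_mult)
 qed
 have "(NI t. ennreal \<bar>T q t\<bar>) \<le> (NI t. ennreal (2 * m) * ennreal (norm (B q t 0)))"
  by (rule nn_integral_mono) (use le m in \<open>auto simp: ennreal_mult[symmetric] intro!: ennreal_leI\<close>)
 also have "... = ennreal (2 * m) * (NI t. ennreal (norm (B q t 0)))" by (rule nn_integral_cmult) measurable
 also have "... \<le> ennreal (2 * m) * ennreal (3 / 2 * N)" by (rule mult_left_mono[OF B_time_nn]) simp
 also have "... = ennreal (3 * m * N)" using m N by (subst ennreal_mult[symmetric]) auto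
 also have "... \<le> ennreal (1 / 8)" by (rule ennreal_leI) (use N in simp)
 finally have *: "(NI t. ennreal \<bar>T q t\<bar>) \<le> ennreal (1 / 8)" .
 then have int: "integrable lborel (T q)"
  by (auto simp: integrable_iff_bounded le_less_trans[OF _ ennreal_less_top])
 have "ennreal (LI t. \<bar>T q t\<bar>) \<le> ennreal (1 / 8)"
  using * int by (subst nn_integral_eq_integral[symmetric]) auto
 then show ?thesis using cont int by (simp add: admissible_def)
qed

end

end


section \<open>Dependence on the speed and the fixed point\<close>

lemma norm_cis_diff_le: "norm (cis a - cis b) \<le> \<bar>a - b\<bar>"
proof -
 have "norm (cis a - cis b) \<le> 1 * norm (a - b)"
 proof (rule differentiable_bound[of UNIV cis "\<lambda>t h. h *\<^sub>R (\<i> * cis t)"])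
  show "(cis has_derivative (\<lambda>h. h *\<^sub>R (\<i> * cis t))) (at t within UNIV)" for t
   using has_derivative_compose[of "\<lambda>t. \<i> * of_real t" "\<lambda>h. \<i> * of_real h" t UNIV exp "\<lambda>h. h * exp (\<i> * of_real t)"] DERIV_exp[of "\<i> * of_real t"]
   unfolding cis_conv_exp[abs_def] has_field_derivative_def
   by (simp add: scaleR_conv_of_real mult_ac has_derivative_mult_right[OF has_derivative_of_real[OF has_derivative_ident]] mult_commute_abs)
  show "onorm (\<lambda>h. h *\<^sub>R (\<i> * cis t)) \<le> 1" for t
   by (rule onorm_le[of _ 1, simplified]) (simp add: norm_mult)
 qed auto
 then show ?thesis by simp
qed

lemma seg_measure: "(LINT s:seg t|lborel. (c::real)) = \<bar>t\<bar> * c"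
 unfolding set_lebesgue_integral_def seg_def by (cases "0 \<le> t") (auto simp: min_def max_def)

lemma seg_subset: "s \<in> seg t ==> seg s \<subseteq> seg t"
 by (auto simp: seg_def min_def max_def split: if_splits)

lemma seg_self: "t \<in> seg t" by (auto simp: seg_def)

lemma seg_abs: "s \<in> seg t ==> \<bar>s\<bar> \<le> \<bar>t\<bar>"
 by (auto simp: seg_def min_def max_def split: if_splits)

lemma set_integral_seg_mono:
 fixes f g :: "real => real"
 assumes "set_integrable lborel (seg t) f" "set_integrable lborel (seg t) g" "\<And>s. s \<in> seg t ==> f s \<le> g s"
 shows "(LINT s:seg t|lborel. f s) \<le> (LINT s:seg t|lborel. g s)"
 unfolding set_lebesgue_integral_def
 by (rule integral_mono) (use assms in \<open>auto simp: set_integrable_def indicator_def\<close>)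

lemma set_integral_seg_subset:
 fixes f :: "real => real"
 assumes "continuous_on UNIV f" "\<And>s. f s \<ge> 0" "s \<in> seg t"
 shows "(LINT u:seg s|lborel. f u) \<le> (LINT u:seg t|lborel. f u)"
 unfolding set_lebesgue_integral_def
 by (rule integral_mono)
  (use set_integrable_seg[OF assms(1)] assms(2) seg_subset[OF assms(3)] in \<open>auto simp: set_integrable_def indicator_def\<close>)

lemma set_integral_seg_power:
 "(LINT s:seg t|lborel. \<bar>s\<bar> ^ k) = \<bar>t\<bar> ^ Suc k / real (Suc k)"
proof (cases "0 \<le> t")
 case True
 have "(LI s. indicator {0..t} s *\<^sub>R s ^ k) = t ^ Suc k / real (Suc k) - 0 ^ Suc k / real (Suc k)"
  by (rule integral_FTC_atLeastAtMost[OF True])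
   (auto intro!: derivative_eq_intros continuous_intros simp: has_real_derivative_iff_has_vector_derivative[symmetric] simp del: of_nat_Suc power_Suc)
 moreover have "(LINT s:seg t|lborel. \<bar>s\<bar> ^ k) = (LI s. indicator {0..t} s *\<^sub>R s ^ k)"
  unfolding set_lebesgue_integral_def using True by (intro Bochner_Integration.integral_cong) (auto simp: seg_def indicator_def)
 ultimately show ?thesis using True by simp
next
 case False
 then have t: "t \<le> 0" by simp
 have "(LI s. indicator {t..0} s *\<^sub>R (- s) ^ k) = - ((- 0) ^ Suc k / real (Suc k)) - (- ((- t) ^ Suc k / real (Suc k)))"
  by (rule integral_FTC_atLeastAtMost[OF t])
   (auto intro!: derivative_eq_intros continuous_intros simp: has_real_derivative_iff_has_vector_derivative[symmetric] simp del: of_nat_Suc power_Suc)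
 moreover have "(LINT s:seg t|lborel. \<bar>s\<bar> ^ k) = (LI s. indicator {t..0} s *\<^sub>R (- s) ^ k)"
  unfolding set_lebesgue_integral_def using False by (intro Bochner_Integration.integral_cong) (auto simp: seg_def indicator_def)
 ultimately show ?thesis using False by simp
qed

context profile
begin

text \<open>The first moment bounds \<open>B\<close> itself; the second arises because the variation
  of the phase brings down one more factor \<open>norm z\<close>.\<close>

definition J :: real where "J = (LI z. (norm z + (norm z)^2) * (X z)^2)"

lemma J_integrable: "integrable lborel (\<lambda>z. (norm z + (norm z)^2) * (X z)^2)"
 using X_moments by (simp add: distrib_right)

lemma J_nonneg: "J \<ge> 0" by (simp add: J_def integral_nonneg_AE)

lemma J_ge: "(LI z. norm z * (X z)^2) \<le> J"
 unfolding J_def by (rule integral_mono) (use X_moments J_integrable in \<open>auto intro!: mult_right_mono\<close>)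

context
 fixes p q assumes p: "admissible p" and q: "admissible q"
begin

text \<open>A distance that looks only at times between 0 and \<open>t\<close>: it controls speeds,
  phases and amplitudes at time \<open>t\<close>, and being an integral in time it gains a factorial
  under iteration.\<close>

definition gap :: "real => real" where "gap t = (LINT s:seg t|lborel. \<bar>p s - q s\<bar>)"

lemma diff_continuous: "continuous_on UNIV (\<lambda>s. \<bar>p s - q s\<bar>)"
 using q_props(1)[OF p] q_props(1)[OF q] by (intro continuous_intros)

lemma gap_nonneg: "gap t \<ge> 0"
 unfolding gap_def set_lebesgue_integral_def by (simp add: integral_nonneg_AE)

lemma gap_mono: "s \<in> seg t ==> gap s \<le> gap t"
 unfolding gap_def by (rule set_integral_seg_subset[OF diff_continuous]) auto

lemma speed_diff: "\<bar>speed p t - speed q t\<bar> \<le> gap t"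
proof -
 have c: "continuous_on UNIV (\<lambda>s. p s - q s)" by (intro continuous_intros q_props(1)[OF p] q_props(1)[OF q])
 have "speed p t - speed q t = (speed p 0 - speed q 0) + primitive (\<lambda>s. p s - q s) t"
  by (rule eq_primitive[OF c]) (intro has_vector_derivative_diff speed_deriv p q)
 then have "speed p t - speed q t = primitive (\<lambda>s. p s - q s) t" by (simp add: speed_def)
 then show ?thesis
  using norm_primitive_le[OF c set_integrable_seg[OF diff_continuous], of t] by (simp add: gap_def)
qed

lemma phase_diff: "\<bar>phase p t - phase q t\<bar> \<le> \<bar>t\<bar> * gap t"
proof -
 have c: "continuous_on UNIV (\<lambda>s. speed p s - speed q s)" by (intro continuous_intros speed_continuous p q)
 have "phase p t - phase q t = (phase p 0 - phase q 0) + primitive (\<lambda>s. speed p s - speed q s) t"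
  by (rule eq_primitive[OF c]) (intro has_vector_derivative_diff phase_deriv p q)
 then have "phase p t - phase q t = primitive (\<lambda>s. speed p s - speed q s) t" using phase_0[OF p] phase_0[OF q] by simp
 moreover have "norm (primitive (\<lambda>s. speed p s - speed q s) t) \<le> (LINT s:seg t|lborel. gap t)"
  by (rule norm_primitive_le[OF c set_integrable_seg]) (auto intro: order_trans[OF speed_diff gap_mono])
 ultimately show ?thesis by (simp add: seg_measure)
qed

lemma inverse_speed_diff: "\<bar>1 / speed p t - 1 / speed q t\<bar> \<le> 2 * gap t"
proof -
 have "1 / speed p t - 1 / speed q t = (speed q t - speed p t) / (speed p t * speed q t)"
  using speed_pos[OF p, of t] speed_pos[OF q, of t] by (simp add: field_simps)
 then have "\<bar>1 / speed p t - 1 / speed q t\<bar> = \<bar>speed p t - speed q t\<bar> / (speed p t * speed q t)"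
  using speed_pos[OF p, of t] speed_pos[OF q, of t] by (simp add: abs_mult abs_minus_commute)
 also have "... \<le> gap t / (7 / 8 * (7 / 8))"
  using speed_bounds(1)[OF p, of t] speed_bounds(1)[OF q, of t] by (intro frac_le speed_diff gap_nonneg mult_mono) auto
 finally show ?thesis using gap_nonneg[of t] by simp
qed

lemma rate_diff: "s \<in> seg t ==> \<bar>rate p s - rate q s\<bar> \<le> 2 * \<bar>p s - q s\<bar> + 2 * gap t * \<bar>q s\<bar>"
proof -
 assume s: "s \<in> seg t"
 have "rate p s - rate q s = (p s - q s) * (1 / speed p s) + q s * (1 / speed p s - 1 / speed q s)"
  by (simp add: rate_def algebra_simps diff_divide_distrib)
 then have "\<bar>rate p s - rate q s\<bar> \<le> \<bar>p s - q s\<bar> * \<bar>1 / speed p s\<bar> + \<bar>q s\<bar> * \<bar>1 / speed p s - 1 / speed q s\<bar>"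
  by (metis abs_mult abs_triangle_ineq)
 also have "... \<le> \<bar>p s - q s\<bar> * 2 + \<bar>q s\<bar> * (2 * gap t)"
 proof (intro add_mono mult_left_mono)
  have "1 / speed p s \<le> 1 / (7 / 8)" by (rule divide_left_mono) (use speed_bounds(1)[OF p, of s] speed_pos[OF p, of s] in auto)
  then show "\<bar>1 / speed p s\<bar> \<le> 2" using speed_pos[OF p, of s] by simp
  show "\<bar>1 / speed p s - 1 / speed q s\<bar> \<le> 2 * gap t" using inverse_speed_diff[of s] gap_mono[OF s] by linarith
 qed auto
 finally show ?thesis by (simp add: mult_ac)
qed

text \<open>The difference solves a linear equation whose forcing comes from the change of rate and
  the change of phase. The latter is multiplied by \<open>2 * r\<close>, whence the growth with
  \<open>r * \<bar>t\<bar>\<close>. The small mean of the rate leaves only \<open>E u / 7\<close> of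
  the unknown on the right, which is absorbed.\<close>

lemma amp_diff:
 assumes r: "r \<ge> 0"
 shows "norm (fst (amp p) t r - fst (amp q) t r) + norm (snd (amp p) t r - snd (amp q) t r) \<le> (6 + r * \<bar>t\<bar>) * gap t"
proof -
 define a where "a s = fst (amp p) s r - fst (amp q) s r" for s
 define g where "g s = snd (amp p) s r - snd (amp q) s r" for s
 let ?e = "\<lambda>w q s. cis (w * (2 * r * phase q s))"
 define a' where "a' w f s = of_real (rate p s / 2) * ?e w p s * f (amp p) s r - of_real (rate q s / 2) * ?e w q s * f (amp q) s r" for w s
  and f :: "(real => real => complex) \<times> (real => real => complex) => real => real => complex"
 have ad: "(a has_vector_derivative a' 1 snd s) (at s)" "(g has_vector_derivative a' (-1) fst s) (at s)" for s
  unfolding a_def g_def a'_def using has_vector_derivative_diff[OF amp_props(5)[OF p] amp_props(5)[OF q]]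
   has_vector_derivative_diff[OF amp_props(6)[OF p] amp_props(6)[OF q]] by simp_all
 have ac: "continuous_on UNIV (\<lambda>s. fst (amp q) s r)" "continuous_on UNIV (\<lambda>s. snd (amp q) s r)" if "admissible q" for q
  using amp_props(5)[OF that, of r] amp_props(6)[OF that, of r] by (meson continuous_at_imp_continuous_on has_vector_derivative_continuous)+
 have ec: "continuous_on UNIV (\<lambda>s. ?e w q s)" if "admissible q" for w q
  unfolding cis_conv_exp by (intro continuous_intros phase_continuous that)
 have a'c: "continuous_on UNIV (a' w fst)" "continuous_on UNIV (a' w snd)" for w
  unfolding a'_def by (intro continuous_intros rate_continuous ec ac p q; simp)+
 have cE: "continuous_on UNIV (\<lambda>s. norm (a s) + norm (g s))"
  unfolding a_def g_def by (intro continuous_intros ac p q)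
 define E where "E s = norm (a s) + norm (g s)" for s
 have "compact (seg t)" "seg t \<noteq> {}" by (auto simp: seg_def)
 \<comment> \<open>A time at which the difference is largest on the segment; estimating there lets
   the term with the unknown be absorbed instead of iterated.\<close>
 then obtain u where u: "u \<in> seg t" "\<And>s. s \<in> seg t ==> E s \<le> E u"
  using continuous_attains_sup[of "seg t" E] continuous_on_subset[OF cE] unfolding E_def by auto
 let ?D = "gap t"
 have le: "norm (primitive (a' w f) u) \<le> (9 / 4 + 2 / 7 * (r * \<bar>t\<bar>)) * ?D + E u / 14"
  if f: "continuous_on UNIV (a' w f)" "\<And>s. norm (f (amp p) s r) \<le> 2" "\<And>s. norm (f (amp p) s r - f (amp q) s r) \<le> E s" and w: "\<bar>w\<bar> = 1" for w f
 proof -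
  let ?b = "\<lambda>s. 2 * \<bar>p s - q s\<bar> + (2 * ?D) * \<bar>q s\<bar> + (2 * (r * \<bar>t\<bar>) * ?D + E u / 2) * \<bar>rate q s\<bar>"
  have bc: "continuous_on UNIV ?b" by (intro continuous_on_add continuous_on_mult_left diff_continuous continuous_on_rabs q_props(1)[OF q] rate_continuous[OF q])
  have "norm (a' w f s) \<le> ?b s" if s: "s \<in> seg u" for s
  proof -
   have s': "s \<in> seg t" using seg_subset[OF u(1)] s by auto
   have "a' w f s = of_real ((rate p s - rate q s) / 2) * ?e w p s * f (amp p) s r
    + of_real (rate q s / 2) * (?e w p s - ?e w q s) * f (amp p) s r
    + of_real (rate q s / 2) * ?e w q s * (f (amp p) s r - f (amp q) s r)"
    unfolding a'_def by (simp add: algebra_simps diff_divide_distrib)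
   then have "norm (a' w f s) \<le> \<bar>rate p s - rate q s\<bar> / 2 * norm (f (amp p) s r)
    + \<bar>rate q s\<bar> / 2 * norm (?e w p s - ?e w q s) * norm (f (amp p) s r)
    + \<bar>rate q s\<bar> / 2 * norm (f (amp p) s r - f (amp q) s r)"
    by (simp only:) (intro norm_triangle_le add_mono, simp_all only: norm_mult norm_of_real norm_cis abs_divide abs_numeral mult_1_right order_refl)
   also have "... \<le> (2 * \<bar>p s - q s\<bar> + 2 * ?D * \<bar>q s\<bar>) / 2 * 2 + \<bar>rate q s\<bar> / 2 * (2 * r * (\<bar>t\<bar> * ?D)) * 2 + \<bar>rate q s\<bar> / 2 * E u"
   proof (intro add_mono mult_mono f(2))
    show "\<bar>rate p s - rate q s\<bar> / 2 \<le> (2 * \<bar>p s - q s\<bar> + 2 * ?D * \<bar>q s\<bar>) / 2" using rate_diff[OF s'] by simp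
    have "\<bar>phase p s - phase q s\<bar> \<le> \<bar>t\<bar> * ?D"
     using phase_diff[of s] mult_mono[OF seg_abs[OF s'] gap_mono[OF s']] gap_nonneg[of s] by simp
    then have "2 * r * \<bar>phase p s - phase q s\<bar> \<le> 2 * r * (\<bar>t\<bar> * ?D)" using r by (intro mult_left_mono) auto
    moreover have "norm (?e w p s - ?e w q s) \<le> 2 * r * \<bar>phase p s - phase q s\<bar>"
     using norm_cis_diff_le[of "w * (2 * r * phase p s)" "w * (2 * r * phase q s)"] w r
     by (simp add: right_diff_distrib[symmetric] abs_mult)
    ultimately show "norm (?e w p s - ?e w q s) \<le> 2 * r * (\<bar>t\<bar> * ?D)" by linarith
    show "norm (f (amp p) s r - f (amp q) s r) \<le> E u" using f(3)[of s] u(2)[OF s'] by linarith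
   qed (use r gap_nonneg[of t] in auto)
   also have "... = ?b s" by (simp add: algebra_simps)
   finally show ?thesis .
  qed
  then have "norm (primitive (a' w f) u) \<le> (LINT s:seg u|lborel. ?b s)"
   by (rule norm_primitive_le[OF f(1) set_integrable_seg[OF bc]])
  also have "... = 2 * gap u + (2 * ?D) * (LINT s:seg u|lborel. \<bar>q s\<bar>) + (2 * (r * \<bar>t\<bar>) * ?D + E u / 2) * (LINT s:seg u|lborel. \<bar>rate q s\<bar>)"
   unfolding gap_def
   by (subst set_integral_add(2), (intro set_integrable_seg continuous_intros q_props(1) rate_continuous p q)+, subst set_integral_add(2), (intro set_integrable_seg continuous_intros q_props(1) rate_continuous p q)+) simp
  also have "... \<le> 2 * ?D + (2 * ?D) * (1 / 8) + (2 * (r * \<bar>t\<bar>) * ?D + E u / 2) * (1 / 7)"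
  proof (intro add_mono mult_left_mono)
   show "gap u \<le> ?D" by (rule gap_mono[OF u(1)])
   show "(LINT s:seg u|lborel. \<bar>q s\<bar>) \<le> 1 / 8"
    using set_integral_seg_le(2)[of "\<lambda>s. \<bar>q s\<bar>" u] q_props[OF q] by simp
   show "(LINT s:seg u|lborel. \<bar>rate q s\<bar>) \<le> 1 / 7"
    using set_integral_seg_le(2)[of "\<lambda>s. \<bar>rate q s\<bar>" u] rate_integrable[OF q] by simp
  qed (use r gap_nonneg[of t] in \<open>auto simp: E_def\<close>)
  also have "... = (9 / 4 + 2 / 7 * (r * \<bar>t\<bar>)) * ?D + E u / 14" by (simp add: algebra_simps)
  finally show ?thesis .
 qed
 have "a u = a 0 + primitive (a' 1 snd) u" "g u = g 0 + primitive (a' (-1) fst) u"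
  by (rule eq_primitive[OF a'c(2) ad(1)], rule eq_primitive[OF a'c(1) ad(2)])
 moreover have "a 0 = 0" "g 0 = 0" unfolding a_def g_def using amp_props(7,8)[OF p] amp_props(7,8)[OF q] by simp_all
 ultimately have "E u = norm (primitive (a' 1 snd) u) + norm (primitive (a' (-1) fst) u)" by (simp add: E_def)
 also have "... \<le> ((9 / 4 + 2 / 7 * (r * \<bar>t\<bar>)) * ?D + E u / 14) + ((9 / 4 + 2 / 7 * (r * \<bar>t\<bar>)) * ?D + E u / 14)"
  by (intro add_mono le a'c amp_props p) (auto simp: E_def a_def g_def)
 finally have "E u \<le> 7 / 6 * ((9 / 2 + 4 / 7 * (r * \<bar>t\<bar>)) * ?D)" by (simp add: algebra_simps)
 also have "... = (21 / 4 + 2 / 3 * (r * \<bar>t\<bar>)) * ?D" by (simp add: algebra_simps)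
 also have "... \<le> (6 + r * \<bar>t\<bar>) * ?D" using r gap_nonneg[of t] mult_nonneg_nonneg[OF r abs_ge_zero[of t]] by (intro mult_right_mono) linarith+
 finally have "E u \<le> (6 + r * \<bar>t\<bar>) * ?D" .
 then show ?thesis using u(2)[OF seg_self] unfolding E_def a_def g_def by linarith
qed

lemma VW_diff:
 "norm (V p t z - V q t z) \<le> (6 + norm z * \<bar>t\<bar>) * gap t * X z" "norm (W p t z - W q t z) \<le> (6 + norm z * \<bar>t\<bar>) * gap t * X z"
proof -
 let ?E = "(6 + norm z * \<bar>t\<bar>) * gap t"
 note d = amp_diff[of "norm z" t]
 have *: "norm (a * V0 z + b * W0 z) \<le> ?E * X z" if "norm a \<le> ?E" "norm b \<le> ?E" for a b
  using norm_triangle_ineq[of "a * V0 z" "b * W0 z"] mult_right_mono[OF that(1), of "norm (V0 z)"] mult_right_mono[OF that(2), of "norm (W0 z)"]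
  unfolding X_def norm_mult distrib_left[of ?E] by simp
 have n: "norm (fst (amp p) t (norm z) - fst (amp q) t (norm z)) \<le> ?E" "norm (snd (amp p) t (norm z) - snd (amp q) t (norm z)) \<le> ?E"
  using d[OF norm_ge_zero] norm_ge_zero[of "snd (amp p) t (norm z) - snd (amp q) t (norm z)"] norm_ge_zero[of "fst (amp p) t (norm z) - fst (amp q) t (norm z)"]
  by linarith+
 then have n': "norm (cnj (fst (amp p) t (norm z)) - cnj (fst (amp q) t (norm z))) \<le> ?E" "norm (cnj (snd (amp p) t (norm z)) - cnj (snd (amp q) t (norm z))) \<le> ?E"
  by (simp_all only: complex_cnj_diff[symmetric] complex_mod_cnj)
 show "norm (V p t z - V q t z) \<le> ?E * X z" "norm (W p t z - W q t z) \<le> ?E * X z"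
  using *[OF n(1) n'(2)] *[OF n(2) n'(1)] by (simp_all add: V_def W_def algebra_simps)
qed

text \<open>The phase contributes \<open>8 * \<bar>t\<bar> * r^2\<close> and the amplitudes
  \<open>24 * r + 4 * \<bar>t\<bar> * r^2\<close>, each times the gap and \<open>(X y)^2\<close>,
  where \<open>r = norm y\<close>.\<close>

lemma B_diff: "norm (B p t 0 - B q t 0) \<le> 24 * (1 + \<bar>t\<bar>) * gap t * J"
proof -
 let ?D = "gap t"
 let ?b = "\<lambda>q y. of_real (norm y) * cis ((0 - 2 * phase q t) * norm y) * Z q t y"
 have i: "integrable lborel (?b q)" if "admissible q" for q
 proof -
  have [measurable]: "Z q t \<in> Borel" using SZ_measurable(2)[OF that] by measurable
  show ?thesis by (rule hat_integrable(1)[OF that _ SZ_le(2)[OF that]]) measurable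
 qed
 have "norm (B p t 0 - B q t 0) = norm (LI y. ?b p y - ?b q y)"
  unfolding B_def by (subst Bochner_Integration.integral_diff[OF i[OF p] i[OF q]]) simp
 also have "... \<le> (LI y. (24 * (1 + \<bar>t\<bar>) * ?D) * ((norm y + (norm y)^2) * (X y)^2))"
 proof (rule Bochner_Integration.integral_norm_bound_integral)
  fix y :: 'a
  let ?r = "norm y" and ?e = "\<lambda>q. cis ((0 - 2 * phase q t) * norm y)"
  have "norm (?e p - ?e q) \<le> \<bar>(0 - 2 * phase p t) * ?r - (0 - 2 * phase q t) * ?r\<bar>" by (rule norm_cis_diff_le)
  also have "(0 - 2 * phase p t) * ?r - (0 - 2 * phase q t) * ?r = - (2 * ?r) * (phase p t - phase q t)" by (simp add: algebra_simps)
  also have "\<bar>- (2 * ?r) * (phase p t - phase q t)\<bar> = 2 * ?r * \<bar>phase p t - phase q t\<bar>" by (simp add: abs_mult)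
  also have "... \<le> 2 * ?r * (\<bar>t\<bar> * ?D)" by (intro mult_left_mono phase_diff) simp
  finally have e: "norm (?e p - ?e q) \<le> 2 * ?r * (\<bar>t\<bar> * ?D)" .
  have "Z p t y - Z q t y = (V p t y - V q t y) * cnj (W p t y) + V q t y * cnj (W p t y - W q t y)"
   by (simp add: Z_def algebra_simps)
  then have "norm (Z p t y - Z q t y) \<le> norm (V p t y - V q t y) * norm (W p t y) + norm (V q t y) * norm (W p t y - W q t y)"
   by (simp only:) (rule norm_triangle_le, simp only: norm_mult complex_mod_cnj)
  also have "... \<le> ((6 + ?r * \<bar>t\<bar>) * ?D * X y) * (2 * X y) + (2 * X y) * ((6 + ?r * \<bar>t\<bar>) * ?D * X y)"
   using gap_nonneg[of t] X_nonneg[of y] by (intro add_mono mult_mono VW_diff VW_le p q) auto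
  finally have z: "norm (Z p t y - Z q t y) \<le> 4 * (6 + ?r * \<bar>t\<bar>) * ?D * (X y)^2" by (simp add: power2_eq_square algebra_simps)
  have "?b p y - ?b q y = of_real ?r * ((?e p - ?e q) * Z p t y + ?e q * (Z p t y - Z q t y))" by (simp add: algebra_simps)
  then have "norm (?b p y - ?b q y) = ?r * norm ((?e p - ?e q) * Z p t y + ?e q * (Z p t y - Z q t y))"
   by (simp only: norm_mult norm_of_real abs_norm_cancel)
  also have "... \<le> ?r * (norm (?e p - ?e q) * norm (Z p t y) + norm (Z p t y - Z q t y))"
   by (intro mult_left_mono norm_triangle_le) (simp_all only: norm_mult norm_cis mult_1_left order_refl norm_ge_zero)
  also have "... \<le> ?r * (2 * ?r * (\<bar>t\<bar> * ?D) * (4 * (X y)^2) + 4 * (6 + ?r * \<bar>t\<bar>) * ?D * (X y)^2)"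
   using gap_nonneg[of t] by (intro mult_left_mono add_mono mult_mono e z SZ_le(2) p) auto
  also have "... = (?D * (X y)^2) * (12 * (\<bar>t\<bar> * ?r\<^sup>2) + 24 * ?r)" by (simp add: power2_eq_square algebra_simps)
  also have "... \<le> (?D * (X y)^2) * (24 * (1 + \<bar>t\<bar>) * (?r + ?r\<^sup>2))"
  proof (rule mult_left_mono)
   have "0 \<le> \<bar>t\<bar> * ?r\<^sup>2" "0 \<le> \<bar>t\<bar> * ?r" "0 \<le> ?r\<^sup>2" by auto
   moreover have "24 * (1 + \<bar>t\<bar>) * (?r + ?r\<^sup>2) = 24 * ?r + 24 * ?r\<^sup>2 + 24 * (\<bar>t\<bar> * ?r) + 24 * (\<bar>t\<bar> * ?r\<^sup>2)" by (simp add: algebra_simps)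
   ultimately show "12 * (\<bar>t\<bar> * ?r\<^sup>2) + 24 * ?r \<le> 24 * (1 + \<bar>t\<bar>) * (?r + ?r\<^sup>2)" by linarith
  qed (use gap_nonneg[of t] in auto)
  finally show "norm (?b p y - ?b q y) \<le> (24 * (1 + \<bar>t\<bar>) * ?D) * ((norm y + (norm y)^2) * (X y)^2)"
   by (simp only: mult_ac)
 qed (use i p q J_integrable in auto)
 also have "... = 24 * (1 + \<bar>t\<bar>) * ?D * J" by (simp add: J_def)
 finally show ?thesis .
qed

text \<open>The change of \<open>1 / speed\<close> gives 8 and the change of \<open>B\<close> gives
  \<open>8 / 7 * 24 * (1 + \<bar>t\<bar>)\<close>, in total less than
  \<open>36 * (1 + \<bar>t\<bar>)\<close>. The factor grows with time, so \<open>T\<close> is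
  compared on bounded intervals.\<close>

lemma T_diff: "\<bar>T p t - T q t\<bar> \<le> 36 * m * J * (1 + \<bar>t\<bar>) * gap t"
proof -
 let ?D = "gap t"
 have "T p t - T q t = (m * c0 / 2) * (Im (B p t 0) * (1 / speed p t - 1 / speed q t) + (1 / speed q t) * Im (B p t 0 - B q t 0))"
  by (simp add: T_def algebra_simps diff_divide_distrib)
 then have "\<bar>T p t - T q t\<bar> = (m * c0 / 2) * \<bar>Im (B p t 0) * (1 / speed p t - 1 / speed q t) + (1 / speed q t) * Im (B p t 0 - B q t 0)\<bar>"
  using m c0 by (simp only: abs_mult[of "m * c0 / 2"]) simp
 also have "... \<le> (m * 2 / 2) * (\<bar>Im (B p t 0)\<bar> * \<bar>1 / speed p t - 1 / speed q t\<bar> + \<bar>1 / speed q t\<bar> * \<bar>Im (B p t 0 - B q t 0)\<bar>)"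
  using m c0 by (intro mult_mono divide_right_mono mult_left_mono) (auto simp: abs_mult[symmetric] intro: order_trans[OF abs_triangle_ineq])
 also have "... \<le> (m * 2 / 2) * ((4 * J) * (2 * ?D) + 8 / 7 * (24 * (1 + \<bar>t\<bar>) * ?D * J))"
 proof (intro mult_left_mono add_mono mult_mono)
  show "\<bar>Im (B p t 0)\<bar> \<le> 4 * J" using abs_Im_le_cmod[of "B p t 0"] AB_le(2)[OF p, of t 0] J_ge by linarith
  show "\<bar>1 / speed p t - 1 / speed q t\<bar> \<le> 2 * ?D" by (rule inverse_speed_diff)
  have "1 / speed q t \<le> 1 / (7 / 8)" by (rule divide_left_mono) (use speed_bounds(1)[OF q, of t] speed_pos[OF q, of t] in auto)
  then show "\<bar>1 / speed q t\<bar> \<le> 8 / 7" using speed_pos[OF q, of t] by simp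
  show "\<bar>Im (B p t 0 - B q t 0)\<bar> \<le> 24 * (1 + \<bar>t\<bar>) * ?D * J" using abs_Im_le_cmod[of "B p t 0 - B q t 0"] B_diff[of t] by linarith
 qed (use m J_nonneg gap_nonneg[of t] in auto)
 also have "... = (m * J * ?D) * (8 + 8 / 7 * 24 * (1 + \<bar>t\<bar>))" by (simp add: field_simps)
 also have "... \<le> (m * J * ?D) * (36 * (1 + \<bar>t\<bar>))"
  using m J_nonneg gap_nonneg[of t] by (intro mult_left_mono) auto
 finally show ?thesis by (simp only: mult_ac)
qed

end

section \<open>Picard iteration for the speed\<close>

primrec Q :: "nat => real => real" where
 "Q 0 = (\<lambda>t. 0)"
| "Q (Suc k) = T (Q k)"

lemma Q_admissible: "admissible (Q k)"
proof (induction k)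
 case 0 show ?case by (simp add: admissible_def)
next
 case (Suc k) then show ?case by (simp add: T_admissible)
qed

text \<open>On \<open>\<bar>t\<bar> <= R\<close> the factor \<open>1 + \<bar>t\<bar>\<close> is
  replaced by the constant \<open>1 + R\<close>; each step then integrates a power of
  \<open>\<bar>s\<bar>\<close>, as in Picard's theorem. The constant 8 is 2 times the bound
  \<open>4 * J\<close> for \<open>B\<close> at the zero speed derivative.\<close>

lemma Q_step:
 fixes t :: real
 assumes "\<bar>t\<bar> \<le> R"
 shows "\<bar>Q (Suc k) t - Q k t\<bar> \<le> 8 * m * J * ((36 * m * J * (1 + R) * \<bar>t\<bar>) ^ k / fact k)"
 using assms
proof (induction k arbitrary: t)
 case 0
 have q: "admissible (\<lambda>t. 0)" using Q_admissible[of 0] by simp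
 have "c0 / (2 * speed (\<lambda>t. 0) t) \<le> 2 / (2 * (7 / 8))"
  using c0 speed_bounds(1)[OF q, of t] by (intro frac_le) auto
 then have "m * (c0 / (2 * speed (\<lambda>t. 0) t)) \<le> m * 2" using m by (intro mult_left_mono) auto
 moreover have "\<bar>Im (B (\<lambda>t. 0) t 0)\<bar> \<le> 4 * J" using abs_Im_le_cmod[of "B (\<lambda>t. 0) t 0"] AB_le(2)[OF q, of t 0] J_ge by linarith
 ultimately have "m * (c0 / (2 * speed (\<lambda>t. 0) t)) * \<bar>Im (B (\<lambda>t. 0) t 0)\<bar> \<le> m * 2 * (4 * J)"
  using m by (intro mult_mono[where b = "m * 2"]) simp_all
 then show ?case using m c0 speed_pos[OF q, of t] by (simp add: T_def abs_mult mult_ac)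
next
 case (Suc k)
 let ?L = "36 * m * J * (1 + R)"
 have scale: "L * (c * L ^ k / fact k * (x ^ Suc k / real (Suc k))) = c * ((L * x) ^ Suc k / fact (Suc k))" for L c x :: real
  by (simp add: power_mult_distrib mult_ac del: of_nat_Suc)
 have L: "?L \<ge> 0" using m J_nonneg Suc.prems by simp
 have s: "\<bar>s\<bar> \<le> R" if "s \<in> seg t" for s using seg_abs[OF that] Suc.prems by linarith
 have "gap (Q (Suc k)) (Q k) t \<le> (LINT s:seg t|lborel. 8 * m * J * ?L ^ k / fact k * \<bar>s\<bar> ^ k)"
  unfolding gap_def[OF Q_admissible Q_admissible]
 proof (rule set_integral_seg_mono)
  show "set_integrable lborel (seg t) (\<lambda>s. \<bar>Q (Suc k) s - Q k s\<bar>)"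
   by (rule set_integrable_seg[OF diff_continuous[OF Q_admissible Q_admissible]])
  show "set_integrable lborel (seg t) (\<lambda>s. 8 * m * J * ?L ^ k / fact k * \<bar>s\<bar> ^ k)"
   by (rule set_integrable_seg) (intro continuous_intros)
  show "\<bar>Q (Suc k) s - Q k s\<bar> \<le> 8 * m * J * ?L ^ k / fact k * \<bar>s\<bar> ^ k" if "s \<in> seg t" for s
   using Suc.IH[OF s[OF that]] by (simp only: power_mult_distrib times_divide_eq_right times_divide_eq_left mult.assoc)
 qed
 also have "... = 8 * m * J * ?L ^ k / fact k * (\<bar>t\<bar> ^ Suc k / real (Suc k))"
  by (simp add: set_integral_seg_power del: of_nat_Suc power_Suc)
 finally have g: "gap (Q (Suc k)) (Q k) t \<le> 8 * m * J * ?L ^ k / fact k * (\<bar>t\<bar> ^ Suc k / real (Suc k))" .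
 have "\<bar>Q (Suc (Suc k)) t - Q (Suc k) t\<bar> \<le> 36 * m * J * (1 + \<bar>t\<bar>) * gap (Q (Suc k)) (Q k) t"
  using T_diff[OF Q_admissible[of "Suc k"] Q_admissible[of k], of t] by simp
 also have "... \<le> ?L * (8 * m * J * ?L ^ k / fact k * (\<bar>t\<bar> ^ Suc k / real (Suc k)))"
  using m J_nonneg Suc.prems gap_nonneg[OF Q_admissible[of "Suc k"] Q_admissible[of k], of t] by (intro mult_mono g mult_left_mono) auto
 also have "... = 8 * m * J * ((?L * \<bar>t\<bar>) ^ Suc k / fact (Suc k))"
  by (rule scale)
 finally show ?case .
qed

text \<open>Convergence is uniform on bounded intervals, which gives continuity of the limit and the
  equation at each time. Integrability over the whole line passes to the limit by Fatou, as all
  iterates obey the same bound 1/8.\<close>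

lemma exists_fixed_point: "\<exists>q. admissible q \<and> T q = q"
proof -
 define q where "q t = (\<Sum>k. Q (Suc k) t - Q k t)" for t
 have partial: "(\<Sum>k<n. Q (Suc k) t - Q k t) = Q n t" for n t
  using sum_lessThan_telescope[of "\<lambda>k. Q k t" n] by simp
 have unif: "uniform_limit {-R..R} Q q sequentially" if "R \<ge> 0" for R
 proof -
  have "uniform_limit {-R..R} (\<lambda>n t. \<Sum>k<n. Q (Suc k) t - Q k t) (\<lambda>t. suminf (\<lambda>k. Q (Suc k) t - Q k t)) sequentially"
  proof (rule Weierstrass_m_test)
   fix k t assume "t \<in> {-R..R}"
   then have t: "\<bar>t\<bar> \<le> R" by auto
   have "(36 * m * J * (1 + R) * \<bar>t\<bar>) ^ k \<le> (36 * m * J * (1 + R) * R) ^ k"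
    using m J_nonneg that t by (intro power_mono mult_left_mono) auto
   then have "8 * m * J * ((36 * m * J * (1 + R) * \<bar>t\<bar>) ^ k / fact k) \<le> 8 * m * J * ((36 * m * J * (1 + R) * R) ^ k / fact k)"
    using m J_nonneg by (intro mult_left_mono divide_right_mono) auto
   then show "norm (Q (Suc k) t - Q k t) \<le> 8 * m * J * ((36 * m * J * (1 + R) * R) ^ k / fact k)"
    using Q_step[OF t, of k] by simp
  next
   show "summable (\<lambda>k. 8 * m * J * ((36 * m * J * (1 + R) * R) ^ k / fact k))"
    by (intro summable_mult) (use summable_exp[of "36 * m * J * (1 + R) * R"] in \<open>simp add: divide_inverse mult.commute\<close>)
  qed
  then show ?thesis unfolding partial q_def[symmetric] .
 qed
 have lim: "(\<lambda>n. Q n t) \<longlonglongrightarrow> q t" for t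
  by (rule tendsto_uniform_limitI[OF unif[of "\<bar>t\<bar>"]]) auto
 have cont: "continuous_on UNIV q"
 proof (rule continuous_at_imp_continuous_on, rule ballI)
  fix t :: real
  let ?R = "\<bar>t\<bar> + 1"
  have "continuous_on {-?R..?R} q"
   by (rule uniform_limit_theorem[OF _ unif]) (auto intro!: always_eventually continuous_on_subset[OF q_props(1)[OF Q_admissible]])
  then show "isCont q t" by (rule continuous_on_interior) auto
 qed
 have "(NI t. ennreal \<bar>q t\<bar>) \<le> ennreal (1 / 8)"
 proof (rule nn_integral_le_of_tendsto[where u = "\<lambda>n t. ennreal \<bar>Q n t\<bar>"])
  show "(\<lambda>t. ennreal \<bar>Q n t\<bar>) \<in> borel_measurable lborel" for n
   using borel_measurable_continuous_onI[OF q_props(1)[OF Q_admissible[of n]]] by simp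
  show "AE t in lborel. (\<lambda>n. ennreal \<bar>Q n t\<bar>) \<longlonglongrightarrow> ennreal \<bar>q t\<bar>"
   by (intro AE_I2 tendsto_ennrealI tendsto_rabs lim)
  show "\<forall>\<^sub>F n in sequentially. (NI t. ennreal \<bar>Q n t\<bar>) \<le> ennreal (1 / 8)"
  proof (intro always_eventually allI)
   fix n
   show "(NI t. ennreal \<bar>Q n t\<bar>) \<le> ennreal (1 / 8)"
    using q_props(2,3)[OF Q_admissible[of n]] by (subst nn_integral_eq_integral) (auto intro!: ennreal_leI)
  qed
 qed
 note nn = this
 have [measurable]: "q \<in> Borel" by (rule borel_measurable_continuous_onI[OF cont])
 have int: "integrable lborel q" using nn by (auto simp: integrable_iff_bounded le_less_trans[OF _ ennreal_less_top])
 have "ennreal (LI t. \<bar>q t\<bar>) \<le> ennreal (1 / 8)"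
  using nn int by (subst nn_integral_eq_integral[symmetric]) auto
 then have adm: "admissible q" using cont int by (simp add: admissible_def)
 have "T q t = q t" for t
 proof (rule LIMSEQ_unique)
  show "(\<lambda>n. T (Q n) t) \<longlonglongrightarrow> q t" using LIMSEQ_Suc[OF lim[of t]] by simp
  have "(\<lambda>n. gap (Q n) q t) \<longlonglongrightarrow> 0"
  proof (rule LIMSEQ_I)
   fix e :: real assume e: "e > 0"
   let ?d = "e / (2 * (\<bar>t\<bar> + 1))"
   have d: "?d > 0" using e by simp
   from uniform_limitD[OF unif[of "\<bar>t\<bar>"] d] obtain n0 where n0': "\<forall>n\<ge>n0. \<forall>s\<in>{-\<bar>t\<bar>..\<bar>t\<bar>}. dist (Q n s) (q s) < ?d"
    unfolding eventually_sequentially by auto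
   have n0: "\<bar>Q n s - q s\<bar> \<le> ?d" if "n \<ge> n0" "s \<in> seg t" for n s
    using n0'[rule_format, of n s] that seg_abs[OF that(2)] by (simp only: dist_real_def atLeastAtMost_iff abs_le_iff) argo
   have "norm (gap (Q n) q t - 0) < e" if "n \<ge> n0" for n
   proof -
    have "gap (Q n) q t \<le> (LINT s:seg t|lborel. ?d)"
     unfolding gap_def[OF Q_admissible adm]
     by (rule set_integral_seg_mono) ((intro set_integrable_seg diff_continuous[OF Q_admissible adm] continuous_on_const)+, rule n0[OF that])
    also have "... = \<bar>t\<bar> * ?d" by (rule seg_measure)
    also have "... < e" using e add_nonneg_pos[of "e * \<bar>t\<bar>" "e * 2"] by (simp add: field_simps)
    finally show ?thesis using gap_nonneg[OF Q_admissible adm, of n t] by simp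
   qed
   then show "\<exists>n0. \<forall>n\<ge>n0. norm (gap (Q n) q t - 0) < e" by blast
  qed
  then have "(\<lambda>n. 36 * m * J * (1 + \<bar>t\<bar>) * gap (Q n) q t) \<longlonglongrightarrow> 0" by (rule tendsto_mult_right_zero)
  then have "(\<lambda>n. T (Q n) t - T q t) \<longlonglongrightarrow> 0"
   by (rule Lim_null_comparison[rotated]) (use T_diff[OF Q_admissible adm] in simp)
  then show "(\<lambda>n. T (Q n) t) \<longlonglongrightarrow> T q t" by (rule LIM_zero_cancel)
 qed
 then show ?thesis using adm by blast
qed

end


section \<open>From the fixed point to a solution in frequency\<close>

lemma L2_norm_tendsto_0:
 fixes f :: "real => 'a::euclidean_space => complex"
 assumes f: "\<And>s. f s \<in> Borel" and G: "integrable lborel (\<lambda>z. (G z)^2)"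
  and le: "\<And>s z. norm (f s z) \<le> G z" and lim: "\<And>z. ((\<lambda>s. f s z) \<longlongrightarrow> 0) (at t)"
 shows "((\<lambda>s. L2_norm (f s)) \<longlongrightarrow> 0) (at t)"
 unfolding tendsto_at_iff_sequentially comp_def
proof (intro allI impI)
 fix u :: "nat => real" assume u: "\<forall>i. u i \<in> UNIV - {t}" "u \<longlonglongrightarrow> t"
 note [measurable] = f
 have "(\<lambda>i. \<integral>z. (norm (f (u i) z))^2 \<partial>lborel) \<longlonglongrightarrow> (\<integral>z. 0 \<partial>(lborel :: 'a measure))"
 proof (rule integral_dominated_convergence[where w = "\<lambda>z. (G z)^2"])
  have "(\<lambda>i. f (u i) z) \<longlonglongrightarrow> 0" for z
   using lim[of z] u unfolding tendsto_at_iff_sequentially comp_def by blast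
  then show "AE z in lborel. (\<lambda>i. (norm (f (u i) z))^2) \<longlonglongrightarrow> 0"
   by (intro AE_I2) (auto intro!: tendsto_eq_intros simp: tendsto_norm_zero_iff)
  show "AE z in lborel. norm ((norm (f (u i) z))^2) \<le> (G z)^2" for i
   using le by (intro AE_I2) (auto intro: power_mono)
 qed (use G in auto)
 then have "(\<lambda>i. sqrt (LI z. (norm (f (u i) z))^2)) \<longlonglongrightarrow> sqrt 0"
  by (intro tendsto_real_sqrt) simp
 then show "(\<lambda>i. L2_norm (f (u i))) \<longlonglongrightarrow> 0" by (simp add: L2_norm_def)
qed

lemma difference_quotient_le:
 fixes f :: "real => complex"
 assumes f: "\<And>s. (f has_vector_derivative f' s) (at s)" and le: "\<And>s. norm (f' s) \<le> K"
 shows "norm ((f (t + h) - f t) / of_real h) \<le> K"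
proof (cases "h = 0")
 case True then show ?thesis using order_trans[OF norm_ge_zero le[of 0]] by simp
next
 case False
 have "norm (f (t + h) - f t) \<le> K * norm (t + h - t)"
 proof (rule differentiable_bound[of UNIV f "\<lambda>s h. h *\<^sub>R f' s"])
  show "(f has_derivative (\<lambda>h. h *\<^sub>R f' s)) (at s within UNIV)" for s
   using f[of s] by (simp add: has_vector_derivative_def)
  show "onorm (\<lambda>h. h *\<^sub>R f' s) \<le> K" for s
   by (rule onorm_bound) (use order_trans[OF norm_ge_zero le[of s]] le[of s] in \<open>auto simp: mult.commute[of K] intro: mult_left_mono\<close>)
 qed auto
 then show ?thesis using False by (simp add: norm_divide field_simps)
qed

context profile
begin

context
 fixes q assumes q: "admissible q" and fixed: "T q = q"
begin

text \<open>The factor \<open>sqrt (c0 / speed q t)\<close> removes the diagonal term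
  \<open>- rate / 2\<close> of the diagonalised first-order system; what is left couples
  \<open>V\<close> and \<open>W\<close> only, which is the amplitude system.\<close>

definition U :: "real => 'a => complex" where
 "U t z = of_real (sqrt (c0 / speed q t)) * (cis (- (norm z * phase q t)) * V q t z + cis (norm z * phase q t) * W q t z) / 2"

definition P :: "real => 'a => complex" where
 "P t z = of_real (sqrt (c0 / speed q t)) * (cis (- (norm z * phase q t)) * V q t z - cis (norm z * phase q t) * W q t z) / (2 * \<i>)"

definition DU :: "real => 'a => complex" where
 "DU t z = of_real (speed q t * norm z) * P t z"

lemma UP_measurable [measurable]:
 "U t \<in> Borel" "P t \<in> Borel" "DU t \<in> Borel"
proof -
 have [measurable]: "V q t \<in> Borel" "W q t \<in> Borel"
  using VW_measurable[OF q] by measurable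
 show "U t \<in> Borel" "P t \<in> Borel" unfolding U_def[abs_def] P_def[abs_def] by measurable
 then show "DU t \<in> Borel" unfolding DU_def[abs_def] by measurable
qed

lemma UP_le: "norm (U t y) \<le> 4 * X y" "norm (P t y) \<le> 4 * X y" "norm (DU t y) \<le> 9 * (norm y * X y)"
proof -
 have "c0 / speed q t \<le> 4" using c0 speed_bounds(1)[OF q, of t] speed_pos[OF q, of t] by (simp add: divide_le_eq)
 then have s: "sqrt (c0 / speed q t) \<le> 2" by (intro real_le_lsqrt) auto
 have s0: "sqrt (c0 / speed q t) \<ge> 0" using c0 speed_pos[OF q, of t] by simp
 let ?a = "cis (- (norm y * phase q t)) * V q t y" and ?b = "cis (norm y * phase q t) * W q t y"
 have *: "norm (of_real (sqrt (c0 / speed q t)) * z / w) \<le> 4 * X y" if "norm z \<le> norm ?a + norm ?b" "norm w = 2" for z w :: complex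
 proof -
  have "norm z \<le> 4 * X y" using that(1) VW_le[OF q, of t y] by (simp add: norm_mult)
  then have "sqrt (c0 / speed q t) * norm z \<le> 2 * (4 * X y)" using s s0 by (intro mult_mono) auto
  then show ?thesis using that(2) s0 by (simp add: norm_mult norm_divide)
 qed
 show "norm (U t y) \<le> 4 * X y" unfolding U_def by (rule *[OF norm_triangle_ineq]) simp
 show P: "norm (P t y) \<le> 4 * X y" unfolding P_def by (rule *[OF norm_triangle_ineq4]) (simp add: norm_mult)
 have "norm (DU t y) = speed q t * norm y * norm (P t y)" using speed_pos[OF q, of t] by (simp add: DU_def norm_mult)
 also have "... \<le> 17 / 8 * norm y * (4 * X y)"
  using P speed_bounds(2)[OF q, of t] by (intro mult_mono mult_right_mono) (auto simp: X_nonneg)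
 also have "... \<le> 9 * (norm y * X y)" using mult_nonneg_nonneg[OF norm_ge_zero[of y] X_nonneg[of y]] by simp
 finally show "norm (DU t y) \<le> 9 * (norm y * X y)" .
qed

lemma half_oscillation_deriv:
 "((\<lambda>t. cis (- (norm z * phase q t)) * V q t z) has_vector_derivative
  - \<i> * of_real (norm z * speed q t) * (cis (- (norm z * phase q t)) * V q t z) + of_real (rate q t / 2) * (cis (norm z * phase q t) * W q t z)) (at t)"
 "((\<lambda>t. cis (norm z * phase q t) * W q t z) has_vector_derivative
  \<i> * of_real (norm z * speed q t) * (cis (norm z * phase q t) * W q t z) + of_real (rate q t / 2) * (cis (- (norm z * phase q t)) * V q t z)) (at t)"
proof -
 have e: "((\<lambda>t. cis (w * phase q t)) has_vector_derivative \<i> * of_real (w * speed q t) * cis (w * phase q t)) (at t)" for w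
  using has_derivative_cis[OF has_derivative_mult_right[OF phase_deriv[OF q, of t, unfolded has_vector_derivative_def], of w]]
  by (simp add: has_vector_derivative_def scaleR_conv_of_real mult_ac)
 have c: "cis (- (norm z * phase q t)) * cis (2 * norm z * phase q t) = cis (norm z * phase q t)"
  "cis (norm z * phase q t) * cis (- (2 * norm z * phase q t)) = cis (- (norm z * phase q t))"
  by (simp_all add: cis_mult)
 note d = VW_deriv[OF q, of z t]
 note e1 = e[of "- norm z", unfolded mult_minus_left] and e2 = e[of "norm z"]
 show "((\<lambda>t. cis (- (norm z * phase q t)) * V q t z) has_vector_derivative
  - \<i> * of_real (norm z * speed q t) * (cis (- (norm z * phase q t)) * V q t z) + of_real (rate q t / 2) * (cis (norm z * phase q t) * W q t z)) (at t)"
  by (rule has_vector_derivative_eq_rhs[OF has_vector_derivative_mult[OF e1 d(1)]]) (simp add: c(1)[symmetric] del: cis_mult)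
 show "((\<lambda>t. cis (norm z * phase q t) * W q t z) has_vector_derivative
  \<i> * of_real (norm z * speed q t) * (cis (norm z * phase q t) * W q t z) + of_real (rate q t / 2) * (cis (- (norm z * phase q t)) * V q t z)) (at t)"
  by (rule has_vector_derivative_eq_rhs[OF has_vector_derivative_mult[OF e2 d(2)]]) (simp add: c(2)[symmetric] del: cis_mult)
qed

lemma UP_deriv:
 "((\<lambda>t. U t z) has_vector_derivative DU t z) (at t)"
 "((\<lambda>t. DU t z) has_vector_derivative - of_real ((speed q t)^2 * (norm z)^2) * U t z) (at t)"
proof -
 have c: "speed q t > 0" for t by (rule speed_pos[OF q])
 have speed: "(speed q has_real_derivative q t) (at t)"
  using speed_deriv[OF q, of t] by (simp add: has_real_derivative_iff_has_vector_derivative)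
 have "((\<lambda>t. sqrt (c0 / speed q t)) has_real_derivative - (rate q t / 2) * sqrt (c0 / speed q t)) (at t)"
 proof -
  have "((\<lambda>t. sqrt (c0 / speed q t)) has_real_derivative - (c0 * q t / (speed q t)^2) / (2 * sqrt (c0 / speed q t))) (at t)"
   using c[of t] c0 by (auto intro!: derivative_eq_intros speed simp: power2_eq_square divide_simps)
  moreover have "- (c0 * q t / (speed q t)^2) / (2 * sqrt (c0 / speed q t)) = - (rate q t / 2) * sqrt (c0 / speed q t)"
  proof -
   define s where "s = sqrt (c0 / speed q t)"
   have s: "s > 0" "s * s = c0 / speed q t" using c[of t] c0 by (simp_all add: s_def)
   have "c0 * q t / (speed q t)^2 = rate q t * (s * s)" unfolding s(2) by (simp add: rate_def power2_eq_square)
   then show ?thesis unfolding s_def[symmetric] using s(1) by (simp add: field_simps)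
  qed
  ultimately show ?thesis by (rule DERIV_cong)
 qed
 then have s: "((\<lambda>t. complex_of_real (sqrt (c0 / speed q t))) has_vector_derivative of_real (- (rate q t / 2) * sqrt (c0 / speed q t))) (at t)"
  by (rule has_vector_derivative_of_real)
 note h = half_oscillation_deriv[of z t]
 show "((\<lambda>t. U t z) has_vector_derivative DU t z) (at t)"
  unfolding U_def DU_def P_def
  by (rule has_vector_derivative_eq_rhs[OF has_vector_derivative_divide[OF has_vector_derivative_mult[OF s has_vector_derivative_add[OF h]]]])
   (simp add: field_simps)
 have p: "((\<lambda>t. P t z) has_vector_derivative - of_real (rate q t) * P t z - of_real (norm z * speed q t) * U t z) (at t)"
  unfolding U_def P_def
  by (rule has_vector_derivative_eq_rhs[OF has_vector_derivative_divide[OF has_vector_derivative_mult[OF s has_vector_derivative_diff[OF h]]]])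
   (simp add: field_simps)
 have k: "((\<lambda>t. complex_of_real (speed q t * norm z)) has_vector_derivative of_real (q t * norm z)) (at t)"
  by (rule has_vector_derivative_of_real) (auto intro!: derivative_eq_intros speed)
 have r: "complex_of_real (speed q t) * of_real (rate q t) = of_real (q t)"
  using c[of t] by (simp add: rate_def)
 show "((\<lambda>t. DU t z) has_vector_derivative - of_real ((speed q t)^2 * (norm z)^2) * U t z) (at t)"
  unfolding DU_def
  by (rule has_vector_derivative_eq_rhs[OF has_vector_derivative_mult[OF k p]])
   (simp add: r[symmetric] algebra_simps power2_eq_square)
qed

text \<open>In the derivative of the squared modulus of \<open>U\<close> the terms with
  \<open>V cnj V\<close> and \<open>W cnj W\<close> cancel, and the time-dependent prefactors
  combine to the constant \<open>c0\<close>. This explains the form of \<open>T\<close>.\<close>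

lemma energy_density: "DU t z * cnj (U t z) + U t z * cnj (DU t z)
  = of_real c0 * of_real (norm z) * (cis ((0 - 2 * phase q t) * norm z) * Z q t z - cnj (cis ((0 - 2 * phase q t) * norm z) * Z q t z)) / (2 * \<i>)"
proof -
 let ?c = "complex_of_real (speed q t)" and ?s = "complex_of_real (sqrt (c0 / speed q t))" and ?r = "complex_of_real (norm z)"
 let ?a = "cis (- (norm z * phase q t)) * V q t z" and ?b = "cis (norm z * phase q t) * W q t z"
 have "sqrt (c0 / speed q t) * sqrt (c0 / speed q t) * speed q t = c0" using speed_pos[OF q, of t] c0 by simp
 then have s: "of_real c0 = ?s * ?s * ?c" by (metis of_real_mult)
 have e: "cis ((0 - 2 * phase q t) * norm z) = cis (- (norm z * phase q t)) * cnj (cis (norm z * phase q t))"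
  by (simp add: cis_cnj cis_mult algebra_simps)
 have "(e * v) * cnj (f * w) = (e * cnj f) * (v * cnj w)" for e v f w :: complex by simp
 then have ab: "cis ((0 - 2 * phase q t) * norm z) * Z q t z = ?a * cnj ?b"
  by (simp only: e Z_def)
 have gen: "c * r * (s * (a - b) / (2 * \<i>)) * cnj (s * (a + b) / 2) + s * (a + b) / 2 * cnj (c * r * (s * (a - b) / (2 * \<i>)))
   = s * s * c * r * (a * cnj b - cnj (a * cnj b)) / (2 * \<i>)" if "cnj c = c" "cnj r = r" "cnj s = s" for a b c r s :: complex
  using that by (simp add: field_simps)
 show ?thesis unfolding ab s U_def DU_def P_def of_real_mult by (rule gen) simp_all
qed

text \<open>At the fixed point \<open>2 * speed q t * q t\<close> is
  \<open>m * c0 * Im (B q t 0)\<close>, so both sides have the same derivative; the assumption on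
  \<open>c0\<close> makes them agree at time zero.\<close>

lemma speed_power2:
 assumes "c0\<^sup>2 = 1 + m * (L2_norm (U 0))^2"
 shows "(speed q t)^2 = 1 + m * (L2_norm (U t))^2"
proof -
 note [measurable] = cnj_measurable[OF q]
 define M where "M t = (LI z. U t z * cnj (U t z))" for t
 have M: "M t = of_real ((L2_norm (U t))^2)" for t
  by (simp add: M_def L2_norm_power2 complex_norm_square[symmetric] integral_complex_of_real flip: of_real_power)
 have Ui: "integrable lborel (\<lambda>z. U t z * cnj (U t z))" for t
 proof (rule Bochner_Integration.integrable_bound)
  show "integrable lborel (\<lambda>z. 16 * (X z)^2)" using X_moments(1) by simp
  show "AE z in lborel. norm (U t z * cnj (U t z)) \<le> norm (16 * (X z)^2)"
   using mult_mono[OF UP_le(1)[of t] UP_le(1)[of t]] by (intro AE_I2) (simp add: norm_mult power2_eq_square X_nonneg)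
  show "(\<lambda>z. U t z * cnj (U t z)) \<in> borel_measurable lborel" using UP_measurable(1)[of t] by simp
 qed
 let ?D = "\<lambda>t z. DU t z * cnj (U t z) + U t z * cnj (DU t z)"
 have "(M has_vector_derivative (LI z. ?D t z)) (at t)" for t
  unfolding M_def[abs_def]
 proof (rule has_vector_derivative_integral[where g = "\<lambda>z. 72 * (norm z * (X z)^2)"])
  show "integrable lborel (\<lambda>z. U t z * cnj (U t z))" for t by (rule Ui)
  show "((\<lambda>t. U t z * cnj (U t z)) has_vector_derivative ?D t z) (at t)" for t z
   by (rule has_vector_derivative_eq_rhs[OF has_vector_derivative_mult[OF UP_deriv(1) has_vector_derivative_cnj[OF UP_deriv(1)]]]) simp
  show "norm (?D s z) \<le> 72 * (norm z * (X z)^2)" for s z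
  proof -
   have "norm (?D s z) \<le> norm (DU s z) * norm (U s z) + norm (U s z) * norm (DU s z)"
    by (rule norm_triangle_le) (simp add: norm_mult)
   also have "... \<le> (9 * (norm z * X z)) * (4 * X z) + (4 * X z) * (9 * (norm z * X z))"
    by (intro add_mono mult_mono UP_le) (auto simp: X_nonneg)
   finally show ?thesis by (simp add: power2_eq_square mult_ac)
  qed
 qed (use X_moments(3) in auto)
 moreover have "(LI z. ?D t z) = of_real (c0 * Im (B q t 0))" for t
 proof -
  let ?b = "\<lambda>z. complex_of_real (norm z) * cis ((0 - 2 * phase q t) * norm z) * Z q t z"
  have [measurable]: "Z q t \<in> Borel" using SZ_measurable(2)[OF q] by measurable
  have i: "integrable lborel ?b" by (rule hat_integrable(1)[OF q _ SZ_le(2)[OF q]]) measurable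
  have "(LI z. ?D t z) = (LI z. of_real c0 / (2 * \<i>) * (?b z - cnj (?b z)))"
   unfolding energy_density by (intro Bochner_Integration.integral_cong refl) (simp add: right_diff_distrib diff_divide_distrib mult_ac)
  also have "... = of_real c0 / (2 * \<i>) * (B q t 0 - cnj (B q t 0))"
   unfolding integral_mult_right_zero B_def
   by (subst Bochner_Integration.integral_diff[OF i integrable_bounded_linear[OF bounded_linear_cnj i]]) (simp only: integral_bounded_linear[OF bounded_linear_cnj i])
  also have "... = of_real (c0 * Im (B q t 0))" by (simp add: complex_eq_iff)
  finally show ?thesis .
 qed
 ultimately have dM: "(M has_vector_derivative of_real (c0 * Im (B q t 0))) (at t)" for t by simp
 have dc: "((\<lambda>t. complex_of_real ((speed q t)^2)) has_vector_derivative of_real (2 * speed q t * q t)) (at t)" for t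
  using speed_deriv[OF q, of t] unfolding has_real_derivative_iff_has_vector_derivative[symmetric]
  by (intro has_vector_derivative_of_real) (auto intro!: derivative_eq_intros)
 have "2 * speed q t * q t = m * (c0 * Im (B q t 0))" for t
 proof -
  have "q t = m * c0 / (2 * speed q t) * Im (B q t 0)" using fun_cong[OF fixed, of t] by (simp add: T_def)
  then show ?thesis using speed_pos[OF q, of t] by (simp add: field_simps)
 qed
 then have "((\<lambda>t. complex_of_real ((speed q t)^2) - of_real m * M t) has_vector_derivative 0) (at t)" for t
  by (intro has_vector_derivative_eq_rhs[OF has_vector_derivative_diff[OF dc has_vector_derivative_mult_right[OF dM]]])
   (simp flip: of_real_mult)
 then obtain k where k: "\<And>t. complex_of_real ((speed q t)^2) - of_real m * M t = k"
  using has_vector_derivative_zero_constant[of UNIV "\<lambda>t. complex_of_real ((speed q t)^2) - of_real m * M t"] by auto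
 have "speed q 0 = c0" by (simp add: speed_def)
 then have "k = of_real (c0\<^sup>2 - m * (L2_norm (U 0))^2)" using k[of 0] unfolding M by simp
 also have "... = 1" using assms by simp
 finally have "k = 1" .
 then have "complex_of_real ((speed q t)^2 - m * (L2_norm (U t))^2) = of_real 1" using k[of t] unfolding M by simp
 then show ?thesis unfolding of_real_eq_iff by linarith
qed

lemma X_L2: "(\<lambda>z. complex_of_real (X z)) \<in> L2" "(\<lambda>z. complex_of_real (norm z * X z)) \<in> L2"
 using X_moments by (auto intro!: L2_I simp: norm_mult power_mult_distrib)

lemma fourier_solution_U:
 assumes mv: "m = 1 / (2 * pi) ^ DIM('a)" and c: "c0\<^sup>2 = 1 + m * (L2_norm (U 0))^2"
 shows "fourier_solution (U 0) (DU 0) U DU"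
proof -
 have DU_L2: "DU t \<in> L2" for t
  by (rule L2_dominated[OF X_L2(2) UP_measurable(3), of _ 9]) (use UP_le(3) in \<open>simp add: norm_mult X_nonneg abs_mult\<close>)
 have U_L2: "U t \<in> L2" for t
  by (rule L2_dominated[OF X_L2(1) UP_measurable(1), of _ 4]) (use UP_le(1) in \<open>simp add: X_nonneg\<close>)
 have rU_le: "norm (of_real (norm z) * U t z) \<le> 4 * (norm z * X z)" for t z
  using mult_left_mono[OF UP_le(1)[of t z] norm_ge_zero[of z]] by (simp add: norm_mult mult_ac)
 have rU_L2: "(\<lambda>z. of_real (norm z) * U t z) \<in> L2" for t
  by (rule L2_dominated[OF X_L2(2), of _ 4]) (use rU_le[of _ t] UP_measurable(1)[of t] in \<open>auto simp: X_nonneg norm_mult\<close>)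
 have cont: "((\<lambda>s. U s z) \<longlongrightarrow> U t z) (at t)" "((\<lambda>s. DU s z) \<longlongrightarrow> DU t z) (at t)" for t z
  using has_vector_derivative_continuous[OF UP_deriv(1)[of z t]] has_vector_derivative_continuous[OF UP_deriv(2)[of z t]]
  by (simp_all add: isCont_def)
 have lim: "((\<lambda>s. L2_norm (\<lambda>z. f s z - f t z)) \<longlongrightarrow> 0) (at t)"
  if "\<And>s. f s \<in> Borel" "integrable lborel (\<lambda>z. (G z)^2)" "\<And>s z. norm (f s z) \<le> K * G z" "\<And>z. ((\<lambda>s. f s z) \<longlongrightarrow> f t z) (at t)"
  for f :: "real => 'a => complex" and G K t
 proof (rule L2_norm_tendsto_0[where G = "\<lambda>z. 2 * K * G z"])
  show "norm (f s z - f t z) \<le> 2 * K * G z" for s z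
   using norm_triangle_ineq4[of "f s z" "f t z"] that(3)[of s z] that(3)[of t z] by simp
  show "((\<lambda>s. f s z - f t z) \<longlongrightarrow> 0) (at t)" for z using that(4) by (rule LIM_zero)
  show "integrable lborel (\<lambda>z. (2 * K * G z)^2)" unfolding power_mult_distrib using that(2) by simp
  show "(\<lambda>z. f s z - f t z) \<in> Borel" for s using that(1)[of s] that(1)[of t] by measurable
 qed
 have rX2: "integrable lborel (\<lambda>z. (norm z * X z)^2)" using X_moments(2) by (simp add: power_mult_distrib)
 have 1: "((\<lambda>s. L2_norm (\<lambda>z. U s z - U t z)) \<longlongrightarrow> 0) (at t)" for t
  by (rule lim[OF UP_measurable(1) X_moments(1) UP_le(1) cont(1)])
 have 2: "((\<lambda>s. L2_norm (\<lambda>z. of_real (norm z) * (U s z - U t z))) \<longlongrightarrow> 0) (at t)" for t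
  unfolding right_diff_distrib by (rule lim[OF _ rX2 rU_le]) (auto intro!: tendsto_mult_left cont(1))
 have 3: "((\<lambda>s. L2_norm (\<lambda>z. DU s z - DU t z)) \<longlongrightarrow> 0) (at t)" for t
  by (rule lim[OF UP_measurable(3) rX2 UP_le(3) cont(2)])
 have 4: "((\<lambda>h. L2_norm (\<lambda>z. (U (t + h) z - U t z) / of_real h - DU t z)) \<longlongrightarrow> 0) (at 0)" for t
 proof (rule L2_norm_tendsto_0[where G = "\<lambda>z. 18 * (norm z * X z)"])
  show "integrable lborel (\<lambda>z. (18 * (norm z * X z))^2)" unfolding power_mult_distrib[of 18] using rX2 by simp
  show "norm ((U (t + h) z - U t z) / of_real h - DU t z) \<le> 18 * (norm z * X z)" for h z
   using norm_triangle_ineq4[of "(U (t + h) z - U t z) / of_real h" "DU t z"]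
    difference_quotient_le[of "\<lambda>t. U t z" "\<lambda>t. DU t z", OF UP_deriv(1) UP_le(3), of t h] UP_le(3)[of t z] by simp
  show "((\<lambda>h. (U (t + h) z - U t z) / of_real h - DU t z) \<longlongrightarrow> 0) (at 0)" for z
  proof (rule LIM_zero)
   show "((\<lambda>h. (U (t + h) z - U t z) / of_real h) \<longlongrightarrow> DU t z) (at 0)"
    using UP_deriv(1)[of z t] unfolding difference_quotient_tendsto_iff[symmetric]
    by (simp add: scaleR_conv_of_real divide_inverse mult.commute)
  qed
  show "(\<lambda>z. (U (t + h) z - U t z) / of_real h - DU t z) \<in> Borel" for h
   using UP_measurable(1)[of "t + h"] UP_measurable(1,3)[of t] by measurable
 qed
 have 5: "((\<lambda>s. \<integral>z. DU s z * fourier k (- z) \<partial>lborel) has_vector_derivative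
    - of_real (1 + (L2_norm (U t))^2 / (2 * pi) ^ DIM('a)) * (LI z. of_real ((norm z)^2) * U t z * fourier k (- z))) (at t)"
  if k: "k \<in> schwartz" for t k
 \<comment> \<open>In the majorant, 20 is 5 for the squared speed times 4 for the bound on
   \<open>U\<close>. The weight \<open>(norm z)^2\<close> is shared: one factor goes to the data and
   one to the test function.\<close>
 proof (rule has_vector_derivative_eq_rhs[OF has_vector_derivative_integral[where f' = "\<lambda>t z. - of_real ((speed q t)^2 * (norm z)^2) * U t z * fourier k (- z)"
   and g = "\<lambda>z. 20 * norm (of_real (norm z * X z) * (of_real (norm z) * fourier k (- z)))"]])
  note F = fourier_schwartz_L2(1,3)[OF k]
  note [measurable] = L2_measurable[OF F(1)]
  show "integrable lborel (\<lambda>z. DU t z * fourier k (- z))" for t by (rule L2_mult_integrable[OF DU_L2 F(1)])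
  show "((\<lambda>t. DU t z * fourier k (- z)) has_vector_derivative - of_real ((speed q t)^2 * (norm z)^2) * U t z * fourier k (- z)) (at t)" for t z
   by (rule has_vector_derivative_mult_left[OF UP_deriv(2)])
  show "(\<lambda>z. - of_real ((speed q t)^2 * (norm z)^2) * U t z * fourier k (- z)) \<in> Borel" by measurable
  show "integrable lborel (\<lambda>z. 20 * norm (of_real (norm z * X z) * (of_real (norm z) * fourier k (- z))))"
   by (rule integrable_mult_right[OF integrable_norm[OF L2_mult_integrable[OF X_L2(2) F(2)]]])
  show "norm (- of_real ((speed q s)^2 * (norm z)^2) * U s z * fourier k (- z)) \<le> 20 * norm (of_real (norm z * X z) * (of_real (norm z) * fourier k (- z)))" for s z
  proof -
   have "(speed q s)^2 \<le> 5" using power_mono[OF speed_bounds(2)[OF q, of s], of 2] speed_pos[OF q, of s] by (simp add: power2_eq_square)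
   then have "(speed q s)^2 * norm (U s z) \<le> 5 * (4 * X z)" by (intro mult_mono UP_le) auto
   then have "((speed q s)^2 * norm (U s z)) * ((norm z)^2 * norm (fourier k (- z))) \<le> (5 * (4 * X z)) * ((norm z)^2 * norm (fourier k (- z)))"
    by (rule mult_right_mono) simp
   then show ?thesis by (simp add: norm_mult abs_mult X_nonneg power2_eq_square mult_ac)
  qed
  have "(LI z. - of_real ((speed q t)^2 * (norm z)^2) * U t z * fourier k (- z))
    = (LI z. - of_real ((speed q t)^2) * (of_real ((norm z)^2) * U t z * fourier k (- z)))"
   by (simp add: mult.assoc)
  also have "... = - of_real ((speed q t)^2) * (LI z. of_real ((norm z)^2) * U t z * fourier k (- z))"
   by (rule integral_mult_right_zero)
  finally show "(LI z. - of_real ((speed q t)^2 * (norm z)^2) * U t z * fourier k (- z))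
    = - of_real (1 + (L2_norm (U t))^2 / (2 * pi) ^ DIM('a)) * (LI z. of_real ((norm z)^2) * U t z * fourier k (- z))"
   using speed_power2[OF c, of t] unfolding mv by simp
 qed
 show ?thesis unfolding fourier_solution_def
  by (intro conjI allI impI ballI AE_I2 refl U_L2 DU_L2 rU_L2 1 2 3 4 5)
qed

lemma U_0: "U 0 z = (V0 z + W0 z) / 2" "DU 0 z = of_real (c0 * norm z) * (V0 z - W0 z) / (2 * \<i>)"
 using c0 by (simp_all add: U_def DU_def P_def VW_0[OF q] phase_0[OF q] speed_def)

end

lemma exists_fourier_solution:
 assumes "m = 1 / (2 * pi) ^ DIM('a)" "c0\<^sup>2 = 1 + m * (L2_norm (\<lambda>z. (V0 z + W0 z) / 2))^2"
 shows "\<exists>u v. fourier_solution (\<lambda>z. (V0 z + W0 z) / 2) (\<lambda>z. of_real (c0 * norm z) * (V0 z - W0 z) / (2 * \<i>)) u v"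
proof -
 obtain q where q: "admissible q" "T q = q" using exists_fixed_point by blast
 have "U q 0 = (\<lambda>z. (V0 z + W0 z) / 2)" "DU q 0 = (\<lambda>z. of_real (c0 * norm z) * (V0 z - W0 z) / (2 * \<i>))"
  using U_0[OF q] by auto
 then show ?thesis using fourier_solution_U[OF q assms(1)] assms(2) by metis
qed

end


section \<open>Oscillatory integrals of the data and the class Y\<close>

lemma Y_radial_integral_ge:
 "ennreal (norm (LINT \<rho>:{0<..}|lborel. Y_radial g h k r \<omega> \<rho>)) \<le> Y_radial_integral g h k r \<omega>"
 by (simp add: Y_radial_integral_def)

text \<open>The added 1 makes positivity immediate, so that the constant can be divided by.\<close>

definition radial_constant :: "'a::euclidean_space itself => real" where
 "radial_constant _ = real DIM('a) * cone_constant TYPE('a) + 1"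

lemma radial_constant_pos: "radial_constant TYPE('a::euclidean_space) > 0"
 unfolding radial_constant_def using cone_constant_nonneg[where 'a='a] by (simp add: add_nonneg_pos)

text \<open>Polar integration multiplies \<open>w\<close> by \<open>\<rho> ^ (n - 1)\<close> in
  dimension \<open>n\<close>, which gives the exponent \<open>n - j\<close> of the class
  \<open>Y\<close>; on the sphere \<open>r\<close> pairs with \<open>\<rho>\<close> alone. The value
  of \<open>w\<close> at 0 is left free, to be chosen conveniently later.\<close>

lemma nn_integral_hat_le:
 fixes g h :: "'a::euclidean_space => complex" and w :: "real => real"
 assumes [measurable]: "g \<in> Borel" "h \<in> Borel" "w \<in> Borel"
  and w: "\<And>\<rho>. \<rho> > 0 ==> w \<rho> = \<rho> powi (1 - j)"
  and i: "\<And>r. integrable lborel (\<lambda>z. of_real (w (norm z)) * cis (r * norm z) * (g z * cnj (h z)))"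
 shows "(NI r. ennreal (norm (LI z. of_real (w (norm z)) * cis (r * norm z) * (g z * cnj (h z)))))
  \<le> ennreal (radial_constant TYPE('a)) * (NI r. (\<integral>\<^sup>+\<omega>. Y_radial_integral g h (int DIM('a) - j) r \<omega> \<partial>sphere_measure))"
proof -
 let ?C = "radial_constant TYPE('a)"
 define f where "f r z = of_real (w (norm z)) * cis (r * norm z) * (g z * cnj (h z))" for r z
 define I where "I r = (LI z. f r z)" for r
 have cnj_h [measurable]: "(\<lambda>z. cnj (h z)) \<in> Borel"
  by (rule borel_measurable_continuous_on[OF _ assms(2)]) (intro continuous_intros)
 have I_measurable [measurable]: "I \<in> Borel" unfolding I_def[abs_def] f_def by measurable
 have le: "ennreal (norm (I r)) \<le> ennreal ?C * (\<integral>\<^sup>+\<omega>. Y_radial_integral g h (int DIM('a) - j) r \<omega> \<partial>sphere_measure)" for r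
 proof -
  have "ennreal (norm (I r)) \<le> ennreal (real DIM('a) * cone_constant TYPE('a)) *
    (\<integral>\<^sup>+\<omega>. ennreal (norm (LINT \<rho>:{0<..}|lborel. f r (\<rho> *\<^sub>R \<omega>) * of_real (\<rho> ^ (DIM('a) - 1)))) \<partial>sphere_measure)"
   unfolding I_def by (rule polar_bound) (use i in \<open>simp add: f_def\<close>)
  also have "... \<le> ennreal ?C * (\<integral>\<^sup>+\<omega>. Y_radial_integral g h (int DIM('a) - j) r \<omega> \<partial>sphere_measure)"
  proof (intro mult_mono nn_integral_mono ennreal_leI)
   fix \<omega> :: 'a assume "\<omega> \<in> space sphere_measure"
   then have \<omega>: "norm \<omega> = 1" by (simp add: sphere_measure_def space_restrict_space)
   have "(LINT \<rho>:{0<..}|lborel. f r (\<rho> *\<^sub>R \<omega>) * of_real (\<rho> ^ (DIM('a) - 1))) = (LINT \<rho>:{0<..}|lborel. Y_radial g h (int DIM('a) - j) r \<omega> \<rho>)"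
   proof (rule set_lebesgue_integral_cong; (intro allI impI)?)
    fix \<rho> :: real assume "\<rho> \<in> {0<..}"
    then have \<rho>: "\<rho> > 0" by simp
    have pw: "\<rho> ^ (DIM('a) - 1) = \<rho> powi (int DIM('a) - 1)"
     using DIM_positive[where 'a='a] by (simp add: power_int_of_nat[symmetric] of_nat_diff Suc_leI del: DIM_positive)
    have "w \<rho> * \<rho> ^ (DIM('a) - 1) = \<rho> powi (int DIM('a) - j)"
     unfolding w[OF \<rho>] pw using \<rho> power_int_add[of \<rho> "1 - j" "int DIM('a) - 1"] by simp
    then have "complex_of_real (w \<rho>) * of_real (\<rho> ^ (DIM('a) - 1)) = of_real (\<rho> powi (int DIM('a) - j))"
     unfolding of_real_mult[symmetric] by (rule arg_cong)
    then show "f r (\<rho> *\<^sub>R \<omega>) * of_real (\<rho> ^ (DIM('a) - 1)) = Y_radial g h (int DIM('a) - j) r \<omega> \<rho>"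
     using \<rho> \<omega> by (simp add: f_def Y_radial_def mult_ac del: of_real_power of_real_power_int)
   qed simp
   then show "ennreal (norm (LINT \<rho>:{0<..}|lborel. f r (\<rho> *\<^sub>R \<omega>) * of_real (\<rho> ^ (DIM('a) - 1)))) \<le> Y_radial_integral g h (int DIM('a) - j) r \<omega>"
    using Y_radial_integral_ge by metis
  qed (auto simp: radial_constant_def)
  finally show ?thesis .
 qed
 \<comment> \<open>The constant is pulled out on the side of \<open>I\<close>, whose measurability
   is at hand; the sphere integral is then used by monotonicity only.\<close>
 have C: "ennreal ?C * ennreal (norm (I r) / ?C) = ennreal (norm (I r))" for r
  using radial_constant_pos[where 'a='a] by (simp flip: ennreal_mult)
 have "(NI r. ennreal (norm (I r))) = ennreal ?C * (NI r. ennreal (norm (I r) / ?C))"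
  by (subst nn_integral_cmult[symmetric]) (simp_all add: C)
 also have "... \<le> ennreal ?C * (NI r. (\<integral>\<^sup>+\<omega>. Y_radial_integral g h (int DIM('a) - j) r \<omega> \<partial>sphere_measure))"
 proof (intro mult_left_mono nn_integral_mono)
  fix r
  have "ennreal ?C * ennreal (norm (I r) / ?C) \<le> ennreal ?C * (\<integral>\<^sup>+\<omega>. Y_radial_integral g h (int DIM('a) - j) r \<omega> \<partial>sphere_measure)"
   unfolding C by (rule le)
  then show "ennreal (norm (I r) / ?C) \<le> (\<integral>\<^sup>+\<omega>. Y_radial_integral g h (int DIM('a) - j) r \<omega> \<partial>sphere_measure)"
   using radial_constant_pos[where 'a='a] by (subst (asm) ennreal_mult_le_mult_iff) auto
 qed simp
 finally show ?thesis unfolding I_def f_def .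
qed

lemma L2_sum_power2_integrable:
 assumes "f \<in> L2" "g \<in> L2"
 shows "integrable lborel (\<lambda>x. (norm (f x) + norm (g x))^2)"
proof -
 note [measurable] = L2_measurable[OF assms(1)] L2_measurable[OF assms(2)]
 have "(\<lambda>x. complex_of_real (norm (f x)) + of_real (norm (g x))) \<in> L2"
  by (rule L2_add; rule L2_dominated[OF assms(1), of _ 1] L2_dominated[OF assms(2), of _ 1]; simp)
 then have "integrable lborel (\<lambda>x. (norm (complex_of_real (norm (f x)) + of_real (norm (g x))))^2)" by (rule L2_integrable)
 then show ?thesis by (simp flip: of_real_add)
qed

lemma fourier_solution_cong_AE:
 assumes "fourier_solution F0 F1 U V" "AE z in lborel. F0 z = G0 z" "AE z in lborel. F1 z = G1 z"
 shows "fourier_solution G0 G1 U V"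
proof -
 have "AE z in lborel. U 0 z = F0 z" "AE z in lborel. V 0 z = F1 z" using assms(1) by (simp_all add: fourier_solution_def)
 then have "AE z in lborel. U 0 z = G0 z" "AE z in lborel. V 0 z = G1 z" using assms(2,3) by (auto elim: AE_mp)
 then show ?thesis using assms(1) unfolding fourier_solution_def by blast
qed

text \<open>The two exponential components \<open>F0 \<plusminus> \<i> F1 / (c0 |z|)\<close> of the initial data have radial
 transforms controlled by the four integrals that make up the norm of the class \<open>Y\<close>.\<close>

lemma profile_of_data:
 fixes F0 F1 :: "'a::euclidean_space => complex"
 assumes F0: "F0 \<in> L2" and rF0: "(\<lambda>z. of_real (norm z) * F0 z) \<in> L2"
  and F1: "F1 \<in> L2" and F1r: "(\<lambda>z. F1 z / of_real (norm z)) \<in> L2"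
  and c0: "1 \<le> c0" "c0 \<le> 2" and m: "m \<ge> 0" and N: "N \<ge> 0" "24 * m * N \<le> 1"
  and Y: "ennreal (2 * radial_constant TYPE('a)) * (\<Sum>j\<in>{0..1::nat}. \<Sum>k\<in>{0..1::nat}.
    \<integral>\<^sup>+r. (\<integral>\<^sup>+\<omega>. Y_radial_integral (if j = 0 then F0 else F1) (if k = 0 then F0 else F1) (int DIM('a) - int j - int k) r \<omega>
        \<partial>sphere_measure) \<partial>lborel) \<le> ennreal N"
 shows "profile (\<lambda>z. F0 z + \<i> * (F1 z / of_real (c0 * norm z))) (\<lambda>z. F0 z - \<i> * (F1 z / of_real (c0 * norm z))) m c0 N"
proof -
 note [measurable] = L2_measurable[OF F0] L2_measurable[OF F1] L2_measurable[OF L2_cnj[OF F0]] L2_measurable[OF L2_cnj[OF F1]]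
 define G where "G z = F1 z / of_real (c0 * norm z)" for z
 have Gm [measurable]: "G \<in> Borel" unfolding G_def[abs_def] by measurable
 have cc: "a \<le> a * c0" if "a \<ge> 0" for a :: real using mult_left_mono[OF c0(1) that] by simp
 have G: "G \<in> L2"
  by (rule L2_dominated[OF F1r Gm, of 1]) (use c0 in \<open>auto simp: G_def norm_divide norm_mult divide_simps cc\<close>)
 have rG: "(\<lambda>z. of_real (norm z) * G z) \<in> L2"
  by (rule L2_dominated[OF F1, of _ 1]) (use c0 in \<open>auto simp: G_def norm_divide norm_mult divide_simps cc\<close>)
 let ?V = "\<lambda>z. F0 z + \<i> * G z" and ?W = "\<lambda>z. F0 z - \<i> * G z"
 have VW: "?V \<in> L2" "?W \<in> L2" by (intro L2_add L2_diff L2_scale F0 G)+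
 have "(\<lambda>z. of_real (norm z) * F0 z + \<i> * (of_real (norm z) * G z)) \<in> L2" "(\<lambda>z. of_real (norm z) * F0 z - \<i> * (of_real (norm z) * G z)) \<in> L2"
  by (intro L2_add L2_diff L2_scale rF0 rG)+
 then have rVW: "(\<lambda>z. of_real (norm z) * ?V z) \<in> L2" "(\<lambda>z. of_real (norm z) * ?W z) \<in> L2"
  by (simp_all add: algebra_simps)
 have X: "integrable lborel (\<lambda>z. (norm (?V z) + norm (?W z))^2)" by (rule L2_sum_power2_integrable[OF VW])
 have rX: "integrable lborel (\<lambda>z. (norm z)^2 * (norm (?V z) + norm (?W z))^2)"
  using L2_sum_power2_integrable[OF rVW] by (simp add: norm_mult distrib_left[symmetric] power_mult_distrib)
 \<comment> \<open>The powers 1, 0 and -1 of the radius, but with \<open>\<rho> / \<rho>\<close> in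
   place of 1: all three vanish at 0, so the pointwise expansions below hold at \<open>z = 0\<close>
   too.\<close>
 define w where "w k \<rho> = (if k = 0 then \<rho> else if k = 1 then \<rho> / \<rho> else 1 / \<rho>)" for k :: nat and \<rho> :: real
 have wm [measurable]: "w k \<in> Borel" for k unfolding w_def[abs_def] by (cases "k = 0"; cases "k = 1") simp_all
 define F where "F j = (if j = 0 then F0 else F1)" for j :: nat
 have [measurable]: "F j \<in> Borel" "(\<lambda>z. cnj (F j z)) \<in> Borel" for j by (simp_all add: F_def)
 define i where "i j k r z = of_real (w (j + k) (norm z)) * cis (r * norm z) * (F j z * cnj (F k z))" for j k r z
 define I where "I j k r = (LI z. i j k r z)" for j k r
 have im [measurable]: "(\<lambda>(r, z). i j k r z) \<in> borel_measurable (borel \<Otimes>\<^sub>M borel)" for j k unfolding i_def by measurable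
 have [measurable]: "I j k \<in> Borel" for j k unfolding I_def[abs_def] by measurable
 have int: "integrable lborel (i j k r)" if jk: "j \<le> 1" "k \<le> 1" for j k r
 proof -
  have *: "integrable lborel (i j k r)" if "a \<in> L2" "b \<in> L2" "\<And>z. norm (i j k r z) \<le> norm (a z * b z)" for a b
   by (rule Bochner_Integration.integrable_bound[OF L2_mult_integrable[OF that(1,2)]]) (use that(3) im[of j k] in auto)
  have "j = 0 \<and> k = 0 \<or> j = 0 \<and> k = 1 \<or> j = 1 \<and> k = 0 \<or> j = 1 \<and> k = 1" using jk by linarith
  then show ?thesis
  proof (elim disjE conjE)
   assume "j = 0" "k = 0"
   then show ?thesis by (intro *[OF rF0 F0]) (simp add: i_def w_def F_def norm_mult)
  next
   assume "j = 0" "k = 1"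
   then show ?thesis by (intro *[OF F0 F1]) (auto simp: i_def w_def F_def norm_mult)
  next
   assume "j = 1" "k = 0"
   then show ?thesis by (intro *[OF F0 F1]) (auto simp: i_def w_def F_def norm_mult)
  next
   assume "j = 1" "k = 1"
   then show ?thesis by (intro *[OF F1r F1]) (simp add: i_def w_def F_def norm_mult norm_divide)
  qed
 qed
 let ?Y = "\<lambda>j k. \<integral>\<^sup>+r. (\<integral>\<^sup>+\<omega>. Y_radial_integral (F j) (F k) (int DIM('a) - int j - int k) r \<omega> \<partial>sphere_measure) \<partial>lborel"
 let ?C = "radial_constant TYPE('a)"
 have hat: "(NI r. ennreal (norm (I j k r))) \<le> ennreal ?C * ?Y j k" if jk: "j \<le> 1" "k \<le> 1" for j k
 proof -
  have "w (j + k) \<rho> = \<rho> powi (1 - (int j + int k))" if "\<rho> > 0" for \<rho>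
  proof -
   have "j + k = 0 \<or> j + k = 1 \<or> j + k = 2" using jk by linarith
   then show ?thesis using that by (auto simp: w_def power_int_def of_nat_add[symmetric] divide_inverse simp del: of_nat_add)
  qed
  then show ?thesis
   using nn_integral_hat_le[of "F j" "F k" "w (j + k)" "int j + int k"] int[OF jk] unfolding I_def i_def
   by (simp add: diff_diff_eq)
 qed
 \<comment> \<open>The factor 2 suffices for both integrals: for the sum of squared moduli the mixed
   terms cancel and the coefficients are 2 and \<open>2 / c0^2\<close>; for the mixed product all
   four coefficients have modulus at most 1, because \<open>c0 >= 1\<close>.\<close>
 have sum: "(NI r. 2 * (ennreal (norm (I 0 0 r)) + ennreal (norm (I 0 1 r)) + (ennreal (norm (I 1 0 r)) + ennreal (norm (I 1 1 r))))) \<le> ennreal N"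
 proof -
  have "(NI r. 2 * (ennreal (norm (I 0 0 r)) + ennreal (norm (I 0 1 r)) + (ennreal (norm (I 1 0 r)) + ennreal (norm (I 1 1 r)))))
    = 2 * ((NI r. ennreal (norm (I 0 0 r))) + (NI r. ennreal (norm (I 0 1 r))) + ((NI r. ennreal (norm (I 1 0 r))) + (NI r. ennreal (norm (I 1 1 r)))))"
   by (simp add: nn_integral_cmult nn_integral_add)
  also have "... \<le> 2 * (ennreal ?C * ?Y 0 0 + ennreal ?C * ?Y 0 1 + (ennreal ?C * ?Y 1 0 + ennreal ?C * ?Y 1 1))"
   by (intro mult_left_mono add_mono hat) simp_all
  also have "... = ennreal (2 * ?C) * (?Y 0 0 + ?Y 0 1 + (?Y 1 0 + ?Y 1 1))"
   using radial_constant_pos[where 'a='a] by (simp only: distrib_left ennreal_mult ennreal_numeral mult.assoc)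
  also have "... \<le> ennreal N"
  proof -
   have "{0..1::nat} = {0, 1}" by auto
   then show ?thesis using Y unfolding F_def by simp
  qed
  finally show ?thesis .
 qed
 have c1: "1 / c0\<^sup>2 \<le> 1" "1 / c0 \<le> 1" using c0 by (auto simp: divide_le_eq)
 have N1: "(NI r. ennreal (norm (LI z. of_real (norm z) * cis (r * norm z) * (?V z * cnj (?V z) + ?W z * cnj (?W z))))) \<le> ennreal N"
 proof (rule order_trans[OF nn_integral_mono sum])
  fix r
  have "of_real (norm z) * cis (r * norm z) * (?V z * cnj (?V z) + ?W z * cnj (?W z)) = 2 * i 0 0 r z + of_real (2 / c0\<^sup>2) * i 1 1 r z" for z
   using c0 by (cases "z = 0") (auto simp: i_def w_def F_def G_def field_simps power2_eq_square)
  then have "(LI z. of_real (norm z) * cis (r * norm z) * (?V z * cnj (?V z) + ?W z * cnj (?W z))) = 2 * I 0 0 r + of_real (2 / c0\<^sup>2) * I 1 1 r"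
   unfolding I_def using int by simp
  then have "norm (LI z. of_real (norm z) * cis (r * norm z) * (?V z * cnj (?V z) + ?W z * cnj (?W z))) \<le> 2 * norm (I 0 0 r) + (2 / c0\<^sup>2) * norm (I 1 1 r)"
   using norm_triangle_ineq[of "2 * I 0 0 r" "of_real (2 / c0\<^sup>2) * I 1 1 r"] by (simp add: norm_mult norm_divide norm_power)
  also have "... \<le> 2 * (norm (I 0 0 r) + norm (I 0 1 r) + (norm (I 1 0 r) + norm (I 1 1 r)))"
  proof -
   have "2 / c0\<^sup>2 * norm (I 1 1 r) \<le> 2 * norm (I 1 1 r)"
    using mult_left_mono[OF mult_right_mono[OF c1(1) norm_ge_zero[of "I 1 1 r"]], of 2] by simp
   then show ?thesis using norm_ge_zero[of "I 0 1 r"] norm_ge_zero[of "I 1 0 r"] by (simp only: distrib_left)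
  qed
  finally have "ennreal (norm (LI z. of_real (norm z) * cis (r * norm z) * (?V z * cnj (?V z) + ?W z * cnj (?W z)))) \<le> ennreal (2 * (norm (I 0 0 r) + norm (I 0 1 r) + (norm (I 1 0 r) + norm (I 1 1 r))))"
   by (rule ennreal_leI)
  then show "ennreal (norm (LI z. of_real (norm z) * cis (r * norm z) * (?V z * cnj (?V z) + ?W z * cnj (?W z)))) \<le> 2 * (ennreal (norm (I 0 0 r)) + ennreal (norm (I 0 1 r)) + (ennreal (norm (I 1 0 r)) + ennreal (norm (I 1 1 r))))"
   by (subst (asm) ennreal_mult) (simp_all add: ennreal_plus)
 qed
 have N2: "(NI r. ennreal (norm (LI z. of_real (norm z) * cis (r * norm z) * (?V z * cnj (?W z))))) \<le> ennreal N"
 proof (rule order_trans[OF nn_integral_mono sum])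
  fix r
  have "of_real (norm z) * cis (r * norm z) * (?V z * cnj (?W z)) = (i 0 0 r z - of_real (1 / c0\<^sup>2) * i 1 1 r z) + (\<i> * of_real (1 / c0)) * (i 0 1 r z + i 1 0 r z)" for z
   using c0 by (cases "z = 0") (auto simp: i_def w_def F_def G_def field_simps power2_eq_square)
  then have "(LI z. of_real (norm z) * cis (r * norm z) * (?V z * cnj (?W z))) = (I 0 0 r - of_real (1 / c0\<^sup>2) * I 1 1 r) + (\<i> * of_real (1 / c0)) * (I 0 1 r + I 1 0 r)"
   unfolding I_def using int by simp
  also have "norm ... \<le> (norm (I 0 0 r) + (1 / c0\<^sup>2) * norm (I 1 1 r)) + (1 / c0) * (norm (I 0 1 r) + norm (I 1 0 r))"
  proof (intro norm_triangle_le add_mono order_trans[OF norm_triangle_ineq4])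
   show "norm ((\<i> * of_real (1 / c0)) * (I 0 1 r + I 1 0 r)) \<le> (1 / c0) * (norm (I 0 1 r) + norm (I 1 0 r))"
    using mult_left_mono[OF norm_triangle_ineq[of "I 0 1 r" "I 1 0 r"], of "1 / c0"] c0 by (simp add: norm_mult norm_divide)
  qed (use c0 in \<open>simp_all add: norm_mult norm_divide norm_power\<close>)
  also have "... \<le> (norm (I 0 0 r) + 1 * norm (I 1 1 r)) + 1 * (norm (I 0 1 r) + norm (I 1 0 r))"
   by (intro add_mono mult_right_mono c1) auto
  also have "... \<le> 2 * (norm (I 0 0 r) + norm (I 0 1 r) + (norm (I 1 0 r) + norm (I 1 1 r)))" by (simp add: add_nonneg_nonneg)
  finally have "ennreal (norm (LI z. of_real (norm z) * cis (r * norm z) * (?V z * cnj (?W z)))) \<le> ennreal (2 * (norm (I 0 0 r) + norm (I 0 1 r) + (norm (I 1 0 r) + norm (I 1 1 r))))"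
   by (rule ennreal_leI)
  then show "ennreal (norm (LI z. of_real (norm z) * cis (r * norm z) * (?V z * cnj (?W z)))) \<le> 2 * (ennreal (norm (I 0 0 r)) + ennreal (norm (I 0 1 r)) + (ennreal (norm (I 1 0 r)) + ennreal (norm (I 1 1 r))))"
   by (subst (asm) ennreal_mult) (simp_all add: ennreal_plus)
 qed
 show ?thesis unfolding G_def[symmetric]
  by unfold_locales (use L2_measurable[OF VW(1)] L2_measurable[OF VW(2)] X rX m c0 N N1 N2 in auto)
qed

lemma exists_solution:
 "\<exists>\<epsilon>::real. \<epsilon> > 0 \<and> (\<forall>f0 f1 :: 'a::euclidean_space => complex. f0 \<in> H1 \<longrightarrow> f1 \<in> L2 \<longrightarrow>
  ennreal ((L2_norm f0)^2) + (Hdot_minus1_norm (dist_of f1))^2 + Y_norm (dist_of f0) (dist_of f1) \<le> ennreal \<epsilon> \<longrightarrow>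
  (\<exists>u. kirchhoff_solution f0 f1 u))"
proof -
 let ?C = "radial_constant TYPE('a)"
 define m :: real where "m = 1 / (2 * pi) ^ DIM('a)"
 \<comment> \<open>With \<open>N = 2 * ?C * \<epsilon>\<close> the second bound is exactly
   \<open>24 * m * N <= 1\<close>; the first gives \<open>c0^2 <= 2\<close>, so that
   \<open>c0 <= 2\<close>.\<close>
 define \<epsilon> where "\<epsilon> = min 1 (1 / (48 * ?C * m))"
 have C: "?C > 0" by (rule radial_constant_pos)
 have m: "m > 0" by (simp add: m_def)
 have \<epsilon>: "\<epsilon> > 0" "\<epsilon> \<le> 1" "\<epsilon> \<le> 1 / (48 * ?C * m)" using C m by (simp_all add: \<epsilon>_def)
 have "\<exists>u. kirchhoff_solution f0 f1 u"
  if f0: "f0 \<in> H1" and f1: "f1 \<in> L2"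
   and small: "ennreal ((L2_norm f0)^2) + (Hdot_minus1_norm (dist_of f1))^2 + Y_norm (dist_of f0) (dist_of f1) \<le> ennreal \<epsilon>"
  for f0 f1 :: "'a => complex"
 proof -
  have f0': "f0 \<in> L2" and rf0: "(\<lambda>z. of_real (norm z) * plancherel f0 z) \<in> L2" using f0 by (simp_all add: H1_iff)
  define F0 where "F0 = fourier_fun (dist_of f0)"
  define F1 where "F1 = fourier_fun (dist_of f1)"
  note [measurable] = fourier_fun_plancherel(1)[OF f0', folded F0_def] fourier_fun_plancherel(1)[OF f1, folded F1_def]
  have AE: "AE z in lborel. F0 z = plancherel f0 z" "AE z in lborel. F1 z = plancherel f1 z"
   unfolding F0_def F1_def by (rule fourier_fun_plancherel(2) f0' f1)+
  have "(Hdot_minus1_norm (dist_of f1))^2 \<le> ennreal \<epsilon>"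
   using order_trans[OF _ small] by (simp add: add_increasing add_increasing2)
  then have "Hdot_minus1_norm (dist_of f1) \<noteq> \<infinity>" by (auto simp: power2_eq_square top_unique)
  then have "Hdot_minus1_norm (dist_of f1) < \<infinity>" by (simp add: less_top)
  then have f1r: "(\<lambda>z. plancherel f1 z / of_real (norm z)) \<in> L2" by (rule plancherel_div_norm_L2[OF f1])
  have F0: "F0 \<in> L2" by (rule L2_cong_AE[OF plancherel_L2[OF f0'] _ AE(1)]) measurable
  have F1: "F1 \<in> L2" by (rule L2_cong_AE[OF plancherel_L2[OF f1] _ AE(2)]) measurable
  have rF0: "(\<lambda>z. of_real (norm z) * F0 z) \<in> L2" by (rule L2_cong_AE[OF rf0]) (use AE(1) in \<open>measurable, auto\<close>)
  have F1r: "(\<lambda>z. F1 z / of_real (norm z)) \<in> L2" by (rule L2_cong_AE[OF f1r]) (use AE(2) in \<open>measurable, auto\<close>)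
  define c0 where "c0 = sqrt (1 + (L2_norm f0)^2)"
  have "ennreal ((L2_norm f0)^2) \<le> ennreal \<epsilon>"
   using order_trans[OF _ small] by (simp add: add_increasing add_increasing2)
  then have f01: "(L2_norm f0)^2 \<le> 1" using \<epsilon> by (simp add: ennreal_le_iff)
  have c0: "1 \<le> c0" "c0 \<le> 2" and c0_power2: "c0\<^sup>2 = 1 + (L2_norm f0)^2" using f01 by (auto simp: c0_def intro!: real_le_lsqrt)
  let ?V = "\<lambda>z. F0 z + \<i> * (F1 z / of_real (c0 * norm z))" and ?W = "\<lambda>z. F0 z - \<i> * (F1 z / of_real (c0 * norm z))"
  have "profile ?V ?W m c0 (2 * ?C * \<epsilon>)"
  proof (rule profile_of_data[OF F0 rF0 F1 F1r c0(1,2)])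
   have "48 * ?C * m * \<epsilon> \<le> 1" using \<epsilon>(3) C m by (simp add: field_simps)
   then show "24 * m * (2 * ?C * \<epsilon>) \<le> 1" by (simp add: mult_ac)
   have "Y_norm (dist_of f0) (dist_of f1) \<le> ennreal \<epsilon>" using order_trans[OF _ small] by (simp add: add_increasing)
   then have "ennreal (2 * ?C) * Y_norm (dist_of f0) (dist_of f1) \<le> ennreal (2 * ?C * \<epsilon>)"
    using C \<epsilon>(1) by (simp add: ennreal_mult mult_left_mono)
   moreover have "fourier_fun (if j = 0 then dist_of f0 else dist_of f1) = (if j = 0 then F0 else F1)" for j :: nat
    by (simp add: F0_def F1_def)
   ultimately show "ennreal (2 * ?C) * (\<Sum>j\<in>{0..1::nat}. \<Sum>k\<in>{0..1::nat}.
    \<integral>\<^sup>+r. (\<integral>\<^sup>+\<omega>. Y_radial_integral (if j = 0 then F0 else F1) (if k = 0 then F0 else F1) (int DIM('a) - int j - int k) r \<omega>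
        \<partial>sphere_measure) \<partial>lborel) \<le> ennreal (2 * ?C * \<epsilon>)"
    unfolding Y_norm_def Let_def by simp
  qed (use m C \<epsilon> in auto)
  then interpret profile ?V ?W m c0 "2 * ?C * \<epsilon>" .
  have half: "(\<lambda>z. (?V z + ?W z) / 2) = F0" by auto
  have "L2_norm F0 = L2_norm (plancherel f0)" by (rule L2_norm_cong_AE[OF _ L2_measurable[OF plancherel_L2[OF f0']] AE(1)]) measurable
  then have "c0\<^sup>2 = 1 + m * (L2_norm F0)^2" using L2_norm_plancherel[OF f0'] by (simp add: c0_power2 m_def)
  then obtain u v where uv: "fourier_solution F0 (\<lambda>z. of_real (c0 * norm z) * (?V z - ?W z) / (2 * \<i>)) u v"
   using exists_fourier_solution[OF m_def, unfolded half] by blast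
  have "AE z in lborel. (z::'a) \<noteq> 0" by (rule AE_lborel_singleton)
  then have "AE z in lborel. of_real (c0 * norm z) * (?V z - ?W z) / (2 * \<i>) = plancherel f1 z"
   using AE(2) by eventually_elim (use c0 in \<open>auto simp: field_simps\<close>)
  then have "fourier_solution (plancherel f0) (plancherel f1) u v" by (rule fourier_solution_cong_AE[OF uv AE(1)])
  then show ?thesis using kirchhoff_solution_of_fourier_solution[OF f0' f1] by blast
 qed
 then show ?thesis using \<epsilon>(1) by blast
qed


section \<open>Real inner product and Riesz representation\<close>

definition L2_inner :: "('a::euclidean_space => complex) => ('a => complex) => real" where
 "L2_inner f g = Re (LI x. f x * cnj (g x))"

lemma L2_inner_eq:
 assumes "f \<in> L2" "g \<in> L2"
 shows "integrable lborel (\<lambda>x. Re (f x * cnj (g x)))" "L2_inner f g = (LI x. Re (f x * cnj (g x)))"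
proof -
 have i: "integrable lborel (\<lambda>x. f x * cnj (g x))" by (intro L2_mult_integrable L2_cnj assms)
 then show "integrable lborel (\<lambda>x. Re (f x * cnj (g x)))" by (rule integrable_bounded_linear[OF bounded_linear_Re])
 show "L2_inner f g = (LI x. Re (f x * cnj (g x)))"
  unfolding L2_inner_def by (rule integral_bounded_linear[OF bounded_linear_Re i, symmetric])
qed

lemma L2_inner_lin:
 assumes "f \<in> L2" "g \<in> L2" "h \<in> L2"
 shows "L2_inner (\<lambda>x. of_real c * f x + of_real d * g x) h = c * L2_inner f h + d * L2_inner g h"
proof -
 note i = L2_inner_eq(1)[OF assms(1,3)] L2_inner_eq(1)[OF assms(2,3)]
 have "L2_inner (\<lambda>x. of_real c * f x + of_real d * g x) h = (LI x. c * Re (f x * cnj (h x)) + d * Re (g x * cnj (h x)))"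
  by (subst L2_inner_eq(2)) (auto intro!: L2_add L2_scale assms Bochner_Integration.integral_cong simp: algebra_simps)
 also have "... = c * L2_inner f h + d * L2_inner g h"
  by (simp only: Bochner_Integration.integral_add[OF integrable_mult_right[OF i(1)] integrable_mult_right[OF i(2)]]
    integral_mult_right_zero L2_inner_eq(2)[OF assms(1,3)] L2_inner_eq(2)[OF assms(2,3)])
 finally show ?thesis .
qed

lemma L2_inner_commute: "f \<in> L2 ==> g \<in> L2 ==> L2_inner f g = L2_inner g f"
 by (simp add: L2_inner_eq mult.commute)

lemma L2_inner_self: "f \<in> L2 ==> L2_inner f f = (L2_norm f)^2"
 by (simp add: L2_inner_eq(2) L2_norm_power2 cmod_power2) (simp add: power2_eq_square)

lemma L2_inner_le: "f \<in> L2 ==> g \<in> L2 ==> \<bar>L2_inner f g\<bar> \<le> L2_norm f * L2_norm g"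
 using L2_Cauchy_Schwarz[OF _ L2_cnj, of f g] abs_Re_le_cmod[of "\<integral>x. f x * cnj (g x) \<partial>lborel"]
 by (simp add: L2_inner_def L2_norm_def)

lemma L2_norm_lin_power2:
 assumes "f \<in> L2" "g \<in> L2"
 shows "(L2_norm (\<lambda>x. f x + of_real c * g x))^2 = (L2_norm f)^2 + 2 * c * L2_inner f g + c\<^sup>2 * (L2_norm g)^2"
proof -
 have h: "(\<lambda>x. f x + of_real c * g x) \<in> L2" by (intro L2_add L2_scale assms)
 have l: "L2_inner (\<lambda>x. f x + of_real c * g x) k = L2_inner f k + c * L2_inner g k" if "k \<in> L2" for k
  using L2_inner_lin[OF assms that, of 1 c] by simp
 show ?thesis
  unfolding L2_inner_self[OF h, symmetric] l[OF h] L2_inner_commute[OF assms(1) h] L2_inner_commute[OF assms(2) h] l[OF assms(1)] l[OF assms(2)]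
  by (simp add: L2_inner_self assms L2_inner_commute[OF assms(2,1)] power2_eq_square algebra_simps)
qed

lemma tendsto_L2_inner:
 assumes f: "\<And>s. f s \<in> L2" "f0 \<in> L2" "((\<lambda>s. L2_norm (\<lambda>x. f s x - f0 x)) \<longlongrightarrow> 0) F"
  and g: "\<And>s. g s \<in> L2" "g0 \<in> L2" "((\<lambda>s. L2_norm (\<lambda>x. g s x - g0 x)) \<longlongrightarrow> 0) F"
 shows "((\<lambda>s. L2_inner (f s) (g s)) \<longlongrightarrow> L2_inner f0 g0) F"
proof (rule LIM_zero_cancel, rule Lim_null_comparison)
 have d: "L2_inner (\<lambda>x. p x - q x) h = L2_inner p h - L2_inner q h" if "p \<in> L2" "q \<in> L2" "h \<in> L2" for p q h
  using L2_inner_lin[OF that, of 1 "-1"] by simp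
 show "\<forall>\<^sub>F s in F. norm (L2_inner (f s) (g s) - L2_inner f0 g0)
   \<le> L2_norm (\<lambda>x. f s x - f0 x) * (L2_norm g0 + L2_norm (\<lambda>x. g s x - g0 x)) + L2_norm f0 * L2_norm (\<lambda>x. g s x - g0 x)"
 proof (intro always_eventually allI)
  fix s
  have "L2_inner (f s) (g s) - L2_inner f0 g0 = L2_inner (\<lambda>x. f s x - f0 x) (g s) + L2_inner (\<lambda>x. g s x - g0 x) f0"
   using L2_inner_commute[OF f(2) g(1)[of s]] L2_inner_commute[OF f(2) g(2)] by (simp add: d f g)
  moreover have "\<bar>L2_inner (\<lambda>x. f s x - f0 x) (g s)\<bar> \<le> L2_norm (\<lambda>x. f s x - f0 x) * (L2_norm g0 + L2_norm (\<lambda>x. g s x - g0 x))"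
   by (rule order_trans[OF L2_inner_le[OF L2_diff[OF f(1,2)] g(1)] mult_left_mono[OF L2_norm_le_add_diff[OF g(1,2)]]]) simp
  moreover have "\<bar>L2_inner (\<lambda>x. g s x - g0 x) f0\<bar> \<le> L2_norm f0 * L2_norm (\<lambda>x. g s x - g0 x)"
   using L2_inner_le[OF L2_diff[OF g(1,2)] f(2), of s] by (simp add: mult.commute)
  ultimately show "norm (L2_inner (f s) (g s) - L2_inner f0 g0)
   \<le> L2_norm (\<lambda>x. f s x - f0 x) * (L2_norm g0 + L2_norm (\<lambda>x. g s x - g0 x)) + L2_norm f0 * L2_norm (\<lambda>x. g s x - g0 x)"
   by simp
 qed
 show "((\<lambda>s. L2_norm (\<lambda>x. f s x - f0 x) * (L2_norm g0 + L2_norm (\<lambda>x. g s x - g0 x)) + L2_norm f0 * L2_norm (\<lambda>x. g s x - g0 x)) \<longlongrightarrow> 0) F"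
  by (rule tendsto_eq_rhs[OF tendsto_add[OF tendsto_mult[OF f(3) tendsto_add[OF tendsto_const g(3)]] tendsto_mult[OF tendsto_const g(3)]]]) simp
qed

text \<open>Riesz representation on a subspace: the minimiser of \<open>\<parallel>p\<parallel>\<^sup>2 - 2 Re (l p)\<close> over the closure represents \<open>l\<close>.\<close>

lemma L2_riesz:
 fixes S :: "('a::euclidean_space => complex) set" and l :: "('a => complex) => complex"
 assumes S: "S \<subseteq> L2" "S \<noteq> {}" and lin: "\<And>p q c. p \<in> S ==> q \<in> S ==> (\<lambda>x. p x + c * q x) \<in> S"
  and l: "\<And>p q c. p \<in> S ==> q \<in> S ==> l (\<lambda>x. p x + c * q x) = l p + c * l q"
  and K0: "K \<ge> 0" and K: "\<And>p. p \<in> S ==> norm (l p) \<le> K * L2_norm p"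
 obtains k where "k \<in> L2" "L2_norm k \<le> K" "\<And>p. p \<in> S ==> l p = (LI x. k x * p x)"
proof -
 define J where "J p = (L2_norm p)^2 - 2 * Re (l p)" for p
 have J: "- K\<^sup>2 \<le> J p" if "p \<in> S" for p
 proof -
  have "Re (l p) \<le> K * L2_norm p" using K[OF that] complex_Re_le_cmod[of "l p"] by linarith
  moreover have "0 \<le> (L2_norm p - K)^2" by simp
  ultimately show ?thesis unfolding J_def by (simp add: power2_eq_square algebra_simps)
 qed
 define d where "d = (INF p\<in>S. J p)"
 have bdd: "bdd_below (J ` S)" using J by (intro bdd_belowI2)
 have dJ: "d \<le> J p" if "p \<in> S" for p unfolding d_def by (rule cINF_lower[OF bdd that])
 have "\<exists>p\<in>S. J p < d + inverse (real (Suc n))" for n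
  unfolding d_def using cINF_less_iff[OF S(2) bdd, of "(INF p\<in>S. J p) + inverse (real (Suc n))"] by simp
 then obtain p where p: "\<And>n. p n \<in> S" "\<And>n. J (p n) < d + inverse (real (Suc n))" by metis
 have pL2: "p n \<in> L2" for n using S p by auto
 \<comment> \<open>The parallelogram law at the midpoint of \<open>f\<close> and \<open>g\<close>,
   where \<open>J\<close> is at least \<open>d\<close>: two nearly minimising elements are close to
   each other.\<close>
 have par: "(L2_norm (\<lambda>x. f x - g x))^2 \<le> 2 * (J f - d) + 2 * (J g - d)" if f: "f \<in> S" and g: "g \<in> S" for f g
 proof -
  have fL: "f \<in> L2" and gL: "g \<in> L2" using S f g by auto
  have f0: "(\<lambda>x. f x + (-1) * f x) \<in> S" by (rule lin[OF f f])
  have 0: "(\<lambda>x. 0) \<in> S" using f0 by simp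
  have h: "(\<lambda>x. 0 + (1 / 2) * (f x + 1 * g x)) \<in> S" by (rule lin[OF 0 lin[OF f g]])
  have "l (\<lambda>x. 0) = 0" using l[OF 0 0, of 1] by simp
  then have lh: "l (\<lambda>x. 0 + (1 / 2) * (f x + 1 * g x)) = (l f + l g) / 2" using l[OF 0 lin[OF f g], of "1 / 2" 1] l[OF f g, of 1] by simp
  have "L2_norm (\<lambda>x. 0 + (1 / 2) * (f x + 1 * g x)) = L2_norm (\<lambda>x. f x + of_real 1 * g x) / 2"
   using L2_norm_scale[of "1 / 2" "\<lambda>x. f x + g x"] by (simp add: norm_divide)
  then have "(L2_norm (\<lambda>x. 0 + (1 / 2) * (f x + 1 * g x)))^2 = ((L2_norm f)^2 + 2 * L2_inner f g + (L2_norm g)^2) / 4"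
   by (simp only: power_divide L2_norm_lin_power2[OF fL gL, of 1]) simp
  then have "4 * d \<le> (L2_norm f)^2 + 2 * L2_inner f g + (L2_norm g)^2 - 4 * Re (l f) - 4 * Re (l g)"
   using dJ[OF h] unfolding J_def lh by (simp add: field_simps)
  moreover have "(L2_norm (\<lambda>x. f x - g x))^2 = (L2_norm f)^2 - 2 * L2_inner f g + (L2_norm g)^2"
   using L2_norm_lin_power2[OF fL gL, of "-1"] by simp
  ultimately show ?thesis unfolding J_def by argo
 qed
 have tail: "2 * inverse (real (Suc n)) \<le> 2 * inverse (real (Suc N))" if "n \<ge> N" for n N :: nat
  using that by (simp add: le_imp_inverse_le)
 have pp: "L2_norm (\<lambda>x. p i x - p j x) \<le> sqrt (4 * inverse (real (Suc N)))" if "i \<ge> N" "j \<ge> N" for i j N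
 proof (rule real_le_rsqrt)
  show "(L2_norm (\<lambda>x. p i x - p j x))^2 \<le> 4 * inverse (real (Suc N))"
   using par[OF p(1)[of i] p(1)[of j]] p(2)[of i] p(2)[of j] tail[OF that(1)] tail[OF that(2)] by argo
 qed
 have lim0: "(\<lambda>N. sqrt (4 * inverse (real (Suc N)))) \<longlonglongrightarrow> sqrt (4 * 0)"
  by (intro tendsto_real_sqrt tendsto_mult tendsto_const LIMSEQ_inverse_real_of_nat)
 obtain k0 where k0: "k0 \<in> L2" "(\<lambda>n. L2_norm (\<lambda>x. p n x - k0 x)) \<longlonglongrightarrow> 0"
 proof (rule L2_complete[OF pL2])
  fix e :: real assume "e > 0"
  then obtain N where "sqrt (4 * inverse (real (Suc N))) < e"
   using order_tendstoD(2)[OF lim0, of e] by (auto simp: eventually_sequentially)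
  then show "\<exists>N. \<forall>i\<ge>N. \<forall>j\<ge>N. L2_norm (\<lambda>x. p i x - p j x) < e" using pp by (meson le_less_trans)
 qed
 \<comment> \<open>The variation of \<open>J\<close> at \<open>p n\<close> in direction
   \<open>q\<close> with step \<open>e\<close>; since \<open>p n\<close> misses the infimum by at
   most \<open>1 / (n + 1)\<close>, the inequality is exact in the limit.\<close>
 have Re_eq: "Re (l q) = L2_inner k0 q" if q: "q \<in> S" for q
 proof -
  have qL: "q \<in> L2" using S q by auto
  have "2 * e * (Re (l q) - L2_inner k0 q) \<le> e\<^sup>2 * (L2_norm q)^2" for e :: real
  proof (rule LIMSEQ_le)
   show "(\<lambda>n. 2 * e * (Re (l q) - L2_inner (p n) q)) \<longlonglongrightarrow> 2 * e * (Re (l q) - L2_inner k0 q)"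
    by (intro tendsto_mult tendsto_diff tendsto_const tendsto_L2_inner[OF pL2 k0 qL qL]) (simp add: L2_norm_def)
   show "(\<lambda>n. e\<^sup>2 * (L2_norm q)^2 + inverse (real (Suc n))) \<longlonglongrightarrow> e\<^sup>2 * (L2_norm q)^2"
    using tendsto_add[OF tendsto_const LIMSEQ_inverse_real_of_nat] by simp
   have "2 * e * (Re (l q) - L2_inner (p n) q) \<le> e\<^sup>2 * (L2_norm q)^2 + inverse (real (Suc n))" for n
   proof -
    have "J (\<lambda>x. p n x + of_real e * q x) = J (p n) + 2 * e * L2_inner (p n) q + e\<^sup>2 * (L2_norm q)^2 - 2 * e * Re (l q)"
     unfolding J_def L2_norm_lin_power2[OF pL2 qL] l[OF p(1) q] by simp
    then show ?thesis using dJ[OF lin[OF p(1)[of n] q, of "of_real e"]] p(2)[of n] by (simp add: algebra_simps)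
   qed
   then show "\<exists>N. \<forall>n\<ge>N. 2 * e * (Re (l q) - L2_inner (p n) q) \<le> e\<^sup>2 * (L2_norm q)^2 + inverse (real (Suc n))" by blast
  qed
  then have quad: "2 * e * y \<le> e\<^sup>2 * z" if "y = Re (l q) - L2_inner k0 q" "z = (L2_norm q)^2" for e y z :: real using that by simp
  define y where "y = Re (l q) - L2_inner k0 q"
  define z where "z = (L2_norm q)^2"
  have z: "z \<ge> 0" by (simp add: z_def)
  \<comment> \<open>The step \<open>e = y / (z + 1)\<close> is nearly the optimal one; the added 1
    keeps the denominator positive when \<open>q\<close> has norm zero.\<close>
  have "2 * (y / (z + 1)) * y \<le> (y / (z + 1))^2 * z" by (rule quad) (simp_all add: y_def z_def)
  also have "... \<le> (y / (z + 1))^2 * (z + 1)" by (intro mult_left_mono) auto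
  also have "... = (y / (z + 1)) * y" using z by (simp add: power2_eq_square)
  finally have "y\<^sup>2 / (z + 1) \<le> 0" by (simp add: power2_eq_square)
  then have "y = 0" using z by (simp add: divide_le_0_iff)
  then show ?thesis by (simp add: y_def)
 qed
 have rep: "l q = (LI x. cnj (k0 x) * q x)" if q: "q \<in> S" for q
 proof -
  have qL: "q \<in> L2" using S q by auto
  have 0: "(\<lambda>x. 0) \<in> S" using lin[OF q q, of "-1"] by simp
  have l0: "l (\<lambda>x. 0) = 0" using l[OF 0 0, of 1] by simp
  \<comment> \<open>Only real parts are known so far; evaluating at \<open>\<i> * q\<close> recovers
    the imaginary part of \<open>l q\<close>.\<close>
  have iq: "(\<lambda>x. 0 + \<i> * q x) \<in> S" by (rule lin[OF 0 q])
  have "l (\<lambda>x. 0 + \<i> * q x) = \<i> * l q" using l[OF 0 q, of \<i>] l0 by simp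
  then have im: "- Im (l q) = L2_inner k0 (\<lambda>x. \<i> * q x)" using Re_eq[OF iq] by simp
  have kq: "integrable lborel (\<lambda>x. k0 x * cnj (q x))" by (intro L2_mult_integrable L2_cnj k0 qL)
  have "(LI x. k0 x * cnj (\<i> * q x)) = (LI x. - \<i> * (k0 x * cnj (q x)))"
   by (intro Bochner_Integration.integral_cong) auto
  also have "... = - \<i> * (LI x. k0 x * cnj (q x))" by (rule integral_mult_right_zero)
  finally have "- Im (l q) = Im (LI x. k0 x * cnj (q x))" using im by (simp add: L2_inner_def)
  moreover have "Re (l q) = Re (LI x. k0 x * cnj (q x))" using Re_eq[OF q] by (simp add: L2_inner_def)
  ultimately have "l q = cnj (LI x. k0 x * cnj (q x))" by (simp add: complex_eq_iff)
  also have "... = (LI x. cnj (k0 x * cnj (q x)))" by (rule integral_bounded_linear[OF bounded_linear_cnj kq, symmetric])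
  finally show ?thesis by simp
 qed
 have "(L2_norm k0)^2 \<le> K * L2_norm k0"
 proof (rule LIMSEQ_le)
  show "(\<lambda>n. L2_inner k0 (p n)) \<longlonglongrightarrow> (L2_norm k0)\<^sup>2"
   unfolding L2_inner_self[OF k0(1), symmetric] by (rule tendsto_L2_inner[OF k0(1) k0(1) _ pL2 k0]) (simp add: L2_norm_def)
  have "(\<lambda>n. L2_norm (p n)) \<longlonglongrightarrow> L2_norm k0"
  proof (rule LIM_zero_cancel, rule Lim_null_comparison[OF always_eventually k0(2)], rule allI)
   fix n show "norm (L2_norm (p n) - L2_norm k0) \<le> L2_norm (\<lambda>x. p n x - k0 x)"
    using L2_norm_le_add_diff[OF pL2 k0(1), of n] L2_norm_le_add_diff[OF k0(1) pL2, of n] L2_norm_minus_commute[of "p n" k0] by simp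
  qed
  then show "(\<lambda>n. K * L2_norm (p n)) \<longlonglongrightarrow> K * L2_norm k0" by (rule tendsto_mult_left)
  have "L2_inner k0 (p n) \<le> K * L2_norm (p n)" for n
   using Re_eq[OF p(1), of n] K[OF p(1), of n] complex_Re_le_cmod[of "l (p n)"] by linarith
  then show "\<exists>N. \<forall>n\<ge>N. L2_inner k0 (p n) \<le> K * L2_norm (p n)" by blast
 qed
 then have "L2_norm k0 \<le> K"
  using K0 mult_right_le_imp_le[of "L2_norm k0" "L2_norm k0" K] L2_norm_nonneg[of k0] unfolding power2_eq_square by (metis order_le_less)
 then have "L2_norm (\<lambda>x. cnj (k0 x)) \<le> K" by (simp add: L2_norm_def)
 then show ?thesis using that[OF L2_cnj[OF k0(1)]] rep by blast
qed

lemma schwartz_lin: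
 fixes h \<psi> :: "'a::euclidean_space => complex"
 assumes "h \<in> schwartz" "\<psi> \<in> schwartz"
 shows "(\<lambda>x. h x + c * \<psi> x) \<in> schwartz"
proof (rule schwartz_coinduct[where A = "{(\<lambda>x. h x + c * \<psi> x) | h \<psi>. h \<in> schwartz \<and> \<psi> \<in> schwartz}"])
 show "(\<lambda>x. h x + c * \<psi> x) \<in> {(\<lambda>x. h x + c * \<psi> x) | h \<psi>. h \<in> schwartz \<and> \<psi> \<in> schwartz}" using assms by blast
next
 fix f :: "'a => complex" and x b :: 'a and N assume "f \<in> {(\<lambda>x. h x + c * \<psi> x) | h \<psi>. h \<in> schwartz \<and> \<psi> \<in> schwartz}"
 then obtain h \<psi> where f: "f = (\<lambda>x. h x + c * \<psi> x)" "h \<in> schwartz" "\<psi> \<in> schwartz" by blast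
 note d = f(2,3)[THEN schwartz_differentiable]
 show "f differentiable (at x)" unfolding f(1) by (intro derivative_intros d differentiable_mult)
 show "\<exists>B. \<forall>x. (1 + norm x) ^ N * norm (f x) \<le> B"
 proof -
  obtain B where B: "\<And>x. norm (h x) \<le> B / (1 + norm x) ^ N" using schwartz_bound[OF f(2), of N] by blast
  obtain C where C: "\<And>x. norm (\<psi> x) \<le> C / (1 + norm x) ^ N" using schwartz_bound[OF f(3), of N] by blast
  have "(1 + norm x) ^ N * norm (f x) \<le> B + norm c * C" for x
  proof -
   have p: "(1 + norm x) ^ N > 0" by (simp add: add_pos_nonneg)
   have "norm (f x) \<le> norm (h x) + norm c * norm (\<psi> x)" unfolding f(1) by (rule norm_triangle_le) (simp add: norm_mult)
   also have "... \<le> B / (1 + norm x) ^ N + norm c * (C / (1 + norm x) ^ N)" by (intro add_mono mult_left_mono B C) simp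
   also have "... = (B + norm c * C) / (1 + norm x) ^ N" by (simp add: add_divide_distrib)
   finally show ?thesis using p by (simp add: pos_le_divide_eq mult.commute)
  qed
  then show ?thesis by blast
 qed
 assume b: "b \<in> Basis"
 have "partial_deriv b f = (\<lambda>x. partial_deriv b h x + c * partial_deriv b \<psi> x)"
 proof
  fix x
  note d = f(2,3)[THEN schwartz_differentiable, of x, unfolded frechet_derivative_works]
  show "partial_deriv b f x = partial_deriv b h x + c * partial_deriv b \<psi> x"
   using partial_deriv_eq[OF has_derivative_add[OF d(1) has_derivative_mult_right[OF d(2), of c]], of b] by (simp add: partial_deriv_def f(1))
 qed
 then show "partial_deriv b f \<in> {(\<lambda>x. h x + c * \<psi> x) | h \<psi>. h \<in> schwartz \<and> \<psi> \<in> schwartz}"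
  using f(2,3)[THEN schwartz_partial_deriv, OF b] by blast
qed

text \<open>The fourth power of the norm is the sum over the basis of
  \<open>(norm z)^2 * (z \<bullet> e)^2\<close>, which reduces the claim to the first moment for the
  partial derivatives.\<close>

lemma fourier_schwartz_laplace_L2:
 fixes h :: "'a::euclidean_space => complex"
 assumes "h \<in> schwartz"
 shows "(\<lambda>z. of_real ((norm z)^2) * fourier h (- z)) \<in> L2"
proof (rule L2_I)
 note [measurable] = L2_measurable[OF fourier_schwartz_L2(1)[OF assms]]
 show "(\<lambda>z. of_real ((norm z)^2) * fourier h (- z)) \<in> Borel" by measurable
 have eq: "(norm (of_real ((norm z)^2) * fourier h (- z)))^2 = (\<Sum>e\<in>Basis. (norm (of_real (norm z) * fourier (partial_deriv e h) (- z)))^2)" for z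
 proof -
  have "(\<Sum>e\<in>Basis. (norm (of_real (norm z) * fourier (partial_deriv e h) (- z)))^2) = (\<Sum>e\<in>Basis. (norm z * norm (fourier h (- z)))^2 * (z \<bullet> e)^2)"
   by (intro sum.cong refl) (simp add: fourier_partial_deriv[OF assms] norm_mult power_mult_distrib)
  also have "... = (norm z * norm (fourier h (- z)))^2 * (norm z)^2" unfolding norm_power2_sum_Basis[of z] by (rule sum_distrib_left[symmetric])
  finally show ?thesis by (simp add: norm_mult power_mult_distrib power2_eq_square)
 qed
 show "integrable lborel (\<lambda>z. (norm (of_real ((norm z)^2) * fourier h (- z)))^2)"
  unfolding eq by (intro Bochner_Integration.integrable_sum L2_integrable fourier_schwartz_L2(3) schwartz_partial_deriv assms)
qed

text \<open>Nothing is known of \<open>e / (norm z)^2\<close> near the origin, but against functions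
  of the form \<open>(norm z)^2 * fourier h (- z)\<close> it is a well-defined functional, which the
  hypothesis bounds together with \<open>q\<close> in the \<open>L2\<close> norm. Its Riesz
  representative is the quotient sought.\<close>

lemma divide_power2_L2:
 fixes e q :: "'a::euclidean_space => complex"
 assumes e: "e \<in> L2" and q: "q \<in> L2" and K: "K \<ge> 0"
  and bound: "\<And>h. h \<in> schwartz ==> norm ((LI z. e z * fourier h (- z)) + (LI z. q z * (of_real ((norm z)^2) * fourier h (- z))))
   \<le> K * L2_norm (\<lambda>z. of_real ((norm z)^2) * fourier h (- z))"
 obtains k where "k \<in> L2" "L2_norm k \<le> K" "AE z in lborel. e z / of_real ((norm z)^2) + q z = k z"
proof -
 define T where "T h z = of_real ((norm z)^2) * fourier h (- z)" for h and z :: 'a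
 note [measurable] = L2_measurable[OF e] L2_measurable[OF q]
 have nz: "AE z in lborel. (z::'a) \<noteq> 0" by (rule AE_lborel_singleton)
 define l where "l p = (LI z. e z / of_real ((norm z)^2) * p z + q z * p z)" for p
 have T: "T h \<in> L2" if "h \<in> schwartz" for h unfolding T_def using fourier_schwartz_laplace_L2[OF that] .
 have i1: "integrable lborel (\<lambda>z. e z * fourier h (- z))" if "h \<in> schwartz" for h
  by (intro L2_mult_integrable e fourier_schwartz_L2(1) that)
 have lT: "integrable lborel (\<lambda>z. e z / of_real ((norm z)^2) * T h z + q z * T h z)"
  "l (T h) = (LI z. e z * fourier h (- z)) + (LI z. q z * T h z)" if h: "h \<in> schwartz" for h
 proof -
  note [measurable] = L2_measurable[OF fourier_schwartz_L2(1)[OF h]] L2_measurable[OF T[OF h]]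
  have ae: "AE z in lborel. e z / of_real ((norm z)^2) * T h z + q z * T h z = e z * fourier h (- z) + q z * T h z"
   using nz by eventually_elim (simp add: T_def)
  note i = i1[OF h] L2_mult_integrable[OF q T[OF h]]
  show "integrable lborel (\<lambda>z. e z / of_real ((norm z)^2) * T h z + q z * T h z)"
   by (rule integrable_cong_AE[THEN iffD2, OF _ _ ae Bochner_Integration.integrable_add[OF i]]) measurable
  have "l (T h) = (LI z. e z * fourier h (- z) + q z * T h z)"
   unfolding l_def by (rule integral_cong_AE[OF _ _ ae]) measurable
  then show "l (T h) = (LI z. e z * fourier h (- z)) + (LI z. q z * T h z)" using i by simp
 qed
 have lin: "(\<lambda>z. T h z + c * T \<psi> z) = T (\<lambda>x. h x + c * \<psi> x)" if "h \<in> schwartz" "\<psi> \<in> schwartz" for h \<psi> c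
 proof
  fix z
  have "fourier (\<lambda>x. h x + c * \<psi> x) (- z) = fourier h (- z) + c * fourier \<psi> (- z)"
   unfolding fourier_def distrib_left mult.left_commute[of _ c]
   using integrable_cis_mult[OF schwartz_integrable[OF that(1)], of "- z"] integrable_cis_mult[OF schwartz_integrable[OF that(2)], of "- z"] by simp
  then show "T h z + c * T \<psi> z = T (\<lambda>x. h x + c * \<psi> x) z" by (simp add: T_def algebra_simps)
 qed
 obtain h0 :: "'a => complex" where "h0 \<in> schwartz" using gaussian_is_fourier[of 1] by (metis zero_less_one)
 then have ne: "T ` schwartz \<noteq> {}" by blast
 obtain k where k: "k \<in> L2" "L2_norm k \<le> K" "\<And>p. p \<in> T ` schwartz ==> l p = (LI x. k x * p x)"
 proof (rule L2_riesz[of "T ` schwartz" l K])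
  show "T ` schwartz \<subseteq> L2" using T by blast
  fix p r c assume "p \<in> T ` schwartz" "r \<in> T ` schwartz"
  then obtain h \<psi> where *: "p = T h" "r = T \<psi>" "h \<in> schwartz" "\<psi> \<in> schwartz" by blast
  show "(\<lambda>x. p x + c * r x) \<in> T ` schwartz" unfolding * lin[OF *(3,4)] using schwartz_lin[OF *(3,4)] by blast
  have "l (\<lambda>x. p x + c * r x) = (LI z. (e z / of_real ((norm z)^2) * T h z + q z * T h z) + c * (e z / of_real ((norm z)^2) * T \<psi> z + q z * T \<psi> z))"
   unfolding l_def * by (intro Bochner_Integration.integral_cong refl) (simp only: distrib_left distrib_right mult_ac add_ac)
  then show "l (\<lambda>x. p x + c * r x) = l p + c * l r" unfolding * l_def using lT(1)[OF *(3)] lT(1)[OF *(4)] by simp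
 next
  fix p assume "p \<in> T ` schwartz"
  then obtain h where h: "p = T h" "h \<in> schwartz" by blast
  show "norm (l p) \<le> K * L2_norm p" unfolding h(1) lT(2)[OF h(2)] using bound[OF h(2)] by (simp only: T_def[abs_def])
 qed (use ne K in auto)
 note [measurable] = L2_measurable[OF k(1)]
 \<comment> \<open>The identity is multiplied by \<open>(norm z)^2\<close> before testing, so that
   no singular quotient is paired with a Gaussian.\<close>
 have zero: "AE z in lborel. e z + of_real ((norm z)^2) * q z - of_real ((norm z)^2) * k z = 0"
 proof (rule AE_zero_of_gaussians)
  fix d :: real and a :: 'a assume "d > 0"
  then have "\<exists>h. h \<in> schwartz \<and> (\<forall>z. fourier h (- z) = gaussian d a 0 z)" by (rule gaussian_is_fourier[of d a 0]) blast
  then obtain h where h: "h \<in> schwartz" "\<And>z. fourier h (- z) = gaussian d a 0 z" by blast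
  have eq: "(e z + of_real ((norm z)^2) * q z - of_real ((norm z)^2) * k z) * gaussian d a 0 z = e z * fourier h (- z) + q z * T h z - k z * T h z" for z
   unfolding T_def h(2) by (simp add: algebra_simps)
  note i = i1[OF h(1)] L2_mult_integrable[OF q T[OF h(1)]] L2_mult_integrable[OF k(1) T[OF h(1)]]
  show "integrable lborel (\<lambda>z. (e z + of_real ((norm z)^2) * q z - of_real ((norm z)^2) * k z) * gaussian d a 0 z)"
   unfolding eq using i by simp
  show "(LI z. (e z + of_real ((norm z)^2) * q z - of_real ((norm z)^2) * k z) * gaussian d a 0 z) = 0"
   unfolding eq using i lT(2)[OF h(1)] k(3)[of "T h"] h(1) by simp
 qed measurable
 have "AE z in lborel. e z / of_real ((norm z)^2) + q z = k z"
  using zero nz by eventually_elim (simp add: field_simps)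
 then show ?thesis using that k(1,2) by blast
qed


section \<open>Curves in L2 and Gronwall's inequality\<close>

lemma time_deriv_L2_D:
 assumes "time_deriv_L2 u v"
 shows "u t \<in> L2" "v t \<in> L2" "((\<lambda>h. L2_norm (\<lambda>x. (u (t + h) x - u t x) / of_real h - v t x)) \<longlongrightarrow> 0) (at 0)"
 using assms by (auto simp: time_deriv_L2_def)

lemma continuous_L2_D:
 assumes "continuous_L2 u"
 shows "u t \<in> L2" "((\<lambda>s. L2_norm (\<lambda>x. u s x - u t x)) \<longlongrightarrow> 0) (at t)"
 using assms by (auto simp: continuous_L2_def)

text \<open>In this form all differencing falls on \<open>u\<close>, and \<open>w\<close> needs only
  continuity. For \<open>w = u\<close> it gives the derivative of a squared norm; in the uniqueness
  proof \<open>w\<close> is a curve not known to be differentiable in \<open>L2\<close>.\<close>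

lemma L2_inner_quotient_deriv:
 assumes N: "\<And>s t. N s - N t = c * L2_inner (\<lambda>x. u s x - u t x) (\<lambda>x. w s x + w t x)"
  and u: "time_deriv_L2 u v" and w: "continuous_L2 w"
 shows "(N has_real_derivative 2 * c * L2_inner (v t) (w t)) (at t)"
 unfolding DERIV_def
proof -
 note uv = time_deriv_L2_D[OF u] and wc = continuous_L2_D[OF w]
 have lim: "((\<lambda>h. L2_inner (\<lambda>x. (u (t + h) x - u t x) / of_real h) (\<lambda>x. w (t + h) x + w t x)) \<longlongrightarrow> L2_inner (v t) (\<lambda>x. w t x + w t x)) (at 0)"
 proof (rule tendsto_L2_inner)
  show "(\<lambda>x. (u (t + h) x - u t x) / of_real h) \<in> L2" for h
   unfolding divide_inverse mult.commute[of _ "inverse _"] by (intro L2_scale L2_diff uv)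
  show "((\<lambda>h. L2_norm (\<lambda>x. w (t + h) x + w t x - (w t x + w t x))) \<longlongrightarrow> 0) (at 0)"
   using LIM_offset_zero[OF wc(2)] by simp
 qed (intro uv wc L2_add)+
 have q: "L2_inner (\<lambda>x. (u (t + h) x - u t x) / of_real h) (\<lambda>x. w (t + h) x + w t x) * c = (N (t + h) - N t) / h" for h
  using L2_inner_lin[OF L2_diff[OF uv(1) uv(1)] L2_diff[OF uv(1) uv(1)] L2_add[OF wc(1) wc(1)], of "inverse h" "t + h" t 0 t t "t + h" t]
  unfolding N by (simp add: divide_inverse mult_ac)
 have "L2_inner (v t) (\<lambda>x. w t x + w t x) = 2 * L2_inner (v t) (w t)"
  using L2_inner_lin[OF wc(1) wc(1) uv(2), of 1 t 1 t t] L2_inner_commute[OF uv(2) wc(1), of t t] L2_inner_commute[OF uv(2) L2_add[OF wc(1) wc(1)], of t t t] by simp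
 then show "((\<lambda>h. (N (t + h) - N t) / h) \<longlongrightarrow> 2 * c * L2_inner (v t) (w t)) (at 0)"
  using tendsto_mult_right[OF lim, of c] unfolding q by (simp add: mult_ac)
qed

lemma L2_norm_power2_deriv:
 assumes u: "time_deriv_L2 u v" "continuous_L2 u"
 shows "((\<lambda>t. (L2_norm (u t))^2) has_real_derivative 2 * L2_inner (v t) (u t)) (at t)"
proof -
 note L = continuous_L2_D(1)[OF u(2)]
 have "(L2_norm (u s))^2 - (L2_norm (u t))^2 = 1 * L2_inner (\<lambda>x. u s x - u t x) (\<lambda>x. u s x + u t x)" for s t
 proof -
  have "L2_inner (\<lambda>x. u s x - u t x) h = L2_inner (u s) h - L2_inner (u t) h" if "h \<in> L2" for h
   using L2_inner_lin[OF L L that, of 1 s "-1" t] by simp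
  moreover have "L2_inner h (\<lambda>x. u s x + u t x) = L2_inner h (u s) + L2_inner h (u t)" if "h \<in> L2" for h
   using L2_inner_lin[OF L L that, of 1 s 1 t] by (simp add: L2_inner_commute[OF that] L L2_add)
  ultimately show ?thesis using L2_inner_commute[OF L L, of s t] by (simp add: L2_add L L2_inner_self)
 qed
 from L2_inner_quotient_deriv[OF this u] show ?thesis by simp
qed

lemma continuous_on_L2_norm:
 assumes "continuous_L2 u" shows "continuous_on UNIV (\<lambda>t. L2_norm (u t))"
proof (intro continuous_at_imp_continuous_on ballI)
 fix t
 note L = continuous_L2_D[OF assms]
 have "\<forall>\<^sub>F s in at t. norm (L2_norm (u s) - L2_norm (u t)) \<le> L2_norm (\<lambda>x. u s x - u t x)"
 proof (intro always_eventually allI)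
  fix s show "norm (L2_norm (u s) - L2_norm (u t)) \<le> L2_norm (\<lambda>x. u s x - u t x)"
   using L2_norm_le_add_diff[OF L(1) L(1), of s t] L2_norm_le_add_diff[OF L(1) L(1), of t s] L2_norm_minus_commute[of "u s" "u t"] by simp
 qed
 then show "isCont (\<lambda>t. L2_norm (u t)) t" unfolding isCont_def
  by (intro LIM_zero_cancel[OF Lim_null_comparison[OF _ L(2)]])
qed

lemma continuous_L2_diff:
 assumes "continuous_L2 u" "continuous_L2 w" shows "continuous_L2 (\<lambda>t x. u t x - w t x)"
 unfolding continuous_L2_def
proof (intro conjI allI)
 fix t
 note L = continuous_L2_D[OF assms(1)] continuous_L2_D[OF assms(2)]
 show "(\<lambda>x. u t x - w t x) \<in> L2" by (intro L2_diff L)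
 show "((\<lambda>s. L2_norm (\<lambda>x. u s x - w s x - (u t x - w t x))) \<longlongrightarrow> 0) (at t)"
 proof (rule Lim_null_comparison[OF _ tendsto_add_zero[OF L(2) L(4)]], intro always_eventually allI)
  fix s
  have "L2_norm (\<lambda>x. (u s x - u t x) + (w t x - w s x)) \<le> L2_norm (\<lambda>x. u s x - u t x) + L2_norm (\<lambda>x. w t x - w s x)"
   by (intro L2_norm_triangle L2_diff L)
  then show "norm (L2_norm (\<lambda>x. u s x - w s x - (u t x - w t x))) \<le> L2_norm (\<lambda>x. u s x - u t x) + L2_norm (\<lambda>x. w s x - w t x)"
   using L2_norm_minus_commute[of "w t" "w s"] by (simp add: algebra_simps)
 qed
qed

lemma continuous_L2_scale:
 assumes u: "continuous_L2 u" and a: "continuous_on UNIV (a :: real => real)"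
 shows "continuous_L2 (\<lambda>t x. of_real (a t) * u t x)"
 unfolding continuous_L2_def
proof (intro conjI allI)
 fix t
 note L = continuous_L2_D[OF u]
 show "(\<lambda>x. of_real (a t) * u t x) \<in> L2" by (intro L2_scale L)
 have a: "(a \<longlongrightarrow> a t) (at t)" using a by (simp add: continuous_on_eq_continuous_at isCont_def)
 show "((\<lambda>s. L2_norm (\<lambda>x. of_real (a s) * u s x - of_real (a t) * u t x)) \<longlongrightarrow> 0) (at t)"
 proof (rule Lim_null_comparison)
  show "\<forall>\<^sub>F s in at t. norm (L2_norm (\<lambda>x. of_real (a s) * u s x - of_real (a t) * u t x)) \<le> \<bar>a s\<bar> * L2_norm (\<lambda>x. u s x - u t x) + \<bar>a s - a t\<bar> * L2_norm (u t)"
  proof (intro always_eventually allI)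
   fix s
   have "L2_norm (\<lambda>x. of_real (a s) * (u s x - u t x) + of_real (a s - a t) * u t x) \<le> L2_norm (\<lambda>x. of_real (a s) * (u s x - u t x)) + L2_norm (\<lambda>x. of_real (a s - a t) * u t x)"
    by (intro L2_norm_triangle L2_diff L2_scale L)
   moreover have "(\<lambda>x. of_real (a s) * (u s x - u t x) + of_real (a s - a t) * u t x) = (\<lambda>x. of_real (a s) * u s x - of_real (a t) * u t x)"
    by (auto simp: algebra_simps)
   ultimately show "norm (L2_norm (\<lambda>x. of_real (a s) * u s x - of_real (a t) * u t x)) \<le> \<bar>a s\<bar> * L2_norm (\<lambda>x. u s x - u t x) + \<bar>a s - a t\<bar> * L2_norm (u t)"
    unfolding L2_norm_scale by (simp only: norm_of_real) simp
  qed
  have "((\<lambda>s. \<bar>a s\<bar> * L2_norm (\<lambda>x. u s x - u t x) + \<bar>a s - a t\<bar> * L2_norm (u t)) \<longlongrightarrow> \<bar>a t\<bar> * 0 + \<bar>a t - a t\<bar> * L2_norm (u t)) (at t)"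
   by (intro tendsto_intros a L)
  then show "((\<lambda>s. \<bar>a s\<bar> * L2_norm (\<lambda>x. u s x - u t x) + \<bar>a s - a t\<bar> * L2_norm (u t)) \<longlongrightarrow> 0) (at t)" by simp
 qed
qed

text \<open>The equation is imposed for nonzero times only. An interval around 0 is cut there, and
  continuity joins the two mean value estimates.\<close>

lemma vector_derivative_bound_except_0:
 fixes g :: "real => complex"
 assumes c: "continuous_on UNIV g" and d: "\<And>w. w \<noteq> 0 ==> (g has_vector_derivative g' w) (at w)"
  and B: "\<And>w. w \<noteq> 0 ==> \<bar>w - t\<bar> \<le> \<bar>s - t\<bar> ==> norm (g' w) \<le> B" "B \<ge> 0"
 shows "norm (g s - g t) \<le> B * \<bar>s - t\<bar>"
proof -
 have 1: "norm (g v - g u) \<le> B * (v - u)" if "u \<le> v" "\<bar>u - t\<bar> \<le> \<bar>s - t\<bar>" "\<bar>v - t\<bar> \<le> \<bar>s - t\<bar>" "0 \<le> u \<or> v \<le> 0" for u v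
 proof (cases "u = v")
  case False
  then have "norm (g v - g u) \<le> B * v - B * u"
  proof (intro differentiable_bound_general[of u v g "\<lambda>x. B * x" g' "\<lambda>_. B"])
   show "((\<lambda>x. B * x) has_vector_derivative B) (at x)" for x
    by (auto intro!: derivative_eq_intros simp flip: has_real_derivative_iff_has_vector_derivative)
  qed (use that c in \<open>auto intro!: d B continuous_intros continuous_on_subset[OF c]\<close>)
  then show ?thesis by (simp add: right_diff_distrib)
 qed simp
 have 2: "norm (g v - g u) \<le> B * (v - u)" if uv: "u \<le> v" "\<bar>u - t\<bar> \<le> \<bar>s - t\<bar>" "\<bar>v - t\<bar> \<le> \<bar>s - t\<bar>" for u v
 proof (cases "0 \<le> u \<or> v \<le> 0")
  case False
  then have "norm (g v - g 0) \<le> B * (v - 0)" "norm (g 0 - g u) \<le> B * (0 - u)" using uv by (intro 1; linarith)+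
  then show ?thesis using norm_triangle_ineq[of "g v - g 0" "g 0 - g u"] by (simp add: algebra_simps)
 qed (use 1 uv in auto)
 show ?thesis
  using 2[of s t] 2[of t s] norm_minus_commute[of "g s" "g t"] by (cases "s \<le> t") (auto simp: abs_if)
qed

text \<open>Multiplication by \<open>exp (- (L * t))\<close> makes the function nonincreasing for
  positive times; as the bound is on \<open>\<bar>e' t\<bar>\<close>, negative times follow by
  reflection.\<close>

lemma gronwall_zero:
 fixes e :: "real => real"
 assumes e: "e 0 \<le> 0" "\<And>t. e t \<ge> 0" and d: "\<And>t. (e has_real_derivative e' t) (at t)"
  and le: "\<And>t. \<bar>t\<bar> \<le> M ==> \<bar>e' t\<bar> \<le> L * e t" and t: "\<bar>t\<bar> \<le> M"
 shows "e t = 0"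
proof -
 have *: "f t = 0" if t: "0 \<le> t" "t \<le> M" and f: "f 0 \<le> 0" "\<And>t. f t \<ge> 0" "\<And>t. (f has_real_derivative f' t) (at t)" "\<And>t. 0 \<le> t ==> t \<le> M ==> f' t \<le> L * f t"
  for f f' and t :: real
 proof -
  have "f t * exp (- (L * t)) \<le> f 0 * exp (- (L * 0))"
  proof (rule DERIV_nonpos_imp_nonincreasing[OF t(1)])
   fix x assume x: "0 \<le> x" "x \<le> t"
   have "((\<lambda>t. f t * exp (- (L * t))) has_real_derivative (f' x - L * f x) * exp (- (L * x))) (at x)"
    by (auto intro!: derivative_eq_intros f(3) simp: algebra_simps)
   moreover have "(f' x - L * f x) * exp (- (L * x)) \<le> 0"
    by (rule mult_nonpos_nonneg) (use f(4)[of x] x t in auto)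
   ultimately show "\<exists>y. ((\<lambda>t. f t * exp (- (L * t))) has_real_derivative y) (at x) \<and> y \<le> 0" by blast
  qed
  then have "f t * exp (- (L * t)) \<le> 0" using f(1) by simp
  then show ?thesis using f(2)[of t] by (simp add: mult_le_0_iff not_le[symmetric])
 qed
 show ?thesis
 proof (cases "t \<ge> 0")
  case True
  have "e' t \<le> L * e t" if "0 \<le> t" "t \<le> M" for t using le[of t] that by simp
  then show ?thesis using *[of t e e', OF True _ e d] t True by simp
 next
  case False
  have "((\<lambda>t. e (- t)) has_real_derivative - e' (- t)) (at t)" for t
   using DERIV_mirror[of e "e' (- t)" t] d[of "- t"] by simp
  moreover have "- e' (- t) \<le> L * e (- t)" if "0 \<le> t" "t \<le> M" for t using le[of "- t"] that by simp
  ultimately show ?thesis using *[of "- t" "\<lambda>t. e (- t)" "\<lambda>t. - e' (- t)"] False t e by simp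
 qed
qed


lemma continuous_L2_bounded:
 assumes "continuous_L2 u" shows "\<exists>B. \<forall>s. \<bar>s\<bar> \<le> M \<longrightarrow> L2_norm (u s) \<le> B"
proof -
 have "bounded ((\<lambda>s. L2_norm (u s)) ` {-M..M})"
  by (rule compact_imp_bounded[OF compact_continuous_image[OF continuous_on_subset[OF continuous_on_L2_norm[OF assms]]]]) auto
 then show ?thesis unfolding bounded_iff by (force simp: abs_le_iff)
qed

text \<open>The weak identity bounds the increments of \<open>E\<close> as functionals on the multiples of \<open>r\<^sup>2\<close>, and Riesz
 representation turns this into an \<open>L\<^sup>2\<close> bound for \<open>E / r\<^sup>2\<close>; no integral of an \<open>L\<^sup>2\<close>-valued curve is needed.\<close>

lemma weak_primitive:
 fixes E R :: "real => 'a::euclidean_space => complex"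
 assumes E: "continuous_L2 E" and R: "continuous_L2 R" and E0: "AE z in lborel. E 0 z = 0"
  and eq: "\<And>t u. t \<noteq> 0 ==> u \<in> schwartz ==> ((\<lambda>s. \<integral>z. E s z * fourier u (- z) \<partial>lborel) has_vector_derivative
    - (LI z. R t z * (of_real ((norm z)^2) * fourier u (- z)))) (at t)"
 shows "time_deriv_L2 (\<lambda>t z. - E t z / of_real ((norm z)^2)) R"
proof -
 note EL = continuous_L2_D[OF E] and RL = continuous_L2_D[OF R]
 note [measurable] = L2_measurable[OF EL(1)] L2_measurable[OF RL(1)]
 \<comment> \<open>A first-order expansion with remainder: \<open>K\<close> bounds the oscillation
   of \<open>R\<close> between the two times, and \<open>k\<close> is minus the error of
   \<open>(s - t) * R t\<close> as increment of \<open>- E / (norm z)^2\<close>. Both membership in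
   \<open>L2\<close> and differentiability are read off from it.\<close>
 have est: "\<exists>k. k \<in> L2 \<and> L2_norm k \<le> K * \<bar>s - t\<bar> \<and> (AE z in lborel. (E s z - E t z) / of_real ((norm z)^2) + of_real (s - t) * R t z = k z)"
  if K: "K \<ge> 0" "\<And>w. \<bar>w - t\<bar> \<le> \<bar>s - t\<bar> ==> L2_norm (\<lambda>z. R w z - R t z) \<le> K" for s t K
 proof -
  have b: "norm ((LI z. (E s z - E t z) * fourier u (- z)) + (LI z. of_real (s - t) * R t z * (of_real ((norm z)^2) * fourier u (- z))))
    \<le> (K * \<bar>s - t\<bar>) * L2_norm (\<lambda>z. of_real ((norm z)^2) * fourier u (- z))" if u: "u \<in> schwartz" for u
  proof -
   note F = fourier_schwartz_L2(1)[OF u]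
   define p where "p z = of_real ((norm z)^2) * fourier u (- z)" for z
   have p: "p \<in> L2" unfolding p_def[abs_def] by (rule fourier_schwartz_laplace_L2[OF u])
   note iE = L2_mult_integrable[OF EL(1) F] and iR = L2_mult_integrable[OF RL(1) p]
   define c where "c = (LI z. R t z * p z)"
   define g where "g w = (LI z. E w z * fourier u (- z)) + of_real w * c" for w
   have "norm (g s - g t) \<le> (K * L2_norm p) * \<bar>s - t\<bar>"
   proof (rule vector_derivative_bound_except_0)
    show "(g has_vector_derivative - (LI z. R w z * p z) + c) (at w)" if "w \<noteq> 0" for w
     unfolding g_def
     by (rule has_vector_derivative_eq_rhs[OF has_vector_derivative_add[OF eq[OF that u, folded p_def] has_vector_derivative_mult_left[OF has_vector_derivative_of_real[OF DERIV_ident], of c]]]) simp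
    show "norm (- (LI z. R w z * p z) + c) \<le> K * L2_norm p" if "\<bar>w - t\<bar> \<le> \<bar>s - t\<bar>" for w
    proof -
     have "norm (- (LI z. R w z * p z) + c) = norm (LI z. (R w z - R t z) * p z)"
      using iR norm_minus_commute[of c "\<integral>z. R w z * p z \<partial>lborel"] by (simp add: c_def left_diff_distrib)
     also have "... \<le> L2_norm (\<lambda>z. R w z - R t z) * L2_norm p" by (rule L2_Cauchy_Schwarz[OF L2_diff[OF RL(1) RL(1)] p])
     finally show ?thesis using mult_right_mono[OF K(2)[OF that], of "L2_norm p"] by simp
    qed
    have "isCont (\<lambda>w. \<integral>z. E w z * fourier u (- z) \<partial>lborel) w" for w
     unfolding isCont_def
    proof (rule LIM_zero_cancel, rule Lim_null_comparison[OF always_eventually], rule allI)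
     show "norm ((LI z. E r z * fourier u (- z)) - (LI z. E w z * fourier u (- z))) \<le> L2_norm (\<lambda>z. E r z - E w z) * L2_norm (\<lambda>z. fourier u (- z))" for r
      using L2_Cauchy_Schwarz[OF L2_diff[OF EL(1) EL(1)] F, of r w] iE by (simp add: left_diff_distrib)
     show "((\<lambda>r. L2_norm (\<lambda>z. E r z - E w z) * L2_norm (\<lambda>z. fourier u (- z))) \<longlongrightarrow> 0) (at w)"
      by (rule tendsto_mult_left_zero[OF EL(2)])
    qed
    then show "continuous_on UNIV g" unfolding g_def by (intro continuous_intros continuous_at_imp_continuous_on) auto
   qed (use K in auto)
   moreover have "g s - g t = (LI z. (E s z - E t z) * fourier u (- z)) + (LI z. of_real (s - t) * R t z * p z)"
   proof -
    have "(LI z. of_real (s - t) * R t z * p z) = of_real (s - t) * c"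
     unfolding c_def mult.assoc by (rule integral_mult_right_zero)
    moreover have "(LI z. (E s z - E t z) * fourier u (- z)) = (LI z. E s z * fourier u (- z)) - (LI z. E t z * fourier u (- z))"
     using iE by (simp add: left_diff_distrib)
    ultimately show ?thesis by (simp only: g_def) (simp add: algebra_simps)
   qed
   ultimately show ?thesis unfolding p_def[symmetric] by (simp add: mult_ac p_def[abs_def])
  qed
  show ?thesis
   by (rule divide_power2_L2[OF L2_diff[OF EL(1) EL(1)] L2_scale[OF RL(1)] _ b]) (use K in auto)
 qed
 define \<Phi> where "\<Phi> t z = - E t z / of_real ((norm z)^2)" for t z
 have \<Phi>m [measurable]: "\<Phi> t \<in> Borel" for t unfolding \<Phi>_def[abs_def] by measurable
 \<comment> \<open>The expansion is used from time zero, where \<open>E\<close> vanishes: this is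
   the sole reason why dividing by \<open>(norm z)^2\<close> does no harm at low
   frequencies.\<close>
 have \<Phi>: "\<Phi> s \<in> L2" for s
 proof -
  have "continuous_L2 (\<lambda>t. R 0)" by (simp add: continuous_L2_def RL L2_norm_def)
  from continuous_L2_bounded[OF continuous_L2_diff[OF R this], of "\<bar>s\<bar>"]
  obtain K where K: "\<And>w. \<bar>w\<bar> \<le> \<bar>s\<bar> ==> L2_norm (\<lambda>z. R w z - R 0 z) \<le> K" by blast
  have "0 \<le> K" using order_trans[OF L2_norm_nonneg K[of 0]] by simp
  with K obtain k where k: "k \<in> L2" "AE z in lborel. (E s z - E 0 z) / of_real ((norm z)^2) + of_real (s - 0) * R 0 z = k z"
   using est[of K 0 s] by auto
  show ?thesis
  proof (rule L2_cong_AE[OF L2_diff[OF L2_scale[OF RL(1)[of 0], of "of_real s"] k(1)] \<Phi>m])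
   show "AE z in lborel. \<Phi> s z = of_real s * R 0 z - k z"
    using k(2) E0
   proof eventually_elim
    case (elim z) then show ?case by (simp add: \<Phi>_def flip: elim(1))
   qed
  qed
 qed
 have "((\<lambda>h. L2_norm (\<lambda>x. (\<Phi> (t + h) x - \<Phi> t x) / of_real h - R t x)) \<longlongrightarrow> 0) (at 0)" for t
 proof (rule LIM_I)
  fix e :: real assume e: "e > 0"
  from LIM_D[OF RL(2)[of t], of "e / 2"] e obtain d where d: "d > 0" "\<And>w. w \<noteq> t ==> \<bar>w - t\<bar> < d ==> L2_norm (\<lambda>z. R w z - R t z) < e / 2" by auto
  \<comment> \<open>The remainder over a step \<open>h\<close> has norm at most
    \<open>e / 2 * \<bar>h\<bar>\<close>, so the error of the difference quotient is at most
    \<open>e / 2\<close>.\<close>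
  have *: "L2_norm (\<lambda>x. (\<Phi> (t + h) x - \<Phi> t x) / of_real h - R t x) \<le> e / 2" if h: "h \<noteq> 0" "\<bar>h\<bar> < d" for h
  proof -
   have "L2_norm (\<lambda>z. R w z - R t z) \<le> e / 2" if "\<bar>w - t\<bar> \<le> \<bar>t + h - t\<bar>" for w
    using d(2)[of w] that h e by (cases "w = t") (auto simp: L2_norm_def)
   then obtain k where k: "k \<in> L2" "L2_norm k \<le> e / 2 * \<bar>h\<bar>" "AE z in lborel. (E (t + h) z - E t z) / of_real ((norm z)^2) + of_real h * R t z = k z"
    using est[of "e / 2" t "t + h"] e by auto
   note [measurable] = L2_measurable[OF k(1)]
   have "L2_norm (\<lambda>x. (\<Phi> (t + h) x - \<Phi> t x) / of_real h - R t x) = L2_norm (\<lambda>x. - inverse (of_real h) * k x)"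
   proof (rule L2_norm_cong_AE)
    show "AE x in lborel. (\<Phi> (t + h) x - \<Phi> t x) / of_real h - R t x = - inverse (of_real h) * k x"
     using k(3)
    proof eventually_elim
     case (elim x)
     have "(- v / n - - y / n) / c - r = - inverse c * ((v - y) / n + c * r)" if "c \<noteq> 0" for v y n r c :: complex
      using that by (cases "n = 0") (simp_all add: field_simps)
     from this[of "of_real h"] show ?case using h unfolding elim[symmetric] \<Phi>_def by simp
    qed
   qed measurable
   also have "... = L2_norm k / \<bar>h\<bar>" unfolding L2_norm_scale by (simp add: norm_inverse divide_inverse mult.commute)
   also have "... \<le> e / 2" using k(2) h by (simp add: divide_le_eq)
   finally show ?thesis .
  qed
  show "\<exists>d>0. \<forall>h. h \<noteq> 0 \<and> norm (h - 0) < d \<longrightarrow> norm (L2_norm (\<lambda>x. (\<Phi> (t + h) x - \<Phi> t x) / of_real h - R t x) - 0) < e"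
  proof (intro exI[of _ d] conjI allI impI d(1))
   fix h :: real assume "h \<noteq> 0 \<and> norm (h - 0) < d"
   then have "L2_norm (\<lambda>x. (\<Phi> (t + h) x - \<Phi> t x) / of_real h - R t x) \<le> e / 2" using * by simp
   then show "norm (L2_norm (\<lambda>x. (\<Phi> (t + h) x - \<Phi> t x) / of_real h - R t x) - 0) < e"
    using e unfolding diff_0_right real_norm_def abs_of_nonneg[OF L2_norm_nonneg] by linarith
  qed
 qed
 then have "time_deriv_L2 \<Phi> R" unfolding time_deriv_L2_def using \<Phi> RL(1) by blast
 then show ?thesis unfolding \<Phi>_def[abs_def] .
qed

section \<open>Uniqueness\<close>

lemma fourier_solution_D:
 assumes "fourier_solution F0 F1 U V"
 shows "continuous_L2 U" "continuous_L2 V" "continuous_L2 (\<lambda>t z. of_real (norm z) * U t z)" "time_deriv_L2 U V"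
 using assms unfolding fourier_solution_def continuous_L2_def time_deriv_L2_def by (simp_all add: right_diff_distrib)

text \<open>The difference of the coefficients is bounded by a multiple of the norm of
  \<open>D\<close>, and it multiplies the pairing of \<open>W\<close> with \<open>E\<close>. One
  factor \<open>norm z\<close> is available for \<open>W\<close>, which turns that pairing into one
  with \<open>E / norm z\<close>; so the energy of one derivative less controls its own derivative,
  with constants depending on the two solutions on a bounded interval.\<close>

lemma fourier_solution_unique:
 fixes U W :: "real => 'a::euclidean_space => complex"
 assumes s: "fourier_solution F0 F1 U U'" "fourier_solution F0 F1 W W'"
 shows "AE z in lborel. U t z = W t z"
proof -
 define \<mu> :: real where "\<mu> = 1 / (2 * pi) ^ DIM('a)"
 have \<mu>: "\<mu> > 0" by (simp add: \<mu>_def)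
 note U = fourier_solution_D[OF s(1)] and W = fourier_solution_D[OF s(2)]
 define a where "a t = 1 + \<mu> * (L2_norm (U t))^2" for t
 define b where "b t = 1 + \<mu> * (L2_norm (W t))^2" for t
 define D where "D t z = U t z - W t z" for t z
 define E where "E t z = U' t z - W' t z" for t z
 define R where "R t z = of_real (a t) * U t z - of_real (b t) * W t z" for t z
 have D: "continuous_L2 D" and E: "continuous_L2 E" unfolding D_def[abs_def] E_def[abs_def] by (rule continuous_L2_diff[OF U(1) W(1)], rule continuous_L2_diff[OF U(2) W(2)])
 have R: "continuous_L2 R" unfolding R_def[abs_def] a_def b_def
  by (rule continuous_L2_diff[OF continuous_L2_scale[OF U(1)] continuous_L2_scale[OF W(1)]]; intro continuous_intros continuous_on_L2_norm U W)
 note UL = continuous_L2_D(1)[OF U(1)] and WL = continuous_L2_D(1)[OF W(1)] and DL = continuous_L2_D(1)[OF D] and EL = continuous_L2_D(1)[OF E]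
 note U'L = continuous_L2_D(1)[OF U(2)] and W'L = continuous_L2_D(1)[OF W(2)] and rWL = continuous_L2_D(1)[OF W(3)]
 note [measurable] = L2_measurable[OF UL] L2_measurable[OF WL] L2_measurable[OF DL] L2_measurable[OF EL]
 have D': "time_deriv_L2 D E"
  unfolding time_deriv_L2_def
 proof (intro allI conjI DL EL)
  fix t
  note d = time_deriv_L2_D(3)[OF U(4), of t] time_deriv_L2_D(3)[OF W(4), of t]
  let ?q = "\<lambda>u v h x. (u (t + h) x - u t x) / of_real h - v t x"
  have q: "?q u v h \<in> L2" if "continuous_L2 u" "continuous_L2 v" for u v :: "real => 'a => complex" and h :: real
   unfolding divide_inverse mult.commute[of _ "inverse _"] by (intro L2_diff L2_scale continuous_L2_D(1) that)
  show "((\<lambda>h. L2_norm (?q D E h)) \<longlongrightarrow> 0) (at 0)"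
  proof (rule Lim_null_comparison[OF always_eventually tendsto_add_zero[OF d]], rule allI)
   fix h
   have "?q D E h = (\<lambda>x. ?q U U' h x - ?q W W' h x)" by (auto simp: D_def E_def diff_divide_distrib)
   moreover have "L2_norm (\<lambda>x. ?q U U' h x - ?q W W' h x) \<le> L2_norm (\<lambda>x. ?q U U' h x - 0) + L2_norm (\<lambda>x. 0 - ?q W W' h x)"
    using L2_norm_triangle_diff[OF q[OF U(1,2), of h] _ q[OF W(1,2), of h], of "\<lambda>x. 0"] by (simp add: L2_def)
   moreover have "L2_norm (\<lambda>x. 0 - ?q W W' h x) = L2_norm (?q W W' h)" by (simp add: L2_norm_def norm_minus_commute)
   ultimately show "norm (L2_norm (?q D E h)) \<le> L2_norm (?q U U' h) + L2_norm (?q W W' h)" by simp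
  qed
 qed
 have E0: "AE z in lborel. E 0 z = 0" and D0: "AE z in lborel. D 0 z = 0"
 proof -
  have "AE z in lborel. U 0 z = F0 z" "AE z in lborel. U' 0 z = F1 z" "AE z in lborel. W 0 z = F0 z" "AE z in lborel. W' 0 z = F1 z"
   using s by (simp_all add: fourier_solution_def)
  then show "AE z in lborel. E 0 z = 0" "AE z in lborel. D 0 z = 0" by (eventually_elim, simp add: D_def E_def)+
 qed
 have \<Phi>: "time_deriv_L2 (\<lambda>t z. - E t z / of_real ((norm z)^2)) R"
 proof (rule weak_primitive[OF E R E0])
  fix t :: real and g :: "'a => complex" assume t: "t \<noteq> 0" and g: "g \<in> schwartz"
  note F = fourier_schwartz_L2(1)[OF g] fourier_schwartz_laplace_L2[OF g]
  let ?p = "\<lambda>z. of_real ((norm z)^2) * fourier g (- z)"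
  have d: "((\<lambda>s. \<integral>z. V s z * fourier g (- z) \<partial>lborel) has_vector_derivative
    - of_real (1 + \<mu> * (L2_norm (u t))^2) * (LI z. u t z * ?p z)) (at t)" if "fourier_solution F0 F1 u V" for u V
   using that t g unfolding fourier_solution_def \<mu>_def by (simp add: mult_ac)
  have "((\<lambda>s. (LI z. U' s z * fourier g (- z)) - (LI z. W' s z * fourier g (- z))) has_vector_derivative
    - (of_real (a t) * (LI z. U t z * ?p z)) - - (of_real (b t) * (LI z. W t z * ?p z))) (at t)"
   by (rule has_vector_derivative_eq_rhs[OF has_vector_derivative_diff[OF d[OF s(1)] d[OF s(2)]]]) (simp only: a_def b_def mult_minus_left)
  moreover have "(LI z. U' s z * fourier g (- z)) - (LI z. W' s z * fourier g (- z)) = (LI z. E s z * fourier g (- z))" for s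
   unfolding E_def left_diff_distrib by (rule Bochner_Integration.integral_diff[symmetric]; intro L2_mult_integrable U'L W'L F)
  moreover have "(LI z. R t z * ?p z) = of_real (a t) * (LI z. U t z * ?p z) - of_real (b t) * (LI z. W t z * ?p z)"
   unfolding R_def left_diff_distrib mult.assoc[of "of_real (a t)"] mult.assoc[of "of_real (b t)"]
   by (subst Bochner_Integration.integral_diff) (auto intro!: integrable_mult_right L2_mult_integrable UL WL F simp only: integral_mult_right_zero)
  ultimately show "((\<lambda>s. \<integral>z. E s z * fourier g (- z) \<partial>lborel) has_vector_derivative - (LI z. R t z * ?p z)) (at t)"
   by simp
 qed
 define \<Phi> where "\<Phi> t z = - E t z / of_real ((norm z)^2)" for t z
 define G where "G t z = E t z / of_real (norm z)" for t z
 have \<Phi>': "time_deriv_L2 \<Phi> R" using \<Phi> unfolding \<Phi>_def .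
 note \<Phi>L = time_deriv_L2_D(1)[OF \<Phi>']
 have [measurable]: "G t \<in> Borel" for t unfolding G_def[abs_def] by measurable
 \<comment> \<open>The weight \<open>1 / (norm z)^2\<close> is shared evenly between the factors.
   Hence \<open>G\<close> lies in \<open>L2\<close> because \<open>\<Phi>\<close> and
   \<open>E\<close> do, and no separate estimate near the origin is required.\<close>
 have GE: "Re (\<Phi> s z * cnj (E t z)) = - Re (G s z * cnj (G t z))" for s t z
  by (simp add: G_def \<Phi>_def power2_eq_square)
 have GL: "G t \<in> L2" for t
 proof (rule L2_I)
  have "(norm (G t z))^2 = - Re (\<Phi> t z * cnj (E t z))" for z unfolding GE by (simp add: cmod_power2) (simp add: power2_eq_square)
  moreover have "integrable lborel (\<lambda>z. - Re (\<Phi> t z * cnj (E t z)))" by (intro Bochner_Integration.integrable_minus L2_inner_eq(1) \<Phi>L EL)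
  ultimately show "integrable lborel (\<lambda>z. (norm (G t z))^2)" by (simp only:)
 qed measurable
 have GI: "L2_inner (\<Phi> s) (E t) = - L2_inner (G s) (G t)" for s t
  unfolding L2_inner_eq(2)[OF \<Phi>L EL] L2_inner_eq(2)[OF GL GL] GE by (rule integral_minus)
 \<comment> \<open>\<open>E\<close> has a time derivative only weakly. Writing the increment of the
   squared norm of \<open>G\<close> through \<open>\<Phi> s - \<Phi> t\<close> paired with
   \<open>E s + E t\<close> puts the difference on \<open>\<Phi>\<close>, which is differentiable in
   \<open>L2\<close>.\<close>
 have n': "((\<lambda>t. (L2_norm (G t))^2) has_real_derivative 2 * (-1) * L2_inner (R t) (E t)) (at t)" for t
 proof (rule L2_inner_quotient_deriv[OF _ \<Phi>' E])
  fix s t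
  have 1: "L2_inner (\<lambda>x. \<Phi> s x - \<Phi> t x) h = L2_inner (\<Phi> s) h - L2_inner (\<Phi> t) h" if "h \<in> L2" for h
   using L2_inner_lin[OF \<Phi>L \<Phi>L that, of 1 s "-1" t] by simp
  have 2: "L2_inner h (\<lambda>x. E s x + E t x) = L2_inner h (E s) + L2_inner h (E t)" if "h \<in> L2" for h
   using L2_inner_lin[OF EL EL that, of 1 s 1 t] by (simp add: L2_inner_commute[OF that] EL L2_add)
  show "(L2_norm (G s))^2 - (L2_norm (G t))^2 = -1 * L2_inner (\<lambda>x. \<Phi> s x - \<Phi> t x) (\<lambda>x. E s x + E t x)"
   using L2_inner_commute[OF GL GL, of s t] by (simp add: 1 2 L2_add EL \<Phi>L GI L2_inner_self GL)
 qed
 define e where "e t = a t * (L2_norm (D t))^2 + (L2_norm (G t))^2" for t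
 define e' where "e' t = 2 * \<mu> * L2_inner (U' t) (U t) * (L2_norm (D t))^2 - 2 * (a t - b t) * L2_inner (W t) (E t)" for t
 have e_deriv: "(e has_real_derivative e' t) (at t)" for t
 proof -
  have "(a has_real_derivative 0 + \<mu> * (2 * L2_inner (U' t) (U t))) (at t)"
   unfolding a_def[abs_def] by (intro DERIV_add DERIV_const DERIV_cmult L2_norm_power2_deriv[OF U(4,1)])
  then have "(e has_real_derivative (0 + \<mu> * (2 * L2_inner (U' t) (U t))) * (L2_norm (D t))^2 + 2 * L2_inner (E t) (D t) * a t + 2 * (-1) * L2_inner (R t) (E t)) (at t)"
   unfolding e_def by (intro DERIV_add DERIV_mult L2_norm_power2_deriv[OF D' D] n')
  \<comment> \<open>The multiple of \<open>D\<close> in \<open>R\<close> cancels the derivative of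
    the squared norm of \<open>D\<close>; only the term with \<open>a t - b t\<close>
    survives.\<close>
  moreover have "L2_inner (R t) (E t) = a t * L2_inner (E t) (D t) + (a t - b t) * L2_inner (W t) (E t)"
  proof -
   have "R t = (\<lambda>z. of_real (a t) * D t z + of_real (a t - b t) * W t z)" by (auto simp: R_def D_def algebra_simps)
   then show ?thesis using L2_inner_lin[OF DL WL EL, of "a t" t "a t - b t" t t] L2_inner_commute[OF DL EL, of t t] by simp
  qed
  ultimately show ?thesis unfolding e'_def by (simp add: algebra_simps)
 qed
 \<comment> \<open>One factor \<open>norm z\<close> moves from \<open>E\<close> to \<open>W\<close>,
   which has a derivative in \<open>L2\<close>.\<close>
 have WE: "\<bar>L2_inner (W t) (E t)\<bar> \<le> L2_norm (\<lambda>z. of_real (norm z) * W t z) * L2_norm (G t)" for t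
 proof -
  have nz: "AE z in lborel. (z::'a) \<noteq> 0" by (rule AE_lborel_singleton)
  have "L2_inner (W t) (E t) = L2_inner (\<lambda>z. of_real (norm z) * W t z) (G t)"
   unfolding L2_inner_eq(2)[OF WL EL] L2_inner_eq(2)[OF rWL GL]
  proof (rule integral_cong_AE)
   show "AE z in lborel. Re (W t z * cnj (E t z)) = Re (of_real (norm z) * W t z * cnj (G t z))"
    using nz by eventually_elim (simp add: G_def)
  qed (use borel_measurable_integrable[OF L2_inner_eq(1)[OF WL EL]] borel_measurable_integrable[OF L2_inner_eq(1)[OF rWL GL]] in auto)
  then show ?thesis using L2_inner_le[OF rWL GL] by simp
 qed
 define M where "M = \<bar>t\<bar>"
 note bd = continuous_L2_bounded[where M = M]
 from bd[OF U(1)] bd[OF U(2)] bd[OF W(1)] bd[OF W(3)] obtain B1 B2 B3 B4 where B4: "\<forall>s. \<bar>s\<bar> \<le> M \<longrightarrow> L2_norm (U s) \<le> B1"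
  "\<forall>s. \<bar>s\<bar> \<le> M \<longrightarrow> L2_norm (U' s) \<le> B2" "\<forall>s. \<bar>s\<bar> \<le> M \<longrightarrow> L2_norm (W s) \<le> B3" "\<forall>s. \<bar>s\<bar> \<le> M \<longrightarrow> L2_norm (\<lambda>z. of_real (norm z) * W s z) \<le> B4"
  by (elim exE) (rule that)
 define B where "B = max (max B1 B2) (max B3 B4)"
 have B: "L2_norm (U s) \<le> B" "L2_norm (U' s) \<le> B" "L2_norm (W s) \<le> B" "L2_norm (\<lambda>z. of_real (norm z) * W s z) \<le> B" if "\<bar>s\<bar> \<le> M" for s
  using B4[rule_format, OF that] by (auto simp: B_def)
 have "e t = 0"
 \<comment> \<open>With \<open>x\<close> and \<open>y\<close> the norms of \<open>D\<close> and
   \<open>G\<close>, the derivative is at most \<open>2 * \<mu> * B^2 * (x^2 + 2 * x * y)\<close>,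
   and the bracket is at most \<open>2 * x^2 + y^2\<close>, hence at most twice the energy because
   \<open>a >= 1\<close>.\<close>
 proof (rule gronwall_zero[where e = e and t = t and e' = e' and M = M and L = "4 * \<mu> * B\<^sup>2"])
  have "L2_norm (D 0) = 0" "L2_norm (G 0) = 0"
  proof -
   have "L2_norm (D 0) = L2_norm (\<lambda>x::'a. 0)" by (rule L2_norm_cong_AE[OF _ _ D0]) measurable
   moreover have "L2_norm (G 0) = L2_norm (\<lambda>x::'a. 0)" by (rule L2_norm_cong_AE) (use E0 in \<open>auto simp: G_def\<close>)
   ultimately show "L2_norm (D 0) = 0" "L2_norm (G 0) = 0" by (simp_all add: L2_norm_def)
  qed
  then show "e 0 \<le> 0" by (simp add: e_def)
  show "e t \<ge> 0" for t using \<mu> by (simp add: e_def a_def)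
  show "\<bar>e' s\<bar> \<le> 4 * \<mu> * B\<^sup>2 * e s" if sM: "\<bar>s\<bar> \<le> M" for s
  proof -
   note Bs = B[OF sM]
   define x where "x = L2_norm (D s)"
   define y where "y = L2_norm (G s)"
   have xy: "x \<ge> 0" "y \<ge> 0" "B \<ge> 0" using order_trans[OF L2_norm_nonneg Bs(1)] by (simp_all add: x_def y_def)
   have "a s - b s = \<mu> * ((L2_norm (U s) - L2_norm (W s)) * (L2_norm (U s) + L2_norm (W s)))"
    by (simp add: a_def b_def power2_eq_square algebra_simps)
   then have "\<bar>a s - b s\<bar> = \<mu> * (\<bar>L2_norm (U s) - L2_norm (W s)\<bar> * (L2_norm (U s) + L2_norm (W s)))"
    using \<mu> by (simp only: abs_mult abs_of_pos abs_of_nonneg[OF add_nonneg_nonneg[OF L2_norm_nonneg L2_norm_nonneg]])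
   also have "... \<le> \<mu> * (x * (B + B))"
   proof (intro mult_left_mono mult_mono add_mono Bs)
    show "\<bar>L2_norm (U s) - L2_norm (W s)\<bar> \<le> x"
     using L2_norm_le_add_diff[OF UL WL, of s s] L2_norm_le_add_diff[OF WL UL, of s s] L2_norm_minus_commute[of "U s" "W s"] by (simp add: x_def D_def[abs_def])
   qed (use \<mu> xy in auto)
   finally have ab: "\<bar>a s - b s\<bar> \<le> 2 * \<mu> * B * x" by (simp add: mult_ac)
   have we: "\<bar>L2_inner (W s) (E s)\<bar> \<le> B * y" using order_trans[OF WE mult_right_mono[OF Bs(4) L2_norm_nonneg]] by (simp add: y_def)
   have uu: "\<bar>L2_inner (U' s) (U s)\<bar> \<le> B * B" using order_trans[OF L2_inner_le[OF U'L UL] mult_mono[OF Bs(2,1)]] xy by simp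
   have "\<bar>e' s\<bar> \<le> 2 * \<mu> * \<bar>L2_inner (U' s) (U s)\<bar> * x\<^sup>2 + 2 * (\<bar>a s - b s\<bar> * \<bar>L2_inner (W s) (E s)\<bar>)"
   proof -
    have "\<bar>2 * \<mu> * L2_inner (U' s) (U s) * x\<^sup>2\<bar> = 2 * \<mu> * \<bar>L2_inner (U' s) (U s)\<bar> * x\<^sup>2" using \<mu> by (simp add: abs_mult)
    moreover have "\<bar>2 * (a s - b s) * L2_inner (W s) (E s)\<bar> = 2 * (\<bar>a s - b s\<bar> * \<bar>L2_inner (W s) (E s)\<bar>)"
     by (simp only: abs_mult abs_numeral mult.assoc)
    ultimately show ?thesis unfolding e'_def x_def[symmetric] by (metis abs_triangle_ineq4)
   qed
   also have "... \<le> 2 * \<mu> * (B * B) * x\<^sup>2 + 2 * ((2 * \<mu> * B * x) * (B * y))"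
    using \<mu> xy by (intro add_mono mult_left_mono mult_right_mono mult_mono uu ab we) auto
   also have "... = 2 * \<mu> * B\<^sup>2 * (x\<^sup>2 + 2 * x * y)" by (simp add: power2_eq_square algebra_simps)
   also have "... \<le> 2 * \<mu> * B\<^sup>2 * (2 * e s)"
   proof (rule mult_left_mono)
    have "0 \<le> (x - y)^2" by simp
    then have "2 * x * y \<le> x\<^sup>2 + y\<^sup>2" by (simp add: power2_eq_square algebra_simps)
    moreover have "1 * x\<^sup>2 \<le> a s * x\<^sup>2" by (rule mult_right_mono) (use \<mu> in \<open>simp_all add: a_def\<close>)
    moreover have "0 \<le> y\<^sup>2" by simp
    ultimately show "x\<^sup>2 + 2 * x * y \<le> 2 * e s" unfolding e_def x_def[symmetric] y_def[symmetric] by argo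
   qed (use \<mu> in auto)
   finally show ?thesis by simp
  qed
 qed (use e_deriv in \<open>auto simp: M_def\<close>)
 moreover have "1 * (L2_norm (D t))^2 \<le> a t * (L2_norm (D t))^2" by (rule mult_right_mono) (use \<mu> in \<open>simp_all add: a_def\<close>)
 moreover have "0 \<le> (L2_norm (G t))^2" by simp
 ultimately have "(L2_norm (D t))^2 \<le> 0" unfolding e_def by linarith
 then have "L2_norm (D t) = 0" by simp
 then show ?thesis using L2_norm_eq_0[OF DL] by (simp add: D_def)
qed

lemma kirchhoff_solution_unique:
 fixes f0 f1 :: "'a::euclidean_space => complex"
 assumes f: "f0 \<in> L2" "f1 \<in> L2" and s: "kirchhoff_solution f0 f1 u" "kirchhoff_solution f0 f1 w"
 shows "AE x in lborel. w t x = u t x"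
proof -
 have L: "u t \<in> L2" "w t \<in> L2" using s by (auto simp: kirchhoff_solution_def continuous_H1_def H1_def)
 obtain U' W' where "fourier_solution (plancherel f0) (plancherel f1) (\<lambda>t. plancherel (u t)) U'"
  "fourier_solution (plancherel f0) (plancherel f1) (\<lambda>t. plancherel (w t)) W'"
  using fourier_solution_of_kirchhoff_solution[OF f s(1)] fourier_solution_of_kirchhoff_solution[OF f s(2)] by metis
 then have "AE z in lborel. plancherel (w t) z = plancherel (u t) z" by (rule fourier_solution_unique[rotated])
 with plancherel_diff[OF L(2,1)] have "AE z in lborel. plancherel (\<lambda>x. w t x - u t x) z = 0" by eventually_elim simp
 then have "L2_norm (plancherel (\<lambda>x. w t x - u t x)) = L2_norm (\<lambda>x::'a. 0)"
  by (rule L2_norm_cong_AE[rotated 2]) (use L2_measurable[OF plancherel_L2[OF L2_diff[OF L(2,1)]]] in auto)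
 then have "L2_norm (\<lambda>x. w t x - u t x) = 0"
  unfolding plancherel_norm[OF L2_diff[OF L(2,1)]] by (simp add: L2_norm_def)
 then show ?thesis using L2_norm_eq_0[OF L2_diff[OF L(2,1)]] by simp
qed


theorem theorem2p7:
  "\<exists>\<epsilon>0::real. \<epsilon>0 > 0 \<and>
     (\<forall>f0 f1 :: real ^ 'n \<Rightarrow> complex.
        f0 \<in> H1 \<longrightarrow> f1 \<in> L2 \<longrightarrow> (dist_of f0, dist_of f1) \<in> Y_class \<longrightarrow>
        ennreal ((L2_norm f0)\<^sup>2) + (Hdot_minus1_norm (dist_of f1))\<^sup>2
          + Y_norm (dist_of f0) (dist_of f1) \<le> ennreal \<epsilon>0 \<longrightarrow>
        (\<exists>u. kirchhoff_solution f0 f1 u \<and>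
           (\<forall>w. kirchhoff_solution f0 f1 w \<longrightarrow> (\<forall>t. AE x in lborel. w t x = u t x))))"
proof -
  obtain \<epsilon> :: real where \<epsilon>: "\<epsilon> > 0" "\<And>f0 f1 :: real ^ 'n \<Rightarrow> complex. f0 \<in> H1 \<Longrightarrow> f1 \<in> L2 \<Longrightarrow>
      ennreal ((L2_norm f0)\<^sup>2) + (Hdot_minus1_norm (dist_of f1))\<^sup>2 + Y_norm (dist_of f0) (dist_of f1) \<le> ennreal \<epsilon> \<Longrightarrow>
      \<exists>u. kirchhoff_solution f0 f1 u"
    using exists_solution[where 'a = "real ^ 'n"] by blast
  show ?thesis
  proof (intro exI[of _ \<epsilon>] conjI allI impI \<epsilon>(1))
    fix f0 f1 :: "real ^ 'n \<Rightarrow> complex"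
    assume f: "f0 \<in> H1" "f1 \<in> L2"
      and small: "ennreal ((L2_norm f0)\<^sup>2) + (Hdot_minus1_norm (dist_of f1))\<^sup>2 + Y_norm (dist_of f0) (dist_of f1) \<le> ennreal \<epsilon>"
    obtain u where u: "kirchhoff_solution f0 f1 u" using \<epsilon>(2)[OF f small] by blast
    have "f0 \<in> L2" using f(1) by (simp add: H1_def)
    from kirchhoff_solution_unique[OF this f(2) u]
    show "\<exists>u. kirchhoff_solution f0 f1 u \<and> (\<forall>w. kirchhoff_solution f0 f1 w \<longrightarrow> (\<forall>t. AE x in lborel. w t x = u t x))"
      using u by blast
  qed
qed

end
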